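(* Let $N\ge 2$, let $\Omega\subseteq\mathbb{R}^N$ be a bounded domain of class $C^2$, and let $1<q<p<N$ with $p<q^*:=\frac{Nq}{N-q}$. Let $w\in C^{0,1}(\overline{\Omega})\cap A_p$ satisfy $w(x)>0$ for every $x\in\Omega$. Then $\phi_p^w\neq\phi_q$.
   Context: A function $w$ belongs to the $p$-Muckenhoupt class $A_p$ (on $\Omega$) if $w,w^{-1}\in L^1_{\rm loc}(\Omega)$ and there is $C>0$ such that for every ball $B\subseteq\Omega$, $\frac{1}{|B|}\int_B w\,dx\le C\left(\frac{1}{|B|}\int_B w^{\frac{1}{1-p}}\,dx\right)^{1-p}$. For a nonnegative weight $w\in C^{0,1}(\overline{\Omega})\cap A_p$, $\phi_p^w$ denotes the first eigenfunction of the weighted $p$-Laplacian Dirichlet problem $-\mathrm{div}(w|\nabla v|^{p-2}\nabla v)=\lambda\, w|v|^{p-2}v$ in $\Omega$, $v=0$ on $\partial\Omega$: i.e. the positive eigenfunction, normalized by $\|\phi_p^w\|_{L^\infty(\Omega)}=1$, associated with the smallest eigenvalue $\lambda_p^w>0$ (which is simple). Similarly, $\phi_q$ denotes the positive first eigenfunction, normalized by $\|\phi_q\|_{L^\infty(\Omega)}=1$, of the Dirichlet problem $-\Delta_q z=\mu|z|^{q-2}z$ in $\Omega$, $z=0$ on $\partial\Omega$, associated with its smallest eigenvalue $\lambda_q>0$. The conclusion $\phi_p^w\neq\phi_q$ is called the linear independence condition. *)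

theory Defs
  imports "HOL-Analysis.Analysis"
begin

definition C2_fun :: "(real^'n \<Rightarrow> real) \<Rightarrow> bool" where
  "C2_fun f \<longleftrightarrow>
     (\<exists>(Df :: real^'n \<Rightarrow> ((real^'n) \<Rightarrow>\<^sub>L real)) (D2f :: real^'n \<Rightarrow> ((real^'n) \<Rightarrow>\<^sub>L ((real^'n) \<Rightarrow>\<^sub>L real))).
        (\<forall>x. (f has_derivative blinfun_apply (Df x)) (at x)) \<and>
        (\<forall>x. (Df has_derivative blinfun_apply (D2f x)) (at x)) \<and>
        continuous_on UNIV D2f)"

definition partial_deriv :: "'n \<Rightarrow> (real^'n \<Rightarrow> real) \<Rightarrow> real^'n \<Rightarrow> real" where
  "partial_deriv i f x = deriv (\<lambda>t. f (x + t *\<^sub>R axis i 1)) 0"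

definition grad :: "(real^'n \<Rightarrow> real) \<Rightarrow> real^'n \<Rightarrow> real^'n" where
  "grad f x = (\<chi> i. partial_deriv i f x)"

definition smooth_fun :: "(real^'n \<Rightarrow> real) \<Rightarrow> bool" where
  "smooth_fun f \<longleftrightarrow>
     (\<exists>F. f \<in> F \<and>
        (\<forall>g\<in>F. continuous_on UNIV g \<and>
           (\<forall>i. (\<forall>x. ((\<lambda>t. g (x + t *\<^sub>R axis i 1)) has_real_derivative partial_deriv i g x) (at 0))
                \<and> partial_deriv i g \<in> F)))"

definition tsupp :: "(real^'n \<Rightarrow> real) \<Rightarrow> (real^'n) set" where
  "tsupp f = closure {x. f x \<noteq> 0}"

definition test_fun :: "(real^'n) set \<Rightarrow> (real^'n \<Rightarrow> real) \<Rightarrow> bool" where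
  "test_fun \<Omega> \<phi> \<longleftrightarrow> smooth_fun \<phi> \<and> compact (tsupp \<phi>) \<and> tsupp \<phi> \<subseteq> \<Omega>"

text \<open>Bounded domain with C^2 boundary: near every boundary point, after an orthogonal
  change of coordinates, Omega is the supergraph of a C^2 function of the remaining coordinates.\<close>
definition C2_boundary :: "(real^'n) set \<Rightarrow> bool" where
  "C2_boundary \<Omega> \<longleftrightarrow>
     (\<forall>x0\<in>frontier \<Omega>. \<exists>r>0. \<exists>T k (\<gamma> :: real^'n \<Rightarrow> real).
        orthogonal_transformation T \<and> C2_fun \<gamma> \<and>
        (\<forall>y t. \<gamma> (y + t *\<^sub>R axis k 1) = \<gamma> y) \<and>
        (\<forall>x\<in>ball x0 r. x \<in> \<Omega> \<longleftrightarrow> (T x) $ k > \<gamma> (T x)))"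

definition loc_integrable :: "(real^'n) set \<Rightarrow> (real^'n \<Rightarrow> real) \<Rightarrow> bool" where
  "loc_integrable \<Omega> f \<longleftrightarrow> (\<forall>K. compact K \<and> K \<subseteq> \<Omega> \<longrightarrow> set_integrable lebesgue K f)"

definition Muckenhoupt :: "real \<Rightarrow> (real^'n) set \<Rightarrow> (real^'n \<Rightarrow> real) \<Rightarrow> bool" where
  "Muckenhoupt p \<Omega> w \<longleftrightarrow>
     loc_integrable \<Omega> w \<and> loc_integrable \<Omega> (\<lambda>x. 1 / w x) \<and>
     (\<exists>C>0. \<forall>x r. r > 0 \<and> ball x r \<subseteq> \<Omega> \<longrightarrow>
        (1 / measure lebesgue (ball x r)) * (LINT y:ball x r|lebesgue. w y)
          \<le> C * ((1 / measure lebesgue (ball x r)) *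
                  (LINT y:ball x r|lebesgue. w y powr (1 / (1 - p)))) powr (1 - p))"

text \<open>W_0^{1,p}(Omega,w): (u,g) with u, g in weighted L^p, approximable by test functions
  (g plays the role of the gradient of u).\<close>
definition W0 :: "real \<Rightarrow> (real^'n \<Rightarrow> real) \<Rightarrow> (real^'n) set \<Rightarrow> (real^'n \<Rightarrow> real) \<Rightarrow> (real^'n \<Rightarrow> real^'n) \<Rightarrow> bool" where
  "W0 p w \<Omega> u g \<longleftrightarrow>
     u \<in> borel_measurable lebesgue \<and> g \<in> borel_measurable lebesgue \<and>
     set_integrable lebesgue \<Omega> (\<lambda>x. w x * \<bar>u x\<bar> powr p) \<and>
     set_integrable lebesgue \<Omega> (\<lambda>x. w x * norm (g x) powr p) \<and>
     (\<exists>\<phi>. (\<forall>k. test_fun \<Omega> (\<phi> k)) \<and>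
        ((\<lambda>k. (LINT x:\<Omega>|lebesgue. w x * \<bar>\<phi> k x - u x\<bar> powr p)
             + (LINT x:\<Omega>|lebesgue. w x * norm (grad (\<phi> k) x - g x) powr p)) \<longlongrightarrow> 0) sequentially)"

text \<open>Weak form of  -div(w |grad u|^{p-2} grad u) = lambda w |u|^{p-2} u  in Omega.\<close>
definition weak_eig :: "real \<Rightarrow> (real^'n \<Rightarrow> real) \<Rightarrow> (real^'n) set \<Rightarrow> real \<Rightarrow> (real^'n \<Rightarrow> real) \<Rightarrow> (real^'n \<Rightarrow> real^'n) \<Rightarrow> bool" where
  "weak_eig p w \<Omega> lam u g \<longleftrightarrow>
     (\<forall>\<phi>. test_fun \<Omega> \<phi> \<longrightarrow>
        (LINT x:\<Omega>|lebesgue. w x * norm (g x) powr (p - 2) * (g x \<bullet> grad \<phi> x))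
          = lam * (LINT x:\<Omega>|lebesgue. w x * \<bar>u x\<bar> powr (p - 2) * u x * \<phi> x))"

definition is_eigenvalue :: "real \<Rightarrow> (real^'n \<Rightarrow> real) \<Rightarrow> (real^'n) set \<Rightarrow> real \<Rightarrow> bool" where
  "is_eigenvalue p w \<Omega> lam \<longleftrightarrow>
     (\<exists>u g. W0 p w \<Omega> u g \<and> \<not> (AE x in lebesgue. x \<in> \<Omega> \<longrightarrow> u x = 0) \<and> weak_eig p w \<Omega> lam u g)"

definition Linf_norm_one :: "(real^'n) set \<Rightarrow> (real^'n \<Rightarrow> real) \<Rightarrow> bool" where
  "Linf_norm_one \<Omega> v \<longleftrightarrow>
     (AE x in lebesgue. x \<in> \<Omega> \<longrightarrow> \<bar>v x\<bar> \<le> 1) \<and>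
     (\<forall>c<1. \<not> (AE x in lebesgue. x \<in> \<Omega> \<longrightarrow> \<bar>v x\<bar> \<le> c))"

definition first_eigenfunction :: "real \<Rightarrow> (real^'n \<Rightarrow> real) \<Rightarrow> (real^'n) set \<Rightarrow> (real^'n \<Rightarrow> real) \<Rightarrow> bool" where
  "first_eigenfunction p w \<Omega> v \<longleftrightarrow>
     (\<exists>lam g. is_eigenvalue p w \<Omega> lam \<and> (\<forall>\<mu>. is_eigenvalue p w \<Omega> \<mu> \<longrightarrow> lam \<le> \<mu>) \<and>
        W0 p w \<Omega> v g \<and> weak_eig p w \<Omega> lam v g \<and>
        (AE x in lebesgue. x \<in> \<Omega> \<longrightarrow> v x > 0) \<and> Linf_norm_one \<Omega> v)"

end

theory Submission
  imports Defs
begin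

text \<open>Let \<open>u\<close> be a common eigenfunction and \<open>\<xi>\<close> its weak gradient. A radial barrier outside an exterior
  ball shows that \<open>u \<le> 1/2\<close> near the boundary, so that for \<open>t \<ge> 1/2\<close> the set \<open>{u > t}\<close> stays in a
  compact part of the domain, where \<open>w\<close> is bounded below and Lipschitz. There the \<open>p\<close>-equation is
  tested with \<open>(u - t)\<^sup>+\<close> times a mollification of \<open>\<kappa> = (s - |\<xi>|)\<^sup>+\<close>, and the \<open>q\<close>-equation with \<open>(u - t)\<^sup>+\<close>
  times a mollification of \<open>w \<kappa>'\<close>, where \<open>\<kappa>'\<close> is the function of \<open>|\<xi>|\<close> with \<open>d\<kappa>' = |\<xi>|\<^bsup>p-q\<^esup> d\<kappa>\<close>. Formally
  the gradients of the two mollified factors cancel against the fluxes up to a term of size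
  \<open>|\<nabla>w| |\<xi>|\<^bsup>q-1\<^esup> \<kappa>'\<close>, because \<open>w |\<xi>|\<^bsup>p-2\<^esup> \<xi> = w |\<xi>|\<^bsup>p-q\<^esup> |\<xi>|\<^bsup>q-2\<^esup> \<xi>\<close>; the error is controlled by
  \<open>\<integral> (Y(x+h) - Y(x)) \<bullet> (\<xi>(x+h) - \<xi>(x)) = o(|h|)\<close> with \<open>Y = |\<xi>|\<^bsup>p-2\<^esup> \<xi>\<close>, which follows by testing the
  \<open>p\<close>-equation with a difference of translates. For small \<open>s\<close> the right-hand side of the \<open>p\<close>-equation
  dominates, and the outcome is \<open>|\<xi>| \<ge> s\<close> almost everywhere on \<open>{u > t}\<close>. The \<open>q\<close>-equation tested with
  \<open>(u - t)\<^sup>+\<close> then bounds \<open>s\<^sup>q\<close> by a multiple of \<open>1 - t\<close>, which is absurd as \<open>t \<rightarrow> 1\<close>.\<close>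

section \<open>Translations and convolutions\<close>

text \<open>Heuristically, where \<xi> = 0 the p-operator vanishes, being w |\<xi>|^(p-q) times the
  q-operator up to terms that vanish with \<xi>, whereas its right-hand side lam w u^(p-1) does not.
  So a common eigenfunction has no critical point, not even at its maximum. The obstacle is that
  only a weak gradient in a Lebesgue space is at hand: |\<xi>| has neither point values nor
  derivatives. Hence \<kappa> expresses "near \<xi> = 0" in integrated form, and it is
  differentiated only after mollification. The gradient of a kernel of radius r has mass of order
  1/r, so an error o(|h|) under shifts by h is exactly what makes the commutator disappear. Of the
  two inequalities |\<xi>|^(p-q) \<kappa> \<le> \<kappa>' \<le> s^(p-q) \<kappa>, the left one gives
  the terms with the gradient of (u - t)^+ a favourable sign, and the right one makes the q-side and
  the error from the weight small for small s.\<close>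

lemma nn_integral_lborel_affine:
  fixes f :: "'a::euclidean_space \<Rightarrow> ennreal"
  assumes [measurable]: "f \<in> borel_measurable borel" and c: "c \<noteq> 0"
  shows "(\<integral>\<^sup>+x. f x \<partial>lborel) = ennreal (\<bar>c\<bar> ^ DIM('a)) * (\<integral>\<^sup>+x. f (t + c *\<^sub>R x) \<partial>lborel)"
  by (subst lborel_affine[OF c, of t])
     (simp add: nn_integral_density nn_integral_distr nn_integral_cmult ennreal_power)

lemma integrable_lborel_affine:
  fixes f :: "'a::euclidean_space \<Rightarrow> 'b::{banach,second_countable_topology}"
  assumes "integrable lborel f" "c \<noteq> 0"
  shows "integrable lborel (\<lambda>x. f (t + c *\<^sub>R x))"
proof -
  have [measurable]: "f \<in> borel_measurable borel"
    using borel_measurable_integrable[OF assms(1)] by simp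
  have "(\<integral>\<^sup>+x. norm (f x) \<partial>lborel) < \<infinity>"
    using assms(1) by (simp add: integrable_iff_bounded)
  moreover have "0 < \<bar>c\<bar> ^ DIM('a)" using assms(2) by simp
  ultimately show ?thesis
    unfolding integrable_iff_bounded
    by (subst (asm) nn_integral_lborel_affine[where c=c and t=t])
      (use assms(2) in \<open>auto simp: ennreal_mult_less_top\<close>)
qed

lemma integral_lborel_affine:
  fixes f :: "'a::euclidean_space \<Rightarrow> 'b::{banach,second_countable_topology}"
  assumes "integrable lborel f" and c: "c \<noteq> 0"
  shows "(\<integral>x. f x \<partial>lborel) = \<bar>c\<bar> ^ DIM('a) *\<^sub>R (\<integral>x. f (t + c *\<^sub>R x) \<partial>lborel)"
proof -
  have [measurable]: "f \<in> borel_measurable borel"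
    using borel_measurable_integrable[OF assms(1)] by simp
  show ?thesis
    using integrable_lborel_affine[OF assms, of t]
    by (subst lborel_affine[OF c, of t]) (simp add: integral_density integral_distr)
qed

lemma nn_integral_lborel_shift:
  fixes f :: "'a::euclidean_space \<Rightarrow> ennreal"
  assumes "f \<in> borel_measurable borel"
  shows "(\<integral>\<^sup>+x. f (x + t) \<partial>lborel) = (\<integral>\<^sup>+x. f x \<partial>lborel)"
  using nn_integral_lborel_affine[OF assms, of 1 t] by (simp add: add.commute)

lemma nn_integral_lborel_reflect:
  fixes f :: "'a::euclidean_space \<Rightarrow> ennreal"
  assumes "f \<in> borel_measurable borel"
  shows "(\<integral>\<^sup>+x. f (t - x) \<partial>lborel) = (\<integral>\<^sup>+x. f x \<partial>lborel)"
  using nn_integral_lborel_affine[OF assms, of "-1" t] by simp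

lemma integrable_lborel_shift:
  fixes f :: "'a::euclidean_space \<Rightarrow> 'b::{banach,second_countable_topology}"
  assumes "integrable lborel f"
  shows "integrable lborel (\<lambda>x. f (x + t))" "integrable lborel (\<lambda>x. f (t - x))"
  using integrable_lborel_affine[OF assms, of 1 t] integrable_lborel_affine[OF assms, of "-1" t]
  by (simp_all add: add.commute)

lemma integral_lborel_shift:
  fixes f :: "'a::euclidean_space \<Rightarrow> 'b::{banach,second_countable_topology}"
  assumes "integrable lborel f"
  shows "(\<integral>x. f (x + t) \<partial>lborel) = (\<integral>x. f x \<partial>lborel)"
    "(\<integral>x. f (t - x) \<partial>lborel) = (\<integral>x. f x \<partial>lborel)"
  using integral_lborel_affine[OF assms, of 1 t] integral_lborel_affine[OF assms, of "-1" t]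
  by (simp_all add: add.commute)

text \<open>Induction over integrable functions. The indicator of \<open>A\<close> is squeezed
  between a compact \<open>K\<close> and an open \<open>U\<close> with \<open>U - K\<close> of small
  measure: a shift shorter than the distance from \<open>K\<close> to the complement of
  \<open>U\<close> changes it only on \<open>U - K\<close> and on a translate of
  \<open>U - K\<close>. Sums and dominated limits distribute \<open>e\<close> over two or three
  pieces.\<close>

lemma L1_translation_continuous:
  fixes f :: "'a::euclidean_space \<Rightarrow> 'b::{banach,second_countable_topology}"
  assumes "integrable lborel f"
  shows "0 < e \<Longrightarrow> \<exists>d>0. \<forall>h. norm h < d \<longrightarrow> (\<integral>\<^sup>+x. norm (f (x + h) - f x) \<partial>lborel) \<le> ennreal e"
  using assms
proof (induction f arbitrary: e rule: integrable_induct)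
  case (base A c)
  have A: "A \<in> sets lebesgue" using base(1) by auto
  \<comment> \<open>Three sets of measure below \<open>e1\<close> cover \<open>U - K\<close>, and
    \<open>U - K\<close> enters twice, once translated; hence the factor 6.\<close>
  define e1 where "e1 = e / (6 * (norm c + 1))"
  have e1: "e1 > 0" using base by (simp add: e1_def add_nonneg_pos)
  obtain U where U: "open U" "A \<subseteq> U" "emeasure lebesgue (U - A) < ennreal e1"
    by (rule sets_lebesgue_outer_open[OF A e1])
  obtain T where T: "closed T" "T \<subseteq> A" "emeasure lebesgue (A - T) < ennreal e1"
    by (rule sets_lebesgue_inner_closed[OF A e1])
  have Am[measurable]: "A \<in> sets borel" and Um[measurable]: "U \<in> sets borel" and Tm[measurable]: "T \<in> sets borel"
    using base(1) U(1) T(1) by auto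
  \<comment> \<open>The inner approximation \<open>T\<close> is only closed. Intersecting it with
    large balls makes it compact at a cost that tends to 0, since \<open>A\<close> has finite
    measure.\<close>
  have "(\<lambda>n::nat. emeasure lborel (T - cball 0 (real n))) \<longlonglongrightarrow> emeasure lborel (\<Inter>n::nat. T - cball 0 (real n))"
  proof (rule Lim_emeasure_decseq)
    show "decseq (\<lambda>n::nat. T - cball 0 (real n))" by (auto simp: decseq_def)
    show "emeasure lborel (T - cball 0 (real n)) \<noteq> \<infinity>" for n
      using emeasure_mono[of "T - cball 0 (real n)" A lborel] T(2) base(2)
      by (metis Am Diff_subset infinity_ennreal_def leD order_trans sets_lborel top_greatest subset_trans)
  qed auto
  moreover have "(\<Inter>n::nat. T - cball 0 (real n)) = {}"
    using real_arch_simple by (auto simp: not_le)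
  ultimately have "(\<lambda>n::nat. emeasure lborel (T - cball 0 (real n))) \<longlonglongrightarrow> 0" by (metis emeasure_empty)
  then have "\<forall>\<^sub>F n in sequentially. emeasure lborel (T - cball 0 (real n)) < ennreal e1"
    using e1 by (intro order_tendstoD) auto
  then obtain n :: nat where n: "emeasure lborel (T - cball 0 (real n)) < ennreal e1"
    by (auto simp: eventually_sequentially)
  define K where "K = T \<inter> cball 0 (real n)"
  have K: "compact K" "K \<subseteq> A" using T by (auto simp: K_def closed_Int_compact)
  have Km[measurable]: "K \<in> sets borel" using K by (simp add: borel_compact)
  have "emeasure lborel (U - K) \<le> emeasure lborel ((U - A) \<union> ((A - T) \<union> (T - cball 0 (real n))))"
    using T by (intro emeasure_mono) (auto simp: K_def)
  also have "\<dots> \<le> emeasure lborel (U - A) + emeasure lborel ((A - T) \<union> (T - cball 0 (real n)))"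
    by (intro emeasure_subadditive) auto
  also have "\<dots> \<le> emeasure lborel (U - A) + (emeasure lborel (A - T) + emeasure lborel (T - cball 0 (real n)))"
    by (intro add_left_mono emeasure_subadditive) auto
  also have "\<dots> \<le> ennreal e1 + (ennreal e1 + ennreal e1)"
    using U(3) T(3) n by (intro add_mono) auto
  also have "\<dots> = ennreal (3 * e1)" using e1 by (simp add: ennreal_plus[symmetric] del: ennreal_plus)
  finally have UK: "emeasure lborel (U - K) \<le> ennreal (3 * e1)" .
  obtain d where d: "d > 0" "\<And>x y. x \<in> K \<Longrightarrow> y \<notin> U \<Longrightarrow> d \<le> dist x y"
  proof -
    have "closed (- U)" "K \<inter> - U = {}" using K(2) U(1,2) by auto
    from separate_compact_closed[OF K(1) this] show ?thesis using that by (metis ComplI)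
  qed
  show ?case
  proof (intro exI[of _ d] conjI allI impI)
    fix h :: 'a assume h: "norm h < d"
    have pt: "norm (indicator A (x + h) *\<^sub>R c - indicator A x *\<^sub>R c)
        \<le> norm c * (indicator (U - K) x + indicator (U - K) (x + h))" for x
    proof -
      have "x \<in> K \<Longrightarrow> x + h \<in> U" using d(2)[of x "x+h"] h by (force simp: dist_norm)
      moreover have "x + h \<in> K \<Longrightarrow> x \<in> U" using d(2)[of "x+h" x] h by (force simp: dist_norm)
      ultimately show ?thesis using U(2) K(2) by (auto simp: indicator_def)
    qed
    have "(\<integral>\<^sup>+x. norm (indicator A (x + h) *\<^sub>R c - indicator A x *\<^sub>R c) \<partial>lborel)
      \<le> (\<integral>\<^sup>+x. ennreal (norm c) * (indicator (U - K) x + indicator (U - K) (x + h)) \<partial>lborel)"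
      using pt by (intro nn_integral_mono)
        (smt (verit) ennreal_indicator ennreal_leI ennreal_mult ennreal_plus indicator_pos_le norm_ge_zero)
    also have "\<dots> = ennreal (norm c) * ((\<integral>\<^sup>+x. indicator (U - K) x \<partial>lborel) + (\<integral>\<^sup>+x. indicator (U - K) (x + h) \<partial>lborel))"
      by (subst nn_integral_cmult; (subst nn_integral_add)?) auto
    also have "(\<integral>\<^sup>+x. indicator (U - K) (x + h) \<partial>lborel) = (\<integral>\<^sup>+x. indicator (U - K) x \<partial>lborel)"
      by (rule nn_integral_lborel_shift) auto
    also have "ennreal (norm c) * ((\<integral>\<^sup>+x. indicator (U - K) x \<partial>lborel) + (\<integral>\<^sup>+x. indicator (U - K) x \<partial>lborel))
       \<le> ennreal (norm c) * (ennreal (3 * e1) + ennreal (3 * e1))"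
      using UK by (intro mult_left_mono add_mono) auto
    also have "\<dots> = ennreal (norm c * (6 * e1))"
      using e1 by (simp add: ennreal_plus[symmetric] ennreal_mult'[symmetric] del: ennreal_plus)
    also have "\<dots> \<le> ennreal e"
    proof (rule ennreal_leI)
      have "norm c * (6 * e1) \<le> (norm c + 1) * (6 * e1)" using e1 by (intro mult_right_mono) auto
      also have "\<dots> = e" using base norm_ge_zero[of c] by (simp add: e1_def divide_simps add_nonneg_eq_0_iff)
      finally show "norm c * (6 * e1) \<le> e" .
    qed
    finally show "(\<integral>\<^sup>+x. norm (indicator A (x + h) *\<^sub>R c - indicator A x *\<^sub>R c) \<partial>lborel) \<le> ennreal e" .
  qed (use d in auto)
next
  case (add f g)
  then have e2: "e/2 > 0" by simp
  obtain d1 where d1: "d1>0" "\<And>h. norm h < d1 \<Longrightarrow> (\<integral>\<^sup>+x. norm (f (x + h) - f x) \<partial>lborel) \<le> ennreal (e/2)"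
    using add.IH(1)[OF e2] by blast
  obtain d2 where d2: "d2>0" "\<And>h. norm h < d2 \<Longrightarrow> (\<integral>\<^sup>+x. norm (g (x + h) - g x) \<partial>lborel) \<le> ennreal (e/2)"
    using add.IH(2)[OF e2] by blast
  have [measurable]: "f \<in> borel_measurable borel" "g \<in> borel_measurable borel"
    using borel_measurable_integrable[OF add.hyps(1)] borel_measurable_integrable[OF add.hyps(2)] by auto
  show ?case
  proof (intro exI[of _ "min d1 d2"] conjI allI impI)
    fix h :: 'a assume h: "norm h < min d1 d2"
    have "(\<integral>\<^sup>+x. norm ((f (x + h) + g (x + h)) - (f x + g x)) \<partial>lborel)
      \<le> (\<integral>\<^sup>+x. ennreal (norm (f (x + h) - f x)) + ennreal (norm (g (x + h) - g x)) \<partial>lborel)"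
      by (intro nn_integral_mono) (simp add: ennreal_plus[symmetric] norm_diff_triangle_ineq del: ennreal_plus)
    also have "\<dots> = (\<integral>\<^sup>+x. norm (f (x + h) - f x) \<partial>lborel) + (\<integral>\<^sup>+x. norm (g (x + h) - g x) \<partial>lborel)"
      by (intro nn_integral_add) auto
    also have "\<dots> \<le> ennreal (e/2) + ennreal (e/2)"
      using h d1(2) d2(2) by (intro add_mono) auto
    also have "\<dots> = ennreal e" using add.prems by (simp add: ennreal_plus[symmetric] del: ennreal_plus)
    finally show "(\<integral>\<^sup>+x. norm ((f (x + h) + g (x + h)) - (f x + g x)) \<partial>lborel) \<le> ennreal e" .
  qed (use d1 d2 in auto)
next
  case (lim f s)
  have [measurable]: "f \<in> borel_measurable borel"
    using borel_measurable_integrable[OF lim.hyps(4)] by auto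
  have sm[measurable]: "s i \<in> borel_measurable borel" for i
    using borel_measurable_integrable[OF lim.hyps(1)] by auto
  have "(\<lambda>i. \<integral>\<^sup>+x. norm (s i x - f x) \<partial>lborel) \<longlonglongrightarrow> 0"
  proof -
    have "integrable lborel (\<lambda>x. 2 *\<^sub>R f x)" using lim.hyps(4) by simp
    then have "(\<integral>\<^sup>+x. norm (2 *\<^sub>R f x) \<partial>lborel) < \<infinity>"
      unfolding integrable_iff_bounded by blast
    then have w2: "(\<integral>\<^sup>+x. ennreal (2 * norm (f x)) \<partial>lborel) < top" by simp
    have "((\<lambda>i. \<integral>\<^sup>+x. norm (f x - s i x) \<partial>lborel) \<longlongrightarrow> 0) sequentially"
      by (rule nn_integral_dominated_convergence_norm[where w="\<lambda>x. 2 * norm (f x)"])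
        (use lim w2 in auto)
    then show ?thesis by (simp add: norm_minus_commute)
  qed
  then have "\<forall>\<^sub>F i in sequentially. (\<integral>\<^sup>+x. norm (s i x - f x) \<partial>lborel) < ennreal (e/3)"
    using lim.prems by (intro order_tendstoD) auto
  then obtain i where i: "(\<integral>\<^sup>+x. norm (s i x - f x) \<partial>lborel) < ennreal (e/3)"
    by (auto simp: eventually_sequentially)
  have "e / 3 > 0" using lim.prems by simp
  from lim.IH[OF this, of i] obtain d where d: "d>0"
    "\<And>h. norm h < d \<Longrightarrow> (\<integral>\<^sup>+x. norm (s i (x + h) - s i x) \<partial>lborel) \<le> ennreal (e/3)" by blast
  show ?case
  proof (intro exI[of _ d] conjI allI impI)
    fix h :: 'a assume h: "norm h < d"
    have "(\<integral>\<^sup>+x. norm (f (x + h) - f x) \<partial>lborel)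
      \<le> (\<integral>\<^sup>+x. ennreal (norm (s i (x + h) - f (x + h))) + (ennreal (norm (s i (x + h) - s i x)) + ennreal (norm (s i x - f x))) \<partial>lborel)"
    proof (intro nn_integral_mono)
      fix x
      have "norm (f (x + h) - f x) \<le> norm (s i (x + h) - f (x + h)) + (norm (s i (x + h) - s i x) + norm (s i x - f x))"
      proof -
        have "norm (f (x + h) - f x) = norm (- (s i (x + h) - f (x + h)) + ((s i (x + h) - s i x) + (s i x - f x)))"
          by simp
        also have "\<dots> \<le> norm (- (s i (x + h) - f (x + h))) + norm ((s i (x + h) - s i x) + (s i x - f x))"
          by (rule norm_triangle_ineq)
        also have "\<dots> \<le> norm (s i (x + h) - f (x + h)) + (norm (s i (x + h) - s i x) + norm (s i x - f x))"
          unfolding norm_minus_cancel by (rule add_left_mono norm_triangle_ineq)+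
        finally show ?thesis .
      qed
      from ennreal_leI[OF this] show "ennreal (norm (f (x + h) - f x)) \<le> ennreal (norm (s i (x + h) - f (x + h))) + (ennreal (norm (s i (x + h) - s i x)) + ennreal (norm (s i x - f x)))"
        by simp
    qed
    also have "\<dots> = (\<integral>\<^sup>+x. norm (s i (x + h) - f (x + h)) \<partial>lborel) + ((\<integral>\<^sup>+x. norm (s i (x + h) - s i x) \<partial>lborel) + (\<integral>\<^sup>+x. norm (s i x - f x) \<partial>lborel))"
      by (subst nn_integral_add; (subst nn_integral_add)?) auto
    also have "(\<integral>\<^sup>+x. norm (s i (x + h) - f (x + h)) \<partial>lborel) = (\<integral>\<^sup>+x. norm (s i x - f x) \<partial>lborel)"
      using nn_integral_lborel_shift[of "\<lambda>x. ennreal (norm (s i x - f x))" h] by simp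
    also have "(\<integral>\<^sup>+x. norm (s i x - f x) \<partial>lborel) + ((\<integral>\<^sup>+x. norm (s i (x + h) - s i x) \<partial>lborel) + (\<integral>\<^sup>+x. norm (s i x - f x) \<partial>lborel))
       \<le> ennreal (e/3) + (ennreal (e/3) + ennreal (e/3))"
      using i h d(2) by (intro add_mono) auto
    also have "\<dots> = ennreal e" using lim.prems by (simp add: ennreal_plus[symmetric] del: ennreal_plus)
    finally show "(\<integral>\<^sup>+x. norm (f (x + h) - f x) \<partial>lborel) \<le> ennreal e" .
  qed (use d in auto)
qed

text \<open>Young's inequality for the product of \<open>s * a\<close> and \<open>b / s\<close>,
  where the p'-th power of \<open>s\<close> is \<tau>; the factors 1/p' and 1/p, both below 1, are
  dropped.\<close>

lemma Young_eps:
  fixes p :: real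
  assumes "p > 1" "\<tau> > 0"
  obtains C where "C > 0" "\<And>a b. 0 \<le> a \<Longrightarrow> 0 \<le> b \<Longrightarrow> a * b \<le> \<tau> * a powr (p/(p-1)) + C * b powr p"
proof -
  define p' where "p' = p/(p-1)"
  have p': "p' > 1" "1/p' + 1/p = 1" using assms by (auto simp: p'_def field_simps)
  define s where "s = \<tau> powr (1/p')"
  have s: "s > 0" using assms by (simp add: s_def)
  show ?thesis
  proof (rule that[of "s powr (-p)"])
    fix a b :: real assume ab: "0 \<le> a" "0 \<le> b"
    have "a * b = (s * a) * (b / s)" using s by simp
    also have "\<dots> \<le> (s * a) powr p' / p' + (b / s) powr p / p"
      by (rule Youngs_inequality) (use assms p' ab s in auto)
    also have "\<dots> \<le> (s * a) powr p' + (b / s) powr p"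
    proof (intro add_mono)
      show "(s * a) powr p' / p' \<le> (s * a) powr p'" "(b / s) powr p / p \<le> (b / s) powr p"
        using p' assms by (simp_all add: divide_le_eq mult_le_cancel_left1)
    qed
    also have "(s * a) powr p' = \<tau> * a powr p'"
      using s ab assms p' by (simp add: powr_mult s_def powr_powr)
    also have "(b / s) powr p = s powr (-p) * b powr p"
      using s ab by (simp add: powr_divide powr_minus divide_simps)
    finally show "a * b \<le> \<tau> * a powr (p/(p-1)) + s powr (-p) * b powr p" by (simp add: p'_def)
  qed (use s in auto)
qed

section \<open>C^1 functions of compact support and convolution\<close>

text \<open>The second argument is the gradient of the first.\<close>
definition C1 :: "('a::euclidean_space \<Rightarrow> real) \<Rightarrow> ('a \<Rightarrow> 'a) \<Rightarrow> bool" where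
  "C1 f G \<longleftrightarrow> (\<forall>x. GDERIV f x :> G x) \<and> continuous_on UNIV G"

definition C1c :: "'a::euclidean_space set \<Rightarrow> ('a \<Rightarrow> real) \<Rightarrow> ('a \<Rightarrow> 'a) \<Rightarrow> bool" where
  "C1c S f G \<longleftrightarrow> C1 f G \<and> (\<exists>K. compact K \<and> K \<subseteq> S \<and> (\<forall>x. x \<notin> K \<longrightarrow> f x = 0))"

text \<open>The first factor is always scalar, so the second may be a vector field. Two uses
  alternate: \<open>conv (k n) f\<close> is the mollification of a function or field, and
  \<open>conv f (k' n)\<close> is the gradient of that mollification for scalar
  \<open>f\<close>.\<close>

definition conv :: "('a::euclidean_space \<Rightarrow> real) \<Rightarrow> ('a \<Rightarrow> 'b::{banach,second_countable_topology}) \<Rightarrow> 'a \<Rightarrow> 'b" where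
  "conv f g x = (\<integral>y. f y *\<^sub>R g (x - y) \<partial>lborel)"

lemma C1_D: "C1 f G \<Longrightarrow> GDERIV f x :> G x" "C1 f G \<Longrightarrow> continuous_on UNIV G"
  "C1 f G \<Longrightarrow> continuous_on UNIV f"
  by (auto simp: C1_def gderiv_def intro: has_derivative_continuous_on[of UNIV f] )

lemma C1_borel: "C1 f G \<Longrightarrow> f \<in> borel_measurable borel" "C1 f G \<Longrightarrow> G \<in> borel_measurable borel"
  by (auto dest: C1_D intro: borel_measurable_continuous_onI)

lemma C1_mult: "C1 f F \<Longrightarrow> C1 g G \<Longrightarrow> C1 (\<lambda>x. f x * g x) (\<lambda>x. f x *\<^sub>R G x + g x *\<^sub>R F x)"
  using C1_D[of f F] C1_D[of g G] unfolding C1_def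
  by (auto intro!: GDERIV_mult continuous_intros)

lemma C1_shift: "C1 f F \<Longrightarrow> C1 (\<lambda>x. f (x + h)) (\<lambda>x. F (x + h))"
proof -
  assume f: "C1 f F"
  have "GDERIV (\<lambda>x. f (x + h)) x :> F (x + h)" for x
  proof -
    have "(f has_derivative (\<lambda>v. v \<bullet> F (x + h))) (at (x + h))" using C1_D(1)[OF f, of "x+h"] by (simp add: gderiv_def)
    moreover have "((\<lambda>x. x + h) has_derivative (\<lambda>v. v)) (at x)" by (auto intro!: derivative_eq_intros)
    ultimately show ?thesis unfolding gderiv_def
      using diff_chain_at[of "\<lambda>x. x + h" "\<lambda>v. v" x f] by (simp add: o_def)
  qed
  then show ?thesis using C1_D(2)[OF f] unfolding C1_def
    by (auto intro!: continuous_intros continuous_on_compose2[of UNIV F UNIV "\<lambda>x. x + h"])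
qed

lemma GDERIV_zero_open:
  assumes "GDERIV f x :> D" "open U" "x \<in> U" "\<And>y. y \<in> U \<Longrightarrow> f y = 0"
  shows "D = 0"
proof -
  have "(f has_derivative (\<lambda>h. h \<bullet> D)) (at x)" using assms(1) by (simp add: gderiv_def)
  moreover have "(f has_derivative (\<lambda>h. 0)) (at x)"
    by (rule has_derivative_transform_within_open[of "\<lambda>_. 0" _ x UNIV U]) (use assms in auto)
  ultimately have "(\<lambda>h. h \<bullet> D) = (\<lambda>h. 0)" by (rule has_derivative_unique)
  then show ?thesis by (metis inner_eq_zero_iff)
qed

lemma C1_grad_zero:
  assumes "C1 f G" "closed K" "\<And>x. x \<notin> K \<Longrightarrow> f x = 0" "x \<notin> K"
  shows "G x = 0"
  using GDERIV_zero_open[OF C1_D(1)[OF assms(1)], of "- K" x] assms by auto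

lemma C1c_obtain:
  assumes "C1c S f G"
  obtains K where "compact K" "K \<subseteq> S" "\<And>x. x \<notin> K \<Longrightarrow> f x = 0" "\<And>x. x \<notin> K \<Longrightarrow> G x = 0"
  using assms C1_grad_zero[of f G] compact_imp_closed unfolding C1c_def by metis

lemma C1c_C1: "C1c S f G \<Longrightarrow> C1 f G"
  by (simp add: C1c_def)

lemma C1c_subset: "C1c S f G \<Longrightarrow> S \<subseteq> T \<Longrightarrow> C1c T f G"
  unfolding C1c_def by blast

lemma C1c_mult: "C1c S f F \<Longrightarrow> C1 g G \<Longrightarrow> C1c S (\<lambda>x. f x * g x) (\<lambda>x. f x *\<^sub>R G x + g x *\<^sub>R F x)"
  using C1_mult[of f F g G] unfolding C1c_def by force

lemma compact_support_integrable:
  fixes f :: "'a::euclidean_space \<Rightarrow> 'b::{banach,second_countable_topology}"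
  assumes "continuous_on UNIV f" "compact K" "\<And>x. x \<notin> K \<Longrightarrow> f x = 0"
  shows "integrable lborel f"
proof -
  have "integrable lborel (\<lambda>x. indicator K x *\<^sub>R f x)"
    using assms by (intro borel_integrable_compact) (auto intro: continuous_on_subset)
  moreover have "(\<lambda>x. indicator K x *\<^sub>R f x) = f" using assms(3) by (auto simp: indicator_def)
  ultimately show ?thesis by simp
qed

lemma compact_support_bounded:
  fixes f :: "'a::euclidean_space \<Rightarrow> 'b::real_normed_vector"
  assumes "continuous_on UNIV f" "compact K" "\<And>x. x \<notin> K \<Longrightarrow> f x = 0"
  obtains M where "M \<ge> 0" "\<And>x. norm (f x) \<le> M"
proof -
  have "compact (f ` K)" using assms by (auto intro!: compact_continuous_image intro: continuous_on_subset)
  then obtain M where M: "\<And>x. x \<in> K \<Longrightarrow> norm (f x) \<le> M"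
    using compact_imp_bounded bounded_iff by (metis imageI)
  show ?thesis
  proof (rule that[of "max M 0"])
    show "norm (f x) \<le> max M 0" for x using M[of x] assms(3)[of x] by (cases "x \<in> K") auto
  qed auto
qed

lemma compact_nbhd:
  fixes K :: "'a::euclidean_space set"
  assumes "compact K"
  shows "compact {x + y | x y. x \<in> K \<and> y \<in> cball 0 r}"
  using compact_sums[OF assms compact_cball] .

lemma compact_support_uniform:
  fixes f :: "'a::euclidean_space \<Rightarrow> 'b::real_normed_vector"
  assumes "continuous_on UNIV f" "compact K" "\<And>x. x \<notin> K \<Longrightarrow> f x = 0" "e > 0"
  obtains d where "d > 0" "\<And>x h. norm h < d \<Longrightarrow> norm (f (x + h) - f x) \<le> e"
proof -
  define K' where "K' = {x + y | x y. x \<in> K \<and> y \<in> cball 0 1}"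
  have "uniformly_continuous_on K' f"
    using compact_nbhd[OF assms(2)] assms(1) unfolding K'_def
    by (intro compact_uniformly_continuous) (auto intro: continuous_on_subset)
  then obtain d where d: "d>0" "\<And>x x'. x \<in> K' \<Longrightarrow> x' \<in> K' \<Longrightarrow> dist x' x < d \<Longrightarrow> dist (f x') (f x) < e"
    using assms(4) unfolding uniformly_continuous_on_def by meson
  show ?thesis
  proof (rule that[of "min d 1"])
    fix x h :: 'a assume h: "norm h < min d 1"
    have in1: "x \<in> K \<Longrightarrow> x \<in> K'" "x \<in> K \<Longrightarrow> x + h \<in> K'"
      unfolding K'_def using h by (force intro: exI[of _ x] exI[of _ 0] exI[of _ h])+
    have in2: "x + h \<in> K \<Longrightarrow> x + h \<in> K'"
      unfolding K'_def using h by (force intro: exI[of _ "x+h"] exI[of _ 0])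
    have in3: "x + h \<in> K \<Longrightarrow> x \<in> K'"
      unfolding K'_def using h by (intro CollectI exI[of _ "x+h"] exI[of _ "-h"]) auto
    show "norm (f (x + h) - f x) \<le> e"
    proof (cases "x \<in> K \<or> x + h \<in> K")
      case True
      then have "x \<in> K'" "x + h \<in> K'" using in1 in2 in3 by auto
      from d(2)[OF this] h show ?thesis by (simp add: dist_norm)
    next
      case False
      then show ?thesis using assms(3,4) by auto
    qed
  qed (use d in auto)
qed

lemma C1c_integrable:
  assumes "C1c S f G"
  shows "integrable lborel f" "integrable lborel G"
  using assms C1_D(2,3)[OF C1c_C1[OF assms]]
  by (auto elim!: C1c_obtain intro: compact_support_integrable)

text \<open>The gradient, continuous with compact support, is uniformly continuous; the mean value
  inequality for \<open>f\<close> minus its linearisation on a ball then gives one \<open>d\<close>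
  for all \<open>x\<close>.\<close>

lemma C1c_remainder:
  assumes f: "C1c S f G" and e: "e > 0"
  obtains d where "d > 0" "\<And>x h. norm h < d \<Longrightarrow> \<bar>f (x + h) - f x - h \<bullet> G x\<bar> \<le> e * norm h"
proof -
  note C = C1c_C1[OF f]
  obtain K where K: "compact K" "\<And>x. x \<notin> K \<Longrightarrow> G x = 0" using f by (auto elim: C1c_obtain)
  obtain d where d: "d > 0" "\<And>x h. norm h < d \<Longrightarrow> norm (G (x + h) - G x) \<le> e"
    using compact_support_uniform[OF C1_D(2)[OF C] K e] by metis
  show ?thesis
  proof (rule that[OF d(1)])
    fix x h :: 'a assume h: "norm h < d"
    have "norm (f (x + h) - f x - (\<lambda>v. v \<bullet> G x) ((x + h) - x)) \<le> norm ((x + h) - x) * e"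
    proof (rule differentiable_bound_linearization[where S="ball x d" and f' = "\<lambda>y v. v \<bullet> G y"])
      show "x + t *\<^sub>R (x + h - x) \<in> ball x d" if "t \<in> {0..1}" for t
      proof -
        have "t * norm h \<le> norm h" using that by (simp add: mult_left_le_one_le)
        then show ?thesis using h that by (simp add: dist_norm)
      qed
      show "(f has_derivative (\<lambda>v. v \<bullet> G y)) (at y within ball x d)" for y
        using C1_D(1)[OF C, of y] by (auto simp: gderiv_def intro: has_derivative_at_withinI)
      show "onorm ((\<lambda>v. v \<bullet> G y) - (\<lambda>v. v \<bullet> G x)) \<le> e" if "y \<in> ball x d" for y
      proof (rule onorm_bound)
        fix v :: 'a
        have "norm (G y - G x) \<le> e" using d(2)[of "y - x" x] that by (simp add: dist_norm norm_minus_commute)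
        then have "norm v * norm (G y - G x) \<le> norm v * e" by (intro mult_left_mono) auto
        then show "norm (((\<lambda>v. v \<bullet> G y) - (\<lambda>v. v \<bullet> G x)) v) \<le> e * norm v"
          using Cauchy_Schwarz_ineq2[of v "G y - G x"] by (simp add: inner_diff_right mult.commute)
      qed (use e in auto)
    qed (use d in auto)
    then show "\<bar>f (x + h) - f x - h \<bullet> G x\<bar> \<le> e * norm h" by (simp add: mult.commute)
  qed
qed

text \<open>By translation invariance the integral of f(x + h) - f(x) is 0, so integrating the
  first-order remainder leaves - h \<bullet> I with I the integral of the gradient. The remainder is
  at most e |h| on a set of fixed measure; with h parallel to I this forces I = 0. All integrations
  by parts below rest on this.\<close>

lemma C1c_integral_grad:
  assumes f: "C1c S f G"
  shows "(\<integral>x. G x \<partial>lborel) = 0"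
proof (rule ccontr)
  define I where "I = (\<integral>x. G x \<partial>lborel)"
  assume "(\<integral>x. G x \<partial>lborel) \<noteq> 0"
  then have I: "I \<noteq> 0" by (simp add: I_def)
  obtain K where K: "compact K" "\<And>x. x \<notin> K \<Longrightarrow> f x = 0" "\<And>x. x \<notin> K \<Longrightarrow> G x = 0"
    using f by (auto elim: C1c_obtain)
  define K' where "K' = {x + y | x y. x \<in> K \<and> y \<in> cball 0 1}"
  have K': "compact K'" unfolding K'_def by (rule compact_nbhd[OF K(1)])
  have K'm: "K' \<in> sets lborel" "emeasure lborel K' < \<infinity>"
    using K' emeasure_bounded_finite[OF compact_imp_bounded[OF K']] by (auto intro: borel_compact)
  define m where "m = measure lborel K'"
  have m: "m \<ge> 0" by (simp add: m_def)
  \<comment> \<open>Ensures that \<open>e * m\<close> is at most half of \<open>norm I\<close>,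
    while the remainder estimate will yield \<open>norm I \<le> e * m\<close>.\<close>
  define e where "e = norm I / (2 * (m + 1))"
  have e: "e > 0" using I m by (simp add: e_def)
  obtain d where d: "d > 0" "\<And>x h. norm h < d \<Longrightarrow> \<bar>f (x + h) - f x - h \<bullet> G x\<bar> \<le> e * norm h"
    using C1c_remainder[OF f e] by metis
  \<comment> \<open>\<open>h\<close> points along \<open>I\<close>, which gives equality in
    Cauchy-Schwarz, and is shorter than 1, so that \<open>x\<close> and \<open>x + h\<close> both
    miss \<open>K\<close> when \<open>x\<close> is outside the unit neighbourhood
    \<open>K'\<close>.\<close>
  define s where "s = min d 1 / (2 * norm I)"
  define h where "h = s *\<^sub>R I"
  have nh: "norm h = min d 1 / 2" using I d by (simp add: h_def s_def)
  have nhd: "norm h < d" using nh d(1) by linarith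
  have s: "s > 0" using I d by (simp add: s_def)
  note int = C1c_integrable[OF f]
  have "(\<integral>x. f (x + h) - f x - h \<bullet> G x \<partial>lborel) = - (h \<bullet> I)"
    using int integrable_lborel_shift(1)[OF int(1), of h] integral_lborel_shift(1)[OF int(1), of h]
    by (simp add: I_def)
  moreover have "\<bar>\<integral>x. f (x + h) - f x - h \<bullet> G x \<partial>lborel\<bar> \<le> (\<integral>x. (e * norm h) * indicator K' x \<partial>lborel)"
  proof (rule order_trans[OF integral_abs_bound])
    show "(\<integral>x. \<bar>f (x + h) - f x - h \<bullet> G x\<bar> \<partial>lborel) \<le> (\<integral>x. (e * norm h) * indicator K' x \<partial>lborel)"
    proof (rule integral_mono)
      show "integrable lborel (\<lambda>x. \<bar>f (x + h) - f x - h \<bullet> G x\<bar>)"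
        using int integrable_lborel_shift(1)[OF int(1), of h] by (intro integrable_abs) auto
      show "integrable lborel (\<lambda>x. (e * norm h) * indicator K' x)"
        using K'm by (intro integrable_mult_right integrable_real_indicator)
      fix x
      show "\<bar>f (x + h) - f x - h \<bullet> G x\<bar> \<le> (e * norm h) * indicator K' x"
      proof (cases "x \<in> K'")
        case True
        then show ?thesis using d(2)[OF nhd, of x] by simp
      next
        case False
        have "x \<notin> K" using False unfolding K'_def by (force intro: exI[of _ x] exI[of _ 0])
        moreover have "x + h \<notin> K"
        proof
          assume "x + h \<in> K"
          then have "x \<in> K'" unfolding K'_def using nh
            by (intro CollectI exI[of _ "x+h"] exI[of _ "-h"]) auto
          with False show False by simp
        qed
        ultimately show ?thesis using K False by simp
      qed
    qed
  qed
  moreover have "(\<integral>x. (e * norm h) * indicator K' x \<partial>lborel) = e * norm h * m"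
    using K'm by (simp add: m_def)
  ultimately have "\<bar>h \<bullet> I\<bar> \<le> e * norm h * m" by linarith
  moreover have "\<bar>h \<bullet> I\<bar> = norm h * norm I"
    using s by (simp add: h_def abs_mult power2_norm_eq_inner[symmetric] power2_eq_square)
  ultimately have "norm h * norm I \<le> norm h * (e * m)" by (simp add: mult_ac)
  then have "norm I \<le> e * m" using nh d(1) by simp
  also have "e * m \<le> norm I / 2" using m I by (simp add: e_def divide_simps)
  finally show False using I by simp
qed

lemma conv_commute:
  fixes g :: "'a::euclidean_space \<Rightarrow> 'b::{banach,second_countable_topology}"
  assumes "integrable lborel (\<lambda>y. f y *\<^sub>R g (x - y))"
  shows "conv f g x = (\<integral>y. f (x - y) *\<^sub>R g y \<partial>lborel)"
  using integral_lborel_shift(2)[OF assms, of x] by (simp add: conv_def)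

lemma conv_integrable:
  fixes g :: "'a::euclidean_space \<Rightarrow> 'b::{banach,second_countable_topology}"
  assumes "integrable lborel f" "continuous_on UNIV g" "\<And>x. norm (g x) \<le> M"
  shows "integrable lborel (\<lambda>y. f y *\<^sub>R g (x - y))"
proof (rule Bochner_Integration.integrable_bound[of _ "\<lambda>y. M * f y"])
  have [measurable]: "f \<in> borel_measurable borel" "g \<in> borel_measurable borel"
    using assms(1,2) by (auto intro: borel_measurable_continuous_onI)
  show "(\<lambda>y. f y *\<^sub>R g (x - y)) \<in> borel_measurable lborel" by measurable
  have "0 \<le> M" using assms(3)[of 0] norm_ge_zero order_trans by blast
  then show "AE y in lborel. norm (f y *\<^sub>R g (x - y)) \<le> norm (M * f y)"
    using assms(3) by (intro AE_I2) (auto simp: abs_mult mult.commute[of M] intro!: mult_left_mono)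
qed (use assms in auto)

lemma conv_integrable':
  fixes f :: "'a::euclidean_space \<Rightarrow> 'b::{banach,second_countable_topology}"
  assumes "integrable lborel f" "continuous_on UNIV k" "\<And>x. \<bar>k x\<bar> \<le> M"
  shows "integrable lborel (\<lambda>y. k y *\<^sub>R f (x - y))"
proof (rule Bochner_Integration.integrable_bound[of _ "\<lambda>y. M *\<^sub>R f (x - y)"])
  have [measurable]: "f \<in> borel_measurable borel" "k \<in> borel_measurable borel"
    using assms(1,2) by (auto intro: borel_measurable_continuous_onI)
  show "(\<lambda>y. k y *\<^sub>R f (x - y)) \<in> borel_measurable lborel" by measurable
  have "0 \<le> M" using assms(3)[of 0] by linarith
  then show "AE y in lborel. norm (k y *\<^sub>R f (x - y)) \<le> norm (M *\<^sub>R f (x - y))"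
    using assms(3) by (auto intro!: mult_right_mono)
qed (use integrable_lborel_shift(2)[OF assms(1), of x] in auto)

text \<open>Only \<open>k\<close> is differentiated: its first-order remainder is uniform in the
  point, so multiplying by |f(y)| and integrating costs the factor \<open>m\<close>, the L^1 norm of
  \<open>f\<close>. No regularity of \<open>f\<close> enters.\<close>

lemma C1_conv:
  assumes f: "integrable lborel f" and k: "C1c S k k'"
  shows "C1 (conv f k) (conv f k')"
proof -
  note C = C1c_C1[OF k]
  obtain K where K: "compact K" "\<And>x. x \<notin> K \<Longrightarrow> k x = 0" "\<And>x. x \<notin> K \<Longrightarrow> k' x = 0"
    using k by (auto elim: C1c_obtain)
  obtain M where M: "\<And>x. norm (k x) \<le> M" using compact_support_bounded[OF C1_D(3)[OF C] K(1,2)] by metis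
  obtain M' where M': "\<And>x. norm (k' x) \<le> M'" using compact_support_bounded[OF C1_D(2)[OF C] K(1,3)] by metis
  note i1 = conv_integrable[OF f C1_D(3)[OF C] M, simplified]
  note i2 = conv_integrable[OF f C1_D(2)[OF C] M']
  define m where "m = (\<integral>y. \<bar>f y\<bar> \<partial>lborel)"
  have m: "m \<ge> 0" by (simp add: m_def)
  have "GDERIV (conv f k) x :> conv f k' x" for x
    unfolding gderiv_def has_derivative_at_alt
  proof (intro conjI allI impI)
    show "bounded_linear (\<lambda>h. h \<bullet> conv f k' x)" by (rule bounded_linear_inner_left)
    fix e :: real assume e: "e > 0"
    have "e / (m + 1) > 0" using e m by simp
    then obtain d where d: "d > 0" "\<And>x h. norm h < d \<Longrightarrow> \<bar>k (x + h) - k x - h \<bullet> k' x\<bar> \<le> e / (m + 1) * norm h"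
      using C1c_remainder[OF k] by metis
    show "\<exists>d>0. \<forall>y. norm (y - x) < d \<longrightarrow> norm (conv f k y - conv f k x - (y - x) \<bullet> conv f k' x) \<le> e * norm (y - x)"
    proof (intro exI[of _ d] conjI allI impI)
      fix z assume z: "norm (z - x) < d"
      have "conv f k z - conv f k x - (z - x) \<bullet> conv f k' x
        = (\<integral>y. f y * k (z - y) - f y * k (x - y) - (z - x) \<bullet> (f y *\<^sub>R k' (x - y)) \<partial>lborel)"
        unfolding conv_def using i1 i2 by (simp del: inner_scaleR_right)
      also have "norm \<dots> \<le> (\<integral>y. (e / (m + 1) * norm (z - x)) * \<bar>f y\<bar> \<partial>lborel)"
      proof (rule order_trans[OF integral_norm_bound integral_mono])
        fix y
        have "f y * k (z - y) - f y * k (x - y) - (z - x) \<bullet> (f y *\<^sub>R k' (x - y))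
          = f y * (k ((x - y) + (z - x)) - k (x - y) - (z - x) \<bullet> k' (x - y))"
          by (simp add: algebra_simps)
        then show "norm (f y * k (z - y) - f y * k (x - y) - (z - x) \<bullet> (f y *\<^sub>R k' (x - y)))
          \<le> (e / (m + 1) * norm (z - x)) * \<bar>f y\<bar>"
          using mult_left_mono[OF d(2)[OF z, of "x - y"], of "\<bar>f y\<bar>"] by (simp add: abs_mult mult_ac)
      qed (use i1 i2 f in \<open>auto simp del: inner_scaleR_right\<close>)
      also have "\<dots> = (e / (m + 1) * norm (z - x)) * m" by (simp add: m_def)
      also have "\<dots> \<le> e * norm (z - x)"
      proof -
        have "m / (m + 1) \<le> 1" using m by simp
        then have "(e * norm (z - x)) * (m / (m + 1)) \<le> (e * norm (z - x)) * 1" using e by (intro mult_left_mono) auto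
        then show ?thesis by (simp add: mult_ac)
      qed
      finally show "norm (conv f k z - conv f k x - (z - x) \<bullet> conv f k' x) \<le> e * norm (z - x)" .
    qed (use d in auto)
  qed
  moreover have "continuous_on UNIV (conv f k')"
    unfolding continuous_on_iff
  proof (intro ballI allI impI)
    fix x e assume e: "(e::real) > 0"
    have "e / (m + 1) / 2 > 0" using e m by simp
    then obtain d where d: "d > 0" "\<And>x h. norm h < d \<Longrightarrow> norm (k' (x + h) - k' x) \<le> e / (m + 1) / 2"
      using compact_support_uniform[OF C1_D(2)[OF C] K(1,3)] by metis
    show "\<exists>d>0. \<forall>x'\<in>UNIV. dist x' x < d \<longrightarrow> dist (conv f k' x') (conv f k' x) < e"
    proof (intro exI[of _ d] conjI ballI impI)
      fix z assume z: "dist z x < d"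
      have "conv f k' z - conv f k' x = (\<integral>y. f y *\<^sub>R k' (z - y) - f y *\<^sub>R k' (x - y) \<partial>lborel)"
        unfolding conv_def using i2 by simp
      also have "norm \<dots> \<le> (\<integral>y. (e / (m + 1) / 2) * \<bar>f y\<bar> \<partial>lborel)"
      proof (rule order_trans[OF integral_norm_bound integral_mono])
        fix y
        have "norm (k' ((x - y) + (z - x)) - k' (x - y)) \<le> e / (m + 1) / 2"
          using d(2)[of "z - x" "x - y"] z by (simp add: dist_norm)
        then have "norm (k' (z - y) - k' (x - y)) \<le> e / (m + 1) / 2" by simp
        then show "norm (f y *\<^sub>R k' (z - y) - f y *\<^sub>R k' (x - y)) \<le> (e / (m + 1) / 2) * \<bar>f y\<bar>"
          by (metis abs_ge_zero mult.commute mult_left_mono norm_scaleR scaleR_diff_right)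
      qed (use i2 f in auto)
      also have "\<dots> = (e / (m + 1) / 2) * m" by (simp add: m_def)
      also have "\<dots> < e" using m e by (simp add: divide_simps)
      finally show "dist (conv f k' z) (conv f k' x) < e" by (simp add: dist_norm)
    qed (use d in auto)
  qed
  ultimately show ?thesis by (simp add: C1_def)
qed

text \<open>Since \<open>k\<close> has integral 1, the error at x is the integral of k(y) (f(x - y)
  - f(x)) over y, and Fubini moves the x-integral inside. \<open>C\<close> bounds the mass of |k|,
  which may exceed 1 because \<open>k\<close> may change sign.\<close>

lemma conv_error:
  fixes f :: "'a::euclidean_space \<Rightarrow> 'b::{banach,second_countable_topology}" and F :: "'a \<Rightarrow> real"
  assumes f: "integrable lborel f" and k: "continuous_on UNIV k" "\<And>x. norm x > r \<Longrightarrow> k x = 0"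
    and k1: "(\<integral>x. k x \<partial>lborel) = 1" and kC: "(\<integral>x. \<bar>k x\<bar> \<partial>lborel) \<le> C"
    and F[measurable]: "F \<in> borel_measurable borel" and \<delta>: "\<delta> \<ge> 0"
    and bound: "\<And>h. norm h \<le> r \<Longrightarrow> (\<integral>\<^sup>+x. \<bar>F x\<bar> * norm (f (x + h) - f x) \<partial>lborel) \<le> ennreal \<delta>"
  shows "(\<integral>\<^sup>+x. \<bar>F x\<bar> * norm (conv k f x - f x) \<partial>lborel) \<le> ennreal (C * \<delta>)"
proof -
  have [measurable]: "f \<in> borel_measurable borel" "k \<in> borel_measurable borel"
    using f k(1) by (auto intro: borel_measurable_continuous_onI)
  have K0: "\<And>x. x \<notin> cball 0 r \<Longrightarrow> k x = 0" using k(2) by auto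
  obtain M where M: "\<And>x. \<bar>k x\<bar> \<le> M" using compact_support_bounded[OF k(1) compact_cball K0] by (metis real_norm_def)
  have ik: "integrable lborel k" by (rule compact_support_integrable[OF k(1) compact_cball K0])
  note ic = conv_integrable'[OF f k(1) M]
  have pt: "ennreal (norm (conv k f x - f x)) \<le> (\<integral>\<^sup>+y. \<bar>k y\<bar> * norm (f (x - y) - f x) \<partial>lborel)" for x
  proof -
    have "conv k f x - f x = (\<integral>y. k y *\<^sub>R f (x - y) - k y *\<^sub>R f x \<partial>lborel)"
      unfolding conv_def using ic ik k1 by simp
    also have "\<dots> = (\<integral>y. k y *\<^sub>R (f (x - y) - f x) \<partial>lborel)" by (simp add: scaleR_diff_right)
    finally have *: "conv k f x - f x = (\<integral>y. k y *\<^sub>R (f (x - y) - f x) \<partial>lborel)" .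
    have "ennreal (norm (conv k f x - f x)) \<le> (\<integral>\<^sup>+y. norm (k y *\<^sub>R (f (x - y) - f x)) \<partial>lborel)"
      unfolding * using ic ik by (intro integral_norm_bound_ennreal) (auto simp: scaleR_diff_right)
    then show ?thesis by simp
  qed
  have "(\<integral>\<^sup>+x. \<bar>F x\<bar> * norm (conv k f x - f x) \<partial>lborel)
     \<le> (\<integral>\<^sup>+x. \<integral>\<^sup>+y. ennreal \<bar>F x\<bar> * (\<bar>k y\<bar> * norm (f (x - y) - f x)) \<partial>lborel \<partial>lborel)"
  proof (rule nn_integral_mono)
    fix x
    have "ennreal (\<bar>F x\<bar> * norm (conv k f x - f x)) = ennreal \<bar>F x\<bar> * ennreal (norm (conv k f x - f x))"
      by (simp add: ennreal_mult)
    also have "\<dots> \<le> ennreal \<bar>F x\<bar> * (\<integral>\<^sup>+y. \<bar>k y\<bar> * norm (f (x - y) - f x) \<partial>lborel)"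
      by (intro mult_left_mono pt) auto
    also have "\<dots> = (\<integral>\<^sup>+y. ennreal \<bar>F x\<bar> * (\<bar>k y\<bar> * norm (f (x - y) - f x)) \<partial>lborel)"
      by (subst nn_integral_cmult) auto
    finally show "ennreal (\<bar>F x\<bar> * norm (conv k f x - f x)) \<le> (\<integral>\<^sup>+y. ennreal \<bar>F x\<bar> * (\<bar>k y\<bar> * norm (f (x - y) - f x)) \<partial>lborel)" .
  qed
  also have "\<dots> = (\<integral>\<^sup>+y. \<integral>\<^sup>+x. ennreal \<bar>F x\<bar> * (\<bar>k y\<bar> * norm (f (x - y) - f x)) \<partial>lborel \<partial>lborel)"
    by (rule lborel_pair.Fubini') measurable
  also have "\<dots> \<le> (\<integral>\<^sup>+y. ennreal \<bar>k y\<bar> * ennreal \<delta> \<partial>lborel)"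
  proof (rule nn_integral_mono)
    fix y
    have "(\<integral>\<^sup>+x. ennreal \<bar>F x\<bar> * (\<bar>k y\<bar> * norm (f (x - y) - f x)) \<partial>lborel)
      = (\<integral>\<^sup>+x. ennreal \<bar>k y\<bar> * (\<bar>F x\<bar> * norm (f (x + (- y)) - f x)) \<partial>lborel)"
      by (intro nn_integral_cong) (simp add: ennreal_mult[symmetric] mult_ac)
    also have "\<dots> = ennreal \<bar>k y\<bar> * (\<integral>\<^sup>+x. \<bar>F x\<bar> * norm (f (x + (- y)) - f x) \<partial>lborel)"
      by (subst nn_integral_cmult) auto
    also have "\<dots> \<le> ennreal \<bar>k y\<bar> * ennreal \<delta>"
    proof (cases "norm y \<le> r")
      case True then show ?thesis using bound[of "-y"] by (intro mult_left_mono) auto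
    next
      case False then show ?thesis using k(2)[of y] by simp
    qed
    finally show "(\<integral>\<^sup>+x. ennreal \<bar>F x\<bar> * (\<bar>k y\<bar> * norm (f (x - y) - f x)) \<partial>lborel) \<le> ennreal \<bar>k y\<bar> * ennreal \<delta>" .
  qed
  also have "\<dots> = ennreal (\<integral>y. \<bar>k y\<bar> \<partial>lborel) * ennreal \<delta>"
    using ik by (subst nn_integral_multc) (auto simp: nn_integral_eq_integral)
  also have "\<dots> \<le> ennreal (C * \<delta>)"
    using kC \<delta> by (subst ennreal_mult[symmetric]) (auto intro!: ennreal_leI mult_right_mono)
  finally show ?thesis .
qed

text \<open>Strong monotonicity: the inner product of |a|^s a - |b|^s b with a - b is at least
  (|a|^s + |b|^s)/2 times |a - b|^2, and the larger of |a|, |b| is at least |a - b|/2. The purpose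
  is to deduce continuity of translations in L^p from that in L^1.\<close>

lemma powr_field_monotone:
  fixes a b :: "'a::real_inner"
  assumes "s > 0"
  shows "norm (a - b) powr (s + 1) \<le> 2 powr (s + 1) * norm (norm a powr s *\<^sub>R a - norm b powr s *\<^sub>R b)"
proof (cases "a = b")
  case False
  define P where "P = norm a powr s *\<^sub>R a - norm b powr s *\<^sub>R b"
  define D where "D = norm (a - b)"
  have D: "D > 0" using False by (simp add: D_def)
  \<comment> \<open>Symmetrisation of the inner product. The second summand is nonnegative because
    r^s and r^2 increase together.\<close>
  have id: "P \<bullet> (a - b) = (norm a powr s + norm b powr s) / 2 * (D^2)
      + (norm a powr s - norm b powr s) / 2 * ((norm a)^2 - (norm b)^2)"
    unfolding P_def D_def power2_norm_eq_inner
    by (simp add: inner_diff_left inner_diff_right inner_commute field_simps)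
  have "(norm a powr s - norm b powr s) * ((norm a)^2 - (norm b)^2) \<ge> 0"
  proof (cases "norm a \<le> norm b")
    case True
    then have "norm a powr s \<le> norm b powr s" "(norm a)^2 \<le> (norm b)^2"
      using assms by (auto intro: powr_mono2)
    then show ?thesis by (intro mult_nonpos_nonpos) auto
  next
    case False
    then have "norm b powr s \<le> norm a powr s" "(norm b)^2 \<le> (norm a)^2"
      using assms by (auto intro: powr_mono2)
    then show ?thesis by (intro mult_nonneg_nonneg) auto
  qed
  then have 1: "P \<bullet> (a - b) \<ge> (norm a powr s + norm b powr s) / 2 * (D^2)" unfolding id by simp
  have "D \<le> 2 * max (norm a) (norm b)" unfolding D_def using norm_triangle_ineq4[of a b] by linarith
  then have "D / 2 \<le> max (norm a) (norm b)" by simp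
  then have "(D/2) powr s \<le> max (norm a) (norm b) powr s" using D assms by (intro powr_mono2) auto
  also have "\<dots> \<le> norm a powr s + norm b powr s" by (simp add: max_def)
  finally have "(D/2) powr s / 2 * (D^2) \<le> P \<bullet> (a - b)" using 1 D
    by (smt (verit) divide_right_mono mult_right_mono zero_le_power2)
  also have "\<dots> \<le> norm P * D" unfolding D_def by (rule norm_cauchy_schwarz)
  finally have "(D/2) powr s / 2 * D \<le> norm P" using D by (simp add: power2_eq_square)
  then have "2 powr (s + 1) * ((D/2) powr s / 2 * D) \<le> 2 powr (s + 1) * norm P" by (intro mult_left_mono) auto
  also have "2 powr (s + 1) * ((D/2) powr s / 2 * D) = D powr (s + 1)"
    using D by (simp add: powr_divide powr_add)
  finally show ?thesis by (simp add: D_def P_def)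
qed (use assms in auto)

text \<open>Continuity of translations in L^1 with the weight |F|. The weight stands still while
  \<open>f\<close> is shifted, so it cannot be absorbed into \<open>f\<close>. The two main cases
  are bounded \<open>f\<close> with integrable \<open>F\<close>, and \<open>f\<close>,
  \<open>F\<close> in conjugate Lebesgue spaces.\<close>

definition tcont :: "('a::euclidean_space \<Rightarrow> real) \<Rightarrow> ('a \<Rightarrow> 'b::real_normed_vector) \<Rightarrow> bool" where
  "tcont F f \<longleftrightarrow> (\<forall>e>0. \<exists>d>0. \<forall>h. norm h \<le> d \<longrightarrow>
     (\<integral>\<^sup>+x. \<bar>F x\<bar> * norm (f (x + h) - f x) \<partial>lborel) \<le> ennreal e)"

text \<open>Where |F| \<le> n the weight is a constant factor on the L^1 modulus of continuity;
  where |F| > n the bound on \<open>f\<close> is used, and the integral of |F| over that set tends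
  to 0 as n grows.\<close>

lemma tcont_bounded:
  fixes f :: "'a::euclidean_space \<Rightarrow> 'b::{banach,second_countable_topology}"
  assumes F: "integrable lborel F" and f: "integrable lborel f" and M: "\<And>x. norm (f x) \<le> M"
  shows "tcont F f"
  unfolding tcont_def
proof (intro allI impI)
  fix e :: real assume e: "e > 0"
  have M0: "M \<ge> 0" using M norm_ge_zero order_trans by blast
  have [measurable]: "f \<in> borel_measurable borel" "F \<in> borel_measurable borel"
    using F f by auto
  define e1 where "e1 = e / (4 * (M + 1))"
  have e1: "e1 > 0" using e M0 by (simp add: e1_def)
  have "(\<lambda>n::nat. \<integral>x. \<bar>F x\<bar> * indicator {x. \<bar>F x\<bar> > real n} x \<partial>lborel) \<longlonglongrightarrow> (\<integral>x. (0::real) \<partial>(lborel :: 'a measure))"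
  proof (rule integral_dominated_convergence[where w="\<lambda>x. \<bar>F x\<bar>"])
    show "AE x in lborel. (\<lambda>n::nat. \<bar>F x\<bar> * indicator {x. \<bar>F x\<bar> > real n} x) \<longlonglongrightarrow> 0"
    proof (intro AE_I2 tendsto_eventually)
      fix x
      obtain N :: nat where N: "\<bar>F x\<bar> \<le> real N" using real_arch_simple by blast
      show "\<forall>\<^sub>F n in sequentially. \<bar>F x\<bar> * indicator {x. \<bar>F x\<bar> > real n} x = 0"
        using eventually_ge_at_top[of N] by eventually_elim (use N in \<open>auto simp: indicator_def\<close>)
    qed
  qed (use F in \<open>auto simp: indicator_def\<close>)
  then have "\<forall>\<^sub>F n in sequentially. (\<integral>x. \<bar>F x\<bar> * indicator {x. \<bar>F x\<bar> > real n} x \<partial>lborel) < e1"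
    using e1 by (intro order_tendstoD) auto
  then obtain n :: nat where n: "(\<integral>x. \<bar>F x\<bar> * indicator {x. \<bar>F x\<bar> > real n} x \<partial>lborel) < e1"
    by (auto simp: eventually_sequentially)
  have n': "(\<integral>\<^sup>+x. \<bar>F x\<bar> * indicator {x. \<bar>F x\<bar> > real n} x \<partial>lborel) \<le> ennreal e1"
  proof -
    have "integrable lborel (\<lambda>x. \<bar>F x\<bar> * indicator {x. \<bar>F x\<bar> > real n} x)"
      using integrable_abs[OF F] by (intro integrable_mult_indicator[where 'b=real, simplified real_scaleR_def mult.commute]) auto
    then show ?thesis using n by (subst nn_integral_eq_integral) (auto intro: ennreal_leI)
  qed
  have "e / (2 * (real n + 1)) > 0" using e by simp
  then obtain d where d: "d > 0" "\<And>h. norm h < d \<Longrightarrow> (\<integral>\<^sup>+x. norm (f (x + h) - f x) \<partial>lborel) \<le> ennreal (e / (2 * (real n + 1)))"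
    using L1_translation_continuous[OF f] by metis
  show "\<exists>d>0. \<forall>h. norm h \<le> d \<longrightarrow> (\<integral>\<^sup>+x. \<bar>F x\<bar> * norm (f (x + h) - f x) \<partial>lborel) \<le> ennreal e"
  proof (intro exI[of _ "d/2"] conjI allI impI)
    fix h :: 'a assume h: "norm h \<le> d/2"
    have "(\<integral>\<^sup>+x. \<bar>F x\<bar> * norm (f (x + h) - f x) \<partial>lborel)
      \<le> (\<integral>\<^sup>+x. ennreal (real n + 1) * ennreal (norm (f (x + h) - f x))
            + ennreal (2 * (M + 1)) * ennreal (\<bar>F x\<bar> * indicator {x. \<bar>F x\<bar> > real n} x) \<partial>lborel)"
    proof (rule nn_integral_mono)
      fix x
      have 1: "norm (f (x + h) - f x) \<le> 2 * (M + 1)"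
        using norm_triangle_ineq4[of "f (x+h)" "f x"] M[of x] M[of "x+h"] by simp
      have "\<bar>F x\<bar> * norm (f (x + h) - f x) \<le> (real n + 1) * norm (f (x + h) - f x)
          + (2 * (M + 1)) * (\<bar>F x\<bar> * indicator {x. \<bar>F x\<bar> > real n} x)"
      proof (cases "\<bar>F x\<bar> > real n")
        case True
        then have i: "indicator {x. \<bar>F x\<bar> > real n} x = (1::real)" by simp
        have "\<bar>F x\<bar> * norm (f (x + h) - f x) \<le> (2 * (M + 1)) * \<bar>F x\<bar>"
          unfolding mult.commute[of "\<bar>F x\<bar>"] using 1 by (rule mult_right_mono) simp
        moreover have "0 \<le> (real n + 1) * norm (f (x + h) - f x)" by simp
        ultimately show ?thesis unfolding i mult_1_right by linarith
      next
        case False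
        then show ?thesis by (auto intro!: mult_right_mono)
      qed
      from ennreal_leI[OF this] show "ennreal (\<bar>F x\<bar> * norm (f (x + h) - f x)) \<le> ennreal (real n + 1) * ennreal (norm (f (x + h) - f x))
            + ennreal (2 * (M + 1)) * ennreal (\<bar>F x\<bar> * indicator {x. \<bar>F x\<bar> > real n} x)"
        using M0 by (simp add: ennreal_mult[symmetric] ennreal_plus[symmetric] del: ennreal_plus)
    qed
    also have "\<dots> = ennreal (real n + 1) * (\<integral>\<^sup>+x. norm (f (x + h) - f x) \<partial>lborel)
       + ennreal (2 * (M + 1)) * (\<integral>\<^sup>+x. \<bar>F x\<bar> * indicator {x. \<bar>F x\<bar> > real n} x \<partial>lborel)"
      by (subst nn_integral_add; (subst nn_integral_cmult)?) (auto simp: nn_integral_cmult)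
    also have "\<dots> \<le> ennreal (real n + 1) * ennreal (e / (2 * (real n + 1))) + ennreal (2 * (M + 1)) * ennreal e1"
      using d h n' by (intro add_mono mult_left_mono) auto
    also have "\<dots> = ennreal (e/2) + ennreal (e/2)"
    proof -
      have "(real n + 1) * (e / (2 * (real n + 1))) = e/2" by (simp add: field_simps)
      moreover have "2 * (M + 1) * e1 = e / 2" using M0 by (simp add: e1_def field_simps)
      moreover have "ennreal (real n + 1) * ennreal (e / (2 * (real n + 1))) = ennreal ((real n + 1) * (e / (2 * (real n + 1))))"
        using e by (intro ennreal_mult[symmetric]) auto
      moreover have "ennreal (2 * (M + 1)) * ennreal e1 = ennreal (2 * (M + 1) * e1)"
        using M0 e1 by (intro ennreal_mult[symmetric]) auto
      ultimately show ?thesis by metis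
    qed
    also have "\<dots> = ennreal e" using e by (simp add: ennreal_plus[symmetric] del: ennreal_plus)
    finally show "(\<integral>\<^sup>+x. \<bar>F x\<bar> * norm (f (x + h) - f x) \<partial>lborel) \<le> ennreal e" .
  qed (use d in auto)
qed

lemma powr_field_integrable:
  fixes f :: "'a::euclidean_space \<Rightarrow> 'b::euclidean_space"
  assumes "integrable lborel (\<lambda>x. norm (f x) powr p)" "p > 1" "f \<in> borel_measurable borel"
  shows "integrable lborel (\<lambda>x. norm (f x) powr (p - 1) *\<^sub>R f x)"
proof (rule Bochner_Integration.integrable_bound[OF assms(1)])
  show "AE x in lborel. norm (norm (f x) powr (p - 1) *\<^sub>R f x) \<le> norm (norm (f x) powr p)"
  proof (rule AE_I2)
    fix x
    have "norm (f x) powr (p - 1) * norm (f x) = norm (f x) powr p"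
      using powr_mult_base[of "norm (f x)" "p - 1"] by (simp add: mult.commute)
    then show "norm (norm (f x) powr (p - 1) *\<^sub>R f x) \<le> norm (norm (f x) powr p)" by simp
  qed
qed (use assms in auto)

text \<open>The field P = |f|^(p-1) f is integrable, and |f(x + h) - f(x)|^p is dominated by a
  multiple of |P(x + h) - P(x)|; so the L^1 statement for P is enough.\<close>

lemma Lp_translation_continuous:
  fixes f :: "'a::euclidean_space \<Rightarrow> 'b::euclidean_space"
  assumes f: "integrable lborel (\<lambda>x. norm (f x) powr p)" "p > 1" and [measurable]: "f \<in> borel_measurable borel"
    and e: "e > 0"
  obtains d where "d > 0" "\<And>h. norm h \<le> d \<Longrightarrow> (\<integral>\<^sup>+x. norm (f (x + h) - f x) powr p \<partial>lborel) \<le> ennreal e"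
proof -
  define P where "P = (\<lambda>x. norm (f x) powr (p - 1) *\<^sub>R f x)"
  have P: "integrable lborel P" unfolding P_def by (rule powr_field_integrable) (use f in auto)
  have [measurable]: "P \<in> borel_measurable borel" unfolding P_def by measurable
  have "e / 2 powr p > 0" using e by simp
  then obtain d where d: "d > 0" "\<And>h. norm h < d \<Longrightarrow> (\<integral>\<^sup>+x. norm (P (x + h) - P x) \<partial>lborel) \<le> ennreal (e / 2 powr p)"
    using L1_translation_continuous[OF P] by metis
  show ?thesis
  proof (rule that[of "d/2"])
    fix h :: 'a assume h: "norm h \<le> d/2"
    have "(\<integral>\<^sup>+x. norm (f (x + h) - f x) powr p \<partial>lborel) \<le> (\<integral>\<^sup>+x. ennreal (2 powr p) * ennreal (norm (P (x + h) - P x)) \<partial>lborel)"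
    proof (rule nn_integral_mono)
      fix x
      have "norm (f (x + h) - f x) powr p \<le> 2 powr p * norm (P (x + h) - P x)"
        using powr_field_monotone[of "p - 1" "f (x+h)" "f x"] f(2) by (simp add: P_def)
      then show "ennreal (norm (f (x + h) - f x) powr p) \<le> ennreal (2 powr p) * ennreal (norm (P (x + h) - P x))"
        by (simp add: ennreal_mult[symmetric] ennreal_leI)
    qed
    also have "\<dots> = ennreal (2 powr p) * (\<integral>\<^sup>+x. norm (P (x + h) - P x) \<partial>lborel)"
      by (subst nn_integral_cmult) auto
    also have "\<dots> \<le> ennreal (2 powr p) * ennreal (e / 2 powr p)"
      using d h by (intro mult_left_mono) auto
    also have "\<dots> = ennreal e" using e by (subst ennreal_mult[symmetric]) auto
    finally show "(\<integral>\<^sup>+x. norm (f (x + h) - f x) powr p \<partial>lborel) \<le> ennreal e" .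
  qed (use d in auto)
qed

text \<open>Young's inequality with a small factor on the fixed weight leaves only the L^p modulus
  of continuity of \<open>f\<close>.\<close>

lemma tcont_Lp:
  fixes f :: "'a::euclidean_space \<Rightarrow> 'b::euclidean_space"
  assumes f: "integrable lborel (\<lambda>x. norm (f x) powr p)" "p > 1" and [measurable]: "f \<in> borel_measurable borel"
    and F: "integrable lborel (\<lambda>x. \<bar>F x\<bar> powr (p / (p - 1)))" and [measurable]: "F \<in> borel_measurable borel"
  shows "tcont F f"
  unfolding tcont_def
proof (intro allI impI)
  fix e :: real assume e: "e > 0"
  define I where "I = (\<integral>x. \<bar>F x\<bar> powr (p / (p - 1)) \<partial>lborel)"
  have I: "I \<ge> 0" by (simp add: I_def)
  define t where "t = e / (2 * (I + 1))"
  have t: "t > 0" using e I by (simp add: t_def)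
  obtain C where C: "C > 0" "\<And>a b. 0 \<le> a \<Longrightarrow> 0 \<le> b \<Longrightarrow> a * b \<le> t * a powr (p/(p-1)) + C * b powr p"
    using Young_eps[OF f(2) t] by metis
  have "e / (2 * C) > 0" using e C by simp
  then obtain d where d: "d > 0" "\<And>h. norm h \<le> d \<Longrightarrow> (\<integral>\<^sup>+x. norm (f (x + h) - f x) powr p \<partial>lborel) \<le> ennreal (e / (2 * C))"
    using Lp_translation_continuous[OF f] by (metis assms(3))
  show "\<exists>d>0. \<forall>h. norm h \<le> d \<longrightarrow> (\<integral>\<^sup>+x. \<bar>F x\<bar> * norm (f (x + h) - f x) \<partial>lborel) \<le> ennreal e"
  proof (intro exI[of _ d] conjI allI impI)
    fix h :: 'a assume h: "norm h \<le> d"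
    have "(\<integral>\<^sup>+x. \<bar>F x\<bar> * norm (f (x + h) - f x) \<partial>lborel)
      \<le> (\<integral>\<^sup>+x. ennreal t * ennreal (\<bar>F x\<bar> powr (p / (p - 1))) + ennreal C * ennreal (norm (f (x + h) - f x) powr p) \<partial>lborel)"
    proof (rule nn_integral_mono)
      fix x
      from ennreal_leI[OF C(2)[of "\<bar>F x\<bar>" "norm (f (x + h) - f x)"]]
      show "ennreal (\<bar>F x\<bar> * norm (f (x + h) - f x))
        \<le> ennreal t * ennreal (\<bar>F x\<bar> powr (p / (p - 1))) + ennreal C * ennreal (norm (f (x + h) - f x) powr p)"
        using t C(1) by (simp add: ennreal_mult)
    qed
    also have "\<dots> = ennreal t * (\<integral>\<^sup>+x. \<bar>F x\<bar> powr (p / (p - 1)) \<partial>lborel) + ennreal C * (\<integral>\<^sup>+x. norm (f (x + h) - f x) powr p \<partial>lborel)"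
      by (subst nn_integral_add) (auto simp: nn_integral_cmult)
    also have "\<dots> \<le> ennreal t * ennreal I + ennreal C * ennreal (e / (2 * C))"
      using d h F by (intro add_mono mult_left_mono) (auto simp: I_def nn_integral_eq_integral)
    also have "\<dots> = ennreal (t * I + e / 2)"
      using t I C e by (simp add: ennreal_mult[symmetric])
    also have "\<dots> \<le> ennreal e"
      using e I by (intro ennreal_leI) (simp add: t_def field_simps)
    finally show "(\<integral>\<^sup>+x. \<bar>F x\<bar> * norm (f (x + h) - f x) \<partial>lborel) \<le> ennreal e" .
  qed (use d in auto)
qed

text \<open>Convergence in L^1 with the weight |F|. It is the mode in which mollified or
  approximating functions replace the original ones in an integral against any field dominated by
  |F|.\<close>

definition wlim :: "('a::euclidean_space \<Rightarrow> real) \<Rightarrow> (nat \<Rightarrow> 'a \<Rightarrow> 'b::real_normed_vector) \<Rightarrow> ('a \<Rightarrow> 'b) \<Rightarrow> bool" where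
  "wlim F g f \<longleftrightarrow> (\<lambda>n. \<integral>\<^sup>+x. \<bar>F x\<bar> * norm (g n x - f x) \<partial>lborel) \<longlonglongrightarrow> 0"

lemma wlim_mono:
  fixes g :: "nat \<Rightarrow> 'a::euclidean_space \<Rightarrow> 'b::euclidean_space" and g' :: "nat \<Rightarrow> 'a \<Rightarrow> 'c::euclidean_space"
  assumes "wlim F g f" and [measurable]: "F \<in> borel_measurable borel" "\<And>n. g n \<in> borel_measurable borel" "f \<in> borel_measurable borel"
    and "c \<ge> 0" "\<And>n x. \<bar>F' x\<bar> * norm (g' n x - f' x) \<le> c * (\<bar>F x\<bar> * norm (g n x - f x))"
  shows "wlim F' g' f'"
  unfolding wlim_def
proof (rule tendsto_sandwich[of "\<lambda>_. 0"])
  have "(\<lambda>n. ennreal c * (\<integral>\<^sup>+x. \<bar>F x\<bar> * norm (g n x - f x) \<partial>lborel)) \<longlonglongrightarrow> ennreal c * 0"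
    using assms(1) unfolding wlim_def by (intro ennreal_tendsto_cmult) auto
  then show "(\<lambda>n. ennreal c * (\<integral>\<^sup>+x. \<bar>F x\<bar> * norm (g n x - f x) \<partial>lborel)) \<longlonglongrightarrow> 0" by simp
  show "\<forall>\<^sub>F n in sequentially. (\<integral>\<^sup>+x. \<bar>F' x\<bar> * norm (g' n x - f' x) \<partial>lborel)
      \<le> ennreal c * (\<integral>\<^sup>+x. \<bar>F x\<bar> * norm (g n x - f x) \<partial>lborel)"
  proof (rule always_eventually, rule allI)
    fix n
    have "(\<integral>\<^sup>+x. \<bar>F' x\<bar> * norm (g' n x - f' x) \<partial>lborel) \<le> (\<integral>\<^sup>+x. ennreal c * ennreal (\<bar>F x\<bar> * norm (g n x - f x)) \<partial>lborel)"
      using assms(5,6) by (intro nn_integral_mono) (simp add: ennreal_mult[symmetric] ennreal_leI)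
    also have "\<dots> = ennreal c * (\<integral>\<^sup>+x. \<bar>F x\<bar> * norm (g n x - f x) \<partial>lborel)"
      by (intro nn_integral_cmult) measurable
    finally show "(\<integral>\<^sup>+x. \<bar>F' x\<bar> * norm (g' n x - f' x) \<partial>lborel) \<le> ennreal c * (\<integral>\<^sup>+x. \<bar>F x\<bar> * norm (g n x - f x) \<partial>lborel)" .
  qed
qed auto

text \<open>Meant for products of convergent factors: the change of one factor is paid with weight
  \<open>F\<close>, that of the other with weight \<open>H\<close>. The constant of the second term
  is part of \<open>H\<close>.\<close>

lemma wlim_add_mono:
  fixes g :: "nat \<Rightarrow> 'a::euclidean_space \<Rightarrow> 'b::euclidean_space" and h :: "nat \<Rightarrow> 'a \<Rightarrow> 'c::euclidean_space"
  assumes "wlim F g f" "wlim H h k"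
    and [measurable]: "F \<in> borel_measurable borel" "\<And>n. g n \<in> borel_measurable borel" "f \<in> borel_measurable borel"
      "H \<in> borel_measurable borel" "\<And>n. h n \<in> borel_measurable borel" "k \<in> borel_measurable borel"
    and c: "c \<ge> 0" and le: "\<And>n x. \<bar>F' x\<bar> * norm (g' n x - f' x) \<le> c * (\<bar>F x\<bar> * norm (g n x - f x)) + \<bar>H x\<bar> * norm (h n x - k x)"
  shows "wlim F' g' f'"
  unfolding wlim_def
proof (rule tendsto_sandwich[of "\<lambda>_. 0"])
  have "(\<lambda>n. ennreal c * (\<integral>\<^sup>+x. \<bar>F x\<bar> * norm (g n x - f x) \<partial>lborel) + (\<integral>\<^sup>+x. \<bar>H x\<bar> * norm (h n x - k x) \<partial>lborel)) \<longlonglongrightarrow> ennreal c * 0 + 0"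
    using assms(1,2) unfolding wlim_def by (intro tendsto_add ennreal_tendsto_cmult) auto
  then show "(\<lambda>n. ennreal c * (\<integral>\<^sup>+x. \<bar>F x\<bar> * norm (g n x - f x) \<partial>lborel) + (\<integral>\<^sup>+x. \<bar>H x\<bar> * norm (h n x - k x) \<partial>lborel)) \<longlonglongrightarrow> 0" by simp
  show "\<forall>\<^sub>F n in sequentially. (\<integral>\<^sup>+x. \<bar>F' x\<bar> * norm (g' n x - f' x) \<partial>lborel)
      \<le> ennreal c * (\<integral>\<^sup>+x. \<bar>F x\<bar> * norm (g n x - f x) \<partial>lborel) + (\<integral>\<^sup>+x. \<bar>H x\<bar> * norm (h n x - k x) \<partial>lborel)"
  proof (rule always_eventually, rule allI)
    fix n
    have "(\<integral>\<^sup>+x. \<bar>F' x\<bar> * norm (g' n x - f' x) \<partial>lborel)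
      \<le> (\<integral>\<^sup>+x. ennreal c * ennreal (\<bar>F x\<bar> * norm (g n x - f x)) + ennreal (\<bar>H x\<bar> * norm (h n x - k x)) \<partial>lborel)"
    proof (intro nn_integral_mono)
      fix x
      from ennreal_leI[OF le[where x=x and n=n]]
      show "ennreal (\<bar>F' x\<bar> * norm (g' n x - f' x)) \<le> ennreal c * ennreal (\<bar>F x\<bar> * norm (g n x - f x)) + ennreal (\<bar>H x\<bar> * norm (h n x - k x))"
        using c by (simp add: ennreal_mult' ennreal_plus)
    qed
    also have "\<dots> = ennreal c * (\<integral>\<^sup>+x. \<bar>F x\<bar> * norm (g n x - f x) \<partial>lborel) + (\<integral>\<^sup>+x. \<bar>H x\<bar> * norm (h n x - k x) \<partial>lborel)"
      by (subst nn_integral_add) (auto simp: nn_integral_cmult)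
    finally show "(\<integral>\<^sup>+x. \<bar>F' x\<bar> * norm (g' n x - f' x) \<partial>lborel)
      \<le> ennreal c * (\<integral>\<^sup>+x. \<bar>F x\<bar> * norm (g n x - f x) \<partial>lborel) + (\<integral>\<^sup>+x. \<bar>H x\<bar> * norm (h n x - k x) \<partial>lborel)" .
  qed
qed auto

lemma wlim_integral:
  fixes g :: "nat \<Rightarrow> 'a::euclidean_space \<Rightarrow> 'b::euclidean_space"
  assumes "wlim F g f" and [measurable]: "G \<in> borel_measurable borel" "\<And>n. g n \<in> borel_measurable borel" "f \<in> borel_measurable borel"
    and G: "\<And>x. norm (G x) \<le> \<bar>F x\<bar>" and int: "integrable lborel (\<lambda>x. G x \<bullet> f x)"
  shows "(\<lambda>n. \<integral>x. G x \<bullet> g n x \<partial>lborel) \<longlonglongrightarrow> (\<integral>x. G x \<bullet> f x \<partial>lborel)"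
proof -
  have le: "(\<integral>\<^sup>+x. norm (G x \<bullet> g n x - G x \<bullet> f x) \<partial>lborel) \<le> (\<integral>\<^sup>+x. \<bar>F x\<bar> * norm (g n x - f x) \<partial>lborel)" for n
  proof (intro nn_integral_mono ennreal_leI)
    fix x
    have "norm (G x \<bullet> g n x - G x \<bullet> f x) \<le> norm (G x) * norm (g n x - f x)"
      using Cauchy_Schwarz_ineq2[of "G x" "g n x - f x"] by (simp add: inner_diff_right)
    also have "\<dots> \<le> \<bar>F x\<bar> * norm (g n x - f x)" using G by (intro mult_right_mono) auto
    finally show "norm (G x \<bullet> g n x - G x \<bullet> f x) \<le> \<bar>F x\<bar> * norm (g n x - f x)" .
  qed
  have lim: "(\<lambda>n. \<integral>\<^sup>+x. norm (G x \<bullet> g n x - G x \<bullet> f x) \<partial>lborel) \<longlonglongrightarrow> 0"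
    by (rule tendsto_sandwich[OF _ _ tendsto_const assms(1)[unfolded wlim_def]]) (use le in auto)
  \<comment> \<open>Finiteness of the weighted distance gives integrability of
    \<open>G x \<bullet> g n x\<close>; a Bochner integral of a nonintegrable function would be the
    default 0.\<close>
  have ev: "\<forall>\<^sub>F n in sequentially. (\<integral>\<^sup>+x. norm (G x \<bullet> g n x - G x \<bullet> f x) \<partial>lborel) < 1"
    using lim by (intro order_tendstoD) auto
  show ?thesis
  proof (rule tendstoI)
    fix e :: real assume e: "e > 0"
    have "\<forall>\<^sub>F n in sequentially. (\<integral>\<^sup>+x. norm (G x \<bullet> g n x - G x \<bullet> f x) \<partial>lborel) < ennreal e"
      using lim e by (intro order_tendstoD) auto
    with ev show "\<forall>\<^sub>F n in sequentially. dist (\<integral>x. G x \<bullet> g n x \<partial>lborel) (\<integral>x. G x \<bullet> f x \<partial>lborel) < e"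
    proof eventually_elim
      case (elim n)
      have i: "integrable lborel (\<lambda>x. G x \<bullet> g n x - G x \<bullet> f x)"
        unfolding integrable_iff_bounded using elim(1)
        by (intro conjI) (measurable, auto simp: top.not_eq_extremum intro: less_le_trans)
      have i2: "integrable lborel (\<lambda>x. G x \<bullet> g n x)" using Bochner_Integration.integrable_add[OF i int] by simp
      have "ennreal \<bar>(\<integral>x. G x \<bullet> g n x \<partial>lborel) - (\<integral>x. G x \<bullet> f x \<partial>lborel)\<bar> \<le> (\<integral>\<^sup>+x. norm (G x \<bullet> g n x - G x \<bullet> f x) \<partial>lborel)"
        using integral_norm_bound_ennreal[OF i] i2 int by simp
      also have "\<dots> < ennreal e" by (rule elim(2))
      finally show ?case by (simp add: dist_real_def ennreal_less_iff)
    qed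
  qed
qed

section \<open>Mollified weak equations\<close>

text \<open>A \<open>C\<^sup>1\<close> substitute for the positive part.\<close>
definition bp :: "real \<Rightarrow> real" where "bp s = sqrt (1 + (max 0 s)\<^sup>2) - 1"
definition bp' :: "real \<Rightarrow> real" where "bp' s = max 0 s / sqrt (1 + (max 0 s)\<^sup>2)"

lemma bp_DERIV: "DERIV bp s :> bp' s"
proof -
  have sq: "DERIV (\<lambda>s::real. (max 0 s)\<^sup>2) s :> 2 * max 0 s"
  proof -
    consider "s > 0" | "s < 0" | "s = 0" by linarith
    then show ?thesis
    proof cases
      case 1
      have "DERIV (\<lambda>s::real. s\<^sup>2) s :> 2 * max 0 s" using 1 by (auto intro!: derivative_eq_intros)
      then show ?thesis
        by (rule has_field_derivative_transform_within_open[of _ _ _ "{0<..}"]) (use 1 in auto)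
    next
      case 2
      have "DERIV (\<lambda>s::real. 0) s :> 2 * max 0 s" using 2 by auto
      then show ?thesis
        by (rule has_field_derivative_transform_within_open[of _ _ _ "{..<0}"]) (use 2 in auto)
    next
      case 3
      have "((\<lambda>h::real. ((max 0 (0 + h))\<^sup>2 - (max 0 0)\<^sup>2) / h) \<longlongrightarrow> 0) (at 0)"
      proof (rule Lim_null_comparison)
        show "\<forall>\<^sub>F h::real in at 0. norm (((max 0 (0 + h))\<^sup>2 - (max 0 0)\<^sup>2) / h) \<le> \<bar>h\<bar>"
          by (intro always_eventually) (auto simp: max_def power2_eq_square)
        show "((\<lambda>h::real. \<bar>h\<bar>) \<longlongrightarrow> 0) (at 0)" by (rule tendsto_eq_intros | simp)+
      qed
      then show ?thesis using 3 by (simp add: DERIV_def)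
    qed
  qed
  have pos: "0 < 1 + (max 0 s)\<^sup>2" by (simp add: add_pos_nonneg)
  have "DERIV (\<lambda>s. sqrt (1 + (max 0 s)\<^sup>2)) s :> inverse (sqrt (1 + (max 0 s)\<^sup>2)) / 2 * (0 + 2 * max 0 s)"
    by (rule DERIV_chain2[OF DERIV_real_sqrt[OF pos] DERIV_add[OF DERIV_const sq]])
  from DERIV_diff[OF this DERIV_const[of 1]] show ?thesis
    unfolding bp_def[abs_def] bp'_def by (rule DERIV_cong) (simp add: field_simps)
qed

lemma sqrt1_pos: "sqrt (1 + (x::real)\<^sup>2) > 0" "sqrt (1 + x\<^sup>2) \<ge> 1" "sqrt (1 + x\<^sup>2) \<ge> x"
  by (auto simp: add_pos_nonneg intro!: real_le_rsqrt)

lemma bp'_bounds: "0 \<le> bp' s" "bp' s \<le> 1" "bp' s \<le> 0 \<longleftrightarrow> s \<le> 0"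
proof -
  have R: "sqrt (1 + (max 0 s)\<^sup>2) > 0" "max 0 s \<le> sqrt (1 + (max 0 s)\<^sup>2)"
    using sqrt1_pos[of "max 0 s"] by auto
  show "0 \<le> bp' s" "bp' s \<le> 1" using R by (simp_all add: bp'_def divide_le_eq)
  show "bp' s \<le> 0 \<longleftrightarrow> s \<le> 0" using R(1) by (simp add: bp'_def divide_le_eq)
qed

text \<open>The tangent inequality of a convex function with value 0 at 0, in the form R (R - 1)
  \<le> s^2 for R = sqrt (1 + s^2). It yields bp(u - t) \<le> (1 - t) bp'(u - t) when t \<le> u
  \<le> 1, the smallness behind the final contradiction.\<close>

lemma bp_le: "s \<ge> 0 \<Longrightarrow> bp s \<le> s * bp' s"
proof -
  define R where "R = sqrt (1 + s\<^sup>2)"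
  have R: "R \<ge> 1" "R * R = 1 + s\<^sup>2" using sqrt1_pos[of s] by (auto simp: R_def add_nonneg_nonneg)
  have "(R - 1) * R \<le> s * s" using R by (simp add: algebra_simps power2_eq_square)
  then have "R - 1 \<le> s * s / R" using R by (simp add: le_divide_eq)
  then show "bp s \<le> s * bp' s" if "s \<ge> 0" using that by (simp add: bp_def bp'_def R_def max_def)
qed

lemma bp_zero: "s \<le> 0 \<Longrightarrow> bp s = 0" "s \<le> 0 \<Longrightarrow> bp' s = 0"
  by (simp_all add: bp_def bp'_def)

lemma bp_ge0: "0 \<le> bp s"
  using sqrt1_pos(2)[of "max 0 s"] by (simp add: bp_def)

lemma bp_pos_iff: "bp s > 0 \<longleftrightarrow> s > 0"
proof (cases "s > 0")
  case True
  then have "1 < sqrt (1 + s\<^sup>2)" by simp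
  then show ?thesis using True by (simp add: bp_def)
qed (use bp_zero(1)[of s] in auto)

lemma bp_Lipschitz: "\<bar>bp s - bp t\<bar> \<le> \<bar>s - t\<bar>"
proof -
  have "norm (bp s - bp t) \<le> 1 * norm (s - t)"
    by (rule field_differentiable_bound[of UNIV bp bp']) (use bp_DERIV bp'_bounds in auto)
  then show ?thesis by simp
qed

text \<open>The derivative of r / sqrt (1 + r^2) is (1 + r^2)^(-3/2), at most 1, and the positive
  part is 1-Lipschitz. This bound is the point of replacing the positive part, whose derivative
  jumps: bp' of a mollified function converges along with the function in weighted L^1.\<close>

lemma bp'_Lipschitz: "\<bar>bp' s - bp' t\<bar> \<le> \<bar>s - t\<bar>"
proof -
  have d: "DERIV (\<lambda>x::real. x / sqrt (1 + x\<^sup>2)) x :> 1 / ((1 + x\<^sup>2) * sqrt (1 + x\<^sup>2))" for x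
  proof -
    have p: "1 + x\<^sup>2 > 0" by (simp add: add_pos_nonneg)
    have q: "sqrt (1 + x\<^sup>2) * sqrt (1 + x\<^sup>2) = 1 + x\<^sup>2" using p by simp
    have "DERIV (\<lambda>x::real. x / sqrt (1 + x\<^sup>2)) x :> (1 * sqrt (1 + x\<^sup>2) - x * (2 * x * (inverse (sqrt (1 + x\<^sup>2)) / 2))) / (sqrt (1 + x\<^sup>2) * sqrt (1 + x\<^sup>2))"
      using p by (auto intro!: derivative_eq_intros)
    moreover have "(1 * sqrt (1 + x\<^sup>2) - x * (2 * x * (inverse (sqrt (1 + x\<^sup>2)) / 2))) / (sqrt (1 + x\<^sup>2) * sqrt (1 + x\<^sup>2)) = 1 / ((1 + x\<^sup>2) * sqrt (1 + x\<^sup>2))"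
    proof -
      have "sqrt (1 + x\<^sup>2) - x * (2 * x * (inverse (sqrt (1 + x\<^sup>2)) / 2)) = 1 / sqrt (1 + x\<^sup>2)"
        using p q by (simp add: field_simps power2_eq_square)
      then show ?thesis unfolding q by simp
    qed
    ultimately show ?thesis by simp
  qed
  have "norm (max 0 s / sqrt (1 + (max 0 s)\<^sup>2) - max 0 t / sqrt (1 + (max 0 t)\<^sup>2)) \<le> 1 * norm (max 0 s - max 0 t)"
  proof (rule field_differentiable_bound[of UNIV "\<lambda>x::real. x / sqrt (1 + x\<^sup>2)"])
    fix x :: real
    have "1 * 1 \<le> (1 + x\<^sup>2) * sqrt (1 + x\<^sup>2)" using sqrt1_pos(2)[of x] by (intro mult_mono) auto
    then show "norm (1 / ((1 + x\<^sup>2) * sqrt (1 + x\<^sup>2))) \<le> 1" by (simp add: divide_le_eq)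
  qed (use d in auto)
  then show ?thesis by (simp add: bp'_def max_def split: if_splits)
qed

lemma bp_continuous [continuous_intros]: "continuous_on S bp" "continuous_on S bp'"
proof -
  show "continuous_on S bp" using bp_DERIV DERIV_continuous_on by (metis has_field_derivative_at_within)
  have "sqrt (1 + (max 0 s)\<^sup>2) \<noteq> 0" for s using sqrt1_pos[of "max 0 s"] by linarith
  then show "continuous_on S bp'" unfolding bp'_def by (intro continuous_intros) auto
qed

lemma bp_borel [measurable]: "bp \<in> borel_measurable borel" "bp' \<in> borel_measurable borel"
  using bp_continuous by (auto intro: borel_measurable_continuous_onI)

lemma C1_bp:
  assumes u: "C1 u G"
  shows "C1 (\<lambda>x. bp (u x - t)) (\<lambda>x. bp' (u x - t) *\<^sub>R G x)"
  unfolding C1_def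
proof (intro conjI allI)
  fix x
  have "DERIV (\<lambda>s. s - t) (u x) :> 1" by (auto intro!: derivative_eq_intros)
  from DERIV_chain2[OF bp_DERIV this]
  show "GDERIV (\<lambda>x. bp (u x - t)) x :> bp' (u x - t) *\<^sub>R G x"
    by (intro GDERIV_DERIV_compose[where g="\<lambda>s. bp (s - t)", OF C1_D(1)[OF u]]) simp
  have "continuous_on UNIV (\<lambda>x. bp' (u x - t))"
    by (rule continuous_on_compose2[OF bp_continuous(2)[of UNIV]])
      (use C1_D(3)[OF u] in \<open>auto intro: continuous_intros\<close>)
  then show "continuous_on UNIV (\<lambda>x. bp' (u x - t) *\<^sub>R G x)"
    by (rule continuous_on_scaleR) (rule C1_D(2)[OF u])
qed

section \<open>Weak gradients, weak divergence equations and mollifying kernels\<close>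

lemma compact_support_bounded':
  fixes f :: "'a::euclidean_space \<Rightarrow> 'b::real_normed_vector"
  assumes "continuous_on UNIV f" "compact K" "\<And>x. x \<notin> K \<Longrightarrow> f x = 0"
  shows "\<exists>M. \<forall>x. norm (f x) \<le> M"
  by (rule compact_support_bounded[OF assms]) blast+

lemma C1_reflect: "C1 f F \<Longrightarrow> C1 (\<lambda>y. f (x - y)) (\<lambda>y. - F (x - y))"
proof -
  assume f: "C1 f F"
  have "GDERIV (\<lambda>y. f (x - y)) y :> - F (x - y)" for y
  proof -
    have "(f has_derivative (\<lambda>v. v \<bullet> F (x - y))) (at (x - y))" using C1_D(1)[OF f, of "x-y"] by (simp add: gderiv_def)
    moreover have "((\<lambda>y. x - y) has_derivative (\<lambda>v. - v)) (at y)" by (auto intro!: derivative_eq_intros)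
    ultimately show ?thesis unfolding gderiv_def
      using diff_chain_at[of "\<lambda>y. x - y" "\<lambda>v. - v" y f "\<lambda>v. v \<bullet> F (x - y)"] by (simp add: o_def)
  qed
  then show ?thesis using C1_D(2)[OF f] unfolding C1_def
    by (auto intro!: continuous_intros continuous_on_compose2[of UNIV F UNIV "\<lambda>y. x - y"])
qed

text \<open>The tests are C^1 and not smooth, so that products of cut-offs with \<open>bp\<close> of
  a mollified function are admissible; \<open>bp\<close> itself is not smooth. The integrals may run
  over the whole space because the tests vanish off \<open>S\<close>.\<close>

definition weak_grad :: "'a::euclidean_space set \<Rightarrow> ('a \<Rightarrow> real) \<Rightarrow> ('a \<Rightarrow> 'a) \<Rightarrow> bool" where
  "weak_grad S u g \<longleftrightarrow> (\<forall>\<phi> G. C1c S \<phi> G \<longrightarrow> (\<integral>x. u x *\<^sub>R G x \<partial>lborel) = - (\<integral>x. \<phi> x *\<^sub>R g x \<partial>lborel))"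

text \<open>Sign convention: this is the weak form of - div F = R in \<open>S\<close>, so that the
  flux of an eigenvalue equation appears without a minus sign.\<close>

definition weak_div :: "'a::euclidean_space set \<Rightarrow> ('a \<Rightarrow> 'a) \<Rightarrow> ('a \<Rightarrow> real) \<Rightarrow> bool" where
  "weak_div S F R \<longleftrightarrow> (\<forall>\<phi> G. C1c S \<phi> G \<longrightarrow> (\<integral>x. F x \<bullet> G x \<partial>lborel) = (\<integral>x. R x * \<phi> x \<partial>lborel))"

lemma compact_open_margin:
  fixes K :: "'a::euclidean_space set"
  assumes "compact K" "open S" "K \<subseteq> S"
  obtains d where "d > 0" "\<And>x. x \<in> K \<Longrightarrow> cball x d \<subseteq> S"
proof -
  have "closed (- S)" "K \<inter> - S = {}" using assms by auto
  from separate_compact_closed[OF assms(1) this] obtain e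
    where e: "e > 0" "\<forall>x\<in>K. \<forall>y\<in>-S. e \<le> dist x y" by blast
  show ?thesis
  proof (rule that[of "e/2"])
    fix x assume x: "x \<in> K"
    show "cball x (e/2) \<subseteq> S"
    proof
      fix y assume "y \<in> cball x (e/2)"
      then have "dist x y < e" using e(1) by simp
      then show "y \<in> S" using e(2) x by (metis ComplI not_less)
    qed
  qed (use e in auto)
qed

text \<open>The kernels may change sign: they are later built from an arbitrary test function with
  nonzero integral, so that no explicit smooth bump function is needed.\<close>
locale mollifier =
  fixes k :: "nat \<Rightarrow> 'a::euclidean_space \<Rightarrow> real" and k' :: "nat \<Rightarrow> 'a \<Rightarrow> 'a" and C :: real and r :: "nat \<Rightarrow> real"
  assumes kC1: "C1 (k n) (k' n)" and k_supp: "norm x > r n \<Longrightarrow> k n x = 0"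
    and k_int: "(\<integral>x. k n x \<partial>lborel) = 1" and k_abs: "(\<integral>x. \<bar>k n x\<bar> \<partial>lborel) \<le> C"
    and k_grad: "(\<integral>x. norm (k' n x) \<partial>lborel) \<le> C / r n"
    and r_pos: "r n > 0" and r_lim: "r \<longlonglongrightarrow> 0"
begin

lemma k_supp': "x \<notin> cball 0 (r n) \<Longrightarrow> k n x = 0"
  using k_supp by auto

lemma kC1c: "C1c UNIV (k n) (k' n)"
  unfolding C1c_def by (intro conjI exI[of _ "cball 0 (r n)"] kC1 compact_cball allI impI k_supp') auto

lemma k'_supp: "norm x > r n \<Longrightarrow> k' n x = 0"
  using C1_grad_zero[OF kC1[of n], of "cball 0 (r n)" x] k_supp'[of _ n] by auto

lemma k_integrable: "integrable lborel (k n)" "integrable lborel (k' n)"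
  using C1c_integrable[OF kC1c] by auto

lemma k_continuous: "continuous_on UNIV (k n)" "continuous_on UNIV (k' n)"
  using C1_D[OF kC1] by auto

lemma k_borel [measurable]: "k n \<in> borel_measurable borel" "k' n \<in> borel_measurable borel"
  using C1_borel[OF kC1] by auto

lemma C_ge: "C \<ge> 1"
proof -
  have "1 = (\<integral>x. k 0 x \<partial>lborel)" by (simp add: k_int)
  also have "\<dots> \<le> (\<integral>x. \<bar>k 0 x\<bar> \<partial>lborel)" using k_integrable by (intro integral_mono) auto
  also have "\<dots> \<le> C" by (rule k_abs)
  finally show ?thesis .
qed

lemma k_bounded: "\<exists>M. \<forall>x. \<bar>k n x\<bar> \<le> M" "\<exists>M. \<forall>x. norm (k' n x) \<le> M"
proof -
  show "\<exists>M. \<forall>x. \<bar>k n x\<bar> \<le> M"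
    using compact_support_bounded'[OF k_continuous(1)[of n] compact_cball k_supp'] unfolding real_norm_def .
  have "x \<notin> cball 0 (r n) \<Longrightarrow> k' n x = 0" for x
    using k'_supp[of n x] by auto
  from compact_support_bounded'[OF k_continuous(2)[of n] compact_cball this]
  show "\<exists>M. \<forall>x. norm (k' n x) \<le> M" .
qed

lemma conv_ints:
  fixes f :: "'a \<Rightarrow> 'b::{banach,second_countable_topology}"
  assumes f: "integrable lborel f"
  shows "integrable lborel (\<lambda>y. k n y *\<^sub>R f (x - y))"
proof -
  obtain M where "\<And>x. \<bar>k n x\<bar> \<le> M" using k_bounded by metis
  then show ?thesis by (rule conv_integrable'[OF f k_continuous(1)])
qed

lemma conv_sym:
  assumes "integrable lborel (f :: 'a \<Rightarrow> real)"
  shows "conv (k n) f = conv f (k n)"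
proof
  fix x
  show "conv (k n) f x = conv f (k n) x"
    unfolding conv_commute[OF conv_ints[OF assms]] by (simp add: conv_def mult.commute)
qed

lemma conv_C1:
  assumes "integrable lborel f"
  shows "C1 (conv (k n) f) (conv f (k' n))"
  unfolding conv_sym[OF assms] by (rule C1_conv[OF assms kC1c])

lemma conv_bounded:
  assumes "integrable lborel (f :: 'a \<Rightarrow> real)" "\<And>x. \<bar>f x\<bar> \<le> M"
  shows "\<bar>conv (k n) f x\<bar> \<le> C * M"
proof -
  have M: "M \<ge> 0" using assms(2)[of 0] by linarith
  have "\<bar>conv (k n) f x\<bar> \<le> (\<integral>y. \<bar>k n y *\<^sub>R f (x - y)\<bar> \<partial>lborel)"
    unfolding conv_def by (rule integral_abs_bound)
  also have "\<dots> \<le> (\<integral>y. \<bar>k n y\<bar> * M \<partial>lborel)"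
    using integrable_abs[OF conv_ints[OF assms(1), of n x]] k_integrable assms(2)
    by (intro integral_mono) (auto simp: abs_mult intro!: mult_left_mono)
  also have "\<dots> \<le> C * M" using k_abs[of n] M by (simp add: mult_right_mono)
  finally show ?thesis .
qed

lemma conv_borel [measurable]:
  fixes f :: "'a \<Rightarrow> 'b::euclidean_space"
  assumes [measurable]: "f \<in> borel_measurable borel"
  shows "conv (k n) f \<in> borel_measurable borel"
  unfolding conv_def by measurable

lemma wlim_conv:
  fixes f :: "'a \<Rightarrow> 'b::euclidean_space"
  assumes t: "tcont F f" and f: "integrable lborel f" and F: "F \<in> borel_measurable borel"
  shows "wlim F (\<lambda>n. conv (k n) f) f"
  unfolding wlim_def
proof (rule order_tendstoI)
  fix a :: ennreal assume a: "0 < a"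
  obtain e where e: "e > 0" "ennreal e < a"
  proof (cases a)
    case (real s)
    then show ?thesis using a that[of "s/2"] by (auto simp: ennreal_less_iff)
  next
    case top
    then show ?thesis using that[of 1] by auto
  qed
  have "e / C > 0" using e C_ge by simp
  then obtain d where d: "d > 0" "\<And>h. norm h \<le> d \<Longrightarrow> (\<integral>\<^sup>+x. \<bar>F x\<bar> * norm (f (x + h) - f x) \<partial>lborel) \<le> ennreal (e / C)"
    using t unfolding tcont_def by meson
  have "\<forall>\<^sub>F n in sequentially. r n < d" using r_lim d(1) by (intro order_tendstoD) auto
  then show "\<forall>\<^sub>F n in sequentially. (\<integral>\<^sup>+x. \<bar>F x\<bar> * norm (conv (k n) f x - f x) \<partial>lborel) < a"
  proof eventually_elim
    case (elim n)
    have "(\<integral>\<^sup>+x. \<bar>F x\<bar> * norm (conv (k n) f x - f x) \<partial>lborel) \<le> ennreal (C * (e / C))"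
      by (rule conv_error[where r="r n"]) (use f k_continuous k_supp k_int k_abs F e C_ge d elim in auto)
    also have "\<dots> < a" using e C_ge by simp
    finally show ?case .
  qed
qed simp

text \<open>The reflected kernel y \<mapsto> k n (x - y) is a test function supported in
  \<open>cball x (r n)\<close>; the sign from the reflection cancels the one from the integration by
  parts.\<close>

lemma conv_weak_grad:
  assumes w: "weak_grad S u g" and u: "integrable lborel u" and g: "integrable lborel g" and x: "cball x (r n) \<subseteq> S"
  shows "conv u (k' n) x = conv (k n) g x"
proof -
  have "C1c S (\<lambda>y. k n (x - y)) (\<lambda>y. - k' n (x - y))"
    unfolding C1c_def using C1_reflect[OF kC1] x k_supp[of n]
    by (intro conjI exI[of _ "cball x (r n)"]) (auto simp: dist_norm)
  then have "(\<integral>y. u y *\<^sub>R (- k' n (x - y)) \<partial>lborel) = - (\<integral>y. k n (x - y) *\<^sub>R g y \<partial>lborel)"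
    using w unfolding weak_grad_def by blast
  then show ?thesis unfolding conv_commute[OF conv_ints[OF g]] by (simp add: conv_def)
qed

text \<open>Mollified indicator of the d/2-neighbourhood \<open>K2\<close> of \<open>K\<close>, with
  a kernel of radius below d/4. It equals 1 on the whole d/4-neighbourhood of \<open>K\<close>, so
  its gradient vanishes on \<open>K\<close>, and it is 0 off the d-neighbourhood. As the kernel may
  change sign, no bound between 0 and 1 is claimed.\<close>

lemma cutoff:
  fixes K :: "'a set"
  assumes K: "compact K" and S: "open S" "K \<subseteq> S"
  obtains \<eta> \<eta>' where "C1c S \<eta> \<eta>'" "\<And>x. x \<in> K \<Longrightarrow> \<eta> x = 1" "\<And>x. x \<in> K \<Longrightarrow> \<eta>' x = 0"
proof -
  obtain d where d: "d > 0" "\<And>x. x \<in> K \<Longrightarrow> cball x d \<subseteq> S" using compact_open_margin[OF K S] by metis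
  define K2 where "K2 = {x + y | x y. x \<in> K \<and> y \<in> cball 0 (d/2)}"
  define K3 where "K3 = {x + y | x y. x \<in> K \<and> y \<in> cball 0 d}"
  have K2: "compact K2" and K3: "compact K3" unfolding K2_def K3_def by (rule compact_nbhd[OF K])+
  have [measurable]: "K2 \<in> sets borel" using K2 by (simp add: borel_compact)
  have "\<forall>\<^sub>F n in sequentially. r n < d/4" using r_lim d(1) by (intro order_tendstoD) auto
  then obtain n where n: "r n < d/4" by (auto simp: eventually_sequentially)
  define f :: "'a \<Rightarrow> real" where "f = indicator K2"
  have f: "integrable lborel f" unfolding f_def
    using K2 emeasure_bounded_finite[OF compact_imp_bounded[OF K2]] by (intro integrable_real_indicator) auto
  define \<eta> where "\<eta> = conv (k n) f"
  have C: "C1 \<eta> (conv f (k' n))" unfolding \<eta>_def by (rule conv_C1[OF f])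
  have supp: "\<eta> x = 0" if "x \<notin> K3" for x
  proof -
    have "k n y *\<^sub>R f (x - y) = 0" for y
    proof (rule ccontr)
      assume "k n y *\<^sub>R f (x - y) \<noteq> 0"
      then have y: "norm y \<le> r n" "x - y \<in> K2" using k_supp[of n y] by (auto simp: f_def indicator_def not_less[symmetric] split: if_splits)
      then obtain a b where ab: "x - y = a + b" "a \<in> K" "norm b \<le> d/2" unfolding K2_def by auto
      have "x = a + (b + y)" using ab(1) by (simp add: algebra_simps)
      moreover have "norm (b + y) \<le> d" using norm_triangle_ineq[of b y] ab(3) y(1) n d by linarith
      ultimately have "x \<in> K3" unfolding K3_def using ab(2) by auto
      with that show False by simp
    qed
    then show ?thesis unfolding \<eta>_def conv_def by (simp only: integral_zero)
  qed
  have one: "\<eta> x = 1" if "a \<in> K" "dist a x < d/4" for x a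
  proof -
    have "k n y *\<^sub>R f (x - y) = k n y" for y
    proof (cases "norm y \<le> r n")
      case True
      have "x - y = a + (x - a - y)" by simp
      moreover have "norm (x - a - y) \<le> d/2"
        using norm_triangle_ineq4[of "x - a" y] that True n d by (simp add: dist_norm norm_minus_commute)
      ultimately have "x - y \<in> K2" unfolding K2_def using that(1) by (intro CollectI exI[of _ a] exI[of _ "x - a - y"]) auto
      then show ?thesis by (simp add: f_def)
    qed (use k_supp in auto)
    then show ?thesis unfolding \<eta>_def conv_def by (simp only: k_int)
  qed
  have K3S: "K3 \<subseteq> S"
  proof
    fix z assume "z \<in> K3"
    then obtain a b where "z = a + b" "a \<in> K" "norm b \<le> d" unfolding K3_def by auto
    then show "z \<in> S" using d(2)[of a] by (auto simp: dist_norm)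
  qed
  show ?thesis
  proof (rule that)
    show "C1c S \<eta> (conv f (k' n))" unfolding C1c_def using C supp K3 K3S by blast
    show "\<eta> x = 1" if "x \<in> K" for x using one[OF that, of x] d by simp
    show "conv f (k' n) x = 0" if x: "x \<in> K" for x
    proof (rule GDERIV_zero_open[where f="\<lambda>x. \<eta> x - 1" and U="ball x (d/4)"])
      show "GDERIV (\<lambda>x. \<eta> x - 1) x :> conv f (k' n) x"
        using GDERIV_diff[OF C1_D(1)[OF C, of x] GDERIV_const[of 1 x]] by simp
    qed (use one[OF x] d in auto)
  qed
qed

end

lemma powr_add_le:
  fixes a b P :: real
  assumes "0 \<le> a" "0 \<le> b" "P > 0"
  shows "(a + b) powr P \<le> 2 powr P * (a powr P + b powr P)"
proof -
  have "(a + b) powr P \<le> (2 * max a b) powr P" using assms by (intro powr_mono2) auto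
  also have "\<dots> = 2 powr P * max a b powr P" using assms by (simp add: powr_mult)
  also have "\<dots> \<le> 2 powr P * (a powr P + b powr P)"
    by (intro mult_left_mono) (auto simp: max_def)
  finally show ?thesis .
qed

lemma bp_abs_le: "\<bar>bp s\<bar> \<le> \<bar>s\<bar>"
  using bp_Lipschitz[of s 0] by (simp add: bp_zero)

context mollifier
begin

text \<open>\<kappa> bp(u - t) is an admissible test although \<open>u\<close> has only a weak
  gradient: \<open>u\<close> is mollified and the limit is taken with weight |F|, which is possible
  because |F| |\<xi>| is integrable and \<xi> is continuous under shifts in that weight. That
  \<open>u \<le> t\<close> off the compact \<open>K\<close> gives the limiting test its compact
  support.\<close>

lemma test_bp:
  fixes F \<xi> \<kappa>' :: "'a \<Rightarrow> 'a" and u R \<kappa> :: "'a \<Rightarrow> real"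
  assumes S: "open S" and K: "compact K" "K \<subseteq> S"
    and u: "integrable lborel u" "\<And>x. \<bar>u x\<bar> \<le> 1" and \<xi>: "integrable lborel \<xi>"
    and wg: "weak_grad S u \<xi>" and off: "\<And>x. x \<notin> K \<Longrightarrow> u x \<le> t"
    and \<kappa>: "C1 \<kappa> \<kappa>'" and wd: "weak_div S F R"
    and F: "integrable lborel F" and R: "integrable lborel R"
    and tc: "tcont (\<lambda>x. norm (F x)) \<xi>" and F\<xi>: "integrable lborel (\<lambda>x. norm (F x) * norm (\<xi> x))"
  shows "(\<integral>x. F x \<bullet> ((\<kappa> x * bp' (u x - t)) *\<^sub>R \<xi> x + bp (u x - t) *\<^sub>R \<kappa>' x) \<partial>lborel)
    = (\<integral>x. R x * (\<kappa> x * bp (u x - t)) \<partial>lborel)"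
proof -
  have [measurable]: "u \<in> borel_measurable borel" "\<xi> \<in> borel_measurable borel"
    "F \<in> borel_measurable borel" "R \<in> borel_measurable borel" "\<kappa> \<in> borel_measurable borel" "\<kappa>' \<in> borel_measurable borel"
    using u \<xi> F R C1_borel[OF \<kappa>] by auto
  obtain \<eta> \<eta>' where \<eta>: "C1c S \<eta> \<eta>'" "\<And>x. x \<in> K \<Longrightarrow> \<eta> x = 1" "\<And>x. x \<in> K \<Longrightarrow> \<eta>' x = 0"
    using cutoff[OF K(1) S K(2)] by blast
  \<comment> \<open>A mollification of \<open>u\<close> may exceed \<open>t\<close> slightly outside
    \<open>K\<close>; the cut-off gives the approximating tests compact support in
    \<open>S\<close>.\<close>
  define \<theta> where "\<theta> x = \<eta> x * \<kappa> x" for x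
  define \<theta>' where "\<theta>' x = \<eta> x *\<^sub>R \<kappa>' x + \<kappa> x *\<^sub>R \<eta>' x" for x
  have \<theta>: "C1c S \<theta> \<theta>'" unfolding \<theta>_def[abs_def] \<theta>'_def[abs_def] by (rule C1c_mult[OF \<eta>(1) \<kappa>])
  have [measurable]: "\<theta> \<in> borel_measurable borel" "\<theta>' \<in> borel_measurable borel"
    using C1_borel[OF C1c_C1[OF \<theta>]] by auto
  obtain Q where Q: "compact Q" "Q \<subseteq> S" "\<And>x. x \<notin> Q \<Longrightarrow> \<theta> x = 0" "\<And>x. x \<notin> Q \<Longrightarrow> \<theta>' x = 0"
    using \<theta> by (auto elim: C1c_obtain)
  obtain M1 where M1: "M1 \<ge> 0" "\<And>x. norm (\<theta> x) \<le> M1"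
    using compact_support_bounded[OF C1_D(3)[OF C1c_C1[OF \<theta>]] Q(1,3)] by auto
  obtain M2 where M2: "M2 \<ge> 0" "\<And>x. norm (\<theta>' x) \<le> M2"
    using compact_support_bounded[OF C1_D(2)[OF C1c_C1[OF \<theta>]] Q(1,4)] by auto
  obtain d where d: "d > 0" "\<And>x. x \<in> Q \<Longrightarrow> cball x d \<subseteq> S"
    using compact_open_margin[OF Q(1) S Q(2)] by auto
  define un where "un n = conv (k n) u" for n
  define xn where "xn n = conv (k n) \<xi>" for n
  have [measurable]: "un n \<in> borel_measurable borel" "xn n \<in> borel_measurable borel" for n
    unfolding un_def xn_def by measurable
  define G where "G x = (\<theta> x * bp' (u x - t)) *\<^sub>R \<xi> x + bp (u x - t) *\<^sub>R \<theta>' x" for x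
  define Gn where "Gn n x = (\<theta> x * bp' (un n x - t)) *\<^sub>R xn n x + bp (un n x - t) *\<^sub>R \<theta>' x" for n x
  have [measurable]: "G \<in> borel_measurable borel" "Gn n \<in> borel_measurable borel" for n
    unfolding G_def[abs_def] Gn_def[abs_def] by measurable
  have ev: "\<forall>\<^sub>F n in sequentially. (\<integral>x. F x \<bullet> Gn n x \<partial>lborel) = (\<integral>x. R x * (\<theta> x * bp (un n x - t)) \<partial>lborel)"
  proof -
    have "\<forall>\<^sub>F n in sequentially. r n < d" using r_lim d(1) by (intro order_tendstoD) auto
    then show ?thesis
    proof eventually_elim
      case (elim n)
      have un: "C1 (un n) (conv u (k' n))" unfolding un_def by (rule conv_C1[OF u(1)])
      have c: "C1c S (\<lambda>x. \<theta> x * bp (un n x - t)) (\<lambda>x. \<theta> x *\<^sub>R (bp' (un n x - t) *\<^sub>R conv u (k' n) x) + bp (un n x - t) *\<^sub>R \<theta>' x)"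
        by (rule C1c_mult[OF \<theta> C1_bp[OF un]])
      have eq: "\<theta> x *\<^sub>R (bp' (un n x - t) *\<^sub>R conv u (k' n) x) + bp (un n x - t) *\<^sub>R \<theta>' x = Gn n x" for x
      proof (cases "x \<in> Q")
        case True
        have "cball x (r n) \<subseteq> S" using d(2)[OF True] elim by (auto simp: subset_iff)
        then have "conv u (k' n) x = xn n x" unfolding xn_def by (intro conv_weak_grad[OF wg u(1) \<xi>])
        then show ?thesis by (simp add: Gn_def)
      qed (use Q in \<open>simp add: Gn_def\<close>)
      have "C1c S (\<lambda>x. \<theta> x * bp (un n x - t)) (Gn n)" using c unfolding eq .
      then show ?case using wd unfolding weak_div_def by blast
    qed
  qed
  have wu: "wlim H un u" if "integrable lborel H" for H
    unfolding un_def using that u by (intro wlim_conv tcont_bounded[where M=1]) auto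
  \<comment> \<open>\<open>Gn n - G\<close> splits into the change of the mollified gradient, paid
    with weight |F|, and the changes of \<open>bp'\<close> and \<open>bp\<close>, both at most |un n
    - u|; the coefficients of the latter form the second weight.\<close>
  have wG: "wlim (\<lambda>x. norm (F x)) Gn G"
  proof (rule wlim_add_mono[where c=M1 and F="\<lambda>x. norm (F x)" and g=xn and f=\<xi>
        and H="\<lambda>x. M1 * (norm (F x) * norm (\<xi> x)) + M2 * norm (F x)" and h=un and k=u])
    show "wlim (\<lambda>x. norm (F x)) xn \<xi>" unfolding xn_def by (rule wlim_conv[OF tc \<xi>]) measurable
    show "wlim (\<lambda>x. M1 * (norm (F x) * norm (\<xi> x)) + M2 * norm (F x)) un u"
      using F F\<xi> by (intro wu Bochner_Integration.integrable_add integrable_mult_right integrable_norm)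
    fix n x
    have "norm (Gn n x - G x) \<le> norm ((\<theta> x * bp' (un n x - t)) *\<^sub>R (xn n x - \<xi> x))
       + norm ((\<theta> x * (bp' (un n x - t) - bp' (u x - t))) *\<^sub>R \<xi> x) + norm ((bp (un n x - t) - bp (u x - t)) *\<^sub>R \<theta>' x)"
    proof -
      have "Gn n x - G x = (\<theta> x * bp' (un n x - t)) *\<^sub>R (xn n x - \<xi> x)
       + (\<theta> x * (bp' (un n x - t) - bp' (u x - t))) *\<^sub>R \<xi> x + (bp (un n x - t) - bp (u x - t)) *\<^sub>R \<theta>' x"
        by (simp add: Gn_def G_def algebra_simps)
      then show ?thesis
        by (simp only:) (rule order_trans[OF norm_triangle_ineq add_right_mono[OF norm_triangle_ineq]])
    qed
    also have "\<dots> \<le> M1 * norm (xn n x - \<xi> x) + (M1 * \<bar>un n x - u x\<bar>) * norm (\<xi> x) + \<bar>un n x - u x\<bar> * M2"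
    proof (intro add_mono)
      have "\<bar>\<theta> x * bp' (un n x - t)\<bar> \<le> M1 * 1" unfolding abs_mult using M1 bp'_bounds by (intro mult_mono) auto
      then show "norm ((\<theta> x * bp' (un n x - t)) *\<^sub>R (xn n x - \<xi> x)) \<le> M1 * norm (xn n x - \<xi> x)"
        by (simp add: mult_right_mono)
      have "\<bar>\<theta> x * (bp' (un n x - t) - bp' (u x - t))\<bar> \<le> M1 * \<bar>un n x - u x\<bar>"
        unfolding abs_mult using M1 bp'_Lipschitz[of "un n x - t" "u x - t"] by (intro mult_mono) auto
      then show "norm ((\<theta> x * (bp' (un n x - t) - bp' (u x - t))) *\<^sub>R \<xi> x) \<le> (M1 * \<bar>un n x - u x\<bar>) * norm (\<xi> x)"
        by (simp add: mult_right_mono)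
      show "norm ((bp (un n x - t) - bp (u x - t)) *\<^sub>R \<theta>' x) \<le> \<bar>un n x - u x\<bar> * M2"
        unfolding norm_scaleR using M2 bp_Lipschitz[of "un n x - t" "u x - t"] by (intro mult_mono) auto
    qed
    finally have "norm (F x) * norm (Gn n x - G x) \<le> norm (F x) * (M1 * norm (xn n x - \<xi> x) + (M1 * \<bar>un n x - u x\<bar>) * norm (\<xi> x) + \<bar>un n x - u x\<bar> * M2)"
      by (intro mult_left_mono) auto
    also have "\<dots> = M1 * (norm (F x) * norm (xn n x - \<xi> x)) + (M1 * (norm (F x) * norm (\<xi> x)) + M2 * norm (F x)) * \<bar>un n x - u x\<bar>"
      by (simp add: algebra_simps)
    finally show "\<bar>norm (F x)\<bar> * norm (Gn n x - G x) \<le> M1 * (\<bar>norm (F x)\<bar> * norm (xn n x - \<xi> x))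
      + \<bar>M1 * (norm (F x) * norm (\<xi> x)) + M2 * norm (F x)\<bar> * norm (un n x - u x)"
      using M1 M2 by simp
  qed (use M1 in measurable)
  have ub: "\<bar>bp (u x - t)\<bar> \<le> 1 + \<bar>t\<bar>" for x
    using bp_abs_le[of "u x - t"] u(2)[of x] by linarith
  have iG: "integrable lborel (\<lambda>x. F x \<bullet> G x)"
  proof (rule Bochner_Integration.integrable_bound[where f="\<lambda>x. M1 * (norm (F x) * norm (\<xi> x)) + ((1 + \<bar>t\<bar>) * M2) * norm (F x)"])
    show "integrable lborel (\<lambda>x. M1 * (norm (F x) * norm (\<xi> x)) + ((1 + \<bar>t\<bar>) * M2) * norm (F x))"
      using F F\<xi> by (intro Bochner_Integration.integrable_add integrable_mult_right integrable_norm)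
    show "AE x in lborel. norm (F x \<bullet> G x) \<le> norm (M1 * (norm (F x) * norm (\<xi> x)) + ((1 + \<bar>t\<bar>) * M2) * norm (F x))"
    proof (rule AE_I2)
      fix x
      have "norm (G x) \<le> norm ((\<theta> x * bp' (u x - t)) *\<^sub>R \<xi> x) + norm (bp (u x - t) *\<^sub>R \<theta>' x)"
        unfolding G_def by (rule norm_triangle_ineq)
      also have "\<dots> \<le> M1 * norm (\<xi> x) + (1 + \<bar>t\<bar>) * M2"
      proof (intro add_mono)
        have "\<bar>\<theta> x * bp' (u x - t)\<bar> \<le> M1 * 1" unfolding abs_mult using M1 bp'_bounds by (intro mult_mono) auto
        then show "norm ((\<theta> x * bp' (u x - t)) *\<^sub>R \<xi> x) \<le> M1 * norm (\<xi> x)" by (simp add: mult_right_mono)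
        show "norm (bp (u x - t) *\<^sub>R \<theta>' x) \<le> (1 + \<bar>t\<bar>) * M2"
          unfolding norm_scaleR using M2 ub[of x] by (intro mult_mono) auto
      qed
      finally have "norm (F x) * norm (G x) \<le> norm (F x) * (M1 * norm (\<xi> x) + (1 + \<bar>t\<bar>) * M2)"
        by (intro mult_left_mono) auto
      moreover have "norm (F x \<bullet> G x) \<le> norm (F x) * norm (G x)" using Cauchy_Schwarz_ineq2 by simp
      ultimately have "norm (F x \<bullet> G x) \<le> M1 * (norm (F x) * norm (\<xi> x)) + ((1 + \<bar>t\<bar>) * M2) * norm (F x)"
        by (simp add: algebra_simps)
      also have "\<dots> \<le> norm (M1 * (norm (F x) * norm (\<xi> x)) + ((1 + \<bar>t\<bar>) * M2) * norm (F x))" by simp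
      finally show "norm (F x \<bullet> G x) \<le> norm (M1 * (norm (F x) * norm (\<xi> x)) + ((1 + \<bar>t\<bar>) * M2) * norm (F x))" .
    qed
  qed measurable
  have lim1: "(\<lambda>n. \<integral>x. F x \<bullet> Gn n x \<partial>lborel) \<longlonglongrightarrow> (\<integral>x. F x \<bullet> G x \<partial>lborel)"
    by (rule wlim_integral[OF wG]) (use iG in auto)
  have iR: "integrable lborel (\<lambda>x. R x \<bullet> (\<theta> x * bp (u x - t)))"
  proof (rule Bochner_Integration.integrable_bound[where f="\<lambda>x. (M1 * (1 + \<bar>t\<bar>)) * R x"])
    show "AE x in lborel. norm (R x \<bullet> (\<theta> x * bp (u x - t))) \<le> norm (M1 * (1 + \<bar>t\<bar>) * R x)"
    proof (rule AE_I2)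
      fix x
      have "\<bar>\<theta> x\<bar> * \<bar>bp (u x - t)\<bar> \<le> M1 * (1 + \<bar>t\<bar>)" using M1 ub[of x] by (intro mult_mono) auto
      then have "\<bar>R x\<bar> * (\<bar>\<theta> x\<bar> * \<bar>bp (u x - t)\<bar>) \<le> \<bar>R x\<bar> * (M1 * (1 + \<bar>t\<bar>))" by (intro mult_left_mono) auto
      then show "norm (R x \<bullet> (\<theta> x * bp (u x - t))) \<le> norm (M1 * (1 + \<bar>t\<bar>) * R x)"
        using M1 by (simp add: abs_mult mult_ac)
    qed
  qed (use R in \<open>auto intro: integrable_mult_right\<close>)
  have wR: "wlim R (\<lambda>n x. \<theta> x * bp (un n x - t)) (\<lambda>x. \<theta> x * bp (u x - t))"
  proof (rule wlim_mono[OF wu[OF R], where c=M1])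
    fix n x
    have "\<bar>\<theta> x\<bar> * \<bar>bp (un n x - t) - bp (u x - t)\<bar> \<le> M1 * \<bar>un n x - u x\<bar>"
      using M1 bp_Lipschitz[of "un n x - t" "u x - t"] by (intro mult_mono) auto
    then have "\<bar>R x\<bar> * (\<bar>\<theta> x\<bar> * \<bar>bp (un n x - t) - bp (u x - t)\<bar>) \<le> \<bar>R x\<bar> * (M1 * \<bar>un n x - u x\<bar>)"
      by (intro mult_left_mono) auto
    then show "\<bar>R x\<bar> * norm (\<theta> x * bp (un n x - t) - \<theta> x * bp (u x - t)) \<le> M1 * (\<bar>R x\<bar> * norm (un n x - u x))"
      by (simp add: abs_mult right_diff_distrib[symmetric] mult_ac)
  qed (use M1 in measurable)
  have lim2: "(\<lambda>n. \<integral>x. R x \<bullet> (\<theta> x * bp (un n x - t)) \<partial>lborel) \<longlonglongrightarrow> (\<integral>x. R x \<bullet> (\<theta> x * bp (u x - t)) \<partial>lborel)"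
    by (rule wlim_integral[OF wR]) (use iR in auto)
  have "(\<lambda>n. \<integral>x. F x \<bullet> Gn n x \<partial>lborel) \<longlonglongrightarrow> (\<integral>x. R x \<bullet> (\<theta> x * bp (u x - t)) \<partial>lborel)"
    by (rule Lim_transform_eventually[OF lim2]) (use ev in \<open>eventually_elim, simp\<close>)
  from LIMSEQ_unique[OF lim1 this]
  have eq: "(\<integral>x. F x \<bullet> G x \<partial>lborel) = (\<integral>x. R x * (\<theta> x * bp (u x - t)) \<partial>lborel)" by simp
  \<comment> \<open>Off \<open>K\<close> both bp(u - t) and bp'(u - t) vanish, on \<open>K\<close>
    the cut-off is 1 with zero gradient; so the cut-off leaves no trace.\<close>
  have G: "G x = (\<kappa> x * bp' (u x - t)) *\<^sub>R \<xi> x + bp (u x - t) *\<^sub>R \<kappa>' x" for x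
    using \<eta>(2,3)[of x] off[of x] by (cases "x \<in> K") (simp_all add: G_def \<theta>_def \<theta>'_def bp_zero)
  have \<theta>\<kappa>: "\<theta> x * bp (u x - t) = \<kappa> x * bp (u x - t)" for x
    using \<eta>(2,3)[of x] off[of x] by (cases "x \<in> K") (simp_all add: \<theta>_def bp_zero)
  show ?thesis using eq unfolding G \<theta>\<kappa> .
qed

text \<open>A bound uniform over all translates of \<xi> passes to the mollified field by Fubini, at
  the price of the mass \<open>C\<close> of the kernel.\<close>

lemma conv_pair_bound:
  fixes \<xi> :: "'a \<Rightarrow> 'b::euclidean_space" and E :: "'a \<Rightarrow> real"
  assumes \<xi>: "integrable lborel \<xi>" and [measurable]: "E \<in> borel_measurable borel" and A: "A \<ge> 0"
    and bound: "\<And>z. (\<integral>\<^sup>+x. \<bar>E x\<bar> * norm (\<xi> (x + z)) \<partial>lborel) \<le> ennreal A"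
  shows "(\<integral>\<^sup>+x. \<bar>E x\<bar> * norm (conv (k n) \<xi> (x + y)) \<partial>lborel) \<le> ennreal (C * A)"
proof -
  have [measurable]: "\<xi> \<in> borel_measurable borel" using \<xi> by auto
  have pt: "ennreal (norm (conv (k n) \<xi> x)) \<le> (\<integral>\<^sup>+z. \<bar>k n z\<bar> * norm (\<xi> (x - z)) \<partial>lborel)" for x
    unfolding conv_def using integral_norm_bound_ennreal[OF conv_ints[OF \<xi>, of n x]] by simp
  have "(\<integral>\<^sup>+x. \<bar>E x\<bar> * norm (conv (k n) \<xi> (x + y)) \<partial>lborel)
    \<le> (\<integral>\<^sup>+x. \<integral>\<^sup>+z. ennreal \<bar>E x\<bar> * (\<bar>k n z\<bar> * norm (\<xi> (x + y - z))) \<partial>lborel \<partial>lborel)"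
  proof (rule nn_integral_mono)
    fix x
    have "ennreal (\<bar>E x\<bar> * norm (conv (k n) \<xi> (x + y))) = ennreal \<bar>E x\<bar> * ennreal (norm (conv (k n) \<xi> (x + y)))"
      by (simp add: ennreal_mult)
    also have "\<dots> \<le> ennreal \<bar>E x\<bar> * (\<integral>\<^sup>+z. \<bar>k n z\<bar> * norm (\<xi> (x + y - z)) \<partial>lborel)"
      by (intro mult_left_mono pt) auto
    also have "\<dots> = (\<integral>\<^sup>+z. ennreal \<bar>E x\<bar> * (\<bar>k n z\<bar> * norm (\<xi> (x + y - z))) \<partial>lborel)"
      by (subst nn_integral_cmult) auto
    finally show "ennreal (\<bar>E x\<bar> * norm (conv (k n) \<xi> (x + y))) \<le> (\<integral>\<^sup>+z. ennreal \<bar>E x\<bar> * (\<bar>k n z\<bar> * norm (\<xi> (x + y - z))) \<partial>lborel)" .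
  qed
  also have "\<dots> = (\<integral>\<^sup>+z. \<integral>\<^sup>+x. ennreal \<bar>E x\<bar> * (\<bar>k n z\<bar> * norm (\<xi> (x + y - z))) \<partial>lborel \<partial>lborel)"
    by (rule lborel_pair.Fubini') measurable
  also have "\<dots> \<le> (\<integral>\<^sup>+z. ennreal \<bar>k n z\<bar> * ennreal A \<partial>lborel)"
  proof (rule nn_integral_mono)
    fix z
    have "(\<integral>\<^sup>+x. ennreal \<bar>E x\<bar> * (\<bar>k n z\<bar> * norm (\<xi> (x + y - z))) \<partial>lborel)
      = (\<integral>\<^sup>+x. ennreal \<bar>k n z\<bar> * (\<bar>E x\<bar> * norm (\<xi> (x + (y - z)))) \<partial>lborel)"
      by (intro nn_integral_cong) (simp add: ennreal_mult[symmetric] mult_ac add_diff_eq)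
    also have "\<dots> = ennreal \<bar>k n z\<bar> * (\<integral>\<^sup>+x. \<bar>E x\<bar> * norm (\<xi> (x + (y - z))) \<partial>lborel)"
      by (subst nn_integral_cmult) auto
    also have "\<dots> \<le> ennreal \<bar>k n z\<bar> * ennreal A" by (intro mult_left_mono bound) auto
    finally show "(\<integral>\<^sup>+x. ennreal \<bar>E x\<bar> * (\<bar>k n z\<bar> * norm (\<xi> (x + y - z))) \<partial>lborel) \<le> ennreal \<bar>k n z\<bar> * ennreal A" .
  qed
  also have "\<dots> = ennreal (\<integral>z. \<bar>k n z\<bar> \<partial>lborel) * ennreal A"
    using k_integrable by (subst nn_integral_multc) (auto simp: nn_integral_eq_integral)
  also have "\<dots> \<le> ennreal (C * A)"
    using k_abs[of n] A by (subst ennreal_mult[symmetric]) (auto intro!: ennreal_leI mult_right_mono)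
  finally show ?thesis .
qed

end

section \<open>Increments of the flux paired with increments of the gradient\<close>

lemma C1_diff: "C1 f F \<Longrightarrow> C1 g G \<Longrightarrow> C1 (\<lambda>x. f x - g x) (\<lambda>x. F x - G x)"
  using C1_D[of f F] C1_D[of g G] unfolding C1_def
  by (auto intro!: GDERIV_diff continuous_intros)

lemma integrable_inner_bounded:
  fixes F G :: "'a::euclidean_space \<Rightarrow> 'b::euclidean_space"
  assumes "integrable lborel F" and [measurable]: "G \<in> borel_measurable borel" and G: "\<And>x. norm (G x) \<le> M"
  shows "integrable lborel (\<lambda>x. F x \<bullet> G x)"
proof (rule Bochner_Integration.integrable_bound[where f="\<lambda>x. M *\<^sub>R F x"])
  have [measurable]: "F \<in> borel_measurable borel" using assms(1) by auto
  show "(\<lambda>x. F x \<bullet> G x) \<in> borel_measurable lborel" by measurable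
  show "AE x in lborel. norm (F x \<bullet> G x) \<le> norm (M *\<^sub>R F x)"
  proof (rule AE_I2)
    fix x
    have "norm (F x \<bullet> G x) \<le> norm (F x) * norm (G x)" using Cauchy_Schwarz_ineq2 by simp
    also have "\<dots> \<le> norm (F x) * \<bar>M\<bar>" using G[of x] by (intro mult_left_mono) auto
    finally show "norm (F x \<bullet> G x) \<le> norm (M *\<^sub>R F x)" by (simp add: mult.commute)
  qed
qed (use assms(1) in simp)

lemma Lp_pair_integrable:
  fixes f :: "'a::euclidean_space \<Rightarrow> 'b::euclidean_space" and g :: "'a \<Rightarrow> 'c::euclidean_space"
  assumes f: "integrable lborel (\<lambda>x. norm (f x) powr p)" and g: "integrable lborel (\<lambda>x. norm (g x) powr (p / (p - 1)))"
    and p: "p > 1" and [measurable]: "f \<in> borel_measurable borel" "g \<in> borel_measurable borel"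
  shows "integrable lborel (\<lambda>x. norm (g x) * norm (f x))"
proof -
  obtain D where D: "D > 0" "\<And>a b. 0 \<le> a \<Longrightarrow> 0 \<le> b \<Longrightarrow> a * b \<le> 1 * a powr (p/(p-1)) + D * b powr p"
    using Young_eps[OF p, of 1] by auto
  show ?thesis
  proof (rule Bochner_Integration.integrable_bound[where f="\<lambda>x. norm (g x) powr (p / (p - 1)) + D * norm (f x) powr p"])
    show "AE x in lborel. norm (norm (g x) * norm (f x)) \<le> norm (norm (g x) powr (p / (p - 1)) + D * norm (f x) powr p)"
    proof (rule AE_I2)
      fix x
      show "norm (norm (g x) * norm (f x)) \<le> norm (norm (g x) powr (p / (p - 1)) + D * norm (f x) powr p)"
        using D(2)[of "norm (g x)" "norm (f x)"] D(1) by simp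
    qed
  qed (use f g in \<open>auto intro: Bochner_Integration.integrable_add integrable_mult_right\<close>)
qed

lemma Lp_diff_integrable:
  fixes f g :: "'a::euclidean_space \<Rightarrow> 'b::euclidean_space"
  assumes f: "integrable lborel (\<lambda>x. norm (f x) powr p)" and g: "integrable lborel (\<lambda>x. norm (g x) powr p)"
    and p: "p > 0" and [measurable]: "f \<in> borel_measurable borel" "g \<in> borel_measurable borel"
  shows "integrable lborel (\<lambda>x. norm (f x - g x) powr p)"
proof (rule Bochner_Integration.integrable_bound[where f="\<lambda>x. 2 powr p * (norm (f x) powr p + norm (g x) powr p)"])
  show "AE x in lborel. norm (norm (f x - g x) powr p) \<le> norm (2 powr p * (norm (f x) powr p + norm (g x) powr p))"
  proof (rule AE_I2)
    fix x
    have "norm (f x - g x) powr p \<le> (norm (f x) + norm (g x)) powr p"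
      using p norm_triangle_ineq4 by (intro powr_mono2) auto
    also have "\<dots> \<le> 2 powr p * (norm (f x) powr p + norm (g x) powr p)"
      using p by (intro powr_add_le) auto
    finally show "norm (norm (f x - g x) powr p) \<le> norm (2 powr p * (norm (f x) powr p + norm (g x) powr p))"
      by simp
  qed
qed (use f g in auto)

context mollifier
begin

lemma conv_C1c:
  assumes u: "integrable lborel u" and B: "compact B" "\<And>x. x \<notin> B \<Longrightarrow> u x = 0"
  shows "C1c UNIV (conv (k n) u) (conv u (k' n))"
  unfolding C1c_def
proof (intro conjI exI[of _ "{x + y | x y. x \<in> B \<and> y \<in> cball 0 (r n)}"])
  show "C1 (conv (k n) u) (conv u (k' n))" by (rule conv_C1[OF u])
  show "compact {x + y | x y. x \<in> B \<and> y \<in> cball 0 (r n)}" by (rule compact_nbhd[OF B(1)])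
  show "\<forall>x. x \<notin> {x + y | x y. x \<in> B \<and> y \<in> cball 0 (r n)} \<longrightarrow> conv (k n) u x = 0"
  proof (intro allI impI)
    fix x assume x: "x \<notin> {x + y | x y. x \<in> B \<and> y \<in> cball 0 (r n)}"
    have "k n y *\<^sub>R u (x - y) = 0" for y
    proof (cases "norm y \<le> r n")
      case True
      have "x - y \<notin> B"
      proof
        assume "x - y \<in> B"
        then have "x \<in> {x + y | x y. x \<in> B \<and> y \<in> cball 0 (r n)}"
          using True by (intro CollectI exI[of _ "x - y"] exI[of _ y]) auto
        from x this show False by (rule notE)
      qed
      then show ?thesis using B(2) by simp
    qed (use k_supp in auto)
    then show "conv (k n) u x = 0" unfolding conv_def by (simp only: integral_zero)
  qed
qed auto

text \<open>The correlation of \<open>E\<close> with the mollified \<open>u\<close> is a C^1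
  function of the shift; its gradient at y is the correlation of \<open>E\<close> with the mollified
  \<xi> shifted by y. The mean value inequality on the ball of radius |h| gives a bound into which
  neither \<open>n\<close> nor any derivative of \<open>E\<close> enters.\<close>

lemma diff_bound:
  fixes \<xi> :: "'a \<Rightarrow> 'a" and u E :: "'a \<Rightarrow> real"
  assumes u: "integrable lborel u" and B: "compact B" "\<And>x. x \<notin> B \<Longrightarrow> u x = 0"
    and \<xi>: "integrable lborel \<xi>" and wg: "weak_grad S u \<xi>"
    and E: "integrable lborel E" "\<And>x. E x \<noteq> 0 \<Longrightarrow> cball x (norm h + r n) \<subseteq> S"
    and A: "A \<ge> 0" "\<And>z. (\<integral>\<^sup>+x. \<bar>E x\<bar> * norm (\<xi> (x + z)) \<partial>lborel) \<le> ennreal A"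
  shows "\<bar>\<integral>x. E x * (conv (k n) u (x + h) - conv (k n) u x) \<partial>lborel\<bar> \<le> norm h * (C * A)"
proof -
  have [measurable]: "E \<in> borel_measurable borel" "u \<in> borel_measurable borel" "\<xi> \<in> borel_measurable borel"
    using E u \<xi> by auto
  define v where "v = conv (k n) u"
  define v' where "v' = conv u (k' n)"
  have v: "C1c UNIV v v'" unfolding v_def v'_def by (rule conv_C1c[OF u B])
  have [measurable]: "v \<in> borel_measurable borel" "v' \<in> borel_measurable borel"
    using C1_borel[OF C1c_C1[OF v]] by auto
  obtain Q where Q: "compact Q" "\<And>x. x \<notin> Q \<Longrightarrow> v x = 0" "\<And>x. x \<notin> Q \<Longrightarrow> v' x = 0" using v by (auto elim: C1c_obtain)
  obtain M where M: "\<And>x. norm (v x) \<le> M" using compact_support_bounded'[OF C1_D(3)[OF C1c_C1[OF v]] Q(1,2)] by auto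
  obtain M' where M': "\<And>x. norm (v' x) \<le> M'" using compact_support_bounded'[OF C1_D(2)[OF C1c_C1[OF v]] Q(1,3)] by auto
  \<comment> \<open>Reflection turns the correlation into a convolution, so that its
    differentiability is an instance of \<open>C1_conv\<close>.\<close>
  define E' where "E' = (\<lambda>x. E (0 - x))"
  have E': "integrable lborel E'" unfolding E'_def by (rule integrable_lborel_shift(2)[OF E(1)])
  have [measurable]: "E' \<in> borel_measurable borel" using E' by auto
  have \<Psi>: "C1 (conv E' v) (conv E' v')" by (rule C1_conv[OF E' v])
  have eq: "conv E' v y = (\<integral>x. E x * v (x + y) \<partial>lborel)" for y
  proof -
    have "integrable lborel (\<lambda>z. E' z *\<^sub>R v (y - z))"
      by (rule conv_integrable[OF E' C1_D(3)[OF C1c_C1[OF v]] M])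
    from integral_lborel_shift(2)[OF this, of 0] show ?thesis
      by (simp add: conv_def E'_def add.commute)
  qed
  have i: "integrable lborel (\<lambda>x. E x * v (x + y))" for y
    using integrable_inner_bounded[OF E(1), of "\<lambda>x. v (x + y)" M] M by simp
  have gb: "norm (conv E' v' y) \<le> C * A" if y: "norm y \<le> norm h" for y
  proof -
    have i': "integrable lborel (\<lambda>z. E' z *\<^sub>R v' (y - z))"
      by (rule conv_integrable[OF E' C1_D(2)[OF C1c_C1[OF v]] M'])
    have "ennreal (norm (conv E' v' y)) \<le> (\<integral>\<^sup>+z. norm (E' z *\<^sub>R v' (y - z)) \<partial>lborel)"
      unfolding conv_def by (rule integral_norm_bound_ennreal[OF i'])
    also have "\<dots> = (\<integral>\<^sup>+z. norm (E' (0 - z) *\<^sub>R v' (y - (0 - z))) \<partial>lborel)"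
      by (rule nn_integral_lborel_reflect[symmetric, of "\<lambda>z. ennreal (norm (E' z *\<^sub>R v' (y - z)))" 0]) measurable
    also have "\<dots> = (\<integral>\<^sup>+x. \<bar>E x\<bar> * norm (conv (k n) \<xi> (x + y)) \<partial>lborel)"
    proof (rule nn_integral_cong)
      fix x
      show "ennreal (norm (E' (0 - x) *\<^sub>R v' (y - (0 - x)))) = ennreal (\<bar>E x\<bar> * norm (conv (k n) \<xi> (x + y)))"
      proof (cases "E x = 0")
        case False
        have "cball (x + y) (r n) \<subseteq> cball x (norm h + r n)"
        proof
          fix z assume "z \<in> cball (x + y) (r n)"
          then have "norm (x + y - z) \<le> r n" by (simp add: dist_norm)
          moreover have "x - z = (x + y - z) - y" by simp
          ultimately have "norm (x - z) \<le> r n + norm h" using norm_triangle_ineq4[of "x + y - z" y] y by simp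
          then show "z \<in> cball x (norm h + r n)" by (simp add: dist_norm)
        qed
        then have "v' (x + y) = conv (k n) \<xi> (x + y)"
          unfolding v'_def using E(2)[OF False] by (intro conv_weak_grad[OF wg u \<xi>]) auto
        then show ?thesis by (simp add: E'_def add.commute)
      qed (simp add: E'_def)
    qed
    also have "\<dots> \<le> ennreal (C * A)" by (rule conv_pair_bound[OF \<xi>]) (use A in auto)
    finally show ?thesis using C_ge A(1) by (simp add: ennreal_le_iff)
  qed
  have "norm (conv E' v h - conv E' v 0) \<le> (C * A) * norm (h - 0)"
  proof (rule differentiable_bound[where S="cball 0 (norm h)" and f'="\<lambda>y v. v \<bullet> conv E' v' y"])
    show "(conv E' v has_derivative (\<lambda>w. w \<bullet> conv E' v' y)) (at y within cball 0 (norm h))" for y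
      using C1_D(1)[OF \<Psi>, of y] by (auto simp: gderiv_def intro: has_derivative_at_withinI)
    show "onorm (\<lambda>w. w \<bullet> conv E' v' y) \<le> C * A" if "y \<in> cball 0 (norm h)" for y
    proof (rule onorm_bound)
      show "0 \<le> C * A" using C_ge A(1) by simp
      fix w
      have "norm (w \<bullet> conv E' v' y) \<le> norm w * norm (conv E' v' y)" using Cauchy_Schwarz_ineq2 by simp
      also have "\<dots> \<le> norm w * (C * A)" using gb[of y] that by (intro mult_left_mono) auto
      finally show "norm (w \<bullet> conv E' v' y) \<le> C * A * norm w" by (simp add: mult_ac)
    qed
  qed auto
  moreover have "(\<integral>x. E x * (conv (k n) u (x + h) - conv (k n) u x) \<partial>lborel) = conv E' v h - conv E' v 0"
    unfolding eq v_def[symmetric] using i[of h] i[of 0] by (simp add: right_diff_distrib)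
  ultimately show ?thesis by (simp add: mult_ac)
qed

lemma wlim_shift:
  fixes g :: "nat \<Rightarrow> 'a \<Rightarrow> 'b::euclidean_space"
  assumes "wlim (\<lambda>x. F (x - h)) g f"
    and [measurable]: "F \<in> borel_measurable borel" "\<And>n. g n \<in> borel_measurable borel" "f \<in> borel_measurable borel"
  shows "wlim F (\<lambda>n x. g n (x + h)) (\<lambda>x. f (x + h))"
proof -
  have "(\<integral>\<^sup>+x. \<bar>F x\<bar> * norm (g n (x + h) - f (x + h)) \<partial>lborel) = (\<integral>\<^sup>+x. \<bar>F (x - h)\<bar> * norm (g n x - f x) \<partial>lborel)" for n
    using nn_integral_lborel_shift[of "\<lambda>x. ennreal (\<bar>F (x - h)\<bar> * norm (g n x - f x))" h] by simp
  then show ?thesis using assms(1) unfolding wlim_def by simp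
qed

text \<open>The equation and its translate by \<open>h\<close> are tested with \<zeta> times the
  difference of the mollified \<open>u\<close> and its translate. Subtraction turns the wanted
  integral into one of \<open>E\<close> against that difference, where \<open>E\<close> collects the
  increments of \<open>R\<close> and \<open>F\<close>. By continuity of translations
  \<open>E\<close> is small in the conjugate space, and the difference supplies a factor |h| through
  \<open>diff_bound\<close>; together this is o(|h|).\<close>

lemma shift_estimate:
  fixes F \<xi> :: "'a \<Rightarrow> 'a" and u R \<zeta> :: "'a \<Rightarrow> real"
  assumes S: "open S" and \<zeta>: "C1c S \<zeta> \<zeta>'" and p: "p > 1"
    and u: "integrable lborel u" "\<And>x. \<bar>u x\<bar> \<le> 1" and B: "compact B" "\<And>x. x \<notin> B \<Longrightarrow> u x = 0"
    and \<xi>: "integrable lborel \<xi>" "integrable lborel (\<lambda>x. norm (\<xi> x) powr p)"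
    and wg: "weak_grad S u \<xi>" and wd: "weak_div S F R"
    and F: "integrable lborel F" "integrable lborel (\<lambda>x. norm (F x) powr (p / (p - 1)))"
    and R: "integrable lborel R" "integrable lborel (\<lambda>x. norm (R x) powr (p / (p - 1)))"
    and e: "e > 0"
  obtains d where "d > 0" "\<And>h. norm h \<le> d \<Longrightarrow>
    \<bar>\<integral>x. \<zeta> x * ((F (x + h) - F x) \<bullet> (\<xi> (x + h) - \<xi> x)) \<partial>lborel\<bar> \<le> e * norm h"
proof -
  have [measurable]: "u \<in> borel_measurable borel" "\<xi> \<in> borel_measurable borel"
    "F \<in> borel_measurable borel" "R \<in> borel_measurable borel"
    using u \<xi> F R by auto
  have [measurable]: "\<zeta> \<in> borel_measurable borel" "\<zeta>' \<in> borel_measurable borel"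
    using C1_borel[OF C1c_C1[OF \<zeta>]] by auto
  define p' where "p' = p / (p - 1)"
  have p': "p' > 1" "p' / (p' - 1) = p" using p by (auto simp: p'_def field_simps)
  obtain Q where Q: "compact Q" "Q \<subseteq> S" "\<And>x. x \<notin> Q \<Longrightarrow> \<zeta> x = 0" "\<And>x. x \<notin> Q \<Longrightarrow> \<zeta>' x = 0"
    using \<zeta> by (auto elim: C1c_obtain)
  obtain d0 where d0: "d0 > 0" "\<And>x. x \<in> Q \<Longrightarrow> cball x d0 \<subseteq> S"
    using compact_open_margin[OF Q(1) S Q(2)] by auto
  obtain M1 where M1: "\<And>x. norm (\<zeta> x) \<le> M1"
    using compact_support_bounded'[OF C1_D(3)[OF C1c_C1[OF \<zeta>]] Q(1,3)] by auto
  obtain M2 where M2: "\<And>x. norm (\<zeta>' x) \<le> M2"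
    using compact_support_bounded'[OF C1_D(2)[OF C1c_C1[OF \<zeta>]] Q(1,4)] by auto
  define M where "M = max 1 (max M1 M2)"
  have M: "M \<ge> 1" "\<And>x. norm (\<zeta> x) \<le> M" "\<And>x. norm (\<zeta>' x) \<le> M"
    using M1 M2 by (auto simp: M_def le_max_iff_disj)
  define I where "I = (\<integral>x. norm (\<xi> x) powr p \<partial>lborel)"
  have I: "I \<ge> 0" by (simp add: I_def)
  \<comment> \<open>\<open>t\<close> and \<open>j\<close> split the budget: |E| |\<xi>| is at most t
    |\<xi>|^p + D |E|^p', and each part contributes at most e/2 after multiplication by the kernel
    constant \<open>C\<close>.\<close>
  define t where "t = e / (2 * C * (I + 1))"
  have t: "t > 0" using e C_ge I by (simp add: t_def)
  obtain D where D: "D > 0" "\<And>a b. 0 \<le> a \<Longrightarrow> 0 \<le> b \<Longrightarrow> a * b \<le> t * a powr p + D * b powr p'"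
    using Young_eps[OF p'(1) t] unfolding p'(2) by metis
  define j where "j = e / (2 * C * D)"
  have j: "j > 0" using e C_ge D by (simp add: j_def)
  define A where "A = t * I + D * j"
  have A: "A \<ge> 0" using t I D j by (simp add: A_def)
  have CA: "C * A \<le> e"
  proof -
    have "I / (I + 1) \<le> 1" using I by simp
    then have "(e / 2) * (I / (I + 1)) \<le> (e / 2) * 1" using e by (intro mult_left_mono) auto
    moreover have "C * (t * I) = (e / 2) * (I / (I + 1))" using C_ge by (simp add: t_def)
    ultimately have "C * (t * I) \<le> e / 2" by simp
    moreover have "C * (D * j) = e / 2" using C_ge D by (simp add: j_def)
    ultimately show ?thesis by (simp add: A_def distrib_left)
  qed
  \<comment> \<open>|E| is at most \<open>M\<close> times the sum of the increments of
    \<open>R\<close> and \<open>F\<close>; the p'-th power of that sum costs (2 M)^p', and there are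
    two increments.\<close>
  define e1 where "e1 = j / (2 * ((2 * M) powr p'))"
  have e1: "e1 > 0" using j M by (simp add: e1_def)
  obtain d1 where d1: "d1 > 0" "\<And>h. norm h \<le> d1 \<Longrightarrow> (\<integral>\<^sup>+x. norm (F (x + h) - F x) powr p' \<partial>lborel) \<le> ennreal e1"
    using Lp_translation_continuous[of F p' e1] F p' e1 unfolding p'_def[symmetric] by auto
  obtain d2 where d2: "d2 > 0" "\<And>h. norm h \<le> d2 \<Longrightarrow> (\<integral>\<^sup>+x. norm (R (x + h) - R x) powr p' \<partial>lborel) \<le> ennreal e1"
    using Lp_translation_continuous[of R p' e1] R p' e1 unfolding p'_def[symmetric] by auto
  show ?thesis
  proof (rule that[of "min (d0/2) (min d1 d2)"])
    fix h :: 'a assume h: "norm h \<le> min (d0/2) (min d1 d2)"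
    define DF where "DF x = F (x + h) - F x" for x
    define DR where "DR x = R (x + h) - R x" for x
    define E where "E x = DR x * \<zeta> x - DF x \<bullet> \<zeta>' x" for x
    have iDF: "integrable lborel DF" unfolding DF_def[abs_def]
      using F(1) integrable_lborel_shift(1)[OF F(1), of h] by auto
    have iDR: "integrable lborel DR" unfolding DR_def[abs_def]
      using R(1) integrable_lborel_shift(1)[OF R(1), of h] by auto
    have [measurable]: "DF \<in> borel_measurable borel" "DR \<in> borel_measurable borel" using iDF iDR by auto
    have [measurable]: "E \<in> borel_measurable borel" unfolding E_def[abs_def] by measurable
    have iE: "integrable lborel E" unfolding E_def[abs_def]
      using integrable_inner_bounded[OF iDR, of \<zeta> M] integrable_inner_bounded[OF iDF, of \<zeta>' M] M by auto
    have E0: "E x = 0" if "x \<notin> Q" for x using Q(3,4)[OF that] by (simp add: E_def)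
    have EJ: "(\<integral>\<^sup>+x. \<bar>E x\<bar> powr p' \<partial>lborel) \<le> ennreal j"
    proof -
      have "(\<integral>\<^sup>+x. \<bar>E x\<bar> powr p' \<partial>lborel) \<le> (\<integral>\<^sup>+x. ennreal ((2 * M) powr p') * (ennreal (norm (DR x) powr p') + ennreal (norm (DF x) powr p')) \<partial>lborel)"
      proof (rule nn_integral_mono)
        fix x
        have "\<bar>E x\<bar> \<le> \<bar>DR x\<bar> * M + norm (DF x) * M"
        proof -
          have "\<bar>E x\<bar> \<le> \<bar>DR x * \<zeta> x\<bar> + \<bar>DF x \<bullet> \<zeta>' x\<bar>" unfolding E_def by linarith
          also have "\<dots> \<le> \<bar>DR x\<bar> * M + norm (DF x) * M"
          proof (intro add_mono)
            show "\<bar>DR x * \<zeta> x\<bar> \<le> \<bar>DR x\<bar> * M" unfolding abs_mult using M(2)[of x] by (intro mult_left_mono) auto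
            have "\<bar>DF x \<bullet> \<zeta>' x\<bar> \<le> norm (DF x) * norm (\<zeta>' x)" by (rule Cauchy_Schwarz_ineq2)
            also have "\<dots> \<le> norm (DF x) * M" using M(3)[of x] by (intro mult_left_mono) auto
            finally show "\<bar>DF x \<bullet> \<zeta>' x\<bar> \<le> norm (DF x) * M" .
          qed
          finally show ?thesis .
        qed
        then have "\<bar>E x\<bar> powr p' \<le> (M * (norm (DR x) + norm (DF x))) powr p'"
          using p' by (intro powr_mono2) (auto simp: algebra_simps)
        also have "\<dots> = M powr p' * (norm (DR x) + norm (DF x)) powr p'"
          by (rule powr_mult)
        also have "\<dots> \<le> M powr p' * (2 powr p' * (norm (DR x) powr p' + norm (DF x) powr p'))"
          using p' by (intro mult_left_mono powr_add_le) auto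
        also have "\<dots> = (2 * M) powr p' * (norm (DR x) powr p' + norm (DF x) powr p')"
          using M by (simp add: powr_mult)
        finally have "ennreal (\<bar>E x\<bar> powr p') \<le> ennreal ((2 * M) powr p' * (norm (DR x) powr p' + norm (DF x) powr p'))"
          by (rule ennreal_leI)
        then show "ennreal (\<bar>E x\<bar> powr p') \<le> ennreal ((2 * M) powr p') * (ennreal (norm (DR x) powr p') + ennreal (norm (DF x) powr p'))"
          by (simp add: ennreal_mult)
      qed
      also have "\<dots> = ennreal ((2 * M) powr p') * ((\<integral>\<^sup>+x. norm (DR x) powr p' \<partial>lborel) + (\<integral>\<^sup>+x. norm (DF x) powr p' \<partial>lborel))"
        by (subst nn_integral_cmult; (subst nn_integral_add)?) auto
      also have "\<dots> \<le> ennreal ((2 * M) powr p') * (ennreal e1 + ennreal e1)"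
        using d1(2)[of h] d2(2)[of h] h unfolding DF_def DR_def by (intro mult_left_mono add_mono) auto
      also have "ennreal e1 + ennreal e1 = ennreal (e1 + e1)"
        using e1 by (intro ennreal_plus[symmetric]) auto
      also have "ennreal ((2 * M) powr p') * ennreal (e1 + e1) = ennreal ((2 * M) powr p' * (e1 + e1))"
        using e1 by (intro ennreal_mult[symmetric]) auto
      also have "(2 * M) powr p' * (e1 + e1) = j" using M by (simp add: e1_def)
      finally show ?thesis .
    qed
    have EA: "(\<integral>\<^sup>+x. \<bar>E x\<bar> * norm (\<xi> (x + z)) \<partial>lborel) \<le> ennreal A" for z
    proof -
      have "(\<integral>\<^sup>+x. \<bar>E x\<bar> * norm (\<xi> (x + z)) \<partial>lborel)
        \<le> (\<integral>\<^sup>+x. ennreal t * ennreal (norm (\<xi> (x + z)) powr p) + ennreal D * ennreal (\<bar>E x\<bar> powr p') \<partial>lborel)"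
      proof (rule nn_integral_mono)
        fix x
        from ennreal_leI[OF D(2)[of "norm (\<xi> (x + z))" "\<bar>E x\<bar>"]]
        show "ennreal (\<bar>E x\<bar> * norm (\<xi> (x + z))) \<le> ennreal t * ennreal (norm (\<xi> (x + z)) powr p) + ennreal D * ennreal (\<bar>E x\<bar> powr p')"
          using t D(1) by (simp add: ennreal_mult mult.commute)
      qed
      also have "\<dots> = ennreal t * (\<integral>\<^sup>+x. norm (\<xi> (x + z)) powr p \<partial>lborel) + ennreal D * (\<integral>\<^sup>+x. \<bar>E x\<bar> powr p' \<partial>lborel)"
        by (subst nn_integral_add) (auto simp: nn_integral_cmult)
      also have "(\<integral>\<^sup>+x. norm (\<xi> (x + z)) powr p \<partial>lborel) = ennreal I"
        using nn_integral_lborel_shift[of "\<lambda>x. ennreal (norm (\<xi> x) powr p)" z] \<xi>(2)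
        by (simp add: I_def nn_integral_eq_integral)
      also have "ennreal t * ennreal I + ennreal D * (\<integral>\<^sup>+x. \<bar>E x\<bar> powr p' \<partial>lborel) \<le> ennreal t * ennreal I + ennreal D * ennreal j"
        by (intro add_left_mono mult_left_mono EJ) auto
      also have "\<dots> = ennreal A" using t I D j by (simp add: A_def ennreal_mult[symmetric])
      finally show ?thesis .
    qed
    define un where "un n = conv (k n) u" for n
    define xn where "xn n = conv (k n) \<xi>" for n
    have [measurable]: "un n \<in> borel_measurable borel" "xn n \<in> borel_measurable borel" for n
      unfolding un_def xn_def by measurable
    have "\<forall>\<^sub>F n in sequentially. r n < d0/2" using r_lim d0(1) by (intro order_tendstoD) auto
    then have ev: "\<forall>\<^sub>F n in sequentially. \<bar>\<integral>x. (\<zeta> x *\<^sub>R DF x) \<bullet> (xn n (x + h) - xn n x) \<partial>lborel\<bar> \<le> e * norm h"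
    proof eventually_elim
      case (elim n)
      have inS: "cball x (norm h + r n) \<subseteq> S" if "x \<in> Q" for x
        using d0(2)[OF that] h elim by (auto simp: subset_iff)
      define un' where "un' = conv u (k' n)"
      have un: "C1 (un n) un'" unfolding un_def un'_def by (rule conv_C1[OF u(1)])
      have un'xn: "un' (x + y) = xn n (x + y)" if "x \<in> Q" "norm y \<le> norm h" for x y
      proof -
        have "cball (x + y) (r n) \<subseteq> cball x (norm h + r n)"
        proof
          fix z assume "z \<in> cball (x + y) (r n)"
          then have "norm (x + y - z) \<le> r n" by (simp add: dist_norm)
          moreover have "x - z = (x + y - z) - y" by simp
          ultimately have "norm (x - z) \<le> r n + norm h" using norm_triangle_ineq4[of "x + y - z" y] that by simp
          then show "z \<in> cball x (norm h + r n)" by (simp add: dist_norm)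
        qed
        then show ?thesis unfolding un'_def xn_def using inS[OF that(1)]
          by (intro conv_weak_grad[OF wg u(1) \<xi>(1)]) auto
      qed
      define \<phi> where "\<phi> x = \<zeta> x * (un n (x + h) - un n x)" for x
      define G where "G x = \<zeta> x *\<^sub>R (xn n (x + h) - xn n x) + (un n (x + h) - un n x) *\<^sub>R \<zeta>' x" for x
      have \<phi>: "C1c S \<phi> G"
      proof -
        have c: "C1c S \<phi> (\<lambda>x. \<zeta> x *\<^sub>R (un' (x + h) - un' x) + (un n (x + h) - un n x) *\<^sub>R \<zeta>' x)"
          unfolding \<phi>_def[abs_def] by (rule C1c_mult[OF \<zeta> C1_diff[OF C1_shift[OF un] un]])
        have eq: "\<zeta> x *\<^sub>R (un' (x + h) - un' x) + (un n (x + h) - un n x) *\<^sub>R \<zeta>' x = G x" for x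
          using un'xn[of x h] un'xn[of x 0] Q(3)[of x] by (cases "x \<in> Q") (simp_all add: G_def)
        show ?thesis using c unfolding eq .
      qed
      have \<phi>Q: "\<phi> x = 0" "G x = 0" if "x \<notin> Q" for x
        using Q(3,4)[OF that] by (simp_all add: \<phi>_def G_def)
      have \<phi>s: "C1c S (\<lambda>x. \<phi> (x - h)) (\<lambda>x. G (x - h))"
        unfolding C1c_def
      proof (intro conjI exI[of _ "(\<lambda>x. x + h) ` Q"] allI impI)
        show "C1 (\<lambda>x. \<phi> (x - h)) (\<lambda>x. G (x - h))" using C1_shift[OF C1c_C1[OF \<phi>], of "-h"] by simp
        show "compact ((\<lambda>x. x + h) ` Q)" using Q(1) by (intro compact_continuous_image continuous_intros) auto
        show "(\<lambda>x. x + h) ` Q \<subseteq> S"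
        proof
          fix z assume "z \<in> (\<lambda>x. x + h) ` Q"
          then obtain x where x: "x \<in> Q" "z = x + h" by auto
          have "z \<in> cball x (norm h + r n)" using r_pos[of n] by (simp add: x(2) dist_norm)
          then show "z \<in> S" using inS[OF x(1)] by auto
        qed
        fix x assume "x \<notin> (\<lambda>x. x + h) ` Q"
        then have "x - h \<notin> Q" by (metis diff_add_cancel image_eqI)
        then show "\<phi> (x - h) = 0" by (rule \<phi>Q)
      qed
      have [measurable]: "\<phi> \<in> borel_measurable borel" "G \<in> borel_measurable borel"
        using C1_borel[OF C1c_C1[OF \<phi>]] by auto
      obtain MG where MG: "\<And>x. norm (G x) \<le> MG"
        using compact_support_bounded'[OF C1_D(2)[OF C1c_C1[OF \<phi>]] Q(1) \<phi>Q(2)] by auto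
      obtain MP where MP: "\<And>x. norm (\<phi> x) \<le> MP"
        using compact_support_bounded'[OF C1_D(3)[OF C1c_C1[OF \<phi>]] Q(1) \<phi>Q(1)] by auto
      have e1: "(\<integral>x. F x \<bullet> G x \<partial>lborel) = (\<integral>x. R x * \<phi> x \<partial>lborel)"
        using wd \<phi> unfolding weak_div_def by blast
      \<comment> \<open>Testing with the test function moved by \<open>h\<close> and substituting
        gives the equation for the translates of \<open>F\<close> and \<open>R\<close>.\<close>
      have "(\<integral>x. F x \<bullet> G (x - h) \<partial>lborel) = (\<integral>x. R x * \<phi> (x - h) \<partial>lborel)"
        using wd \<phi>s unfolding weak_div_def by blast
      moreover have "integrable lborel (\<lambda>x. F x \<bullet> G (x - h))"
        by (rule integrable_inner_bounded[OF F(1) _ MG]) measurable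
      note integral_lborel_shift(1)[OF this, of h]
      moreover have "integrable lborel (\<lambda>x. R x \<bullet> \<phi> (x - h))"
        by (rule integrable_inner_bounded[OF R(1) _ MP]) measurable
      note integral_lborel_shift(1)[OF this, of h]
      ultimately have e2: "(\<integral>x. F (x + h) \<bullet> G x \<partial>lborel) = (\<integral>x. R (x + h) * \<phi> x \<partial>lborel)"
        by simp
      have i1: "integrable lborel (\<lambda>x. F x \<bullet> G x)" "integrable lborel (\<lambda>x. F (x + h) \<bullet> G x)"
        by (rule integrable_inner_bounded[OF _ _ MG]; use F(1) integrable_lborel_shift(1)[OF F(1), of h] in measurable)+
      have i2: "integrable lborel (\<lambda>x. R x \<bullet> \<phi> x)" "integrable lborel (\<lambda>x. R (x + h) \<bullet> \<phi> x)"
        by (rule integrable_inner_bounded[OF _ _ MP]; use R(1) integrable_lborel_shift(1)[OF R(1), of h] in measurable)+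
      have e3: "(\<integral>x. DF x \<bullet> G x \<partial>lborel) = (\<integral>x. DR x * \<phi> x \<partial>lborel)"
        using e1 e2 i1 i2 by (simp add: DF_def DR_def inner_diff_left left_diff_distrib)
      have unb: "\<bar>un n x\<bar> \<le> C * 1" for x unfolding un_def by (rule conv_bounded[OF u])
      have unb2: "norm (un n (x + h) - un n x) \<le> 2 * C" for x using unb[of x] unb[of "x+h"] by simp
      have i3: "integrable lborel (\<lambda>x. DF x \<bullet> ((un n (x + h) - un n x) *\<^sub>R \<zeta>' x))"
      proof (rule integrable_inner_bounded[OF iDF, of _ "(2 * C) * M"])
        show "norm ((un n (x + h) - un n x) *\<^sub>R \<zeta>' x) \<le> (2 * C) * M" for x
          unfolding norm_scaleR using unb2[of x] M(3)[of x] C_ge by (intro mult_mono) auto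
      qed measurable
      have i4: "integrable lborel (\<lambda>x. DF x \<bullet> G x)" by (rule integrable_inner_bounded[OF iDF _ MG]) measurable
      have i5: "integrable lborel (\<lambda>x. DR x \<bullet> \<phi> x)" by (rule integrable_inner_bounded[OF iDR _ MP]) measurable
      have "(\<integral>x. (\<zeta> x *\<^sub>R DF x) \<bullet> (xn n (x + h) - xn n x) \<partial>lborel)
        = (\<integral>x. DF x \<bullet> G x - DF x \<bullet> ((un n (x + h) - un n x) *\<^sub>R \<zeta>' x) \<partial>lborel)"
        by (intro Bochner_Integration.integral_cong) (simp_all add: G_def inner_add_right)
      also have "\<dots> = (\<integral>x. DR x * \<phi> x \<partial>lborel) - (\<integral>x. DF x \<bullet> ((un n (x + h) - un n x) *\<^sub>R \<zeta>' x) \<partial>lborel)"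
        using i3 i4 e3 by (simp del: inner_scaleR_right)
      also have "\<dots> = (\<integral>x. DR x * \<phi> x - DF x \<bullet> ((un n (x + h) - un n x) *\<^sub>R \<zeta>' x) \<partial>lborel)"
        using i3 i5 by (simp del: inner_scaleR_right)
      also have "\<dots> = (\<integral>x. E x * (conv (k n) u (x + h) - conv (k n) u x) \<partial>lborel)"
        by (intro Bochner_Integration.integral_cong) (simp_all add: \<phi>_def E_def un_def algebra_simps)
      also have "\<bar>\<dots>\<bar> \<le> norm h * (C * A)"
      proof (rule diff_bound[OF u(1) B \<xi>(1) wg iE _ A EA])
        show "cball x (norm h + r n) \<subseteq> S" if "E x \<noteq> 0" for x using inS[of x] E0[of x] that by auto
      qed
      also have "\<dots> \<le> norm h * e" by (intro mult_left_mono CA) auto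
      finally show ?case by (simp add: mult.commute)
    qed
    have DFp: "integrable lborel (\<lambda>x. norm (DF x) powr p')" unfolding DF_def[abs_def]
      using F(2) integrable_lborel_shift(1)[OF F(2), of h] p' unfolding p'_def[symmetric]
      by (intro Lp_diff_integrable) auto
    have D\<xi>p: "integrable lborel (\<lambda>x. norm (\<xi> (x + h) - \<xi> x) powr p)"
      using \<xi>(2) integrable_lborel_shift(1)[OF \<xi>(2), of h] p by (intro Lp_diff_integrable) auto
    \<comment> \<open>The limit in \<open>n\<close> is taken for fixed \<open>h\<close>. The weight
      is the increment of the flux, which lies in the conjugate space, so the mollifications of
      \<xi> and of its translate both converge.\<close>
    define W where "W x = M * norm (DF x)" for x
    have [measurable]: "W \<in> borel_measurable borel" unfolding W_def[abs_def] by measurable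
    have Wp: "integrable lborel (\<lambda>x. \<bar>W x\<bar> powr p')"
      using DFp M by (simp add: W_def powr_mult abs_mult)
    have w1: "wlim W xn \<xi>" unfolding xn_def
      by (rule wlim_conv[OF tcont_Lp[OF \<xi>(2) p] \<xi>(1)]) (use Wp in \<open>auto simp: p'_def\<close>)
    have "integrable lborel (\<lambda>x. \<bar>W (x - h)\<bar> powr p')"
      using integrable_lborel_shift(1)[OF Wp, of "-h"] by simp
    then have "wlim (\<lambda>x. W (x - h)) xn \<xi>" unfolding xn_def
      by (intro wlim_conv[OF tcont_Lp[OF \<xi>(2) p] \<xi>(1)]) (auto simp: p'_def)
    then have w2: "wlim W (\<lambda>n x. xn n (x + h)) (\<lambda>x. \<xi> (x + h))" by (rule wlim_shift) measurable
    have w3: "wlim W (\<lambda>n x. xn n (x + h) - xn n x) (\<lambda>x. \<xi> (x + h) - \<xi> x)"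
    proof (rule wlim_add_mono[OF w1 w2, where c=1])
      fix n x
      have "norm (xn n (x + h) - xn n x - (\<xi> (x + h) - \<xi> x)) = norm ((xn n (x + h) - \<xi> (x + h)) - (xn n x - \<xi> x))"
        by (simp add: algebra_simps)
      also have "\<dots> \<le> norm (xn n x - \<xi> x) + norm (xn n (x + h) - \<xi> (x + h))"
        using norm_triangle_ineq4[of "xn n (x + h) - \<xi> (x + h)" "xn n x - \<xi> x"] by simp
      finally have "\<bar>W x\<bar> * norm (xn n (x + h) - xn n x - (\<xi> (x + h) - \<xi> x)) \<le> \<bar>W x\<bar> * (norm (xn n x - \<xi> x) + norm (xn n (x + h) - \<xi> (x + h)))"
        by (intro mult_left_mono) auto
      then show "\<bar>W x\<bar> * norm (xn n (x + h) - xn n x - (\<xi> (x + h) - \<xi> x))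
        \<le> 1 * (\<bar>W x\<bar> * norm (xn n x - \<xi> x)) + \<bar>W x\<bar> * norm (xn n (x + h) - \<xi> (x + h))"
        by (simp add: distrib_left)
    qed measurable
    have iL: "integrable lborel (\<lambda>x. (\<zeta> x *\<^sub>R DF x) \<bullet> (\<xi> (x + h) - \<xi> x))"
    proof (rule Bochner_Integration.integrable_bound[where f="\<lambda>x. M * (norm (DF x) * norm (\<xi> (x + h) - \<xi> x))"])
      show "integrable lborel (\<lambda>x. M * (norm (DF x) * norm (\<xi> (x + h) - \<xi> x)))"
        using Lp_pair_integrable[OF D\<xi>p, of DF] DFp p by (intro integrable_mult_right) (auto simp: p'_def)
      show "AE x in lborel. norm ((\<zeta> x *\<^sub>R DF x) \<bullet> (\<xi> (x + h) - \<xi> x)) \<le> norm (M * (norm (DF x) * norm (\<xi> (x + h) - \<xi> x)))"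
      proof (rule AE_I2)
        fix x
        have "norm ((\<zeta> x *\<^sub>R DF x) \<bullet> (\<xi> (x + h) - \<xi> x)) \<le> norm (\<zeta> x *\<^sub>R DF x) * norm (\<xi> (x + h) - \<xi> x)"
          unfolding real_norm_def by (rule Cauchy_Schwarz_ineq2)
        also have "\<dots> \<le> (M * norm (DF x)) * norm (\<xi> (x + h) - \<xi> x)"
          unfolding norm_scaleR using M(2)[of x] by (intro mult_right_mono) auto
        finally show "norm ((\<zeta> x *\<^sub>R DF x) \<bullet> (\<xi> (x + h) - \<xi> x)) \<le> norm (M * (norm (DF x) * norm (\<xi> (x + h) - \<xi> x)))"
          using M(1) by (simp add: mult_ac)
      qed
    qed measurable
    have "(\<lambda>n. \<integral>x. (\<zeta> x *\<^sub>R DF x) \<bullet> (xn n (x + h) - xn n x) \<partial>lborel) \<longlonglongrightarrow> (\<integral>x. (\<zeta> x *\<^sub>R DF x) \<bullet> (\<xi> (x + h) - \<xi> x) \<partial>lborel)"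
    proof (rule wlim_integral[OF w3 _ _ _ _ iL])
      show "norm (\<zeta> x *\<^sub>R DF x) \<le> \<bar>W x\<bar>" for x
        using M(1) M(2)[of x] by (simp add: W_def abs_mult mult_right_mono)
    qed measurable
    from tendsto_rabs[OF this]
    have "\<bar>\<integral>x. (\<zeta> x *\<^sub>R DF x) \<bullet> (\<xi> (x + h) - \<xi> x) \<partial>lborel\<bar> \<le> e * norm h"
      by (rule tendsto_upperbound) (use ev in auto)
    then show "\<bar>\<integral>x. \<zeta> x * ((F (x + h) - F x) \<bullet> (\<xi> (x + h) - \<xi> x)) \<partial>lborel\<bar> \<le> e * norm h"
      by (simp add: DF_def)
  qed (use d0 d1 d2 in auto)
qed

end

section \<open>The lower gradient bound\<close>

definition pf :: "real \<Rightarrow> 'a::real_inner \<Rightarrow> 'a" where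
  "pf p x = norm x powr (p - 2) *\<^sub>R x"

lemma powr_mult_self: "norm x powr (s - 1) * norm x = norm x powr s" if "s > 0"
  using powr_mult_base[of "norm x" "s - 1"] by (simp add: mult.commute)

lemma norm_pf: "p > 1 \<Longrightarrow> norm (pf p x) = norm x powr (p - 1)"
  using powr_mult_self[of "p - 1" x] by (simp add: pf_def)

lemma pf_inner: "p > 1 \<Longrightarrow> pf p x \<bullet> x = norm x powr p"
proof -
  assume p: "p > 1"
  have "pf p x \<bullet> x = (norm x powr (p - 2) * norm x) * norm x"
    by (simp add: pf_def power2_norm_eq_inner[symmetric] power2_eq_square)
  also have "norm x powr (p - 2) * norm x = norm x powr (p - 1)" using powr_mult_self[of "p - 1" x] p by simp
  also have "norm x powr (p - 1) * norm x = norm x powr p" using powr_mult_self[of p x] p by simp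
  finally show ?thesis .
qed

lemma pf_split: "p \<noteq> q \<Longrightarrow> pf p x = norm x powr (p - q) *\<^sub>R pf q x"
  by (simp add: pf_def powr_add[symmetric])

lemma pf_borel [measurable]: "pf p \<in> borel_measurable (borel :: 'a::euclidean_space measure)"
  unfolding pf_def[abs_def] by measurable

text \<open>Cauchy-Schwarz replaces the mixed terms by products of norms, so only the radial part of
  the monotonicity is kept. That suffices, since the truncations below depend on |\<xi>|
  alone.\<close>

lemma pf_monotone:
  fixes a b :: "'a::real_inner"
  assumes p: "p > 1"
  shows "\<bar>norm a powr (p - 1) - norm b powr (p - 1)\<bar> * \<bar>norm a - norm b\<bar> \<le> (pf p a - pf p b) \<bullet> (a - b)"
proof -
  have 1: "pf p a \<bullet> b \<le> norm a powr (p - 1) * norm b"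
    using norm_cauchy_schwarz[of "pf p a" b] norm_pf[OF p, of a] by simp
  have 2: "pf p b \<bullet> a \<le> norm b powr (p - 1) * norm a"
    using norm_cauchy_schwarz[of "pf p b" a] norm_pf[OF p, of b] by simp
  have "(pf p a - pf p b) \<bullet> (a - b) = norm a powr p + norm b powr p - pf p a \<bullet> b - pf p b \<bullet> a"
    using pf_inner[OF p, of a] pf_inner[OF p, of b] by (simp add: inner_diff_left inner_diff_right)
  also have "\<dots> \<ge> norm a powr p + norm b powr p - norm a powr (p - 1) * norm b - norm b powr (p - 1) * norm a"
    using 1 2 by simp
  also have "norm a powr p = norm a powr (p - 1) * norm a" using powr_mult_self[of p a] p by simp
  also have "norm b powr p = norm b powr (p - 1) * norm b" using powr_mult_self[of p b] p by simp
  finally have 3: "(norm a powr (p - 1) - norm b powr (p - 1)) * (norm a - norm b) \<le> (pf p a - pf p b) \<bullet> (a - b)"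
    by (simp add: algebra_simps)
  have "(norm a powr (p - 1) - norm b powr (p - 1)) * (norm a - norm b) = \<bar>norm a powr (p - 1) - norm b powr (p - 1)\<bar> * \<bar>norm a - norm b\<bar>"
  proof (cases "norm a \<le> norm b")
    case True
    then have "norm a powr (p - 1) \<le> norm b powr (p - 1)" using p by (intro powr_mono2) auto
    then show ?thesis using True by (simp add: algebra_simps)
  next
    case False
    then have "norm b powr (p - 1) \<le> norm a powr (p - 1)" using p by (intro powr_mono2) auto
    then show ?thesis using False by simp
  qed
  with 3 show ?thesis by simp
qed

lemma pf_monotone0:
  fixes a b :: "'a::real_inner"
  shows "p > 1 \<Longrightarrow> 0 \<le> (pf p a - pf p b) \<bullet> (a - b)"
  by (rule order_trans[OF _ pf_monotone]) auto

text \<open>\<open>Kf s a = (s - a)\<^sup>+\<close> and \<open>Kt m s a\<close> is the integral of \<open>z\<^sup>m\<close> over \<open>[a, s]\<close>, so that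
  \<open>dKt = a\<^sup>m dKf\<close>.\<close>
definition Kf :: "real \<Rightarrow> real \<Rightarrow> real" where "Kf s a = s - min a s"
definition Kt :: "real \<Rightarrow> real \<Rightarrow> real \<Rightarrow> real" where
  "Kt m s a = (s powr (m + 1) - min a s powr (m + 1)) / (m + 1)"

lemma Kf_borel [measurable]: "Kf s \<in> borel_measurable borel" unfolding Kf_def[abs_def] by measurable
lemma Kt_borel [measurable]: "Kt m s \<in> borel_measurable borel" unfolding Kt_def[abs_def] by measurable

lemma powr_mvt:
  fixes c d m :: real
  assumes "0 \<le> c" "c \<le> d" "m > 0"
  obtains z where "c \<le> z" "z \<le> d" "(d powr (m + 1) - c powr (m + 1)) / (m + 1) = z powr m * (d - c)"
proof (cases "c = d")
  case True
  then show ?thesis using that[of c] assms by simp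
next
  case False
  then have cd: "c < d" using assms by simp
  have "\<exists>l z. c < z \<and> z < d \<and> DERIV (\<lambda>x. x powr (m + 1)) z :> l \<and> d powr (m + 1) - c powr (m + 1) = (d - c) * l"
  proof (rule MVT[OF cd])
    show "continuous_on {c..d} (\<lambda>x. x powr (m + 1))"
      using assms by (intro continuous_on_powr' continuous_intros) auto
    show "(\<lambda>x. x powr (m + 1)) differentiable (at x)" if "c < x" "x < d" for x
      using that assms has_real_derivative_powr[of x "m+1"] by (auto simp: real_differentiable_def)
  qed
  then obtain l z where z: "c < z" "z < d" "DERIV (\<lambda>x. x powr (m + 1)) z :> l" "d powr (m + 1) - c powr (m + 1) = (d - c) * l"
    by auto
  have "DERIV (\<lambda>x. x powr (m + 1)) z :> (m + 1) * z powr (m + 1 - 1)"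
    using z assms by (intro has_real_derivative_powr) auto
  then have "l = (m + 1) * z powr m" using z(3) DERIV_unique by fastforce
  then show ?thesis using z assms that[of z] by (simp add: field_simps)
qed

lemma Kf_bounds: assumes "0 \<le> a" "0 < s" shows "0 \<le> Kf s a" "Kf s a \<le> s" "Kf s a \<le> 0 \<longleftrightarrow> s \<le> a"
  using assms by (auto simp: Kf_def)

text \<open>The mean value theorem gives Kt = z^m Kf for some z between min a s and s. The lower
  bound fixes the sign of the leading terms; the upper one makes the contribution of the q-equation
  small when \<open>s\<close> is small.\<close>

lemma Kt_bounds:
  assumes a: "0 \<le> a" and s: "0 < s" and m: "m > 0"
  shows "a powr m * Kf s a \<le> Kt m s a" "Kt m s a \<le> s powr m * Kf s a" "0 \<le> Kt m s a"
proof -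
  obtain z where z: "min a s \<le> z" "z \<le> s" "(s powr (m + 1) - min a s powr (m + 1)) / (m + 1) = z powr m * (s - min a s)"
    using powr_mvt[of "min a s" s m] a s m by (metis min.bounded_iff min.cobounded2 less_imp_le)
  have Kt: "Kt m s a = z powr m * Kf s a" using z(3) by (simp add: Kt_def Kf_def)
  have K0: "0 \<le> Kf s a" using Kf_bounds[OF a s] by simp
  show "0 \<le> Kt m s a" unfolding Kt using K0 by simp
  have "z powr m \<le> s powr m" using z a s m by (intro powr_mono2) auto
  then show "Kt m s a \<le> s powr m * Kf s a" unfolding Kt using K0 by (rule mult_right_mono)
  show "a powr m * Kf s a \<le> Kt m s a"
  proof (cases "a \<le> s")
    case True
    then have "a powr m \<le> z powr m" using z a m by (intro powr_mono2) auto
    then show ?thesis unfolding Kt using K0 by (rule mult_right_mono)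
  next
    case False
    then show ?thesis unfolding Kt by (simp add: Kf_def)
  qed
qed

text \<open>If dKt = a^m dKf held for finite increments, the left side would vanish. The defect is
  the difference of z^m and a^m, for an intermediate z, times the increment of the truncated
  argument, hence at most |b^m - a^m| |b - a|. After multiplication by a^(q-1) the first factor is
  at most |b^(p-1) - a^(p-1)|. The result is a product of two increments, the expression that
  \<open>pf_monotone\<close> controls.\<close>

lemma Kf_Kt_commutator:
  assumes a: "0 \<le> a" and b: "0 \<le> b" and s: "0 < s" and q: "1 < q" and pq: "q < p"
  shows "a powr (q - 1) * \<bar>a powr (p - q) * (Kf s b - Kf s a) - (Kt (p - q) s b - Kt (p - q) s a)\<bar>
    \<le> \<bar>b powr (p - 1) - a powr (p - 1)\<bar> * \<bar>b - a\<bar>"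
proof -
  define m where "m = p - q"
  have m: "m > 0" using pq by (simp add: m_def)
  have split: "x powr (q - 1) * x powr m = x powr (p - 1)" for x by (simp add: m_def powr_add[symmetric])
  define c where "c = min a s"
  define d where "d = min b s"
  have Kd: "Kf s b - Kf s a = c - d" by (simp add: Kf_def c_def d_def)
  have Ktd: "Kt m s b - Kt m s a = (c powr (m + 1) - d powr (m + 1)) / (m + 1)"
    by (simp add: Kt_def c_def d_def diff_divide_distrib[symmetric])
  have pos: "c \<ge> 0" "d \<ge> 0" using a b s by (auto simp: c_def d_def)
  \<comment> \<open>\<open>c\<close> and \<open>d\<close> are the truncated arguments. If both
    \<open>a\<close> and \<open>b\<close> are at least \<open>s\<close>, they coincide; if
    \<open>c\<close> and \<open>d\<close> differ, the smaller of them is not truncated.\<close>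
  consider "c = d" | "c < d" | "d < c" by linarith
  then show ?thesis unfolding m_def[symmetric] Kd Ktd
  proof cases
    case 1
    have "0 \<le> \<bar>b powr (p - 1) - a powr (p - 1)\<bar> * \<bar>b - a\<bar>" by (intro mult_nonneg_nonneg abs_ge_zero)
    with 1 show "a powr (q - 1) * \<bar>a powr m * (c - d) - (c powr (m + 1) - d powr (m + 1)) / (m + 1)\<bar>
       \<le> \<bar>b powr (p - 1) - a powr (p - 1)\<bar> * \<bar>b - a\<bar>" by simp
  next
    case 2
    then have ca: "c = a" "a < d" "d \<le> b" by (auto simp: c_def d_def min_def split: if_splits)
    obtain z where z: "c \<le> z" "z \<le> d" "(d powr (m + 1) - c powr (m + 1)) / (m + 1) = z powr m * (d - c)"
      using powr_mvt[of c d m] 2 pos m by auto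
    have e: "a powr m * (c - d) - (c powr (m + 1) - d powr (m + 1)) / (m + 1) = (z powr m - a powr m) * (d - c)"
      using z(3) by (simp add: field_simps minus_divide_left[symmetric] diff_divide_distrib)
    have z1: "a powr m \<le> z powr m" "z powr m \<le> b powr m"
      using z ca a m by (auto intro!: powr_mono2)
    have "a powr (q - 1) * ((z powr m - a powr m) * (d - c)) \<le> a powr (q - 1) * ((b powr m - a powr m) * (b - a))"
      using z1 ca 2 by (intro mult_left_mono mult_mono) auto
    also have "\<dots> = (a powr (q - 1) * b powr m - a powr (p - 1)) * (b - a)"
      unfolding split[symmetric] by (simp add: algebra_simps)
    also have "\<dots> \<le> (b powr (p - 1) - a powr (p - 1)) * (b - a)"
    proof (intro mult_right_mono diff_right_mono)
      have "a powr (q - 1) * b powr m \<le> b powr (q - 1) * b powr m"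
        using a ca q by (intro mult_right_mono powr_mono2) auto
      then show "a powr (q - 1) * b powr m \<le> b powr (p - 1)" unfolding split .
    qed (use ca in auto)
    also have "\<dots> \<le> \<bar>b powr (p - 1) - a powr (p - 1)\<bar> * \<bar>b - a\<bar>" by (metis abs_ge_self abs_mult)
    finally show "a powr (q - 1) * \<bar>a powr m * (c - d) - (c powr (m + 1) - d powr (m + 1)) / (m + 1)\<bar>
       \<le> \<bar>b powr (p - 1) - a powr (p - 1)\<bar> * \<bar>b - a\<bar>"
      unfolding e using z1 2 by (simp add: abs_mult)
  next
    case 3
    then have ca: "d = b" "b < c" "c \<le> a" by (auto simp: c_def d_def min_def split: if_splits)
    obtain z where z: "d \<le> z" "z \<le> c" "(c powr (m + 1) - d powr (m + 1)) / (m + 1) = z powr m * (c - d)"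
      using powr_mvt[of d c m] 3 pos m by auto
    have e: "a powr m * (c - d) - (c powr (m + 1) - d powr (m + 1)) / (m + 1) = (a powr m - z powr m) * (c - d)"
      unfolding z(3) by (simp add: algebra_simps)
    have z1: "z powr m \<le> a powr m" "b powr m \<le> z powr m"
      using z ca b pos m by (auto intro!: powr_mono2)
    have "a powr (q - 1) * ((a powr m - z powr m) * (c - d)) \<le> a powr (q - 1) * ((a powr m - b powr m) * (a - b))"
      using z1 ca 3 by (intro mult_left_mono mult_mono) auto
    also have "\<dots> = (a powr (p - 1) - a powr (q - 1) * b powr m) * (a - b)"
      unfolding split[symmetric] by (simp add: algebra_simps)
    also have "\<dots> \<le> (a powr (p - 1) - b powr (p - 1)) * (a - b)"
    proof (intro mult_right_mono diff_left_mono)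
      have "b powr (q - 1) * b powr m \<le> a powr (q - 1) * b powr m"
        using b ca q by (intro mult_right_mono powr_mono2) auto
      then show "b powr (p - 1) \<le> a powr (q - 1) * b powr m" unfolding split .
    qed (use ca in auto)
    also have "\<dots> \<le> \<bar>b powr (p - 1) - a powr (p - 1)\<bar> * \<bar>b - a\<bar>"
      by (metis abs_ge_self abs_minus_commute abs_mult)
    finally show "a powr (q - 1) * \<bar>a powr m * (c - d) - (c powr (m + 1) - d powr (m + 1)) / (m + 1)\<bar>
       \<le> \<bar>b powr (p - 1) - a powr (p - 1)\<bar> * \<bar>b - a\<bar>"
      unfolding e using z1 3 by (simp add: abs_mult)
  qed
qed

text \<open>The local situation inside the domain. One pair \<open>u\<close>, \<xi> solves both
  equations on the open set \<open>S\<close>; \<open>K0\<close> contains the points where u > t0;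
  \<open>B\<close> is a compact set around \<open>S\<close> off which \<open>u\<close> and \<xi> are
  put to 0, which makes them integrable over the whole space. The weight is bounded below by
  \<open>w0\<close> and Lipschitz on \<open>S\<close>. The signs of \<open>lam\<close> and
  \<open>mu\<close> are left open.\<close>

locale two_equations = mollifier k k' C r
  for k :: "nat \<Rightarrow> 'a::euclidean_space \<Rightarrow> real" and k' :: "nat \<Rightarrow> 'a \<Rightarrow> 'a" and C :: real and r :: "nat \<Rightarrow> real" +
  fixes S K0 B :: "'a set" and p q :: real and u w :: "'a \<Rightarrow> real" and \<xi> :: "'a \<Rightarrow> 'a"
    and w0 W L lam mu t0 :: real
  assumes S: "open S" and K0: "compact K0" "K0 \<subseteq> S" and B: "compact B" "S \<subseteq> B"
    and pq: "1 < q" "q < p"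
    and u_int: "integrable lborel u" and u01: "\<And>x. 0 \<le> u x" "\<And>x. u x \<le> 1" and uB: "\<And>x. x \<notin> B \<Longrightarrow> u x = 0"
    and \<xi>_borel: "\<xi> \<in> borel_measurable borel" and \<xi>p: "integrable lborel (\<lambda>x. norm (\<xi> x) powr p)" and \<xi>B: "\<And>x. x \<notin> B \<Longrightarrow> \<xi> x = 0"
    and wg: "weak_grad S u \<xi>" and off: "\<And>x. x \<notin> K0 \<Longrightarrow> u x \<le> t0" and t0: "0 < t0" "t0 < 1"
    and w_borel: "w \<in> borel_measurable borel" and wW: "\<And>x. \<bar>w x\<bar> \<le> W" and w0: "0 < w0" "\<And>x. x \<in> S \<Longrightarrow> w0 \<le> w x"
    and wL: "\<And>x y. x \<in> S \<Longrightarrow> y \<in> S \<Longrightarrow> \<bar>w x - w y\<bar> \<le> L * dist x y" and L: "0 \<le> L"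
    and wdp: "weak_div S (\<lambda>x. w x *\<^sub>R pf p (\<xi> x)) (\<lambda>x. lam * (w x * u x powr (p - 1)))"
    and wdq: "weak_div S (\<lambda>x. pf q (\<xi> x)) (\<lambda>x. mu * u x powr (q - 1))"
begin

lemma meas [measurable]: "u \<in> borel_measurable borel" "\<xi> \<in> borel_measurable borel" "w \<in> borel_measurable borel"
  using u_int \<xi>_borel w_borel by auto

lemma W: "W \<ge> 0" using wW[of undefined] by linarith

lemma B_borel [measurable]: "B \<in> sets borel" using B by (simp add: borel_compact)

lemma K0_borel [measurable]: "K0 \<in> sets borel" using K0 by (simp add: borel_compact)

lemma B_ind: "integrable lborel (indicator B :: 'a \<Rightarrow> real)"
  using B emeasure_bounded_finite[OF compact_imp_bounded[OF B(1)]] by (intro integrable_real_indicator) auto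

lemma xi_powr_integrable:
  assumes "0 < s" "s \<le> p"
  shows "integrable lborel (\<lambda>x. norm (\<xi> x) powr s)"
proof (rule Bochner_Integration.integrable_bound[where f="\<lambda>x. indicator B x + norm (\<xi> x) powr p"])
  show "AE x in lborel. norm (norm (\<xi> x) powr s) \<le> norm (indicator B x + norm (\<xi> x) powr p)"
  proof (rule AE_I2)
    fix x
    have "norm (\<xi> x) powr s \<le> indicator B x + norm (\<xi> x) powr p"
    proof (cases "x \<in> B")
      case True
      show ?thesis
      proof (cases "norm (\<xi> x) \<le> 1")
        case True
        then have "norm (\<xi> x) powr s \<le> 1 powr s" using assms by (intro powr_mono2) auto
        then have "norm (\<xi> x) powr s \<le> 1" by simp
        then show ?thesis using \<open>x \<in> B\<close> by (simp add: add_increasing2)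
      next
        case False
        then have "norm (\<xi> x) powr s \<le> norm (\<xi> x) powr p" using assms by (intro powr_mono) auto
        then show ?thesis by (simp add: add_increasing)
      qed
    qed (use \<xi>B in simp)
    then show "norm (norm (\<xi> x) powr s) \<le> norm (indicator B x + norm (\<xi> x) powr p)"
      by (simp add: add_nonneg_nonneg)
  qed
qed (use B_ind \<xi>p in auto)

lemma xi_integrable: "integrable lborel \<xi>"
  using integrable_norm_cancel[of lborel \<xi>] xi_powr_integrable[of 1] pq by simp

lemma u_abs: "\<bar>u x\<bar> \<le> 1" using u01[of x] by simp

definition "Fp x = w x *\<^sub>R pf p (\<xi> x)"
definition "Fq x = pf q (\<xi> x)"
definition "Rp x = lam * (w x * u x powr (p - 1))"
definition "Rq x = mu * u x powr (q - 1)"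

lemma F_borel [measurable]: "Fp \<in> borel_measurable borel" "Fq \<in> borel_measurable borel"
  "Rp \<in> borel_measurable borel" "Rq \<in> borel_measurable borel"
  unfolding Fp_def[abs_def] Fq_def[abs_def] Rp_def[abs_def] Rq_def[abs_def] by measurable

lemma norm_Fp: "norm (Fp x) \<le> W * norm (\<xi> x) powr (p - 1)"
  using norm_pf[of p "\<xi> x"] pq wW[of x] by (simp add: Fp_def mult_right_mono)

lemma norm_Fq: "norm (Fq x) = norm (\<xi> x) powr (q - 1)"
  using norm_pf[of q "\<xi> x"] pq by (simp add: Fq_def)

lemma conj_exp: "(p - 1) * (p / (p - 1)) = p" "0 < (q - 1) * (p / (p - 1))" "(q - 1) * (p / (p - 1)) \<le> p" "0 < p / (p - 1)"
  using pq by (auto simp: field_simps)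

lemma Fp_int: "integrable lborel Fp" "integrable lborel (\<lambda>x. norm (Fp x) powr (p / (p - 1)))"
proof -
  show "integrable lborel Fp"
  proof (rule Bochner_Integration.integrable_bound[where f="\<lambda>x. W * norm (\<xi> x) powr (p - 1)"])
    show "AE x in lborel. norm (Fp x) \<le> norm (W * norm (\<xi> x) powr (p - 1))"
      using norm_Fp W by (intro AE_I2) (simp add: abs_mult)
  qed (use xi_powr_integrable[of "p-1"] pq in auto)
  show "integrable lborel (\<lambda>x. norm (Fp x) powr (p / (p - 1)))"
  proof (rule Bochner_Integration.integrable_bound[where f="\<lambda>x. W powr (p / (p - 1)) * norm (\<xi> x) powr p"])
    show "AE x in lborel. norm (norm (Fp x) powr (p / (p - 1))) \<le> norm (W powr (p / (p - 1)) * norm (\<xi> x) powr p)"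
    proof (rule AE_I2)
      fix x
      have "norm (Fp x) powr (p / (p - 1)) \<le> (W * norm (\<xi> x) powr (p - 1)) powr (p / (p - 1))"
        using norm_Fp conj_exp by (intro powr_mono2) auto
      also have "\<dots> = W powr (p / (p - 1)) * norm (\<xi> x) powr p"
        using conj_exp(1) by (simp add: powr_mult powr_powr)
      finally show "norm (norm (Fp x) powr (p / (p - 1))) \<le> norm (W powr (p / (p - 1)) * norm (\<xi> x) powr p)" by simp
    qed
  qed (use \<xi>p in auto)
qed

text \<open>As (q - 1) p / (p - 1) \<le> p, the flux of the q-equation lies in the same conjugate
  space as that of the p-equation, so both equations admit the same kind of test.\<close>

lemma Fq_int: "integrable lborel Fq" "integrable lborel (\<lambda>x. norm (Fq x) powr (p / (p - 1)))"
proof -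
  have "integrable lborel (\<lambda>x. norm (Fq x))"
    unfolding norm_Fq using pq by (intro xi_powr_integrable) auto
  then show "integrable lborel Fq" by (rule integrable_norm_cancel) measurable
  show "integrable lborel (\<lambda>x. norm (Fq x) powr (p / (p - 1)))"
    unfolding norm_Fq powr_powr using conj_exp by (intro xi_powr_integrable) auto
qed

lemma bounded_B_integrable:
  fixes f :: "'a \<Rightarrow> real"
  assumes [measurable]: "f \<in> borel_measurable borel" and M: "\<And>x. \<bar>f x\<bar> \<le> M" "\<And>x. x \<notin> B \<Longrightarrow> f x = 0"
  shows "integrable lborel f"
proof (rule Bochner_Integration.integrable_bound[where f="\<lambda>x. M * indicator B x"])
  show "AE x in lborel. norm (f x) \<le> norm (M * indicator B x)"
  proof (rule AE_I2)
    fix x show "norm (f x) \<le> norm (M * indicator B x)"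
      using M(1)[of x] M(2)[of x] by (cases "x \<in> B") auto
  qed
qed (use B_ind in auto)

lemma u_powr: "0 \<le> u x powr s" "u x powr s \<le> 1" if "s > 0" for s
  using u01[of x] that powr_mono2[of s "u x" 1] by auto

lemma Rp_bound: "\<bar>Rp x\<bar> \<le> \<bar>lam\<bar> * W" and Rq_bound: "\<bar>Rq x\<bar> \<le> \<bar>mu\<bar>"
proof -
  have "\<bar>w x\<bar> * u x powr (p - 1) \<le> W * 1" using wW[of x] u_powr[of "p - 1" x] pq W by (intro mult_mono) auto
  then show "\<bar>Rp x\<bar> \<le> \<bar>lam\<bar> * W" unfolding Rp_def abs_mult by (intro mult_left_mono) auto
  have "u x powr (q - 1) \<le> 1" using u_powr[of "q - 1" x] pq by auto
  then have "\<bar>mu\<bar> * u x powr (q - 1) \<le> \<bar>mu\<bar> * 1" by (intro mult_left_mono) auto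
  then show "\<bar>Rq x\<bar> \<le> \<bar>mu\<bar>" unfolding Rq_def abs_mult by simp
qed

lemma R_int: "integrable lborel Rp" "integrable lborel Rq" "integrable lborel (\<lambda>x. norm (Rp x) powr (p / (p - 1)))"
proof -
  show "integrable lborel Rp" by (rule bounded_B_integrable[OF _ Rp_bound]) (auto simp: Rp_def uB)
  show "integrable lborel Rq" by (rule bounded_B_integrable[OF _ Rq_bound]) (auto simp: Rq_def uB)
  show "integrable lborel (\<lambda>x. norm (Rp x) powr (p / (p - 1)))"
  proof (rule bounded_B_integrable)
    show "\<bar>norm (Rp x) powr (p / (p - 1))\<bar> \<le> (\<bar>lam\<bar> * W) powr (p / (p - 1))" for x
      using Rp_bound[of x] conj_exp(4) by (simp add: powr_mono2)
  qed (auto simp: Rp_def uB)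
qed

lemma tc_F: "tcont (\<lambda>x. norm (Fp x)) \<xi>" "tcont (\<lambda>x. norm (Fq x)) \<xi>"
  by (rule tcont_Lp[OF \<xi>p]; use pq Fp_int Fq_int in simp)+

lemma pair_F: "integrable lborel (\<lambda>x. norm (Fp x) * norm (\<xi> x))" "integrable lborel (\<lambda>x. norm (Fq x) * norm (\<xi> x))"
  by (rule Lp_pair_integrable[OF \<xi>p]; use pq Fp_int Fq_int in simp)+

lemma test_p:
  assumes t: "t0 \<le> t" and \<kappa>: "C1 \<kappa> \<kappa>'"
  shows "(\<integral>x. Fp x \<bullet> ((\<kappa> x * bp' (u x - t)) *\<^sub>R \<xi> x + bp (u x - t) *\<^sub>R \<kappa>' x) \<partial>lborel)
    = (\<integral>x. Rp x * (\<kappa> x * bp (u x - t)) \<partial>lborel)"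
  using off order_trans[OF off t] wdp unfolding Fp_def[abs_def, symmetric] Rp_def[abs_def, symmetric]
  by (intro test_bp[OF S K0 u_int u_abs xi_integrable wg _ \<kappa> _ Fp_int(1) R_int(1) tc_F(1) pair_F(1)]) auto

lemma test_q:
  assumes t: "t0 \<le> t" and \<kappa>: "C1 \<kappa> \<kappa>'"
  shows "(\<integral>x. Fq x \<bullet> ((\<kappa> x * bp' (u x - t)) *\<^sub>R \<xi> x + bp (u x - t) *\<^sub>R \<kappa>' x) \<partial>lborel)
    = (\<integral>x. Rq x * (\<kappa> x * bp (u x - t)) \<partial>lborel)"
  using off order_trans[OF off t] wdq unfolding Fq_def[abs_def, symmetric] Rq_def[abs_def, symmetric]
  by (intro test_bp[OF S K0 u_int u_abs xi_integrable wg _ \<kappa> _ Fq_int(1) R_int(2) tc_F(2) pair_F(2)]) auto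

text \<open>The monotonicity pairing for a shift by \<open>h\<close>, with the flux taken without
  the weight. Its integral over \<open>K0\<close> controls the commutator.\<close>

definition "DD h x = (pf p (\<xi> (x + h)) - pf p (\<xi> x)) \<bullet> (\<xi> (x + h) - \<xi> x)"

lemma DD_nonneg: "0 \<le> DD h x"
  unfolding DD_def using pq by (intro pf_monotone0) simp

text \<open>\<open>shift_estimate\<close> speaks of the weighted flux. With Y = pf p \<xi>, the
  increment of that flux is w times the increment of Y plus the increment of w times the translate
  of Y. The last part, paired with the increment of \<xi>, is at most L |h| |Y(x + h)| |\<xi>(x + h)
  - \<xi>(x)|, and the integral of the product of norms tends to 0 with h. So removing the weight
  costs only o(|h|).\<close>

lemma DD_small:
  assumes e: "e > 0"
  obtains d where "d > 0" "\<And>h. norm h \<le> d \<Longrightarrow> (\<integral>\<^sup>+x. indicator K0 x * DD h x \<partial>lborel) \<le> ennreal (e * norm h)"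
proof -
  obtain \<eta> \<eta>' where \<eta>: "C1c S \<eta> \<eta>'" "\<And>x. x \<in> K0 \<Longrightarrow> \<eta> x = 1" "\<And>x. x \<in> K0 \<Longrightarrow> \<eta>' x = 0"
    by (rule cutoff[OF K0(1) S K0(2)]) blast
  \<comment> \<open>The square of the cut-off: the cut-off itself may take negative values, whereas
    \<open>DD\<close> is to be multiplied by a nonnegative factor.\<close>
  define \<zeta> where "\<zeta> x = \<eta> x * \<eta> x" for x
  define \<zeta>' where "\<zeta>' x = \<eta> x *\<^sub>R \<eta>' x + \<eta> x *\<^sub>R \<eta>' x" for x
  have \<zeta>: "C1c S \<zeta> \<zeta>'" unfolding \<zeta>_def[abs_def] \<zeta>'_def[abs_def] by (rule C1c_mult[OF \<eta>(1) C1c_C1[OF \<eta>(1)]])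
  have \<zeta>0: "0 \<le> \<zeta> x" "x \<in> K0 \<Longrightarrow> \<zeta> x = 1" for x using \<eta>(2) by (auto simp: \<zeta>_def)
  have [measurable]: "\<zeta> \<in> borel_measurable borel" using C1_borel[OF C1c_C1[OF \<zeta>]] by auto
  obtain Q where Q: "compact Q" "Q \<subseteq> S" "\<And>x. x \<notin> Q \<Longrightarrow> \<zeta> x = 0" using \<zeta> by (auto elim: C1c_obtain)
  obtain d0 where d0: "d0 > 0" "\<And>x. x \<in> Q \<Longrightarrow> cball x d0 \<subseteq> S" using compact_open_margin[OF Q(1) S Q(2)] by auto
  obtain M where M: "M \<ge> 0" "\<And>x. norm (\<zeta> x) \<le> M" using compact_support_bounded[OF C1_D(3)[OF C1c_C1[OF \<zeta>]] Q(1,3)] by auto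
  have wd: "weak_div S Fp Rp" using wdp unfolding Fp_def[abs_def] Rp_def[abs_def] .
  have p1: "p > 1" using pq by simp
  have ew: "e * w0 / 2 > 0" using e w0 by simp
  obtain d1 where d1: "d1 > 0" "\<And>h. norm h \<le> d1 \<Longrightarrow>
    \<bar>\<integral>x. \<zeta> x * ((Fp (x + h) - Fp x) \<bullet> (\<xi> (x + h) - \<xi> x)) \<partial>lborel\<bar> \<le> (e * w0 / 2) * norm h"
    by (rule shift_estimate[OF S \<zeta> p1 u_int u_abs B(1) uB xi_integrable \<xi>p wg wd Fp_int R_int(1,3) ew]) (assumption, rule that)
  define Y where "Y x = pf p (\<xi> x)" for x
  have [measurable]: "Y \<in> borel_measurable borel" unfolding Y_def[abs_def] by measurable
  have Yp: "integrable lborel (\<lambda>x. norm (Y x) powr (p / (p - 1)))"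
    unfolding Y_def norm_pf[OF p1] powr_powr conj_exp(1) by (rule \<xi>p)
  have tY: "tcont (\<lambda>x. norm (Y x)) \<xi>" by (rule tcont_Lp[OF \<xi>p p1]) (use Yp in auto)
  define e2 where "e2 = e * w0 / (2 * (M * L + 1))"
  have e2: "e2 > 0" using e w0 M L by (simp add: e2_def add_nonneg_pos)
  have mlb: "M * L * e2 \<le> e * w0 / 2"
  proof -
    have "0 \<le> M * L" using M L by simp
    then have "M * L / (M * L + 1) \<le> 1" by simp
    then have "(e * w0 / 2) * (M * L / (M * L + 1)) \<le> (e * w0 / 2) * 1" using e w0 by (intro mult_left_mono) auto
    moreover have "M * L * e2 = (e * w0 / 2) * (M * L / (M * L + 1))" by (simp add: e2_def)
    ultimately show ?thesis by simp
  qed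
  obtain d2 where d2: "d2 > 0" "\<And>h. norm h \<le> d2 \<Longrightarrow> (\<integral>\<^sup>+x. \<bar>norm (Y x)\<bar> * norm (\<xi> (x + h) - \<xi> x) \<partial>lborel) \<le> ennreal e2"
    using tY e2 unfolding tcont_def by blast
  show ?thesis
  proof (rule that[of "min d0 (min d1 d2)"])
    fix h :: 'a assume h: "norm h \<le> min d0 (min d1 d2)"
    define P where "P x = \<zeta> x * ((Fp (x + h) - Fp x) \<bullet> (\<xi> (x + h) - \<xi> x))" for x
    define T where "T x = norm (Y (x + h)) * norm (\<xi> (x + h) - \<xi> x)" for x
    have [measurable]: "P \<in> borel_measurable borel" "T \<in> borel_measurable borel" "DD h \<in> borel_measurable borel"
      unfolding P_def[abs_def] T_def[abs_def] DD_def[abs_def] by measurable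
    have Tb: "(\<integral>\<^sup>+x. T x \<partial>lborel) \<le> ennreal e2"
    proof -
      \<comment> \<open>After a translation by \<open>h\<close> the factor |Y| stands at the
        unshifted point and \<xi> is shifted by -h, which is the form of
        \<open>tcont\<close>.\<close>
      have "(\<integral>\<^sup>+x. T x \<partial>lborel) = (\<integral>\<^sup>+x. \<bar>norm (Y x)\<bar> * norm (\<xi> (x + (- h)) - \<xi> x) \<partial>lborel)"
        using nn_integral_lborel_shift[of "\<lambda>x. ennreal (norm (Y x) * norm (\<xi> x - \<xi> (x - h)))" h]
        by (simp add: T_def norm_minus_commute)
      also have "\<dots> \<le> ennreal e2" using d2(2)[of "-h"] h by simp
      finally show ?thesis .
    qed
    have iT: "integrable lborel T"
      unfolding integrable_iff_bounded using Tb by (auto simp: T_def less_top intro: le_less_trans)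
    have iP: "integrable lborel P"
    proof (rule Bochner_Integration.integrable_bound[where f="\<lambda>x. M * (norm (Fp (x + h) - Fp x) * norm (\<xi> (x + h) - \<xi> x))"])
      have a: "integrable lborel (\<lambda>x. norm (\<xi> (x + h) - \<xi> x) powr p)"
        using \<xi>p integrable_lborel_shift(1)[OF \<xi>p, of h] p1 by (intro Lp_diff_integrable) auto
      have b: "integrable lborel (\<lambda>x. norm (Fp (x + h) - Fp x) powr (p / (p - 1)))"
        using Fp_int(2) integrable_lborel_shift(1)[OF Fp_int(2), of h] conj_exp(4) by (intro Lp_diff_integrable) auto
      show "integrable lborel (\<lambda>x. M * (norm (Fp (x + h) - Fp x) * norm (\<xi> (x + h) - \<xi> x)))"
        by (intro integrable_mult_right Lp_pair_integrable[OF a b p1]) measurable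
      show "AE x in lborel. norm (P x) \<le> norm (M * (norm (Fp (x + h) - Fp x) * norm (\<xi> (x + h) - \<xi> x)))"
      proof (rule AE_I2)
        fix x
        have "norm (P x) \<le> M * (norm (Fp (x + h) - Fp x) * norm (\<xi> (x + h) - \<xi> x))"
          unfolding P_def norm_mult using M(1) M(2)[of x]
          by (intro mult_mono) (auto intro: Cauchy_Schwarz_ineq2)
        then show "norm (P x) \<le> norm (M * (norm (Fp (x + h) - Fp x) * norm (\<xi> (x + h) - \<xi> x)))" using M(1) by simp
      qed
    qed measurable
    have pt: "indicator K0 x * (w0 * DD h x) \<le> P x + (M * L * norm h) * T x" for x
    proof (cases "x \<in> Q")
      case False
      then have "x \<notin> K0" using \<zeta>0(2)[of x] Q(3)[of x] by auto
      then show ?thesis using False Q(3)[of x] M L by (simp add: P_def T_def)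
    next
      case True
      have xS: "x \<in> S" "x + h \<in> S" using True Q(2) d0(2)[OF True] h by (auto simp: dist_norm)
      have dw: "\<bar>w (x + h) - w x\<bar> \<le> L * norm h" using wL[OF xS(2,1)] by (simp add: dist_norm)
      have "indicator K0 x * (w0 * DD h x) \<le> \<zeta> x * (w0 * DD h x)"
        using \<zeta>0[of x] DD_nonneg[of h x] w0 by (auto simp: indicator_def)
      also have "\<dots> \<le> \<zeta> x * (w x * DD h x)"
        using \<zeta>0[of x] DD_nonneg[of h x] w0(2)[OF xS(1)] by (intro mult_left_mono mult_right_mono) auto
      also have "\<dots> = P x - \<zeta> x * ((w (x + h) - w x) * (Y (x + h) \<bullet> (\<xi> (x + h) - \<xi> x)))"
        by (simp add: P_def DD_def Fp_def Y_def algebra_simps inner_simps)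
      also have "\<dots> \<le> P x + M * ((L * norm h) * T x)"
      proof -
        have "\<bar>\<zeta> x * ((w (x + h) - w x) * (Y (x + h) \<bullet> (\<xi> (x + h) - \<xi> x)))\<bar> \<le> M * ((L * norm h) * T x)"
          unfolding abs_mult T_def using M(1) M(2)[of x] dw L
          by (intro mult_mono) (auto intro: Cauchy_Schwarz_ineq2)
        then show ?thesis by linarith
      qed
      finally show ?thesis by (simp add: mult_ac)
    qed
    have iPT: "integrable lborel (\<lambda>x. P x + (M * L * norm h) * T x)" using iP iT by auto
    have "(\<integral>\<^sup>+x. ennreal (w0) * ennreal (indicator K0 x * DD h x) \<partial>lborel) \<le> (\<integral>\<^sup>+x. ennreal (P x + (M * L * norm h) * T x) \<partial>lborel)"
    proof (rule nn_integral_mono)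
      fix x
      have "ennreal w0 * ennreal (indicator K0 x * DD h x) = ennreal (indicator K0 x * (w0 * DD h x))"
        using w0 DD_nonneg[of h x] by (simp add: ennreal_mult'[symmetric] mult_ac)
      also have "\<dots> \<le> ennreal (P x + (M * L * norm h) * T x)" by (rule ennreal_leI[OF pt])
      finally show "ennreal w0 * ennreal (indicator K0 x * DD h x) \<le> ennreal (P x + (M * L * norm h) * T x)" .
    qed
    also have "\<dots> = ennreal (\<integral>x. P x + (M * L * norm h) * T x \<partial>lborel)"
    proof (rule nn_integral_eq_integral[OF iPT])
      show "AE x in lborel. 0 \<le> P x + M * L * norm h * T x"
      proof (rule AE_I2)
        fix x
        have "0 \<le> indicator K0 x * (w0 * DD h x)" using w0 DD_nonneg[of h x] by (simp add: indicator_def)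
        with pt[of x] show "0 \<le> P x + M * L * norm h * T x" by linarith
      qed
    qed
    also have "\<dots> \<le> ennreal (w0 * (e * norm h))"
    proof (rule ennreal_leI)
      have "(\<integral>x. T x \<partial>lborel) \<le> e2"
      proof -
        have "ennreal (\<integral>x. T x \<partial>lborel) = (\<integral>\<^sup>+x. T x \<partial>lborel)"
          by (rule nn_integral_eq_integral[OF iT, symmetric]) (simp add: T_def)
        then have "ennreal (\<integral>x. T x \<partial>lborel) \<le> ennreal e2" using Tb by (simp only:)
        then show ?thesis using e2 by (subst (asm) ennreal_le_iff) auto
      qed
      then have "(M * L * norm h) * (\<integral>x. T x \<partial>lborel) \<le> (M * L * norm h) * e2" using M L by (intro mult_left_mono) auto
      also have "\<dots> = norm h * (M * L * e2)" by (simp add: mult_ac)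
      also have "\<dots> \<le> norm h * (e * w0 / 2)" using mlb by (intro mult_left_mono) auto
      finally have 1: "(M * L * norm h) * (\<integral>x. T x \<partial>lborel) \<le> norm h * (e * w0 / 2)" .
      have 2: "(\<integral>x. P x \<partial>lborel) \<le> norm h * (e * w0 / 2)" using d1(2)[of h] h unfolding P_def by (simp add: mult.commute)
      have "(\<integral>x. P x + (M * L * norm h) * T x \<partial>lborel) = (\<integral>x. P x \<partial>lborel) + (M * L * norm h) * (\<integral>x. T x \<partial>lborel)"
        using iP iT by simp
      then show "(\<integral>x. P x + (M * L * norm h) * T x \<partial>lborel) \<le> w0 * (e * norm h)" using 1 2 by (simp add: mult_ac)
    qed
    finally have "ennreal w0 * (\<integral>\<^sup>+x. indicator K0 x * DD h x \<partial>lborel) \<le> ennreal w0 * ennreal (e * norm h)"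
      using w0 e by (subst (asm) nn_integral_cmult) (auto simp: ennreal_mult)
    then show "(\<integral>\<^sup>+x. indicator K0 x * DD h x \<partial>lborel) \<le> ennreal (e * norm h)"
      using w0 by (simp add: ennreal_mult_le_mult_iff)
  qed (use d0 d1 d2 in auto)
qed

end

lemma C1_const: "C1 (\<lambda>_. c) (\<lambda>_. 0)"
  unfolding C1_def by (auto intro: GDERIV_const)

lemma C1_inner: "C1 (\<lambda>x. x \<bullet> b) (\<lambda>_. b)"
  unfolding C1_def gderiv_def by (auto intro!: derivative_eq_intros)

text \<open>The identity field has divergence \<open>DIM('a)\<close>; the coordinates are integrated
  by parts one by one. It serves to show that a function whose gradient vanishes above a level
  cannot exceed that level.\<close>

lemma weak_div_identity:
  fixes \<phi> :: "'a::euclidean_space \<Rightarrow> real"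
  assumes \<phi>: "C1c S \<phi> G"
  shows "(\<integral>x. x \<bullet> G x \<partial>lborel) = - real DIM('a) * (\<integral>x. \<phi> x \<partial>lborel)"
proof -
  obtain K where K: "compact K" "\<And>x. x \<notin> K \<Longrightarrow> \<phi> x = 0" "\<And>x. x \<notin> K \<Longrightarrow> G x = 0" using \<phi> by (auto elim: C1c_obtain)
  note i1 = C1c_integrable[OF \<phi>]
  have i2: "integrable lborel (\<lambda>x. (x \<bullet> b) * (G x \<bullet> b))" for b
    by (rule compact_support_integrable[OF _ K(1)])
      (use C1_D(2)[OF C1c_C1[OF \<phi>]] K(3) in \<open>auto intro!: continuous_intros\<close>)
  have i3: "integrable lborel (\<lambda>x. (x \<bullet> b) *\<^sub>R G x)" for b
    by (rule compact_support_integrable[OF _ K(1)])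
      (use C1_D(2)[OF C1c_C1[OF \<phi>]] K(3) in \<open>auto intro!: continuous_intros\<close>)
  have b: "(\<integral>x. (x \<bullet> b) * (G x \<bullet> b) \<partial>lborel) = - (\<integral>x. \<phi> x \<partial>lborel)" if "b \<in> Basis" for b
  proof -
    have "(\<integral>x. \<phi> x *\<^sub>R b + (x \<bullet> b) *\<^sub>R G x \<partial>lborel) = 0"
      by (rule C1c_integral_grad[OF C1c_mult[OF \<phi> C1_inner]])
    then have "(\<integral>x. \<phi> x *\<^sub>R b + (x \<bullet> b) *\<^sub>R G x \<partial>lborel) \<bullet> b = 0" by simp
    moreover have "integrable lborel (\<lambda>x. \<phi> x *\<^sub>R b + (x \<bullet> b) *\<^sub>R G x)" using i1 i3 by simp
    ultimately have "(\<integral>x. (\<phi> x *\<^sub>R b + (x \<bullet> b) *\<^sub>R G x) \<bullet> b \<partial>lborel) = 0" by simp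
    moreover have "(\<phi> x *\<^sub>R b + (x \<bullet> b) *\<^sub>R G x) \<bullet> b = \<phi> x + (x \<bullet> b) * (G x \<bullet> b)" for x
      using that by (simp add: inner_add_left)
    ultimately show ?thesis using i1 i2[of b] by simp
  qed
  have "(\<integral>x. x \<bullet> G x \<partial>lborel) = (\<integral>x. (\<Sum>b\<in>Basis. (x \<bullet> b) * (G x \<bullet> b)) \<partial>lborel)"
    by (intro Bochner_Integration.integral_cong refl) (rule euclidean_inner)
  also have "\<dots> = (\<Sum>b\<in>(Basis :: 'a set). - (\<integral>x. \<phi> x \<partial>lborel))"
    using i2 b by (subst Bochner_Integration.integral_sum) auto
  finally show ?thesis by simp
qed

context mollifier
begin

lemma conv_grad_bounded:
  fixes f :: "'a \<Rightarrow> real"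
  assumes f: "integrable lborel f" "\<And>x. \<bar>f x\<bar> \<le> M"
  shows "norm (conv f (k' n) x) \<le> M * (C / r n)"
proof -
  have M: "M \<ge> 0" using f(2)[of undefined] by linarith
  obtain M' where "\<And>x. norm (k' n x) \<le> M'" using k_bounded(2) by blast
  then have i: "integrable lborel (\<lambda>y. f y *\<^sub>R k' n (x - y))" by (rule conv_integrable[OF f(1) k_continuous(2)])
  have i2: "integrable lborel (\<lambda>y. norm (k' n y))" using k_integrable by (intro integrable_norm)
  have "norm (conv f (k' n) x) \<le> (\<integral>y. norm (f y *\<^sub>R k' n (x - y)) \<partial>lborel)"
    unfolding conv_def by (rule integral_norm_bound)
  also have "\<dots> \<le> (\<integral>y. M * norm (k' n (x - y)) \<partial>lborel)"
    using i f(2) integrable_lborel_shift(2)[OF i2, of x]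
    by (intro integral_mono integrable_norm) (auto intro!: mult_right_mono)
  also have "\<dots> = M * (\<integral>y. norm (k' n y) \<partial>lborel)"
    using integral_lborel_shift(2)[OF i2, of x] by simp
  also have "\<dots> \<le> M * (C / r n)" using k_grad M by (intro mult_left_mono) auto
  finally show ?thesis .
qed

end

section \<open>The commutator of the two tested equations and its consequences\<close>

context two_equations
begin

text \<open>Off \<open>B\<close> the field \<xi> is 0 and the truncation alone would equal
  \<open>s\<close>; the indicator makes it integrable. \<open>\<kappa>0\<close> multiplies the test
  of the p-equation, and \<open>\<kappa>t\<close>, which carries the weight, that of the
  q-equation.\<close>

definition "\<kappa>0 s x = indicator B x * Kf s (norm (\<xi> x))"
definition "\<kappa>1 s x = indicator B x * Kt (p - q) s (norm (\<xi> x))"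
definition "\<kappa>t s x = w x * \<kappa>1 s x"

lemma \<kappa>_borel [measurable]: "\<kappa>0 s \<in> borel_measurable borel" "\<kappa>1 s \<in> borel_measurable borel" "\<kappa>t s \<in> borel_measurable borel"
  unfolding \<kappa>0_def[abs_def] \<kappa>1_def[abs_def] \<kappa>t_def[abs_def] by measurable

lemma \<kappa>_bounds:
  assumes s: "s > 0"
  shows "0 \<le> \<kappa>0 s x" "\<kappa>0 s x \<le> s" "0 \<le> \<kappa>1 s x" "\<kappa>1 s x \<le> s powr (p - q) * \<kappa>0 s x"
    "norm (\<xi> x) powr (p - q) * \<kappa>0 s x \<le> \<kappa>1 s x" "\<kappa>1 s x \<le> s powr (p - q) * s" "\<bar>\<kappa>t s x\<bar> \<le> W * (s powr (p - q) * s)"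
proof -
  note a = Kf_bounds[OF norm_ge_zero[of "\<xi> x"] s] and b = Kt_bounds[OF norm_ge_zero[of "\<xi> x"] s, of "p - q"]
  have m: "p - q > 0" using pq by simp
  show 1: "0 \<le> \<kappa>0 s x" "\<kappa>0 s x \<le> s" using a s by (auto simp: \<kappa>0_def indicator_def)
  show 2: "0 \<le> \<kappa>1 s x" using b(3)[OF m] by (simp add: \<kappa>1_def indicator_def)
  show 3: "\<kappa>1 s x \<le> s powr (p - q) * \<kappa>0 s x" using b(2)[OF m] by (simp add: \<kappa>0_def \<kappa>1_def indicator_def)
  show "norm (\<xi> x) powr (p - q) * \<kappa>0 s x \<le> \<kappa>1 s x" using b(1)[OF m] by (simp add: \<kappa>0_def \<kappa>1_def indicator_def)
  have "s powr (p - q) * \<kappa>0 s x \<le> s powr (p - q) * s" using 1 by (intro mult_left_mono) auto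
  with 3 show 4: "\<kappa>1 s x \<le> s powr (p - q) * s" by linarith
  show "\<bar>\<kappa>t s x\<bar> \<le> W * (s powr (p - q) * s)" unfolding \<kappa>t_def abs_mult using 2 4 wW[of x] W by (intro mult_mono) auto
qed

lemma \<kappa>_int:
  assumes s: "s > 0"
  shows "integrable lborel (\<kappa>0 s)" "integrable lborel (\<kappa>1 s)" "integrable lborel (\<kappa>t s)"
proof -
  show "integrable lborel (\<kappa>0 s)"
    by (rule bounded_B_integrable[where M=s]) (use \<kappa>_bounds[OF s] in \<open>auto simp: \<kappa>0_def\<close>)
  show "integrable lborel (\<kappa>1 s)"
    by (rule bounded_B_integrable[where M="s powr (p - q) * s"]) (use \<kappa>_bounds[OF s] in \<open>auto simp: \<kappa>1_def\<close>)
  show "integrable lborel (\<kappa>t s)"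
    by (rule bounded_B_integrable[where M="W * (s powr (p - q) * s)"]) (use \<kappa>_bounds[OF s] in \<open>auto simp: \<kappa>t_def \<kappa>1_def\<close>)
qed

text \<open>The gradient of the kernel has integral 0, so both truncations may be replaced by their
  increments from \<open>x\<close>. Since the p-flux is w |\<xi>|^(p-q) times the q-flux, what
  remains is the commutator defect \<open>Q1\<close>, dominated by \<open>DD\<close>, plus a term
  with the increment of the weight, which is at most L r on the support of the kernel.\<close>

lemma comm_pt:
  assumes s: "s > 0" and x: "x \<in> K0" "cball x (r n) \<subseteq> S"
  shows "ennreal \<bar>Fp x \<bullet> conv (\<kappa>0 s) (k' n) x - Fq x \<bullet> conv (\<kappa>t s) (k' n) x\<bar>
    \<le> (\<integral>\<^sup>+y. norm (k' n y) * (W * DD (- y) x + (L * r n) * (norm (Fq x) * \<kappa>1 s (x - y))) \<partial>lborel)"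
proof -
  obtain M' where M': "\<And>x. norm (k' n x) \<le> M'" using k_bounded(2) by blast
  have i: "integrable lborel (\<lambda>y. f (x - y) *\<^sub>R k' n y)" "conv f (k' n) x = (\<integral>y. (f (x - y) - f x) *\<^sub>R k' n y \<partial>lborel)"
    if f: "integrable lborel f" for f :: "'a \<Rightarrow> real"
  proof -
    have a: "integrable lborel (\<lambda>y. f y *\<^sub>R k' n (x - y))" by (rule conv_integrable[OF f k_continuous(2) M'])
    from integrable_lborel_shift(2)[OF this, of x] show b: "integrable lborel (\<lambda>y. f (x - y) *\<^sub>R k' n y)" by simp
    have "(\<integral>y. (f (x - y) - f x) *\<^sub>R k' n y \<partial>lborel) = (\<integral>y. f (x - y) *\<^sub>R k' n y - f x *\<^sub>R k' n y \<partial>lborel)"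
      by (simp add: scaleR_diff_left)
    also have "\<dots> = (\<integral>y. f (x - y) *\<^sub>R k' n y \<partial>lborel)"
      using b k_integrable(2)[of n] C1c_integral_grad[OF kC1c] by simp
    also have "\<dots> = conv f (k' n) x" by (rule conv_commute[OF a, symmetric])
    finally show "conv f (k' n) x = (\<integral>y. (f (x - y) - f x) *\<^sub>R k' n y \<partial>lborel)" by simp
  qed
  have j: "integrable lborel (\<lambda>y. (f (x - y) - f x) *\<^sub>R k' n y)" if f: "integrable lborel f" for f :: "'a \<Rightarrow> real"
    using i(1)[OF f] k_integrable(2)[of n] by (simp add: scaleR_diff_left)
  define g where "g y = Fp x \<bullet> ((\<kappa>0 s (x - y) - \<kappa>0 s x) *\<^sub>R k' n y) - Fq x \<bullet> ((\<kappa>t s (x - y) - \<kappa>t s x) *\<^sub>R k' n y)" for y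
  have ig: "integrable lborel g" unfolding g_def[abs_def]
    using j[OF \<kappa>_int(1)[OF s]] j[OF \<kappa>_int(3)[OF s]]
    by (intro Bochner_Integration.integrable_diff integrable_inner_right) auto
  have "Fp x \<bullet> conv (\<kappa>0 s) (k' n) x - Fq x \<bullet> conv (\<kappa>t s) (k' n) x = (\<integral>y. g y \<partial>lborel)"
    unfolding g_def[abs_def] i(2)[OF \<kappa>_int(1)[OF s]] i(2)[OF \<kappa>_int(3)[OF s]]
    using j[OF \<kappa>_int(1)[OF s]] j[OF \<kappa>_int(3)[OF s]] by (simp del: inner_scaleR_right)
  then have "ennreal \<bar>Fp x \<bullet> conv (\<kappa>0 s) (k' n) x - Fq x \<bullet> conv (\<kappa>t s) (k' n) x\<bar> \<le> (\<integral>\<^sup>+y. norm (g y) \<partial>lborel)"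
    using integral_norm_bound_ennreal[OF ig] by simp
  also have "\<dots> \<le> (\<integral>\<^sup>+y. norm (k' n y) * (W * DD (- y) x + (L * r n) * (norm (Fq x) * \<kappa>1 s (x - y))) \<partial>lborel)"
  proof (intro nn_integral_mono ennreal_leI)
    fix y
    show "norm (g y) \<le> norm (k' n y) * (W * DD (- y) x + (L * r n) * (norm (Fq x) * \<kappa>1 s (x - y)))"
    proof (cases "norm y \<le> r n")
      case False
      then show ?thesis using k'_supp[of n y] by (simp add: g_def)
    next
      case True
      define a where "a = norm (\<xi> x)"
      define b where "b = norm (\<xi> (x - y))"
      have xS: "x \<in> S" "x - y \<in> S" using x K0(2) True by (auto simp: dist_norm subset_iff)
      then have xB: "x \<in> B" "x - y \<in> B" using B by auto
      define Q1 where "Q1 = a powr (p - q) * (Kf s b - Kf s a) - (Kt (p - q) s b - Kt (p - q) s a)"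
      have Fpq: "Fp x = (w x * a powr (p - q)) *\<^sub>R Fq x"
        using pf_split[of p q "\<xi> x"] pq by (simp add: Fp_def Fq_def a_def)
      \<comment> \<open>The product w \<kappa>1 at x - y is compared with w(x) times \<kappa>1 at x
        - y, which isolates the increment of the weight.\<close>
      have "g y = (Fq x \<bullet> k' n y) * (w x * Q1 - (w (x - y) - w x) * Kt (p - q) s b)"
        unfolding g_def Fpq using xB by (simp add: \<kappa>0_def \<kappa>t_def \<kappa>1_def a_def[symmetric] b_def[symmetric] Q1_def algebra_simps)
      then have "norm (g y) = \<bar>Fq x \<bullet> k' n y\<bar> * \<bar>w x * Q1 - (w (x - y) - w x) * Kt (p - q) s b\<bar>"
        by (simp add: abs_mult)
      also have "\<dots> \<le> (norm (Fq x) * norm (k' n y)) * (W * \<bar>Q1\<bar> + (L * r n) * Kt (p - q) s b)"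
      proof (intro mult_mono)
        show "\<bar>Fq x \<bullet> k' n y\<bar> \<le> norm (Fq x) * norm (k' n y)" by (rule Cauchy_Schwarz_ineq2)
        have Kt0: "0 \<le> Kt (p - q) s b" using Kt_bounds(3)[of b s "p - q"] s pq by (simp add: b_def)
        have "\<bar>w x * Q1\<bar> \<le> W * \<bar>Q1\<bar>" unfolding abs_mult using wW[of x] by (intro mult_right_mono) auto
        moreover have "\<bar>(w (x - y) - w x) * Kt (p - q) s b\<bar> \<le> (L * r n) * Kt (p - q) s b"
        proof -
          have "\<bar>w (x - y) - w x\<bar> \<le> L * norm y" using wL[OF xS(2,1)] by (simp add: dist_norm)
          also have "\<dots> \<le> L * r n" using True L by (intro mult_left_mono) auto
          finally show ?thesis unfolding abs_mult using Kt0 by (simp add: mult_right_mono)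
        qed
        ultimately show "\<bar>w x * Q1 - (w (x - y) - w x) * Kt (p - q) s b\<bar> \<le> W * \<bar>Q1\<bar> + (L * r n) * Kt (p - q) s b" by linarith
      qed auto
      also have "\<dots> = norm (k' n y) * (W * (norm (Fq x) * \<bar>Q1\<bar>) + (L * r n) * (norm (Fq x) * Kt (p - q) s b))"
        by (simp add: algebra_simps)
      also have "\<dots> \<le> norm (k' n y) * (W * DD (- y) x + (L * r n) * (norm (Fq x) * \<kappa>1 s (x - y)))"
      proof (intro mult_left_mono add_mono)
        have "norm (Fq x) * \<bar>Q1\<bar> \<le> \<bar>b powr (p - 1) - a powr (p - 1)\<bar> * \<bar>b - a\<bar>"
          unfolding norm_Fq a_def[symmetric] Q1_def using pq s
          by (intro Kf_Kt_commutator) (auto simp: a_def b_def)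
        also have "\<dots> \<le> DD (- y) x"
          unfolding DD_def a_def b_def using pf_monotone[of p "\<xi> (x - y)" "\<xi> x"] pq by simp
        finally show "norm (Fq x) * \<bar>Q1\<bar> \<le> DD (- y) x" .
        show "Kt (p - q) s b \<le> \<kappa>1 s (x - y)" using xB by (simp add: \<kappa>1_def b_def)
      qed (use W L r_pos[of n] in auto)
      finally show ?thesis .
    qed
  qed
  finally show ?thesis .
qed

lemma bp_u: "0 \<le> bp (u x - t)" "t0 \<le> t \<Longrightarrow> bp (u x - t) \<le> indicator K0 x" "bp (u x - t) \<le> 1" if "t \<ge> 0" for t
proof -
  show "0 \<le> bp (u x - t)" by (rule bp_ge0)
  show 1: "bp (u x - t) \<le> 1"
  proof (cases "u x \<le> t")
    case False
    then show ?thesis using bp_abs_le[of "u x - t"] u01(2)[of x] that bp_ge0[of "u x - t"] by linarith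
  qed (simp add: bp_zero)
  show "bp (u x - t) \<le> indicator K0 x" if "t0 \<le> t"
    using 1 off[of x] that by (cases "x \<in> K0") (auto simp: bp_zero)
qed

text \<open>\<open>comm_pt\<close> is integrated against bp(u - t), with the order of integration
  exchanged. \<open>DD\<close> contributes at most e r n, the weight term L r n times an integral
  close to the stated one, and the mass C / r n of the kernel gradient cancels r n. The term with L
  survives the limit: it stands for the gradient of the weight, and only small \<open>s\<close>
  makes it harmless.\<close>

lemma comm_bound:
  assumes s: "s > 0" and e: "e > 0" and t: "t0 \<le> t"
  shows "\<forall>\<^sub>F n in sequentially.
    (\<integral>\<^sup>+x. bp (u x - t) * \<bar>Fp x \<bullet> conv (\<kappa>0 s) (k' n) x - Fq x \<bullet> conv (\<kappa>t s) (k' n) x\<bar> \<partial>lborel)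
    \<le> ennreal (C * (W * e + L * ((\<integral>x. bp (u x - t) * (norm (Fq x) * \<kappa>1 s x) \<partial>lborel) + e)))"
proof -
  have t': "t \<ge> 0" using t t0 by simp
  define \<beta> where "\<beta> x = bp (u x - t)" for x
  have \<beta>: "0 \<le> \<beta> x" "\<beta> x \<le> indicator K0 x" "\<beta> x \<le> 1" for x using bp_u[OF t', of x] t by (auto simp: \<beta>_def)
  have [measurable]: "\<beta> \<in> borel_measurable borel" unfolding \<beta>_def[abs_def] by measurable
  have \<beta>K: "\<beta> x = 0" if "x \<notin> K0" for x using \<beta>(1,2)[of x] that by simp
  define H where "H x = \<beta> x * norm (Fq x)" for x
  have [measurable]: "H \<in> borel_measurable borel" unfolding H_def[abs_def] by measurable
  have H0: "0 \<le> H x" for x using \<beta> by (simp add: H_def)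
  have iH: "integrable lborel H"
  proof (rule Bochner_Integration.integrable_bound[OF integrable_norm[OF Fq_int(1)]])
    show "AE x in lborel. norm (H x) \<le> norm (norm (Fq x))"
      using \<beta> by (intro AE_I2) (simp add: H_def abs_mult mult_left_le_one_le)
  qed measurable
  define J where "J = (\<integral>x. H x * \<kappa>1 s x \<partial>lborel)"
  have iJ: "integrable lborel (\<lambda>x. H x * \<kappa>1 s x)"
    using integrable_inner_bounded[OF iH, of "\<kappa>1 s" "s powr (p - q) * s"] \<kappa>_bounds[OF s] by simp
  have J0: "J \<ge> 0" unfolding J_def using H0 \<kappa>_bounds[OF s] by (intro Bochner_Integration.integral_nonneg) auto
  obtain d0 where d0: "d0 > 0" "\<And>x. x \<in> K0 \<Longrightarrow> cball x d0 \<subseteq> S" using compact_open_margin[OF K0(1) S K0(2)] by auto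
  obtain d1 where d1: "d1 > 0" "\<And>h. norm h \<le> d1 \<Longrightarrow> (\<integral>\<^sup>+x. indicator K0 x * DD h x \<partial>lborel) \<le> ennreal (e * norm h)"
    using DD_small[OF e] by auto
  \<comment> \<open>Allows \<open>\<kappa>1 s (x - y)\<close> to be replaced by
    \<open>\<kappa>1 s x\<close> under the weight \<open>H\<close>, with error
    \<open>e\<close>.\<close>
  have "tcont H (\<kappa>1 s)"
    by (rule tcont_bounded[OF iH \<kappa>_int(2)[OF s], of "s powr (p - q) * s"]) (use \<kappa>_bounds[OF s] in auto)
  then obtain d2 where d2: "d2 > 0" "\<And>h. norm h \<le> d2 \<Longrightarrow> (\<integral>\<^sup>+x. \<bar>H x\<bar> * norm (\<kappa>1 s (x + h) - \<kappa>1 s x) \<partial>lborel) \<le> ennreal e"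
    using e unfolding tcont_def by blast
  have "\<forall>\<^sub>F n in sequentially. r n < min d0 (min d1 d2)" using r_lim d0 d1 d2 by (intro order_tendstoD) auto
  then show ?thesis
  proof eventually_elim
    case (elim n)
    define c where "c x = Fp x \<bullet> conv (\<kappa>0 s) (k' n) x - Fq x \<bullet> conv (\<kappa>t s) (k' n) x" for x
    have DDm [measurable]: "(\<lambda>(y, x). DD (- y) x) \<in> borel_measurable (borel \<Otimes>\<^sub>M borel)"
      unfolding DD_def by measurable
    have DDm' [measurable]: "DD h \<in> borel_measurable borel" for h
      unfolding DD_def[abs_def] by measurable
    define Z where "Z x y = ennreal (norm (k' n y)) * (ennreal W * ennreal (\<beta> x * DD (- y) x) + ennreal (L * r n) * ennreal (H x * \<kappa>1 s (x - y)))" for x y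
    have Lr: "0 \<le> L * r n" using L r_pos[of n] by simp
    have "(\<integral>\<^sup>+x. \<beta> x * \<bar>c x\<bar> \<partial>lborel) \<le> (\<integral>\<^sup>+x. \<integral>\<^sup>+y. Z x y \<partial>lborel \<partial>lborel)"
    proof (rule nn_integral_mono)
      fix x
      show "ennreal (\<beta> x * \<bar>c x\<bar>) \<le> (\<integral>\<^sup>+y. Z x y \<partial>lborel)"
      proof (cases "x \<in> K0")
        case True
        have "cball x (r n) \<subseteq> S" using d0(2)[OF True] elim by (auto simp: subset_iff)
        note pt = comm_pt[OF s True this]
        have "ennreal (\<beta> x * \<bar>c x\<bar>) = ennreal (\<beta> x) * ennreal \<bar>c x\<bar>" using \<beta> by (simp add: ennreal_mult)
        also have "\<dots> \<le> ennreal (\<beta> x) * (\<integral>\<^sup>+y. norm (k' n y) * (W * DD (- y) x + (L * r n) * (norm (Fq x) * \<kappa>1 s (x - y))) \<partial>lborel)"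
          unfolding c_def by (intro mult_left_mono pt) auto
        also have "\<dots> = (\<integral>\<^sup>+y. ennreal (\<beta> x) * ennreal (norm (k' n y) * (W * DD (- y) x + (L * r n) * (norm (Fq x) * \<kappa>1 s (x - y)))) \<partial>lborel)"
          by (intro nn_integral_cmult[symmetric]) measurable
        also have "\<dots> = (\<integral>\<^sup>+y. Z x y \<partial>lborel)"
        proof (rule nn_integral_cong)
          fix y
          have nn: "0 \<le> W * (\<beta> x * DD (- y) x)" "0 \<le> (L * r n) * (H x * \<kappa>1 s (x - y))" "0 \<le> \<beta> x * DD (- y) x" "0 \<le> H x * \<kappa>1 s (x - y)"
            using W \<beta>(1)[of x] DD_nonneg[of "-y" x] Lr H0[of x] \<kappa>_bounds(3)[OF s, of "x - y"] by auto
          have "Z x y = ennreal (norm (k' n y) * (W * (\<beta> x * DD (- y) x) + (L * r n) * (H x * \<kappa>1 s (x - y))))"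
            unfolding Z_def using nn W Lr by (simp add: ennreal_mult[symmetric] ennreal_plus[symmetric] del: ennreal_plus)
          also have "norm (k' n y) * (W * (\<beta> x * DD (- y) x) + (L * r n) * (H x * \<kappa>1 s (x - y)))
             = \<beta> x * (norm (k' n y) * (W * DD (- y) x + (L * r n) * (norm (Fq x) * \<kappa>1 s (x - y))))"
            by (simp add: H_def algebra_simps)
          also have "ennreal \<dots> = ennreal (\<beta> x) * ennreal (norm (k' n y) * (W * DD (- y) x + (L * r n) * (norm (Fq x) * \<kappa>1 s (x - y))))"
            using \<beta>(1)[of x] by (rule ennreal_mult')
          finally show "ennreal (\<beta> x) * ennreal (norm (k' n y) * (W * DD (- y) x + (L * r n) * (norm (Fq x) * \<kappa>1 s (x - y)))) = Z x y" by simp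
        qed
        finally show ?thesis .
      qed (use \<beta>K in simp)
    qed
    also have "\<dots> = (\<integral>\<^sup>+y. \<integral>\<^sup>+x. Z x y \<partial>lborel \<partial>lborel)"
      unfolding Z_def by (rule lborel_pair.Fubini') measurable
    also have "\<dots> \<le> (\<integral>\<^sup>+y. ennreal (norm (k' n y)) * ennreal (r n * (W * e + L * (J + e))) \<partial>lborel)"
    proof (rule nn_integral_mono)
      fix y
      show "(\<integral>\<^sup>+x. Z x y \<partial>lborel) \<le> ennreal (norm (k' n y)) * ennreal (r n * (W * e + L * (J + e)))"
      proof (cases "norm y \<le> r n")
        case False
        then show ?thesis using k'_supp[of n y] by (simp add: Z_def)
      next
        case True
        have "(\<integral>\<^sup>+x. Z x y \<partial>lborel) = ennreal (norm (k' n y)) * (ennreal W * (\<integral>\<^sup>+x. \<beta> x * DD (- y) x \<partial>lborel) + ennreal (L * r n) * (\<integral>\<^sup>+x. H x * \<kappa>1 s (x - y) \<partial>lborel))"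
          unfolding Z_def by (subst nn_integral_cmult; (subst nn_integral_add)?) (auto simp: nn_integral_cmult)
        also have "\<dots> \<le> ennreal (norm (k' n y)) * (ennreal W * ennreal (e * r n) + ennreal (L * r n) * ennreal (J + e))"
        proof (intro mult_left_mono add_mono)
          have "(\<integral>\<^sup>+x. \<beta> x * DD (- y) x \<partial>lborel) \<le> (\<integral>\<^sup>+x. indicator K0 x * DD (- y) x \<partial>lborel)"
            using \<beta>(2) DD_nonneg by (intro nn_integral_mono ennreal_leI mult_right_mono) auto
          also have "\<dots> \<le> ennreal (e * norm (- y))" using d1(2)[of "-y"] True elim by simp
          also have "\<dots> \<le> ennreal (e * r n)" using True e by (intro ennreal_leI mult_left_mono) auto
          finally show "(\<integral>\<^sup>+x. \<beta> x * DD (- y) x \<partial>lborel) \<le> ennreal (e * r n)" .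
          have "(\<integral>\<^sup>+x. H x * \<kappa>1 s (x - y) \<partial>lborel) \<le> (\<integral>\<^sup>+x. ennreal (H x * \<kappa>1 s x) + ennreal (\<bar>H x\<bar> * norm (\<kappa>1 s (x + (- y)) - \<kappa>1 s x)) \<partial>lborel)"
          proof (rule nn_integral_mono)
            fix x
            have "H x * \<kappa>1 s (x - y) \<le> H x * (\<kappa>1 s x + \<bar>\<kappa>1 s (x + (- y)) - \<kappa>1 s x\<bar>)" using H0[of x] by (intro mult_left_mono) auto
            then have "H x * \<kappa>1 s (x - y) \<le> H x * \<kappa>1 s x + \<bar>H x\<bar> * norm (\<kappa>1 s (x + (- y)) - \<kappa>1 s x)"
              using H0[of x] by (simp add: distrib_left)
            from ennreal_leI[OF this] show "ennreal (H x * \<kappa>1 s (x - y)) \<le> ennreal (H x * \<kappa>1 s x) + ennreal (\<bar>H x\<bar> * norm (\<kappa>1 s (x + (- y)) - \<kappa>1 s x))"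
              using H0[of x] \<kappa>_bounds(3)[OF s, of x] by simp
          qed
          also have "\<dots> = (\<integral>\<^sup>+x. H x * \<kappa>1 s x \<partial>lborel) + (\<integral>\<^sup>+x. \<bar>H x\<bar> * norm (\<kappa>1 s (x + (- y)) - \<kappa>1 s x) \<partial>lborel)"
            by (intro nn_integral_add) auto
          also have "\<dots> \<le> ennreal J + ennreal e"
          proof (rule add_mono)
            show "(\<integral>\<^sup>+x. H x * \<kappa>1 s x \<partial>lborel) \<le> ennreal J"
              unfolding J_def using iJ H0 \<kappa>_bounds(3)[OF s] by (subst nn_integral_eq_integral) auto
            show "(\<integral>\<^sup>+x. \<bar>H x\<bar> * norm (\<kappa>1 s (x + (- y)) - \<kappa>1 s x) \<partial>lborel) \<le> ennreal e"
              using d2(2)[of "-y"] True elim by simp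
          qed
          also have "\<dots> = ennreal (J + e)" using J0 e by simp
          finally show "(\<integral>\<^sup>+x. H x * \<kappa>1 s (x - y) \<partial>lborel) \<le> ennreal (J + e)" .
        qed auto
        also have "ennreal W * ennreal (e * r n) + ennreal (L * r n) * ennreal (J + e) = ennreal (r n * (W * e + L * (J + e)))"
        proof -
          have "ennreal W * ennreal (e * r n) = ennreal (W * (e * r n))" using W by (rule ennreal_mult'[symmetric])
          moreover have "ennreal (L * r n) * ennreal (J + e) = ennreal ((L * r n) * (J + e))" using Lr by (rule ennreal_mult'[symmetric])
          moreover have "ennreal (W * (e * r n)) + ennreal ((L * r n) * (J + e)) = ennreal (W * (e * r n) + (L * r n) * (J + e))"
            using W e r_pos[of n] Lr J0 by (intro ennreal_plus[symmetric]) auto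
          moreover have "W * (e * r n) + (L * r n) * (J + e) = r n * (W * e + L * (J + e))" by (simp add: algebra_simps)
          ultimately show ?thesis by metis
        qed
        finally show ?thesis .
      qed
    qed
    also have "\<dots> = (\<integral>\<^sup>+y. ennreal (norm (k' n y)) \<partial>lborel) * ennreal (r n * (W * e + L * (J + e)))"
      by (rule nn_integral_multc) measurable
    also have "(\<integral>\<^sup>+y. ennreal (norm (k' n y)) \<partial>lborel) = ennreal (\<integral>y. norm (k' n y) \<partial>lborel)"
      using k_integrable(2)[of n] by (intro nn_integral_eq_integral integrable_norm) auto
    also have "ennreal (\<integral>y. norm (k' n y) \<partial>lborel) * ennreal (r n * (W * e + L * (J + e)))
      = ennreal ((\<integral>y. norm (k' n y) \<partial>lborel) * (r n * (W * e + L * (J + e))))"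
      by (intro ennreal_mult'[symmetric]) auto
    \<comment> \<open>Here the order 1/r of the kernel gradient meets the order r of the
      increments.\<close>
    also have "\<dots> \<le> ennreal ((C / r n) * (r n * (W * e + L * (J + e))))"
      using k_grad[of n] W e L J0 r_pos[of n] by (intro ennreal_leI mult_right_mono) auto
    also have "(C / r n) * (r n * (W * e + L * (J + e))) = C * (W * e + L * (J + e))" using r_pos[of n] by simp
    finally show ?case unfolding c_def \<beta>_def J_def H_def by (simp add: mult.assoc)
  qed
qed

text \<open>The p-equation tested with bp(u - t0) times the mollified \<open>\<kappa>0\<close>,
  minus the q-equation tested with bp(u - t0) times the mollified \<open>\<kappa>t\<close>. The
  terms with bp' converge to \<open>a\<close>, the right-hand sides to \<open>b\<close>, and the
  gradients of the mollified factors form \<open>c n\<close>, which therefore tends to b - a. A sign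
  for \<open>a\<close>, a lower bound for \<open>b\<close> and \<open>comm_bound\<close> for the
  limit of \<open>c n\<close> combine to the claim.\<close>

lemma gradient_inequality:
  assumes s: "s > 0" and lam: "lam \<ge> 0"
  shows "(lam * w0 * t0 powr (p - 1) - \<bar>mu\<bar> * W * s powr (p - q) - C * L * s powr (q - 1) * s powr (p - q))
     * (\<integral>x. bp (u x - t0) * \<kappa>0 s x \<partial>lborel) \<le> 0"
proof -
  define \<beta> where "\<beta> x = bp (u x - t0)" for x
  define \<beta>' where "\<beta>' x = bp' (u x - t0)" for x
  have \<beta>: "0 \<le> \<beta> x" "\<beta> x \<le> indicator K0 x" "\<beta> x \<le> 1" for x using bp_u[of t0 x] t0 by (auto simp: \<beta>_def)
  have \<beta>': "0 \<le> \<beta>' x" "\<beta>' x \<le> 1" for x using bp'_bounds by (auto simp: \<beta>'_def)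
  have [measurable]: "\<beta> \<in> borel_measurable borel" "\<beta>' \<in> borel_measurable borel"
    unfolding \<beta>_def[abs_def] \<beta>'_def[abs_def] by measurable
  have \<beta>K: "\<beta> x = 0" "\<beta>' x = 0" if "x \<notin> K0" for x
    using off[OF that] by (simp_all add: \<beta>_def \<beta>'_def bp_zero)
  define J where "J = (\<integral>x. \<beta> x * \<kappa>0 s x \<partial>lborel)"
  define J2 where "J2 = (\<integral>x. \<beta> x * (norm (Fq x) * \<kappa>1 s x) \<partial>lborel)"
  define kn where "kn n = conv (k n) (\<kappa>0 s)" for n
  define tn where "tn n = conv (k n) (\<kappa>t s)" for n
  define kn' where "kn' n = conv (\<kappa>0 s) (k' n)" for n
  define tn' where "tn' n = conv (\<kappa>t s) (k' n)" for n
  have C1k: "C1 (kn n) (kn' n)" "C1 (tn n) (tn' n)" for n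
    unfolding kn_def kn'_def tn_def tn'_def by (rule conv_C1[OF \<kappa>_int(1)[OF s]] conv_C1[OF \<kappa>_int(3)[OF s]])+
  have [measurable]: "kn n \<in> borel_measurable borel" "kn' n \<in> borel_measurable borel"
     "tn n \<in> borel_measurable borel" "tn' n \<in> borel_measurable borel" for n
    using C1_borel[OF C1k(1)[of n]] C1_borel[OF C1k(2)[of n]] by auto
  define Wt where "Wt = W * (s powr (p - q) * s)"
  have kb: "\<bar>\<kappa>0 s x\<bar> \<le> s" "\<bar>\<kappa>t s x\<bar> \<le> Wt" for x using \<kappa>_bounds[OF s, of x] by (auto simp: Wt_def)
  have knb: "norm (kn n x) \<le> C * s" "norm (tn n x) \<le> C * Wt" for n x
    unfolding kn_def tn_def real_norm_def
    by (rule conv_bounded[OF \<kappa>_int(1)[OF s] kb(1)] conv_bounded[OF \<kappa>_int(3)[OF s] kb(2)])+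
  have knb': "norm (kn' n x) \<le> s * (C / r n)" "norm (tn' n x) \<le> Wt * (C / r n)" for n x
    unfolding kn'_def tn'_def
    by (rule conv_grad_bounded[OF \<kappa>_int(1)[OF s] kb(1)] conv_grad_bounded[OF \<kappa>_int(3)[OF s] kb(2)])+
  define f1 where "f1 x = \<beta>' x * (Fp x \<bullet> \<xi> x)" for x
  define f2 where "f2 x = \<beta>' x * (Fq x \<bullet> \<xi> x)" for x
  define f3 where "f3 x = \<beta> x * Rp x" for x
  define f4 where "f4 x = \<beta> x * Rq x" for x
  have fm [measurable]: "f1 \<in> borel_measurable borel" "f2 \<in> borel_measurable borel" "f3 \<in> borel_measurable borel" "f4 \<in> borel_measurable borel"
    unfolding f1_def[abs_def] f2_def[abs_def] f3_def[abs_def] f4_def[abs_def] by measurable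
  have i12: "integrable lborel (\<lambda>x. \<beta>' x * (F x \<bullet> \<xi> x))"
    if "integrable lborel (\<lambda>x. norm (F x) * norm (\<xi> x))" "F \<in> borel_measurable borel" for F :: "'a \<Rightarrow> 'a"
  proof (rule Bochner_Integration.integrable_bound[OF that(1)])
    show "AE x in lborel. norm (\<beta>' x * (F x \<bullet> \<xi> x)) \<le> norm (norm (F x) * norm (\<xi> x))"
    proof (rule AE_I2)
      fix x
      have "\<bar>\<beta>' x\<bar> * \<bar>F x \<bullet> \<xi> x\<bar> \<le> 1 * (norm (F x) * norm (\<xi> x))"
        using \<beta>'[of x] by (intro mult_mono Cauchy_Schwarz_ineq2) auto
      then show "norm (\<beta>' x * (F x \<bullet> \<xi> x)) \<le> norm (norm (F x) * norm (\<xi> x))" by (simp add: abs_mult)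
    qed
  qed (use that in measurable)
  have if12: "integrable lborel f1" "integrable lborel f2"
    unfolding f1_def[abs_def] f2_def[abs_def] using i12 pair_F by auto
  have i34: "integrable lborel (\<lambda>x. \<beta> x * R x)" if "integrable lborel R" for R :: "'a \<Rightarrow> real"
    using integrable_inner_bounded[OF that, of \<beta> 1] \<beta> by (simp add: mult.commute)
  have if34: "integrable lborel f3" "integrable lborel f4"
    unfolding f3_def[abs_def] f4_def[abs_def] using i34 R_int by auto
  have ik: "integrable lborel (\<lambda>x. f x * kn n x)" "integrable lborel (\<lambda>x. f x * tn n x)" if "integrable lborel f" for f n
    using integrable_inner_bounded[OF that, of "kn n" "C * s"] integrable_inner_bounded[OF that, of "tn n" "C * Wt"] knb by auto
  have ic: "integrable lborel (\<lambda>x. Fp x \<bullet> (\<beta> x *\<^sub>R kn' n x))" "integrable lborel (\<lambda>x. Fq x \<bullet> (\<beta> x *\<^sub>R tn' n x))" for n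
  proof -
    have "norm (\<beta> x *\<^sub>R kn' n x) \<le> 1 * (s * (C / r n))" for x
      unfolding norm_scaleR using \<beta>[of x] knb'(1)[of n x] by (intro mult_mono) auto
    then show "integrable lborel (\<lambda>x. Fp x \<bullet> (\<beta> x *\<^sub>R kn' n x))"
      by (intro integrable_inner_bounded[OF Fp_int(1)]) measurable
    have "norm (\<beta> x *\<^sub>R tn' n x) \<le> 1 * (Wt * (C / r n))" for x
      unfolding norm_scaleR using \<beta>[of x] knb'(2)[of n x] by (intro mult_mono) auto
    then show "integrable lborel (\<lambda>x. Fq x \<bullet> (\<beta> x *\<^sub>R tn' n x))"
      by (intro integrable_inner_bounded[OF Fq_int(1)]) measurable
  qed
  define c where "c n = (\<integral>x. \<beta> x * (Fp x \<bullet> kn' n x - Fq x \<bullet> tn' n x) \<partial>lborel)" for n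
  have eqn: "c n = ((\<integral>x. f3 x * kn n x \<partial>lborel) - (\<integral>x. f4 x * tn n x \<partial>lborel))
      - ((\<integral>x. f1 x * kn n x \<partial>lborel) - (\<integral>x. f2 x * tn n x \<partial>lborel))" for n
  proof -
    have "(\<integral>x. f1 x * kn n x \<partial>lborel) + (\<integral>x. Fp x \<bullet> (\<beta> x *\<^sub>R kn' n x) \<partial>lborel)
       = (\<integral>x. Fp x \<bullet> ((kn n x * bp' (u x - t0)) *\<^sub>R \<xi> x + bp (u x - t0) *\<^sub>R kn' n x) \<partial>lborel)"
      using ik(1)[OF if12(1), of n] ic(1)[of n]
      by (subst Bochner_Integration.integral_add[symmetric])
        (auto intro!: Bochner_Integration.integral_cong simp: f1_def \<beta>_def \<beta>'_def inner_add_right mult_ac)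
    also have "\<dots> = (\<integral>x. Rp x * (kn n x * bp (u x - t0)) \<partial>lborel)" by (rule test_p[OF order_refl C1k(1)])
    also have "\<dots> = (\<integral>x. f3 x * kn n x \<partial>lborel)"
      by (intro Bochner_Integration.integral_cong) (simp_all add: f3_def \<beta>_def)
    finally have P: "(\<integral>x. f1 x * kn n x \<partial>lborel) + (\<integral>x. Fp x \<bullet> (\<beta> x *\<^sub>R kn' n x) \<partial>lborel) = (\<integral>x. f3 x * kn n x \<partial>lborel)" .
    have "(\<integral>x. f2 x * tn n x \<partial>lborel) + (\<integral>x. Fq x \<bullet> (\<beta> x *\<^sub>R tn' n x) \<partial>lborel)
       = (\<integral>x. Fq x \<bullet> ((tn n x * bp' (u x - t0)) *\<^sub>R \<xi> x + bp (u x - t0) *\<^sub>R tn' n x) \<partial>lborel)"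
      using ik(2)[OF if12(2), of n] ic(2)[of n]
      by (subst Bochner_Integration.integral_add[symmetric])
        (auto intro!: Bochner_Integration.integral_cong simp: f2_def \<beta>_def \<beta>'_def inner_add_right mult_ac)
    also have "\<dots> = (\<integral>x. Rq x * (tn n x * bp (u x - t0)) \<partial>lborel)" by (rule test_q[OF order_refl C1k(2)])
    also have "\<dots> = (\<integral>x. f4 x * tn n x \<partial>lborel)"
      by (intro Bochner_Integration.integral_cong) (simp_all add: f4_def \<beta>_def)
    finally have Q: "(\<integral>x. f2 x * tn n x \<partial>lborel) + (\<integral>x. Fq x \<bullet> (\<beta> x *\<^sub>R tn' n x) \<partial>lborel) = (\<integral>x. f4 x * tn n x \<partial>lborel)" .
    have "c n = (\<integral>x. Fp x \<bullet> (\<beta> x *\<^sub>R kn' n x) - Fq x \<bullet> (\<beta> x *\<^sub>R tn' n x) \<partial>lborel)"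
      unfolding c_def by (intro Bochner_Integration.integral_cong) (simp_all add: right_diff_distrib)
    also have "\<dots> = (\<integral>x. Fp x \<bullet> (\<beta> x *\<^sub>R kn' n x) \<partial>lborel) - (\<integral>x. Fq x \<bullet> (\<beta> x *\<^sub>R tn' n x) \<partial>lborel)"
      using ic[of n] by (intro Bochner_Integration.integral_diff)
    finally show ?thesis using P Q by linarith
  qed
  have wk: "wlim f kn (\<kappa>0 s)" "wlim f tn (\<kappa>t s)" if "integrable lborel f" for f
    unfolding kn_def tn_def using that kb
    by (auto intro!: wlim_conv tcont_bounded[OF that \<kappa>_int(1)[OF s], where M=s] tcont_bounded[OF that \<kappa>_int(3)[OF s], where M=Wt] \<kappa>_int[OF s])
  have i0: "integrable lborel (\<lambda>x. f x * \<kappa>0 s x)" "integrable lborel (\<lambda>x. f x * \<kappa>t s x)" if "integrable lborel f" for f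
    using integrable_inner_bounded[OF that, of "\<kappa>0 s" s] integrable_inner_bounded[OF that, of "\<kappa>t s" Wt] kb by auto
  have lim: "(\<lambda>n. \<integral>x. f x * kn n x \<partial>lborel) \<longlonglongrightarrow> (\<integral>x. f x * \<kappa>0 s x \<partial>lborel)"
    "(\<lambda>n. \<integral>x. f x * tn n x \<partial>lborel) \<longlonglongrightarrow> (\<integral>x. f x * \<kappa>t s x \<partial>lborel)" if "integrable lborel f" for f :: "'a \<Rightarrow> real"
  proof -
    have [measurable]: "f \<in> borel_measurable borel" using that by auto
    show "(\<lambda>n. \<integral>x. f x * kn n x \<partial>lborel) \<longlonglongrightarrow> (\<integral>x. f x * \<kappa>0 s x \<partial>lborel)"
      using wlim_integral[OF wk(1)[OF that], of f] i0(1)[OF that] by simp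
    show "(\<lambda>n. \<integral>x. f x * tn n x \<partial>lborel) \<longlonglongrightarrow> (\<integral>x. f x * \<kappa>t s x \<partial>lborel)"
      using wlim_integral[OF wk(2)[OF that], of f] i0(2)[OF that] by simp
  qed
  define b where "b = (\<integral>x. f3 x * \<kappa>0 s x \<partial>lborel) - (\<integral>x. f4 x * \<kappa>t s x \<partial>lborel)"
  define a where "a = (\<integral>x. f1 x * \<kappa>0 s x \<partial>lborel) - (\<integral>x. f2 x * \<kappa>t s x \<partial>lborel)"
  have climit: "c \<longlonglongrightarrow> b - a"
    unfolding eqn[abs_def] a_def b_def by (intro tendsto_diff lim if12 if34)
  \<comment> \<open>The integrand is bp' w |\<xi>|^q times |\<xi>|^(p-q) \<kappa>0 - \<kappa>1, and
    the last factor is nonpositive.\<close>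
  have a0: "a \<le> 0"
  proof -
    have "a = (\<integral>x. f1 x * \<kappa>0 s x - f2 x * \<kappa>t s x \<partial>lborel)"
      unfolding a_def using i0(1)[OF if12(1)] i0(2)[OF if12(2)] by simp
    also have "\<dots> \<le> (\<integral>x. 0 \<partial>(lborel :: 'a measure))"
    proof (rule integral_mono)
      fix x
      have Fpx: "Fp x \<bullet> \<xi> x = w x * norm (\<xi> x) powr p" using pf_inner[of p "\<xi> x"] pq by (simp add: Fp_def)
      have Fqx: "Fq x \<bullet> \<xi> x = norm (\<xi> x) powr q" using pf_inner[of q "\<xi> x"] pq by (simp add: Fq_def)
      show "f1 x * \<kappa>0 s x - f2 x * \<kappa>t s x \<le> 0"
      proof (cases "x \<in> K0")
        case True
        then have wx: "0 \<le> w x" using K0(2) w0 by (meson order_trans less_imp_le subsetD)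
        have "norm (\<xi> x) powr p = norm (\<xi> x) powr q * norm (\<xi> x) powr (p - q)"
          by (simp add: powr_add[symmetric])
        then have "f1 x * \<kappa>0 s x - f2 x * \<kappa>t s x = (\<beta>' x * w x * norm (\<xi> x) powr q) * (norm (\<xi> x) powr (p - q) * \<kappa>0 s x - \<kappa>1 s x)"
          unfolding f1_def f2_def Fpx Fqx \<kappa>t_def by (simp add: algebra_simps)
        also have "\<dots> \<le> 0" using \<beta>'[of x] wx \<kappa>_bounds(5)[OF s, of x] by (intro mult_nonneg_nonpos) auto
        finally show ?thesis .
      qed (simp add: f1_def f2_def \<beta>K)
    qed (use i0(1)[OF if12(1)] i0(2)[OF if12(2)] in auto)
    finally show ?thesis by simp
  qed
  have i\<beta>: "integrable lborel (\<lambda>x. \<beta> x * \<kappa>0 s x)" using i34[OF \<kappa>_int(1)[OF s]] .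
  define c1 where "c1 = lam * w0 * t0 powr (p - 1) - \<bar>mu\<bar> * W * s powr (p - q)"
  \<comment> \<open>Where u > t0 the p-side is bounded below through \<open>w0\<close> and t0^(p-1),
    while the q-side carries the small factor in |\<kappa>t| \<le> W s^(p-q) \<kappa>0.\<close>
  have bJ: "c1 * J \<le> b"
  proof -
    have "c1 * J = (\<integral>x. c1 * (\<beta> x * \<kappa>0 s x) \<partial>lborel)" unfolding J_def by simp
    also have "\<dots> \<le> (\<integral>x. f3 x * \<kappa>0 s x - f4 x * \<kappa>t s x \<partial>lborel)"
    proof (rule integral_mono)
      fix x
      show "c1 * (\<beta> x * \<kappa>0 s x) \<le> f3 x * \<kappa>0 s x - f4 x * \<kappa>t s x"
      proof (cases "u x \<le> t0")
        case True
        then show ?thesis by (simp add: f3_def f4_def \<beta>_def bp_zero)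
      next
        case False
        then have "x \<in> K0" using off by blast
        then have wx: "w0 \<le> w x" using K0(2) w0 by auto
        have up: "t0 powr (p - 1) \<le> u x powr (p - 1)" using False t0 pq by (intro powr_mono2) auto
        have "w0 * t0 powr (p - 1) \<le> w x * u x powr (p - 1)" using wx up w0 by (intro mult_mono) auto
        then have 1: "lam * w0 * t0 powr (p - 1) \<le> Rp x" unfolding Rp_def mult.assoc using lam by (rule mult_left_mono)
        have "\<bar>Rq x\<bar> * \<bar>\<kappa>t s x\<bar> \<le> \<bar>mu\<bar> * (W * (s powr (p - q) * \<kappa>0 s x))"
        proof (rule mult_mono[OF Rq_bound])
          show "\<bar>\<kappa>t s x\<bar> \<le> W * (s powr (p - q) * \<kappa>0 s x)"
            unfolding \<kappa>t_def abs_mult using \<kappa>_bounds[OF s, of x] wW[of x] W by (intro mult_mono) auto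
        qed auto
        then have "Rq x * \<kappa>t s x \<le> (\<bar>mu\<bar> * W * s powr (p - q)) * \<kappa>0 s x"
          by (metis abs_ge_self abs_mult mult.assoc order_trans)
        moreover have "(lam * w0 * t0 powr (p - 1)) * \<kappa>0 s x \<le> Rp x * \<kappa>0 s x" using 1 \<kappa>_bounds[OF s, of x] by (intro mult_right_mono) auto
        ultimately have "c1 * \<kappa>0 s x \<le> Rp x * \<kappa>0 s x - Rq x * \<kappa>t s x" by (simp add: c1_def left_diff_distrib)
        from mult_left_mono[OF this \<beta>(1)[of x]] show ?thesis by (simp add: f3_def f4_def algebra_simps)
      qed
    qed (use i\<beta> i0(1)[OF if34(1)] i0(2)[OF if34(2)] in auto)
    also have "\<dots> = b" unfolding b_def using i0(1)[OF if34(1)] i0(2)[OF if34(2)] by simp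
    finally show ?thesis .
  qed
  \<comment> \<open>\<open>\<kappa>1\<close> vanishes where |\<xi>| > s, and elsewhere |\<xi>|^(q-1)
    \<le> s^(q-1).\<close>
  have J2J: "J2 \<le> s powr (q - 1) * s powr (p - q) * J"
  proof -
    have iFq: "integrable lborel (\<lambda>x. \<beta> x * (norm (Fq x) * \<kappa>1 s x))"
      using i34[OF integrable_inner_bounded[OF integrable_norm[OF Fq_int(1)], of "\<kappa>1 s" "s powr (p - q) * s"]] \<kappa>_bounds[OF s] by simp
    have "J2 \<le> (\<integral>x. (s powr (q - 1) * s powr (p - q)) * (\<beta> x * \<kappa>0 s x) \<partial>lborel)"
      unfolding J2_def
    proof (rule integral_mono[OF iFq])
      show "integrable lborel (\<lambda>x. (s powr (q - 1) * s powr (p - q)) * (\<beta> x * \<kappa>0 s x))" using i\<beta> by simp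
      fix x
      have "norm (Fq x) * \<kappa>1 s x \<le> s powr (q - 1) * (s powr (p - q) * \<kappa>0 s x)"
      proof (cases "norm (\<xi> x) \<le> s")
        case True
        then have "norm (Fq x) \<le> s powr (q - 1)" unfolding norm_Fq using pq by (intro powr_mono2) auto
        then show ?thesis using \<kappa>_bounds[OF s, of x] by (intro mult_mono) auto
      next
        case False
        then have "\<kappa>1 s x = 0" by (simp add: \<kappa>1_def Kt_def)
        then show ?thesis using \<kappa>_bounds[OF s, of x] by simp
      qed
      from mult_left_mono[OF this \<beta>(1)[of x]]
      show "\<beta> x * (norm (Fq x) * \<kappa>1 s x) \<le> (s powr (q - 1) * s powr (p - q)) * (\<beta> x * \<kappa>0 s x)" by (simp add: mult_ac)
    qed
    then show ?thesis by (simp add: J_def)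
  qed
  have J20: "0 \<le> J2" unfolding J2_def using \<beta> \<kappa>_bounds[OF s] by (intro Bochner_Integration.integral_nonneg) auto
  have cb: "b - a \<le> C * (W * e + L * (J2 + e))" if e: "e > 0" for e
  proof (rule tendsto_upperbound[OF climit])
    show "\<forall>\<^sub>F n in sequentially. c n \<le> C * (W * e + L * (J2 + e))"
      using comm_bound[OF s e order_refl]
    proof eventually_elim
      case (elim n)
      have bnn: "0 \<le> C * (W * e + L * (J2 + e))" using C_ge W L J20 e by (intro mult_nonneg_nonneg add_nonneg_nonneg) auto
      have ii: "integrable lborel (\<lambda>x. \<beta> x * (Fp x \<bullet> kn' n x - Fq x \<bullet> tn' n x))"
        using Bochner_Integration.integrable_diff[OF ic(1)[of n] ic(2)[of n]] by (simp add: right_diff_distrib)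
      have "ennreal \<bar>c n\<bar> \<le> (\<integral>\<^sup>+x. norm (\<beta> x * (Fp x \<bullet> kn' n x - Fq x \<bullet> tn' n x)) \<partial>lborel)"
        unfolding c_def using integral_norm_bound_ennreal[OF ii] by simp
      also have "\<dots> = (\<integral>\<^sup>+x. \<beta> x * \<bar>Fp x \<bullet> kn' n x - Fq x \<bullet> tn' n x\<bar> \<partial>lborel)"
        using \<beta>(1) by (intro nn_integral_cong) (simp add: abs_mult)
      also have "\<dots> \<le> ennreal (C * (W * e + L * (J2 + e)))"
        using elim unfolding \<beta>_def kn'_def tn'_def J2_def .
      finally have "\<bar>c n\<bar> \<le> C * (W * e + L * (J2 + e))" using bnn by (subst (asm) ennreal_le_iff) auto
      then show ?case by linarith
    qed
  qed simp
  \<comment> \<open>The limit over \<open>n\<close> has been taken for each \<open>e\<close>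
    separately, and b - a is free of \<open>e\<close>; so \<open>e\<close> may now tend to
    0.\<close>
  have cb2: "b - a \<le> C * (L * J2)"
  proof (rule field_le_epsilon)
    fix e :: real assume e: "e > 0"
    define D where "D = C * (W + L) + 1"
    have D: "D > 0" using C_ge W L by (simp add: D_def add_nonneg_pos)
    have "b - a \<le> C * (W * (e / D) + L * (J2 + e / D))" using cb[of "e / D"] e D by simp
    also have "\<dots> = C * (L * J2) + (C * (W + L)) * (e / D)" by (simp add: algebra_simps)
    also have "(C * (W + L)) * (e / D) \<le> D * (e / D)" using e D by (intro mult_right_mono) (auto simp: D_def)
    also have "D * (e / D) = e" using D by simp
    finally show "b - a \<le> C * (L * J2) + e" by simp
  qed
  have "C * (L * J2) \<le> C * (L * (s powr (q - 1) * s powr (p - q) * J))"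
    using J2J C_ge L by (intro mult_left_mono) auto
  then have "c1 * J \<le> C * (L * (s powr (q - 1) * s powr (p - q) * J))" using cb2 bJ a0 by linarith
  then show ?thesis unfolding J_def[unfolded \<beta>_def, symmetric] c1_def by (simp add: algebra_simps)
qed

text \<open>For small \<open>s\<close> the coefficient in \<open>gradient_inequality\<close> is
  positive, as both subtracted terms carry s^(p-q). Then the nonnegative function bp(u - t0)
  \<kappa>0 vanishes almost everywhere, and \<kappa>0 = 0 at a point of \<open>B\<close> means
  |\<xi>| \<ge> s.\<close>

lemma gradient_lower_bound:
  assumes lam: "lam > 0"
  obtains s where "s > 0" "AE x in lborel. t0 < u x \<longrightarrow> s \<le> norm (\<xi> x)"
proof -
  define c where "c = lam * w0 * t0 powr (p - 1)"
  have c: "c > 0" using lam w0 t0 by (simp add: c_def)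
  define A where "A = \<bar>mu\<bar> * W + C * L + 1"
  have A: "A \<ge> 1" using W C_ge L by (simp add: A_def)
  \<comment> \<open>With s^(p-q) \<le> z and s \<le> 1 the subtracted terms amount to at most A z =
    c/2.\<close>
  define z where "z = c / (2 * A)"
  have z: "z > 0" using c A by (simp add: z_def)
  define s where "s = min 1 (z powr (1 / (p - q)))"
  have s: "s > 0" "s \<le> 1" using z by (auto simp: s_def)
  have m: "p - q > 0" using pq by simp
  have sm: "s powr (p - q) \<le> z"
  proof -
    have "s powr (p - q) \<le> (z powr (1 / (p - q))) powr (p - q)" using s m by (intro powr_mono2) (auto simp: s_def)
    also have "\<dots> = z" using z m by (simp add: powr_powr)
    finally show ?thesis .
  qed
  have sq: "s powr (q - 1) \<le> 1" using powr_mono2[of "q - 1" s 1] s pq by simp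
  have "\<bar>mu\<bar> * W * s powr (p - q) + C * L * s powr (q - 1) * s powr (p - q) \<le> (\<bar>mu\<bar> * W + C * L * 1) * s powr (p - q)"
    unfolding distrib_right using sq C_ge L by (intro add_mono mult_right_mono mult_left_mono) auto
  also have "\<dots> \<le> A * z" using sm A W C_ge L z by (intro mult_mono) (auto simp: A_def)
  also have "A * z = c / 2" using A by (simp add: z_def)
  finally have pos: "c - \<bar>mu\<bar> * W * s powr (p - q) - C * L * s powr (q - 1) * s powr (p - q) > 0" using c by linarith
  have "(\<integral>x. bp (u x - t0) * \<kappa>0 s x \<partial>lborel) \<le> 0"
    using gradient_inequality[OF s(1) less_imp_le[OF lam]] pos unfolding c_def by (simp add: mult_le_0_iff)
  moreover have nn: "0 \<le> bp (u x - t0) * \<kappa>0 s x" for x using bp_ge0 \<kappa>_bounds(1)[OF s(1)] by simp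
  moreover have i: "integrable lborel (\<lambda>x. bp (u x - t0) * \<kappa>0 s x)"
    using integrable_inner_bounded[OF \<kappa>_int(1)[OF s(1)], of "\<lambda>x. bp (u x - t0)" 1] bp_u[of t0] t0
    by (simp add: mult.commute bp_ge0)
  ultimately have "(\<integral>x. bp (u x - t0) * \<kappa>0 s x \<partial>lborel) = 0"
    by (intro antisym Bochner_Integration.integral_nonneg) auto
  then have "AE x in lborel. bp (u x - t0) * \<kappa>0 s x = 0"
    using integral_nonneg_eq_0_iff_AE[OF i] nn by simp
  then have "AE x in lborel. t0 < u x \<longrightarrow> s \<le> norm (\<xi> x)"
  proof eventually_elim
    case (elim x)
    show ?case
    proof
      assume u: "t0 < u x"
      then have "bp (u x - t0) > 0" by (simp add: bp_pos_iff)
      with elim have "\<kappa>0 s x = 0" by simp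
      moreover have "x \<in> B" using off u K0 B by (meson not_le subsetD)
      ultimately show "s \<le> norm (\<xi> x)" by (simp add: \<kappa>0_def Kf_def min_def split: if_splits)
    qed
  qed
  then show ?thesis using that s by blast
qed

lemma bp_test_integrable:
  assumes "t \<ge> t0"
  shows "integrable lborel (\<lambda>x. bp (u x - t))" "integrable lborel (\<lambda>x. bp' (u x - t))"
proof -
  show "integrable lborel (\<lambda>x. bp (u x - t))"
  proof (rule bounded_B_integrable[where M=1])
    show "\<bar>bp (u x - t)\<bar> \<le> 1" for x using bp_u[of t x] assms t0 by simp
  qed (use uB assms t0 in \<open>auto intro!: bp_zero\<close>)
  show "integrable lborel (\<lambda>x. bp' (u x - t))"
    by (rule bounded_B_integrable[where M=1]) (use uB assms t0 bp'_bounds in \<open>auto intro!: bp_zero\<close>)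
qed

text \<open>If lam \<le> 0, testing the p-equation with bp(u - t0) shows that \<xi> = 0 almost
  everywhere on {u > t0}. The divergence identity of the field x \<mapsto> x, tested with the same
  function, then makes the integral of bp(u - t0) vanish, so u \<le> t0 almost everywhere. This
  takes the place of a Poincare inequality.\<close>

lemma lam_pos:
  assumes top: "\<not> (AE x in lborel. u x \<le> t0)"
  shows "lam > 0"
proof (rule ccontr)
  assume "\<not> lam > 0"
  then have lam: "lam \<le> 0" by simp
  have wS: "0 < w x" if "t0 < u x" for x using that off[of x] w0 K0 by (metis less_le_trans not_le subsetD)
  have "(\<integral>x. Fp x \<bullet> (bp' (u x - t0) *\<^sub>R \<xi> x) \<partial>lborel) = (\<integral>x. Rp x * bp (u x - t0) \<partial>lborel)"
    using test_p[OF order_refl C1_const[of 1]] by simp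
  also have "\<dots> \<le> 0"
  proof -
    have "(\<integral>x. Rp x * bp (u x - t0) \<partial>lborel) \<le> (\<integral>x. 0 \<partial>(lborel :: 'a measure))"
    proof (rule integral_mono)
      show "integrable lborel (\<lambda>x. Rp x * bp (u x - t0))"
        using integrable_inner_bounded[OF R_int(1), of "\<lambda>x. bp (u x - t0)" 1] bp_u[of t0] t0 by (simp add: bp_ge0)
      fix x
      show "Rp x * bp (u x - t0) \<le> 0"
      proof (cases "t0 < u x")
        case True
        then have "0 \<le> w x * u x powr (p - 1)" using wS by (simp add: less_imp_le)
        then have "Rp x \<le> 0" unfolding Rp_def using lam by (intro mult_nonpos_nonneg) auto
        then show ?thesis using bp_ge0 by (intro mult_nonpos_nonneg) auto
      qed (simp add: bp_zero)
    qed auto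
    then show ?thesis by simp
  qed
  finally have le: "(\<integral>x. Fp x \<bullet> (bp' (u x - t0) *\<^sub>R \<xi> x) \<partial>lborel) \<le> 0" .
  have Fpx: "Fp x \<bullet> (bp' (u x - t0) *\<^sub>R \<xi> x) = bp' (u x - t0) * (w x * norm (\<xi> x) powr p)" for x
    using pf_inner[of p "\<xi> x"] pq by (simp add: Fp_def)
  have nn: "0 \<le> Fp x \<bullet> (bp' (u x - t0) *\<^sub>R \<xi> x)" for x
  proof (cases "t0 < u x")
    case True
    then show ?thesis unfolding Fpx using wS[of x] bp'_bounds by (intro mult_nonneg_nonneg) auto
  qed (simp add: bp_zero)
  have i: "integrable lborel (\<lambda>x. Fp x \<bullet> (bp' (u x - t0) *\<^sub>R \<xi> x))"
  proof (rule Bochner_Integration.integrable_bound[OF pair_F(1)])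
    show "AE x in lborel. norm (Fp x \<bullet> (bp' (u x - t0) *\<^sub>R \<xi> x)) \<le> norm (norm (Fp x) * norm (\<xi> x))"
    proof (rule AE_I2)
      fix x
      have "\<bar>bp' (u x - t0)\<bar> * \<bar>Fp x \<bullet> \<xi> x\<bar> \<le> 1 * (norm (Fp x) * norm (\<xi> x))"
        using bp'_bounds[of "u x - t0"] by (intro mult_mono Cauchy_Schwarz_ineq2) auto
      then show "norm (Fp x \<bullet> (bp' (u x - t0) *\<^sub>R \<xi> x)) \<le> norm (norm (Fp x) * norm (\<xi> x))" by (simp add: abs_mult)
    qed
  qed measurable
  have "(\<integral>x. Fp x \<bullet> (bp' (u x - t0) *\<^sub>R \<xi> x) \<partial>lborel) = 0"
    using le nn by (intro antisym Bochner_Integration.integral_nonneg) auto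
  then have "AE x in lborel. Fp x \<bullet> (bp' (u x - t0) *\<^sub>R \<xi> x) = 0"
    using integral_nonneg_eq_0_iff_AE[OF i] nn by simp
  then have ae: "AE x in lborel. bp' (u x - t0) *\<^sub>R \<xi> x = 0"
  proof eventually_elim
    case (elim x)
    show ?case
    proof (cases "t0 < u x")
      case True
      then have "bp' (u x - t0) \<noteq> 0" using bp'_bounds(3)[of "u x - t0"] by auto
      with elim wS[OF True] show ?thesis unfolding Fpx by simp
    qed (simp add: bp_zero)
  qed
  \<comment> \<open>The identity field, cut to \<open>B\<close> for integrability and unchanged on
    \<open>S\<close>; its equation reads - div F = R with R = - DIM on \<open>S\<close>.\<close>
  define F where "F x = indicator B x *\<^sub>R x" for x :: 'a
  define R where "R x = - real DIM('a) * indicator B x" for x :: 'a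
  obtain M where M: "M > 0" "\<And>x. x \<in> B \<Longrightarrow> norm x \<le> M" using compact_imp_bounded[OF B(1)] unfolding bounded_pos by blast
  have [measurable]: "F \<in> borel_measurable borel" "R \<in> borel_measurable borel" unfolding F_def[abs_def] R_def[abs_def] by measurable
  have FM: "norm (F x) \<le> M" for x using M by (auto simp: F_def indicator_def)
  have Fi: "integrable lborel (\<lambda>x. norm (F x))" by (rule bounded_B_integrable[where M=M]) (use FM in \<open>auto simp: F_def\<close>)
  have Fi': "integrable lborel F" using Fi by (rule integrable_norm_cancel) measurable
  have Fp': "integrable lborel (\<lambda>x. norm (F x) powr (p / (p - 1)))"
  proof (rule bounded_B_integrable[where M="M powr (p / (p - 1))"])
    show "\<bar>norm (F x) powr (p / (p - 1))\<bar> \<le> M powr (p / (p - 1))" for x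
      using FM[of x] conj_exp(4) by (simp add: powr_mono2)
  qed (auto simp: F_def)
  have Ri: "integrable lborel R" unfolding R_def[abs_def] using B_ind by simp
  have wd: "weak_div S F R"
    unfolding weak_div_def
  proof (intro allI impI)
    fix \<phi> G assume \<phi>: "C1c S \<phi> G"
    obtain K where K: "K \<subseteq> S" "\<And>x. x \<notin> K \<Longrightarrow> \<phi> x = 0" "\<And>x. x \<notin> K \<Longrightarrow> G x = 0" using \<phi> by (auto elim: C1c_obtain)
    have z: "x \<notin> B \<Longrightarrow> \<phi> x = 0" "x \<notin> B \<Longrightarrow> G x = 0" for x using K B by blast+
    have "(\<integral>x. F x \<bullet> G x \<partial>lborel) = (\<integral>x. x \<bullet> G x \<partial>lborel)"
      by (intro Bochner_Integration.integral_cong refl) (use z in \<open>auto simp: F_def indicator_def\<close>)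
    also have "\<dots> = (\<integral>x. - real DIM('a) * \<phi> x \<partial>lborel)" using weak_div_identity[OF \<phi>] by simp
    also have "\<dots> = (\<integral>x. R x * \<phi> x \<partial>lborel)"
      by (intro Bochner_Integration.integral_cong refl) (use z in \<open>auto simp: R_def indicator_def\<close>)
    finally show "(\<integral>x. F x \<bullet> G x \<partial>lborel) = (\<integral>x. R x * \<phi> x \<partial>lborel)" .
  qed
  have "tcont (\<lambda>x. norm (F x)) \<xi>" by (rule tcont_Lp[OF \<xi>p]; use pq Fp' in simp)
  moreover have "integrable lborel (\<lambda>x. norm (F x) * norm (\<xi> x))" by (rule Lp_pair_integrable[OF \<xi>p]; use pq Fp' in simp)
  ultimately have "(\<integral>x. F x \<bullet> ((1 * bp' (u x - t0)) *\<^sub>R \<xi> x + bp (u x - t0) *\<^sub>R 0) \<partial>lborel) = (\<integral>x. R x * (1 * bp (u x - t0)) \<partial>lborel)"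
    using off by (intro test_bp[OF S K0 u_int u_abs xi_integrable wg _ C1_const wd Fi' Ri]) auto
  moreover have "(\<integral>x. F x \<bullet> ((1 * bp' (u x - t0)) *\<^sub>R \<xi> x + bp (u x - t0) *\<^sub>R 0) \<partial>lborel) = (\<integral>x. 0 \<partial>(lborel :: 'a measure))"
    by (rule integral_cong_AE) (use ae in \<open>auto elim!: eventually_mono\<close>)
  moreover have "(\<integral>x. R x * (1 * bp (u x - t0)) \<partial>lborel) = - real DIM('a) * (\<integral>x. bp (u x - t0) \<partial>lborel)"
  proof -
    have "R x * (1 * bp (u x - t0)) = - real DIM('a) * bp (u x - t0)" for x
      using uB[of x] t0 by (cases "x \<in> B") (auto simp: R_def bp_zero)
    then show ?thesis by simp
  qed
  ultimately have "(\<integral>x. bp (u x - t0) \<partial>lborel) = 0" by simp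
  then have "AE x in lborel. bp (u x - t0) = 0"
    using integral_nonneg_eq_0_iff_AE[OF bp_test_integrable(1)[OF order_refl]] bp_ge0 by simp
  then have "AE x in lborel. u x \<le> t0"
    by eventually_elim (metis bp_pos_iff diff_gt_0_iff_gt less_irrefl not_le)
  with top show False by simp
qed

text \<open>Testing the q-equation with bp(u - t): s^q times the integral of bp'(u - t) is at most
  |mu| times that of bp(u - t), hence at most |mu| (1 - t) times that of bp'(u - t). For t close to
  1 this forces bp'(u - t) = 0 almost everywhere, that is u \<le> t.\<close>

lemma contradiction:
  assumes top: "\<And>t. t < 1 \<Longrightarrow> \<not> (AE x in lborel. u x \<le> t)"
  shows False
proof -
  have lam: "lam > 0" using lam_pos top t0 by blast
  obtain s where s: "s > 0" "AE x in lborel. t0 < u x \<longrightarrow> s \<le> norm (\<xi> x)" using gradient_lower_bound[OF lam] by blast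
  \<comment> \<open>Chosen so that |mu| (1 - t) \<le> s^q / 2; the summand 1 in the denominator
    avoids a division by 0.\<close>
  define t where "t = max t0 (1 - s powr q / (2 * (\<bar>mu\<bar> + 1)))"
  have sq: "s powr q > 0" using s by simp
  have t: "t0 \<le> t" "t < 1" using t0 sq by (auto simp: t_def)
  have "1 - t \<le> s powr q / (2 * (\<bar>mu\<bar> + 1))" by (simp add: t_def)
  then have "(\<bar>mu\<bar> + 1) * (1 - t) \<le> (\<bar>mu\<bar> + 1) * (s powr q / (2 * (\<bar>mu\<bar> + 1)))" by (intro mult_left_mono) auto
  also have "\<dots> = s powr q / 2"
  proof -
    have "\<bar>mu\<bar> + 1 \<noteq> 0" by linarith
    then show ?thesis by (simp add: field_simps)
  qed
  finally have mt: "\<bar>mu\<bar> * (1 - t) \<le> s powr q / 2" using t by (simp add: distrib_right)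
  define I where "I = (\<integral>x. bp' (u x - t) \<partial>lborel)"
  have i': "integrable lborel (\<lambda>x. bp' (u x - t))" by (rule bp_test_integrable[OF t(1)])
  have Fqx: "Fq x \<bullet> (bp' (u x - t) *\<^sub>R \<xi> x) = bp' (u x - t) * norm (\<xi> x) powr q" for x
    using pf_inner[of q "\<xi> x"] pq by (simp add: Fq_def)
  have iq: "integrable lborel (\<lambda>x. Fq x \<bullet> (bp' (u x - t) *\<^sub>R \<xi> x))"
  proof (rule Bochner_Integration.integrable_bound[OF pair_F(2)])
    show "AE x in lborel. norm (Fq x \<bullet> (bp' (u x - t) *\<^sub>R \<xi> x)) \<le> norm (norm (Fq x) * norm (\<xi> x))"
    proof (rule AE_I2)
      fix x
      have "\<bar>bp' (u x - t)\<bar> * \<bar>Fq x \<bullet> \<xi> x\<bar> \<le> 1 * (norm (Fq x) * norm (\<xi> x))"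
        using bp'_bounds[of "u x - t"] by (intro mult_mono Cauchy_Schwarz_ineq2) auto
      then show "norm (Fq x \<bullet> (bp' (u x - t) *\<^sub>R \<xi> x)) \<le> norm (norm (Fq x) * norm (\<xi> x))" by (simp add: abs_mult)
    qed
  qed measurable
  have "s powr q * I = (\<integral>x. s powr q * bp' (u x - t) \<partial>lborel)" by (simp add: I_def)
  also have "\<dots> \<le> (\<integral>x. Fq x \<bullet> (bp' (u x - t) *\<^sub>R \<xi> x) \<partial>lborel)"
  proof (rule integral_mono_AE)
    show "AE x in lborel. s powr q * bp' (u x - t) \<le> Fq x \<bullet> (bp' (u x - t) *\<^sub>R \<xi> x)"
      using s(2)
    proof eventually_elim
      case (elim x)
      show ?case
      proof (cases "t < u x")
        case True
        then have "s powr q \<le> norm (\<xi> x) powr q" using elim t s(1) pq by (intro powr_mono2) auto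
        then show ?thesis unfolding Fqx mult.commute[of "s powr q"] using bp'_bounds by (intro mult_left_mono) auto
      qed (simp add: bp_zero)
    qed
  qed (use i' iq in auto)
  also have "\<dots> = (\<integral>x. Rq x * bp (u x - t) \<partial>lborel)"
    using test_q[OF t(1) C1_const[of 1]] by simp
  also have "\<dots> \<le> (\<integral>x. (s powr q / 2) * bp' (u x - t) \<partial>lborel)"
  proof (rule integral_mono)
    show "integrable lborel (\<lambda>x. Rq x * bp (u x - t))"
      using integrable_inner_bounded[OF R_int(2), of "\<lambda>x. bp (u x - t)" 1] bp_u[of t] t t0 by (simp add: bp_ge0)
    fix x
    show "Rq x * bp (u x - t) \<le> (s powr q / 2) * bp' (u x - t)"
    proof (cases "t < u x")
      case True
      have "bp (u x - t) \<le> (u x - t) * bp' (u x - t)" using True by (intro bp_le) auto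
      also have "\<dots> \<le> (1 - t) * bp' (u x - t)" using u01(2)[of x] bp'_bounds by (intro mult_right_mono) auto
      finally have b: "bp (u x - t) \<le> (1 - t) * bp' (u x - t)" .
      have "Rq x * bp (u x - t) \<le> \<bar>mu\<bar> * ((1 - t) * bp' (u x - t))"
        using Rq_bound[of x] b bp_ge0 by (intro mult_mono) auto
      also have "\<dots> = (\<bar>mu\<bar> * (1 - t)) * bp' (u x - t)" by simp
      also have "\<dots> \<le> (s powr q / 2) * bp' (u x - t)" using mt bp'_bounds by (intro mult_right_mono) auto
      finally show ?thesis .
    qed (simp add: bp_zero)
  qed (use i' in auto)
  also have "\<dots> = (s powr q / 2) * I" by (simp add: I_def)
  finally have "s powr q * I \<le> 0" by linarith
  then have "I \<le> 0" using sq by (simp add: mult_le_0_iff)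
  moreover have "0 \<le> I" unfolding I_def using bp'_bounds by (intro Bochner_Integration.integral_nonneg) auto
  ultimately have "I = 0" by simp
  then have "AE x in lborel. bp' (u x - t) = 0"
    using integral_nonneg_eq_0_iff_AE[OF i'] bp'_bounds by (simp add: I_def)
  then have "AE x in lborel. u x \<le> t"
    by eventually_elim (metis bp'_bounds(3) diff_le_0_iff_le order_refl)
  with top[OF t(2)] show False by simp
qed

end

section \<open>Test functions and Borel representatives\<close>

text \<open>Continuous partial derivatives give differentiability: the coordinates of the increment
  are moved one at a time, by induction on the set of coordinates already moved, with the mean value
  theorem along the new one.\<close>

lemma GDERIV_partials:
  fixes f :: "'a::euclidean_space \<Rightarrow> real" and D :: "'a \<Rightarrow> 'a"
  assumes der: "\<And>b x. b \<in> Basis \<Longrightarrow> ((\<lambda>t. f (x + t *\<^sub>R b)) has_real_derivative D x \<bullet> b) (at 0)"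
    and cont: "continuous_on UNIV D"
  shows "GDERIV f x :> D x"
proof -
  have main: "\<forall>e>0. \<exists>d>0. \<forall>h. norm h < d \<longrightarrow>
      \<bar>f (x + (\<Sum>b\<in>S. (h \<bullet> b) *\<^sub>R b)) - f x - (\<Sum>b\<in>S. (h \<bullet> b) * (D x \<bullet> b))\<bar> \<le> e * norm h"
    if "finite S" "S \<subseteq> Basis" for S
    using that
  proof (induction S rule: finite_induct)
    case empty
    show ?case by (auto intro: exI[of _ 1])
  next
    case (insert b S)
    have b: "b \<in> Basis" using insert by auto
    show ?case
    proof (intro allI impI)
      fix e :: real assume e: "e > 0"
      have e2: "e/2 > 0" using e by simp
      have IH: "\<forall>e>0. \<exists>d>0. \<forall>h. norm h < d \<longrightarrow>
          \<bar>f (x + (\<Sum>b\<in>S. (h \<bullet> b) *\<^sub>R b)) - f x - (\<Sum>b\<in>S. (h \<bullet> b) * (D x \<bullet> b))\<bar> \<le> e * norm h"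
        using insert.IH insert.prems by simp
      from IH[rule_format, OF e2] obtain d1 where d1: "d1 > 0" "\<And>h. norm h < d1 \<Longrightarrow>
          \<bar>f (x + (\<Sum>b\<in>S. (h \<bullet> b) *\<^sub>R b)) - f x - (\<Sum>b\<in>S. (h \<bullet> b) * (D x \<bullet> b))\<bar> \<le> (e/2) * norm h"
        by blast
      have "isCont D x" using cont by (simp add: continuous_on_eq_continuous_at)
      from this[unfolded continuous_at_eps_delta, rule_format, OF e2] obtain d2
        where d2: "d2 > 0" "\<And>y. dist y x < d2 \<Longrightarrow> dist (D y) (D x) < e/2" by blast
      \<comment> \<open>All points met on the path lie within (card S + 1) |h| of \<open>x\<close>,
        hence the radius \<open>d2 / c\<close>.\<close>
      define c where "c = real (card S) + 1"
      have c: "c > 0" by (simp add: c_def)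
      show "\<exists>d>0. \<forall>h. norm h < d \<longrightarrow>
        \<bar>f (x + (\<Sum>b\<in>insert b S. (h \<bullet> b) *\<^sub>R b)) - f x - (\<Sum>b\<in>insert b S. (h \<bullet> b) * (D x \<bullet> b))\<bar> \<le> e * norm h"
      proof (intro exI[of _ "min d1 (d2 / c)"] conjI allI impI)
        fix h :: 'a assume h: "norm h < min d1 (d2 / c)"
        define P where "P = (\<Sum>b\<in>S. (h \<bullet> b) *\<^sub>R b)"
        define s where "s = h \<bullet> b"
        have hb: "\<bar>h \<bullet> b'\<bar> \<le> norm h" if "b' \<in> Basis" for b' using Basis_le_norm[OF that] .
        have nP: "norm P \<le> real (card S) * norm h"
        proof -
          have "norm P \<le> (\<Sum>b\<in>S. norm ((h \<bullet> b) *\<^sub>R b))" unfolding P_def by (rule norm_sum)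
          also have "\<dots> \<le> (\<Sum>b\<in>S. norm h)"
          proof (rule sum_mono)
            fix b' assume "b' \<in> S"
            then have "b' \<in> Basis" using insert.prems by auto
            then show "norm ((h \<bullet> b') *\<^sub>R b') \<le> norm h" using hb by simp
          qed
          finally show ?thesis by simp
        qed
        define \<phi> where "\<phi> t = f (x + P + t *\<^sub>R b)" for t
        have d\<phi>: "(\<phi> has_real_derivative D (x + P + t *\<^sub>R b) \<bullet> b) (at t)" for t
        proof -
          have "((\<lambda>s. \<phi> (s + t)) has_real_derivative D (x + P + t *\<^sub>R b) \<bullet> b) (at 0)"
            using der[OF b, of "x + P + t *\<^sub>R b"] by (simp add: \<phi>_def algebra_simps)
          then show ?thesis using DERIV_shift[of \<phi> "D (x + P + t *\<^sub>R b) \<bullet> b" 0 t] by simp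
        qed
        obtain z where z: "\<bar>z\<bar> \<le> \<bar>s\<bar>" "\<phi> s - \<phi> 0 = s * (D (x + P + z *\<^sub>R b) \<bullet> b)"
        proof -
          consider "s = 0" | "0 < s" | "s < 0" by linarith
          then show thesis
          proof cases
            case 1 then show thesis using that[of 0] by simp
          next
            case 2
            from MVT2[OF 2, of \<phi> "\<lambda>t. D (x + P + t *\<^sub>R b) \<bullet> b"] d\<phi> obtain z where
              "0 < z" "z < s" "\<phi> s - \<phi> 0 = (s - 0) * (D (x + P + z *\<^sub>R b) \<bullet> b)" by blast
            then show thesis using that[of z] by simp
          next
            case 3
            from MVT2[OF 3, of \<phi> "\<lambda>t. D (x + P + t *\<^sub>R b) \<bullet> b"] d\<phi> obtain z where
              "s < z" "z < 0" "\<phi> 0 - \<phi> s = (0 - s) * (D (x + P + z *\<^sub>R b) \<bullet> b)" by blast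
            then show thesis using that[of z] by (simp add: algebra_simps)
          qed
        qed
        have "norm (P + z *\<^sub>R b) \<le> norm P + norm (z *\<^sub>R b)" by (rule norm_triangle_ineq)
        also have "\<dots> \<le> real (card S) * norm h + norm h"
          using nP z(1) hb[OF b] b by (intro add_mono) (auto simp: s_def)
        also have "\<dots> = norm h * c" by (simp add: c_def algebra_simps)
        also have "\<dots> < d2" using h c by (simp add: pos_less_divide_eq)
        finally have "dist (x + P + z *\<^sub>R b) x < d2" by (simp add: dist_norm add.assoc)
        from d2(2)[OF this] have Dz: "norm (D (x + P + z *\<^sub>R b) - D x) < e/2" by (simp add: dist_norm)
        have "\<bar>\<phi> s - \<phi> 0 - s * (D x \<bullet> b)\<bar> = \<bar>s\<bar> * \<bar>(D (x + P + z *\<^sub>R b) - D x) \<bullet> b\<bar>"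
          unfolding z(2) by (simp add: inner_diff_left abs_mult[symmetric] algebra_simps)
        also have "\<dots> \<le> norm h * (e/2)"
        proof (rule mult_mono)
          show "\<bar>s\<bar> \<le> norm h" unfolding s_def by (rule hb[OF b])
          show "\<bar>(D (x + P + z *\<^sub>R b) - D x) \<bullet> b\<bar> \<le> e/2" using Basis_le_norm[OF b, of "D (x + P + z *\<^sub>R b) - D x"] Dz by linarith
        qed auto
        finally have 1: "\<bar>\<phi> s - \<phi> 0 - s * (D x \<bullet> b)\<bar> \<le> norm h * (e/2)" .
        have 2: "\<bar>f (x + P) - f x - (\<Sum>b\<in>S. (h \<bullet> b) * (D x \<bullet> b))\<bar> \<le> (e/2) * norm h"
          using d1(2)[of h] h unfolding P_def by simp
        have q1: "f (x + (\<Sum>b\<in>insert b S. (h \<bullet> b) *\<^sub>R b)) = \<phi> s"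
          using insert.hyps by (simp add: \<phi>_def P_def s_def add_ac)
        have q2: "f (x + P) = \<phi> 0" by (simp add: \<phi>_def)
        have q3: "(\<Sum>b\<in>insert b S. (h \<bullet> b) * (D x \<bullet> b)) = s * (D x \<bullet> b) + (\<Sum>b\<in>S. (h \<bullet> b) * (D x \<bullet> b))"
          using insert.hyps by (simp add: s_def)
        show "\<bar>f (x + (\<Sum>b\<in>insert b S. (h \<bullet> b) *\<^sub>R b)) - f x - (\<Sum>b\<in>insert b S. (h \<bullet> b) * (D x \<bullet> b))\<bar> \<le> e * norm h"
          unfolding q1 q3
        proof -
          define T where "T = (\<Sum>b\<in>S. (h \<bullet> b) * (D x \<bullet> b))"
          have "\<phi> s - f x - (s * (D x \<bullet> b) + T) = (\<phi> s - \<phi> 0 - s * (D x \<bullet> b)) + (\<phi> 0 - f x - T)" by simp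
          then have "\<bar>\<phi> s - f x - (s * (D x \<bullet> b) + T)\<bar> \<le> \<bar>\<phi> s - \<phi> 0 - s * (D x \<bullet> b)\<bar> + \<bar>\<phi> 0 - f x - T\<bar>"
            by (simp only: abs_triangle_ineq)
          also have "\<dots> \<le> norm h * (e/2) + (e/2) * norm h" using 1 2[unfolded q2, folded T_def] by (rule add_mono)
          also have "\<dots> = e * norm h" by (simp add: field_simps)
          finally show "\<bar>\<phi> s - f x - (s * (D x \<bullet> b) + (\<Sum>b\<in>S. (h \<bullet> b) * (D x \<bullet> b)))\<bar> \<le> e * norm h"
            unfolding T_def .
        qed
      qed (use d1 d2 c in auto)
    qed
  qed
  show ?thesis unfolding gderiv_def has_derivative_at_alt
  proof (intro conjI allI impI)
    show "bounded_linear (\<lambda>h. h \<bullet> D x)" by (rule bounded_linear_inner_left)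
    fix e :: real assume "e > 0"
    then obtain d where d: "d > 0" "\<And>h. norm h < d \<Longrightarrow>
      \<bar>f (x + (\<Sum>b\<in>Basis. (h \<bullet> b) *\<^sub>R b)) - f x - (\<Sum>b\<in>Basis. (h \<bullet> b) * (D x \<bullet> b))\<bar> \<le> e * norm h"
      using main[OF finite_Basis] by blast
    show "\<exists>d>0. \<forall>y. norm (y - x) < d \<longrightarrow> norm (f y - f x - (y - x) \<bullet> D x) \<le> e * norm (y - x)"
    proof (intro exI[of _ d] conjI allI impI)
      fix y assume "norm (y - x) < d"
      from d(2)[OF this] show "norm (f y - f x - (y - x) \<bullet> D x) \<le> e * norm (y - x)"
        by (simp add: euclidean_representation euclidean_inner[of "y - x" "D x"])
    qed (use d in auto)
  qed
qed

lemma GDERIV_partial: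
  assumes "GDERIV f x :> D"
  shows "((\<lambda>t. f (x + t *\<^sub>R b)) has_real_derivative D \<bullet> b) (at 0)"
proof -
  have "(f has_derivative (\<lambda>h. h \<bullet> D)) (at (x + 0 *\<^sub>R b))" using assms by (simp add: gderiv_def)
  moreover have "((\<lambda>t. x + t *\<^sub>R b) has_derivative (\<lambda>t. t *\<^sub>R b)) (at 0)"
    by (auto intro!: derivative_eq_intros)
  ultimately have "((\<lambda>t. f (x + t *\<^sub>R b)) has_derivative (\<lambda>t. (t *\<^sub>R b) \<bullet> D)) (at 0)"
    using diff_chain_at[of "\<lambda>t. x + t *\<^sub>R b" "\<lambda>t. t *\<^sub>R b" 0 f "\<lambda>h. h \<bullet> D"] by (simp add: o_def)
  moreover have "(\<lambda>t. (t *\<^sub>R b) \<bullet> D) = (*) (D \<bullet> b)" by (auto simp: inner_commute)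
  ultimately show ?thesis by (simp add: has_field_derivative_def)
qed

lemma partial_deriv_eq:
  assumes "GDERIV f x :> D"
  shows "partial_deriv i f x = D \<bullet> axis i 1"
  unfolding partial_deriv_def by (rule DERIV_imp_deriv[OF GDERIV_partial[OF assms]])

lemma grad_inner: "grad f x \<bullet> axis i 1 = partial_deriv i f x"
  by (simp add: grad_def inner_axis)

lemma grad_eq:
  assumes "C1 f G" shows "grad f = G"
proof
  fix x show "grad f x = G x"
    unfolding grad_def using partial_deriv_eq[OF C1_D(1)[OF assms, of x]]
    by (simp add: vec_eq_iff inner_axis)
qed

text \<open>The family in the definition of \<open>smooth_fun\<close> contains \<open>f\<close> and
  its partial derivatives, all of them continuous, so the criterion by continuous partial
  derivatives applies.\<close>

lemma smooth_fun_C1: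
  assumes "smooth_fun (f :: real^'n \<Rightarrow> real)"
  shows "C1 f (grad f)"
proof -
  obtain F where F: "f \<in> F" "\<And>g. g \<in> F \<Longrightarrow> continuous_on UNIV g"
    "\<And>g i x. g \<in> F \<Longrightarrow> ((\<lambda>t. g (x + t *\<^sub>R axis i 1)) has_real_derivative partial_deriv i g x) (at 0)"
    "\<And>g i. g \<in> F \<Longrightarrow> partial_deriv i g \<in> F"
    using assms unfolding smooth_fun_def by blast
  have cont: "continuous_on UNIV (grad f)"
    unfolding grad_def[abs_def] by (intro continuous_on_vec_lambda F(2) F(4) F(1))
  have "GDERIV f x :> grad f x" for x
  proof (rule GDERIV_partials[OF _ cont])
    fix b :: "real^'n" and x assume "b \<in> Basis"
    then obtain i where "b = axis i 1" by (auto simp: Basis_vec_def)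
    then show "((\<lambda>t. f (x + t *\<^sub>R b)) has_real_derivative grad f x \<bullet> b) (at 0)"
      using F(3)[OF F(1)] by (simp add: grad_inner)
  qed
  then show ?thesis using cont by (simp add: C1_def)
qed

lemma smooth_fun_partial: "smooth_fun g \<Longrightarrow> smooth_fun (partial_deriv i g)"
  unfolding smooth_fun_def by blast

lemma test_fun_C1c:
  assumes "test_fun \<Omega> \<phi>"
  shows "C1c \<Omega> \<phi> (grad \<phi>)"
proof -
  have "\<phi> x = 0" if "x \<notin> tsupp \<phi>" for x
    using that closure_subset[of "{x. \<phi> x \<noteq> 0}"] unfolding tsupp_def by auto
  then show ?thesis using assms smooth_fun_C1[of \<phi>] unfolding test_fun_def C1c_def by blast
qed

text \<open>The family closed under partial derivatives is that of all a g(c x) with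
  \<open>c\<close> fixed, \<open>a\<close> arbitrary and \<open>g\<close> smooth: differentiation
  multiplies \<open>a\<close> by \<open>c\<close> and replaces \<open>g\<close> by a partial
  derivative.\<close>

lemma smooth_fun_scale:
  fixes g :: "real^'n \<Rightarrow> real"
  assumes "smooth_fun g"
  shows "smooth_fun (\<lambda>x. a * g (c *\<^sub>R x))"
proof -
  define F where "F = {(\<lambda>x::real^'n. a * g (c *\<^sub>R x)) | a g. smooth_fun g}"
  have der: "C1 (\<lambda>x. a * g (c *\<^sub>R x)) (\<lambda>x. (a * c) *\<^sub>R grad g (c *\<^sub>R x))" if "smooth_fun g" for a and g :: "real^'n \<Rightarrow> real"
  proof -
    note g = smooth_fun_C1[OF that]
    have "GDERIV (\<lambda>x. a * g (c *\<^sub>R x)) x :> (a * c) *\<^sub>R grad g (c *\<^sub>R x)" for x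
    proof -
      have "(g has_derivative (\<lambda>h. h \<bullet> grad g (c *\<^sub>R x))) (at (c *\<^sub>R x))" using C1_D(1)[OF g] by (simp add: gderiv_def)
      moreover have "((\<lambda>x. c *\<^sub>R x) has_derivative (\<lambda>h. c *\<^sub>R h)) (at x)" by (auto intro!: derivative_eq_intros)
      ultimately have "((\<lambda>x. g (c *\<^sub>R x)) has_derivative (\<lambda>h. (c *\<^sub>R h) \<bullet> grad g (c *\<^sub>R x))) (at x)"
        using diff_chain_at[of "\<lambda>x. c *\<^sub>R x" "\<lambda>h. c *\<^sub>R h" x g "\<lambda>h. h \<bullet> grad g (c *\<^sub>R x)"] by (simp add: o_def)
      from has_derivative_mult_right[OF this, of a] show ?thesis by (simp add: gderiv_def mult_ac)
    qed
    then show ?thesis using C1_D(2)[OF g] unfolding C1_def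
      by (auto intro!: continuous_intros continuous_on_compose2[of UNIV "grad g" UNIV "\<lambda>x. c *\<^sub>R x"])
  qed
  show ?thesis unfolding smooth_fun_def
  proof (intro exI[of _ F] conjI ballI allI)
    show "(\<lambda>x. a * g (c *\<^sub>R x)) \<in> F" unfolding F_def using assms by blast
    fix h assume "h \<in> F"
    then obtain a g where h: "h = (\<lambda>x. a * g (c *\<^sub>R x))" "smooth_fun g" unfolding F_def by blast
    note C = der[OF h(2), of a, folded h(1)]
    show "continuous_on UNIV h" by (rule C1_D(3)[OF C])
    fix i
    show "((\<lambda>t. h (x + t *\<^sub>R axis i 1)) has_real_derivative partial_deriv i h x) (at 0)" for x
      using GDERIV_partial[OF C1_D(1)[OF C, of x]] partial_deriv_eq[OF C1_D(1)[OF C, of x]] by simp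
    have "partial_deriv i h = (\<lambda>x. (a * c) * partial_deriv i g (c *\<^sub>R x))"
      using partial_deriv_eq[OF C1_D(1)[OF C]] by (auto simp: grad_inner)
    then show "partial_deriv i h \<in> F" unfolding F_def using smooth_fun_partial[OF h(2)] by blast
  qed
qed

lemma partial_deriv_zero:
  fixes g :: "real^'n \<Rightarrow> real"
  assumes "smooth_fun g" "closed K" "\<And>x. x \<notin> K \<Longrightarrow> g x = 0" "x \<notin> K"
  shows "partial_deriv i g x = 0"
  using C1_grad_zero[OF smooth_fun_C1[OF assms(1)] assms(2,3,4)] grad_inner[of g x i] by simp

text \<open>The closed family is the image under \<open>conv f\<close> of the smooth functions that
  vanish off the fixed set \<open>K\<close>. Derivatives fall on the second factor and keep
  \<open>K\<close>, so integrability of \<open>f\<close> is enough.\<close>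

lemma smooth_fun_conv:
  fixes g :: "real^'n \<Rightarrow> real"
  assumes f: "integrable lborel f" and g: "smooth_fun g" and K: "compact K" "\<And>x. x \<notin> K \<Longrightarrow> g x = 0"
  shows "smooth_fun (conv f g)"
proof -
  define F0 where "F0 = {g :: real^'n \<Rightarrow> real. smooth_fun g \<and> (\<forall>x. x \<notin> K \<longrightarrow> g x = 0)}"
  have C: "C1c UNIV g (grad g)" if "g \<in> F0" for g
    unfolding C1c_def using that smooth_fun_C1[of g] K(1) unfolding F0_def by blast
  have pd: "partial_deriv i g \<in> F0" if "g \<in> F0" for g i
    using that smooth_fun_partial[of g i] partial_deriv_zero[of g K _ i] compact_imp_closed[OF K(1)] unfolding F0_def by blast
  show ?thesis unfolding smooth_fun_def
  proof (intro exI[of _ "conv f ` F0"] conjI ballI allI)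
    show "conv f g \<in> conv f ` F0" using g K(2) unfolding F0_def by blast
    fix h assume "h \<in> conv f ` F0"
    then obtain g where h: "h = conv f g" "g \<in> F0" by blast
    note Cg = C[OF h(2)]
    note Ch = C1_conv[OF f Cg, folded h(1)]
    show "continuous_on UNIV h" by (rule C1_D(3)[OF Ch])
    fix i
    show "((\<lambda>t. h (x + t *\<^sub>R axis i 1)) has_real_derivative partial_deriv i h x) (at 0)" for x
      using GDERIV_partial[OF C1_D(1)[OF Ch, of x]] partial_deriv_eq[OF C1_D(1)[OF Ch, of x]] by simp
    have "partial_deriv i h x = conv f (partial_deriv i g) x" for x
    proof -
      obtain Q where Q: "compact Q" "\<And>x. x \<notin> Q \<Longrightarrow> grad g x = 0" using Cg by (auto elim: C1c_obtain)
      obtain M where M: "\<And>x. norm (grad g x) \<le> M"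
        using compact_support_bounded'[OF C1_D(2)[OF C1c_C1[OF Cg]] Q] by auto
      have i: "integrable lborel (\<lambda>y. f y *\<^sub>R grad g (x - y))"
        by (rule conv_integrable[OF f C1_D(2)[OF C1c_C1[OF Cg]] M])
      have "partial_deriv i h x = conv f (grad g) x \<bullet> axis i 1" by (rule partial_deriv_eq[OF C1_D(1)[OF Ch]])
      also have "\<dots> = (\<integral>y. (f y *\<^sub>R grad g (x - y)) \<bullet> axis i 1 \<partial>lborel)" unfolding conv_def using i by (intro integral_inner_left[symmetric]) simp
      also have "\<dots> = conv f (partial_deriv i g) x" by (simp add: conv_def grad_inner)
      finally show ?thesis .
    qed
    then have "partial_deriv i h = conv f (partial_deriv i g)" by blast
    then show "partial_deriv i h \<in> conv f ` F0" using pd[OF h(2)] by blast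
  qed
qed

section \<open>Smooth kernels and the passage from smooth to C^1 tests\<close>

locale smooth_mollifier = mollifier k k' C r
  for k :: "nat \<Rightarrow> real^'n \<Rightarrow> real" and k' C r +
  assumes smooth: "smooth_fun (k n)"

text \<open>Dilations of \<rho> divided by its integral. If \<rho> vanishes beyond the radius
  \<open>A\<close>, the dilation by c n = A (n + 1) has support of radius 1 / (n + 1); with the
  factor c n ^ N the mass of the kernel is unchanged, and that of its gradient gains the factor c
  n.\<close>

lemma smooth_mollifier_exists:
  fixes \<rho> :: "real^'n \<Rightarrow> real"
  assumes \<rho>: "test_fun \<Omega> \<rho>" and I: "(\<integral>x. \<rho> x \<partial>lborel) \<noteq> 0"
  obtains k k' C r where "smooth_mollifier (k :: nat \<Rightarrow> real^'n \<Rightarrow> real) k' C r"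
proof -
  define I0 where "I0 = (\<integral>x. \<rho> x \<partial>lborel)"
  have I0: "I0 \<noteq> 0" using I by (simp add: I0_def)
  note C = test_fun_C1c[OF \<rho>]
  note C1 = C1c_C1[OF C]
  obtain K where K: "compact K" "\<And>x. x \<notin> K \<Longrightarrow> \<rho> x = 0" using C by (auto elim: C1c_obtain)
  obtain A where A: "A > 0" "\<And>x. x \<in> K \<Longrightarrow> norm x \<le> A"
    using compact_imp_bounded[OF K(1)] unfolding bounded_pos by blast
  have \<rho>0: "\<rho> x = 0" if "norm x > A" for x using K(2) A(2) that by (metis not_le)
  have \<rho>i: "integrable lborel \<rho>" "integrable lborel (grad \<rho>)" by (rule C1c_integrable[OF C])+
  define c where "c n = A * real (Suc n)" for n
  have c: "c n > 0" for n using A by (simp add: c_def)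
  define N where "N = DIM(real^'n)"
  define k where "k n x = (c n ^ N / I0) * \<rho> (c n *\<^sub>R x)" for n x
  define k' where "k' n x = ((c n ^ N / I0) * c n) *\<^sub>R grad \<rho> (c n *\<^sub>R x)" for n x
  define r where "r n = 1 / real (Suc n)" for n
  \<comment> \<open>One constant for the mass of the kernel and for that of its gradient; the factor
    \<open>A\<close> in the second comes from c n = A / r n.\<close>
  define CC where "CC = max ((\<integral>x. \<bar>\<rho> x\<bar> \<partial>lborel) / \<bar>I0\<bar>) (A * (\<integral>x. norm (grad \<rho> x) \<partial>lborel) / \<bar>I0\<bar>)"
  have sc: "(\<integral>x. f (c n *\<^sub>R x) \<partial>lborel) = (\<integral>x. f x \<partial>lborel) / c n ^ N" if "integrable lborel f" for f :: "real^'n \<Rightarrow> real" and n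
    using integral_lborel_affine[OF that, of "c n" 0] c[of n] by (simp add: N_def field_simps)
  have "smooth_mollifier k k' CC r"
  proof unfold_locales
    fix n
    show sm: "smooth_fun (k n)"
      unfolding k_def[abs_def] using \<rho> by (intro smooth_fun_scale) (simp add: test_fun_def)
    show "C1 (k n) (k' n)"
    proof -
      have "GDERIV (k n) x :> k' n x" for x
      proof -
        have "(\<rho> has_derivative (\<lambda>h. h \<bullet> grad \<rho> (c n *\<^sub>R x))) (at (c n *\<^sub>R x))" using C1_D(1)[OF C1] by (simp add: gderiv_def)
        moreover have "((\<lambda>x. c n *\<^sub>R x) has_derivative (\<lambda>h. c n *\<^sub>R h)) (at x)" by (auto intro!: derivative_eq_intros)
        ultimately have "((\<lambda>x. \<rho> (c n *\<^sub>R x)) has_derivative (\<lambda>h. (c n *\<^sub>R h) \<bullet> grad \<rho> (c n *\<^sub>R x))) (at x)"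
          using diff_chain_at[of "\<lambda>x. c n *\<^sub>R x" "\<lambda>h. c n *\<^sub>R h" x \<rho> "\<lambda>h. h \<bullet> grad \<rho> (c n *\<^sub>R x)"] by (simp add: o_def)
        from has_derivative_mult_right[OF this, of "c n ^ N / I0"] show ?thesis
          unfolding k_def[abs_def] k'_def by (simp add: gderiv_def mult_ac)
      qed
      then show ?thesis using C1_D(2)[OF C1] unfolding C1_def k'_def[abs_def]
        by (auto intro!: continuous_intros continuous_on_compose2[of UNIV "grad \<rho>" UNIV "\<lambda>x. c n *\<^sub>R x"])
    qed
    show "k n x = 0" if "norm x > r n" for x
    proof -
      have "A < norm (c n *\<^sub>R x)"
      proof -
        have "A * 1 < A * (real (Suc n) * norm x)" using that A by (intro mult_strict_left_mono) (auto simp: r_def field_simps)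
        then show ?thesis using A by (simp add: c_def mult_ac)
      qed
      then show ?thesis using \<rho>0 by (simp add: k_def)
    qed
    show "(\<integral>x. k n x \<partial>lborel) = 1"
      unfolding k_def using sc[OF \<rho>i(1), of n] I0 c[of n] by (simp add: I0_def[symmetric])
    have "(\<integral>x. \<bar>k n x\<bar> \<partial>lborel) = (\<integral>x. \<bar>\<rho> x\<bar> \<partial>lborel) / \<bar>I0\<bar>"
      unfolding k_def abs_mult using sc[OF integrable_abs[OF \<rho>i(1)], of n] c[of n] by simp
    then show "(\<integral>x. \<bar>k n x\<bar> \<partial>lborel) \<le> CC" by (simp add: CC_def)
    have "(\<integral>x. norm (k' n x) \<partial>lborel) = (A * (\<integral>x. norm (grad \<rho> x) \<partial>lborel) / \<bar>I0\<bar>) * real (Suc n)"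
      unfolding k'_def norm_scaleR abs_mult using sc[OF integrable_norm[OF \<rho>i(2)], of n] c[of n] A by (simp add: c_def)
    also have "\<dots> \<le> CC * real (Suc n)" unfolding CC_def by (intro mult_right_mono) auto
    also have "\<dots> = CC / r n" by (simp add: r_def)
    finally show "(\<integral>x. norm (k' n x) \<partial>lborel) \<le> CC / r n" .
    show "r n > 0" by (simp add: r_def)
    show "r \<longlonglongrightarrow> 0" unfolding r_def[abs_def] using LIMSEQ_inverse_real_of_nat by (simp add: inverse_eq_divide)
  qed
  then show ?thesis by (rule that)
qed

context smooth_mollifier
begin

lemma conv_test_fun:
  assumes \<phi>: "C1c \<Omega> \<phi> G" and \<Omega>: "open \<Omega>"
  shows "\<forall>\<^sub>F n in sequentially. test_fun \<Omega> (conv (k n) \<phi>)"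
proof -
  obtain K where K: "compact K" "K \<subseteq> \<Omega>" "\<And>x. x \<notin> K \<Longrightarrow> \<phi> x = 0" using \<phi> by (auto elim: C1c_obtain)
  obtain d where d: "d > 0" "\<And>x. x \<in> K \<Longrightarrow> cball x d \<subseteq> \<Omega>" using compact_open_margin[OF K(1) \<Omega> K(2)] by auto
  define K2 where "K2 = {x + y | x y. x \<in> K \<and> y \<in> cball 0 d}"
  have K2: "compact K2" unfolding K2_def by (rule compact_nbhd[OF K(1)])
  have K2\<Omega>: "K2 \<subseteq> \<Omega>"
  proof
    fix z assume "z \<in> K2"
    then obtain a b where "z = a + b" "a \<in> K" "norm b \<le> d" unfolding K2_def by auto
    then show "z \<in> \<Omega>" using d(2)[of a] by (auto simp: dist_norm)
  qed
  have i: "integrable lborel \<phi>" by (rule C1c_integrable(1)[OF \<phi>])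
  have "\<forall>\<^sub>F n in sequentially. r n < d" using r_lim d(1) by (intro order_tendstoD) auto
  then show ?thesis
  proof eventually_elim
    case (elim n)
    have "conv (k n) \<phi> x = 0" if "x \<notin> K2" for x
    proof -
      have "k n y *\<^sub>R \<phi> (x - y) = 0" for y
      proof (cases "norm y \<le> r n")
        case True
        have "x - y \<notin> K"
        proof
          assume "x - y \<in> K"
          then have "x \<in> K2" unfolding K2_def using True elim
            by (intro CollectI exI[of _ "x - y"] exI[of _ y]) auto
          from that this show False by (rule notE)
        qed
        then show ?thesis using K(3) by simp
      qed (use k_supp in auto)
      then show ?thesis unfolding conv_def by (simp only: integral_zero)
    qed
    then have "{x. conv (k n) \<phi> x \<noteq> 0} \<subseteq> K2" by blast
    then have sub: "tsupp (conv (k n) \<phi>) \<subseteq> K2"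
      unfolding tsupp_def using compact_imp_closed[OF K2] by (rule closure_minimal)
    have "compact (tsupp (conv (k n) \<phi>))"
      using compact_Int_closed[OF K2, of "tsupp (conv (k n) \<phi>)"] sub by (simp add: tsupp_def Int_absorb1)
    moreover have "smooth_fun (conv (k n) \<phi>)"
      unfolding conv_sym[OF i] by (rule smooth_fun_conv[OF i smooth compact_cball k_supp'])
    ultimately show ?case using sub K2\<Omega> by (auto simp: test_fun_def)
  qed
qed

text \<open>Mollifying a C^1 test gives smooth tests that are eventually supported in \<Omega> and
  whose gradients are mollifications of \<open>G\<close>. Since \<phi> and \<open>G\<close> are
  bounded, the integrals against the integrable \<open>F\<close> and \<open>R\<close>
  converge.\<close>

lemma weak_div_extend:
  fixes \<Omega> :: "(real^'n) set" and F :: "real^'n \<Rightarrow> real^'n" and R :: "real^'n \<Rightarrow> real"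
  assumes \<Omega>: "open \<Omega>" and F: "integrable lborel F" and R: "integrable lborel R"
    and eq: "\<And>\<phi>. test_fun \<Omega> \<phi> \<Longrightarrow> (\<integral>x. F x \<bullet> grad \<phi> x \<partial>lborel) = (\<integral>x. R x * \<phi> x \<partial>lborel)"
  shows "weak_div \<Omega> F R"
  unfolding weak_div_def
proof (intro allI impI)
  fix \<phi> G assume \<phi>: "C1c \<Omega> \<phi> G"
  have \<phi>U: "C1c UNIV \<phi> G" using C1c_subset[OF \<phi>] by simp
  obtain K where K: "compact K" "\<And>x. x \<notin> K \<Longrightarrow> \<phi> x = 0" "\<And>x. x \<notin> K \<Longrightarrow> G x = 0" using \<phi> by (auto elim: C1c_obtain)
  obtain M1 where M1: "\<And>x. norm (\<phi> x) \<le> M1" using compact_support_bounded'[OF C1_D(3)[OF C1c_C1[OF \<phi>]] K(1,2)] by auto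
  obtain M2 where M2: "\<And>x. norm (G x) \<le> M2" using compact_support_bounded'[OF C1_D(2)[OF C1c_C1[OF \<phi>]] K(1,3)] by auto
  have i: "integrable lborel \<phi>" "integrable lborel G" by (rule C1c_integrable[OF \<phi>])+
  have [measurable]: "F \<in> borel_measurable borel" "R \<in> borel_measurable borel" "\<phi> \<in> borel_measurable borel" "G \<in> borel_measurable borel"
    using F R i by auto
  have gr: "grad (conv (k n) \<phi>) = conv (k n) G" for n
    by (rule grad_eq[OF C1_conv[OF k_integrable(1) \<phi>U]])
  have ev: "\<forall>\<^sub>F n in sequentially. (\<integral>x. F x \<bullet> conv (k n) G x \<partial>lborel) = (\<integral>x. R x * conv (k n) \<phi> x \<partial>lborel)"
    using conv_test_fun[OF \<phi> \<Omega>]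
  proof eventually_elim
    case (elim n)
    show ?case using eq[OF elim] unfolding gr .
  qed
  have lim1: "(\<lambda>n. \<integral>x. F x \<bullet> conv (k n) G x \<partial>lborel) \<longlonglongrightarrow> (\<integral>x. F x \<bullet> G x \<partial>lborel)"
  proof (rule wlim_integral)
    show "wlim (\<lambda>x. norm (F x)) (\<lambda>n. conv (k n) G) G"
      using F i M2 by (intro wlim_conv tcont_bounded[where M=M2]) auto
    show "integrable lborel (\<lambda>x. F x \<bullet> G x)" by (rule integrable_inner_bounded[OF F _ M2]) measurable
  qed auto
  have lim2: "(\<lambda>n. \<integral>x. R x \<bullet> conv (k n) \<phi> x \<partial>lborel) \<longlonglongrightarrow> (\<integral>x. R x \<bullet> \<phi> x \<partial>lborel)"
  proof (rule wlim_integral)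
    show "wlim R (\<lambda>n. conv (k n) \<phi>) \<phi>"
      using R i M1 by (intro wlim_conv tcont_bounded[where M=M1]) auto
    show "integrable lborel (\<lambda>x. R x \<bullet> \<phi> x)" by (rule integrable_inner_bounded[OF R _ M1]) measurable
  qed auto
  have "(\<lambda>n. \<integral>x. F x \<bullet> conv (k n) G x \<partial>lborel) \<longlonglongrightarrow> (\<integral>x. R x \<bullet> \<phi> x \<partial>lborel)"
    by (rule Lim_transform_eventually[OF lim2]) (use ev in \<open>eventually_elim, simp\<close>)
  from LIMSEQ_unique[OF lim1 this]
  show "(\<integral>x. F x \<bullet> G x \<partial>lborel) = (\<integral>x. R x * \<phi> x \<partial>lborel)" by simp
qed

end

section \<open>Borel representatives and weak gradients of limits of test functions\<close>

lemma AE_eq_lebesgue_measurable: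
  fixes f f' :: "'a::euclidean_space \<Rightarrow> 'b::euclidean_space"
  assumes f': "f' \<in> borel_measurable borel" and ae: "AE x in lborel. f x = f' x"
  shows "f \<in> borel_measurable lebesgue"
proof (rule measurableI)
  fix A :: "'b set" assume A: "A \<in> sets borel"
  obtain N where N: "{x. f x \<noteq> f' x} \<subseteq> N" "N \<in> null_sets lborel"
    using ae unfolding eventually_ae_filter by auto
  have "f' -` A \<in> sets borel" using measurable_sets[OF f' A] by simp
  moreover have "N \<in> sets borel" using null_setsD2[OF N(2)] by simp
  ultimately have "f' -` A \<inter> - N \<in> sets lborel" by auto
  then have 1: "f' -` A \<inter> - N \<in> sets lebesgue" by (rule sets_completionI_sets)
  have "f -` A \<inter> N \<in> null_sets lebesgue"
    by (rule null_sets_completion_subset[of _ N]) (use N(2) in \<open>auto intro: null_sets_completionI\<close>)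
  then have 2: "f -` A \<inter> N \<in> sets lebesgue" by (rule null_setsD2)
  have "f -` A \<inter> space lebesgue = (f' -` A \<inter> - N) \<union> (f -` A \<inter> N)"
    using N(1) by (auto simp: subset_iff) metis+
  then show "f -` A \<inter> space lebesgue \<in> sets lebesgue" by (simp only: sets.Un[OF 1 2])
qed simp

text \<open>The eigenvalue problem is formulated with Lebesgue measurable functions, the analysis
  with Borel functions and \<open>lborel\<close>. A Borel function that agrees almost everywhere
  carries integrals and integrability across, nonintegrable cases included.\<close>

lemma lebesgue_transfer:
  fixes f f' :: "'a::euclidean_space \<Rightarrow> 'b::euclidean_space"
  assumes f': "f' \<in> borel_measurable borel" and ae: "AE x in lborel. f x = f' x"
  shows "integral\<^sup>L lebesgue f = integral\<^sup>L lborel f'" "integrable lebesgue f \<longleftrightarrow> integrable lborel f'"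
proof -
  have f: "f \<in> borel_measurable lebesgue" by (rule AE_eq_lebesgue_measurable[OF f' ae])
  have f'2: "f' \<in> borel_measurable lborel" using f' by simp
  have ae': "AE x in lebesgue. f x = f' x" using ae by (rule AE_completion)
  show "integral\<^sup>L lebesgue f = integral\<^sup>L lborel f'"
    unfolding integral_completion[OF f'2, symmetric]
    by (rule integral_cong_AE[OF f measurable_completion[OF f'2] ae'])
  show "integrable lebesgue f \<longleftrightarrow> integrable lborel f'"
    unfolding integrable_completion[OF f'2, symmetric]
    by (rule integrable_cong_AE[OF f measurable_completion[OF f'2] ae'])
qed

lemma lebesgue_borel_rep:
  fixes g :: "'a::euclidean_space \<Rightarrow> real^'n"
  assumes g: "g \<in> borel_measurable lebesgue"
  obtains g' where "g' \<in> borel_measurable borel" "AE x in lborel. g x = g' x"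
proof -
  have "\<exists>h. h \<in> borel_measurable lborel \<and> (AE x in lborel. g x $ i = h x)" for i
  proof -
    have "(\<lambda>x. g x \<bullet> axis i 1) \<in> borel_measurable lebesgue" using g by measurable
    then have "(\<lambda>x. g x $ i) \<in> borel_measurable lebesgue" by (simp add: inner_axis)
    from completion_ex_borel_measurable_real[OF this] show ?thesis by blast
  qed
  then obtain h where h: "\<And>i. h i \<in> borel_measurable lborel" "\<And>i. AE x in lborel. g x $ i = h i x" by metis
  define g' where "g' x = (\<Sum>i\<in>UNIV. h i x *\<^sub>R axis i (1::real))" for x
  have c: "g' x $ i = h i x" for x i
  proof -
    have "g' x $ i = (\<Sum>j\<in>UNIV. if j = i then h j x else 0)"
      unfolding g'_def sum_component by (rule sum.cong) (auto simp: axis_def)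
    then show ?thesis by simp
  qed
  have hb: "h i \<in> borel_measurable borel" for i using h(1)[of i] by simp
  note hb[measurable]
  have "g' \<in> borel_measurable borel" unfolding g'_def[abs_def] by measurable
  moreover have "AE x in lborel. \<forall>i. g x $ i = h i x"
    using h(2) by (subst AE_all_countable) auto
  then have "AE x in lborel. g x = g' x" by eventually_elim (simp add: vec_eq_iff c)
  ultimately show ?thesis by (rule that)
qed

text \<open>From weighted L^p to L^1 on a compact set where the weight is at least c. The elementary
  bound d \<le> t + t^(1-p) d^p takes the role of Hoelder's inequality: the first part is small by
  the choice of t, the second by the assumed convergence once t is fixed.\<close>

lemma wlim_weighted:
  fixes f :: "'a::euclidean_space \<Rightarrow> 'b::euclidean_space"
  assumes lim: "(\<lambda>n. \<integral>\<^sup>+x. w x * norm (g n x - f x) powr p \<partial>lborel) \<longlonglongrightarrow> 0"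
    and p: "p > 1" and [measurable]: "w \<in> borel_measurable borel" "\<And>n. g n \<in> borel_measurable borel" "f \<in> borel_measurable borel"
    and K: "compact K" and c: "c > 0" "\<And>x. x \<in> K \<Longrightarrow> c \<le> w x"
    and H: "\<And>x. \<bar>H x\<bar> \<le> M" "\<And>x. x \<notin> K \<Longrightarrow> H x = 0"
  shows "wlim H g f"
  unfolding wlim_def
proof (rule order_tendstoI)
  fix a :: ennreal assume a: "0 < a"
  obtain e where e: "e > 0" "ennreal e < a"
  proof (cases a)
    case (real s)
    then show ?thesis using a that[of "s/2"] by (auto simp: ennreal_less_iff)
  next
    case top
    then show ?thesis using that[of 1] by auto
  qed
  have M: "M \<ge> 0" using H(1)[of undefined] by linarith
  have [measurable]: "K \<in> sets borel" using K by (simp add: borel_compact)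
  define m where "m = measure lborel K"
  have m: "m \<ge> 0" "emeasure lborel K = ennreal m"
    using emeasure_bounded_finite[OF compact_imp_bounded[OF K]] by (auto simp: m_def emeasure_eq_ennreal_measure less_top)
  define t where "t = e / (2 * (M * m + 1))"
  have t: "t > 0" using e M m by (simp add: t_def add_nonneg_pos)
  define D where "D = M * t powr (1 - p) / c"
  have D: "D \<ge> 0" using M c by (simp add: D_def)
  have Mtm: "(M * t) * m \<le> e / 2"
  proof -
    have mm: "0 \<le> M * m" using M m by simp
    then have "M * m / (M * m + 1) \<le> 1" by simp
    then have "(e / 2) * (M * m / (M * m + 1)) \<le> (e / 2) * 1" using e by (intro mult_left_mono) auto
    moreover have "(M * t) * m = (e / 2) * (M * m / (M * m + 1))" by (simp add: t_def)
    ultimately show ?thesis by simp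
  qed
  have "(\<lambda>n. ennreal D * (\<integral>\<^sup>+x. w x * norm (g n x - f x) powr p \<partial>lborel)) \<longlonglongrightarrow> ennreal D * 0"
    by (intro ennreal_tendsto_cmult lim) auto
  then have "\<forall>\<^sub>F n in sequentially. ennreal D * (\<integral>\<^sup>+x. w x * norm (g n x - f x) powr p \<partial>lborel) < ennreal (e/2)"
    using e by (intro order_tendstoD) auto
  then show "\<forall>\<^sub>F n in sequentially. (\<integral>\<^sup>+x. \<bar>H x\<bar> * norm (g n x - f x) \<partial>lborel) < a"
  proof eventually_elim
    case (elim n)
    have "(\<integral>\<^sup>+x. \<bar>H x\<bar> * norm (g n x - f x) \<partial>lborel)
      \<le> (\<integral>\<^sup>+x. ennreal (M * t) * indicator K x + ennreal D * ennreal (w x * norm (g n x - f x) powr p) \<partial>lborel)"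
    proof (rule nn_integral_mono)
      fix x
      show "ennreal (\<bar>H x\<bar> * norm (g n x - f x)) \<le> ennreal (M * t) * indicator K x + ennreal D * ennreal (w x * norm (g n x - f x) powr p)"
      proof (cases "x \<in> K")
        case False
        then show ?thesis using H(2) by simp
      next
        case True
        define d where "d = norm (g n x - f x)"
        have d0: "d \<ge> 0" by (simp add: d_def)
        have "d \<le> t + t powr (1 - p) * d powr p"
        proof (cases "d \<le> t")
          case False
          then have "d = d powr (1 - p) * d powr p" using t by (simp add: powr_add[symmetric])
          also have "\<dots> \<le> t powr (1 - p) * d powr p"
            using False t p by (intro mult_right_mono powr_mono2') auto
          finally show ?thesis using t by linarith
        qed (use t in \<open>simp add: add_increasing2\<close>)
        then have "\<bar>H x\<bar> * d \<le> M * (t + t powr (1 - p) * d powr p)" using H(1)[of x] d0 M by (intro mult_mono) auto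
        also have "\<dots> = M * t + D * (c * d powr p)" using c(1) by (simp add: D_def distrib_left)
        also have "\<dots> \<le> M * t + D * (w x * d powr p)" using c(2)[OF True] D by (intro add_left_mono mult_left_mono mult_right_mono) auto
        finally have "ennreal (\<bar>H x\<bar> * d) \<le> ennreal (M * t + D * (w x * d powr p))" by (rule ennreal_leI)
        also have "\<dots> = ennreal (M * t) + ennreal D * ennreal (w x * d powr p)"
        proof -
          have "0 \<le> w x" using c True by (meson less_imp_le order_trans)
          then have nn: "0 \<le> w x * d powr p" by simp
          show ?thesis using nn D M t by (simp add: ennreal_mult)
        qed
        finally show ?thesis using True by (simp add: d_def)
      qed
    qed
    also have "\<dots> = ennreal (M * t) * ennreal m + ennreal D * (\<integral>\<^sup>+x. w x * norm (g n x - f x) powr p \<partial>lborel)"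
      by (subst nn_integral_add) (auto simp: nn_integral_cmult nn_integral_cmult_indicator m(2))
    also have "\<dots> \<le> ennreal (e/2) + ennreal (e/2)"
    proof (rule add_mono)
      have "ennreal (M * t) * ennreal m = ennreal ((M * t) * m)" using M t by (intro ennreal_mult'[symmetric]) simp
      then show "ennreal (M * t) * ennreal m \<le> ennreal (e/2)" using Mtm by (simp add: ennreal_leI)
      show "ennreal D * (\<integral>\<^sup>+x. w x * norm (g n x - f x) powr p \<partial>lborel) \<le> ennreal (e/2)" using elim by (rule less_imp_le)
    qed
    also have "\<dots> = ennreal (e/2 + e/2)" using e by (intro ennreal_plus[symmetric]) auto
    also have "\<dots> < a" using e by simp
    finally show ?case .
  qed
qed simp

lemma wlim_Lp:
  fixes f :: "'a::euclidean_space \<Rightarrow> 'b::euclidean_space"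
  assumes lim: "(\<lambda>n. \<integral>\<^sup>+x. norm (g n x - f x) powr p \<partial>lborel) \<longlonglongrightarrow> 0"
    and p: "p > 1" and [measurable]: "\<And>n. g n \<in> borel_measurable borel" "f \<in> borel_measurable borel" "F \<in> borel_measurable borel"
    and F: "integrable lborel (\<lambda>x. \<bar>F x\<bar> powr (p / (p - 1)))"
  shows "wlim F g f"
  unfolding wlim_def
proof (rule order_tendstoI)
  fix a :: ennreal assume a: "0 < a"
  obtain e where e: "e > 0" "ennreal e < a"
  proof (cases a)
    case (real s)
    then show ?thesis using a that[of "s/2"] by (auto simp: ennreal_less_iff)
  next
    case top
    then show ?thesis using that[of 1] by auto
  qed
  define I where "I = (\<integral>x. \<bar>F x\<bar> powr (p / (p - 1)) \<partial>lborel)"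
  have I: "I \<ge> 0" by (simp add: I_def)
  define t where "t = e / (2 * (I + 1))"
  have t: "t > 0" using e I by (simp add: t_def)
  have tI: "t * I \<le> e / 2"
  proof -
    have "I / (I + 1) \<le> 1" using I by simp
    then have "(e / 2) * (I / (I + 1)) \<le> (e / 2) * 1" using e by (intro mult_left_mono) auto
    moreover have "t * I = (e / 2) * (I / (I + 1))" by (simp add: t_def)
    ultimately show ?thesis by simp
  qed
  obtain D where D: "D > 0" "\<And>a b. 0 \<le> a \<Longrightarrow> 0 \<le> b \<Longrightarrow> a * b \<le> t * a powr (p/(p-1)) + D * b powr p"
    using Young_eps[OF p t] by metis
  have "(\<lambda>n. ennreal D * (\<integral>\<^sup>+x. norm (g n x - f x) powr p \<partial>lborel)) \<longlonglongrightarrow> ennreal D * 0"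
    by (intro ennreal_tendsto_cmult lim) auto
  then have "\<forall>\<^sub>F n in sequentially. ennreal D * (\<integral>\<^sup>+x. norm (g n x - f x) powr p \<partial>lborel) < ennreal (e/2)"
    using e by (intro order_tendstoD) auto
  then show "\<forall>\<^sub>F n in sequentially. (\<integral>\<^sup>+x. \<bar>F x\<bar> * norm (g n x - f x) \<partial>lborel) < a"
  proof eventually_elim
    case (elim n)
    have "(\<integral>\<^sup>+x. \<bar>F x\<bar> * norm (g n x - f x) \<partial>lborel)
      \<le> (\<integral>\<^sup>+x. ennreal t * ennreal (\<bar>F x\<bar> powr (p / (p - 1))) + ennreal D * ennreal (norm (g n x - f x) powr p) \<partial>lborel)"
    proof (rule nn_integral_mono)
      fix x
      from ennreal_leI[OF D(2)[of "\<bar>F x\<bar>" "norm (g n x - f x)"]]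
      show "ennreal (\<bar>F x\<bar> * norm (g n x - f x))
        \<le> ennreal t * ennreal (\<bar>F x\<bar> powr (p / (p - 1))) + ennreal D * ennreal (norm (g n x - f x) powr p)"
        using t D(1) by (simp add: ennreal_mult)
    qed
    also have "\<dots> = ennreal t * (\<integral>\<^sup>+x. \<bar>F x\<bar> powr (p / (p - 1)) \<partial>lborel) + ennreal D * (\<integral>\<^sup>+x. norm (g n x - f x) powr p \<partial>lborel)"
      by (subst nn_integral_add) (auto simp: nn_integral_cmult)
    also have "(\<integral>\<^sup>+x. \<bar>F x\<bar> powr (p / (p - 1)) \<partial>lborel) = ennreal I"
      using F by (simp add: I_def nn_integral_eq_integral)
    also have "ennreal t * ennreal I + ennreal D * (\<integral>\<^sup>+x. norm (g n x - f x) powr p \<partial>lborel) \<le> ennreal (e/2) + ennreal (e/2)"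
    proof (rule add_mono)
      have "ennreal t * ennreal I = ennreal (t * I)" using t by (intro ennreal_mult'[symmetric]) simp
      then show "ennreal t * ennreal I \<le> ennreal (e/2)" using tI by (simp add: ennreal_leI)
      show "ennreal D * (\<integral>\<^sup>+x. norm (g n x - f x) powr p \<partial>lborel) \<le> ennreal (e/2)" using elim by (rule less_imp_le)
    qed
    also have "\<dots> = ennreal (e/2 + e/2)" using e by (intro ennreal_plus[symmetric]) auto
    also have "\<dots> < a" using e by simp
    finally show ?case .
  qed
qed simp

text \<open>The limit in \<open>W0\<close> concerns Bochner integrals, which are 0 for nonintegrable
  functions, so it carries information only once integrability is known. Bounds on the weight, on v'
  and on each test function, together with the integrability that \<open>W0\<close> grants for the
  gradient, supply it; then the limit can be restated with nonnegative integrals.\<close>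

lemma W0_extract:
  fixes \<Omega> :: "(real^'n) set"
  assumes W: "W0 p w \<Omega> v g" and p: "p > 1" and \<Omega>: "open \<Omega>" "bounded \<Omega>"
    and w': "w' \<in> borel_measurable borel" "\<And>x. x \<in> \<Omega> \<Longrightarrow> w' x = w x" "\<And>x. 0 \<le> w' x" "\<And>x. w' x \<le> Wb" "\<And>x. x \<notin> \<Omega> \<Longrightarrow> w' x = 0"
    and v': "v' \<in> borel_measurable borel" "AE x in lborel. x \<in> \<Omega> \<longrightarrow> v x = v' x" "\<And>x. \<bar>v' x\<bar> \<le> 1"
    and \<xi>: "\<xi> \<in> borel_measurable borel" "AE x in lborel. x \<in> \<Omega> \<longrightarrow> g x = \<xi> x"
  shows "integrable lborel (\<lambda>x. w' x * norm (\<xi> x) powr p)"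
    and "\<exists>\<phi>. (\<forall>k. test_fun \<Omega> (\<phi> k)) \<and> (\<lambda>k. \<integral>\<^sup>+x. w' x * norm (\<phi> k x - v' x) powr p \<partial>lborel) \<longlonglongrightarrow> 0
       \<and> (\<lambda>k. \<integral>\<^sup>+x. w' x * norm (grad (\<phi> k) x - \<xi> x) powr p \<partial>lborel) \<longlonglongrightarrow> 0"
proof -
  note w'(1)[measurable] v'(1)[measurable] \<xi>(1)[measurable]
  have W': "set_integrable lebesgue \<Omega> (\<lambda>x. w x * norm (g x) powr p)" using W unfolding W0_def by blast
  have "AE x in lborel. indicator \<Omega> x *\<^sub>R (w x * norm (g x) powr p) = w' x * norm (\<xi> x) powr p"
    using \<xi>(2) by eventually_elim (use w' in \<open>auto simp: indicator_def\<close>)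
  from lebesgue_transfer(2)[OF _ this] W' show int: "integrable lborel (\<lambda>x. w' x * norm (\<xi> x) powr p)"
    unfolding set_integrable_def by auto
  obtain \<phi> where \<phi>: "\<And>k. test_fun \<Omega> (\<phi> k)" and lim: "((\<lambda>k. (LINT x:\<Omega>|lebesgue. w x * \<bar>\<phi> k x - v x\<bar> powr p)
             + (LINT x:\<Omega>|lebesgue. w x * norm (grad (\<phi> k) x - g x) powr p)) \<longlongrightarrow> 0) sequentially"
    using W unfolding W0_def by blast
  define a where "a k = (\<integral>x. w' x * norm (\<phi> k x - v' x) powr p \<partial>lborel)" for k
  define b where "b k = (\<integral>x. w' x * norm (grad (\<phi> k) x - \<xi> x) powr p \<partial>lborel)" for k
  have C: "C1 (\<phi> k) (grad (\<phi> k))" for k using C1c_C1[OF test_fun_C1c[OF \<phi>]] .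
  have [measurable]: "\<phi> k \<in> borel_measurable borel" "grad (\<phi> k) \<in> borel_measurable borel" for k
    using C1_borel[OF C[of k]] by auto
  have "AE x in lborel. indicator \<Omega> x *\<^sub>R (w x * \<bar>\<phi> k x - v x\<bar> powr p) = w' x * norm (\<phi> k x - v' x) powr p" for k
    using v'(2) by eventually_elim (use w' in \<open>auto simp: indicator_def\<close>)
  from lebesgue_transfer(1)[OF _ this] have 1: "(LINT x:\<Omega>|lebesgue. w x * \<bar>\<phi> k x - v x\<bar> powr p) = a k" for k
    unfolding set_lebesgue_integral_def a_def by auto
  have "AE x in lborel. indicator \<Omega> x *\<^sub>R (w x * norm (grad (\<phi> k) x - g x) powr p) = w' x * norm (grad (\<phi> k) x - \<xi> x) powr p" for k
    using \<xi>(2) by eventually_elim (use w' in \<open>auto simp: indicator_def\<close>)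
  from lebesgue_transfer(1)[OF _ this] have 2: "(LINT x:\<Omega>|lebesgue. w x * norm (grad (\<phi> k) x - g x) powr p) = b k" for k
    unfolding set_lebesgue_integral_def b_def by auto
  have ab: "(\<lambda>k. a k + b k) \<longlonglongrightarrow> 0" using lim unfolding 1 2 .
  have nn: "0 \<le> a k" "0 \<le> b k" for k unfolding a_def b_def using w'(3) by (auto intro!: Bochner_Integration.integral_nonneg)
  have alim: "a \<longlonglongrightarrow> 0"
    by (rule tendsto_sandwich[OF _ _ tendsto_const ab]) (use nn in \<open>auto intro!: always_eventually\<close>)
  have blim: "b \<longlonglongrightarrow> 0"
    by (rule tendsto_sandwich[OF _ _ tendsto_const ab]) (use nn in \<open>auto intro!: always_eventually\<close>)
  have \<Omega>m [measurable]: "\<Omega> \<in> sets borel" using \<Omega> by simp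
  have i\<Omega>: "integrable lborel (indicator \<Omega> :: real^'n \<Rightarrow> real)"
    using emeasure_bounded_finite[OF \<Omega>(2)] by (intro integrable_real_indicator) auto
  have ib: "integrable lborel (\<lambda>x. w' x * f x)" if [measurable]: "f \<in> borel_measurable borel" and f: "\<And>x. \<bar>f x\<bar> \<le> M" for f :: "real^'n \<Rightarrow> real" and M
  proof (rule Bochner_Integration.integrable_bound[where f="\<lambda>x. (Wb * M) * indicator \<Omega> x"])
    show "AE x in lborel. norm (w' x * f x) \<le> norm (Wb * M * indicator \<Omega> x)"
    proof (rule AE_I2)
      fix x
      have M: "0 \<le> M" using f[of undefined] by linarith
      have Wb: "0 \<le> Wb" using w'(3,4) order_trans by blast
      show "norm (w' x * f x) \<le> norm (Wb * M * indicator \<Omega> x)"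
      proof (cases "x \<in> \<Omega>")
        case True
        have "\<bar>w' x\<bar> * \<bar>f x\<bar> \<le> Wb * M" using w'(3)[of x] w'(4)[of x] f[of x] Wb by (intro mult_mono) auto
        then show ?thesis using True M Wb by (simp add: abs_mult)
      qed (use w'(5) in simp)
    qed
  qed (use i\<Omega> in auto)
  have ia: "integrable lborel (\<lambda>x. w' x * norm (\<phi> k x - v' x) powr p)" for k
  proof -
    obtain K where K: "compact K" "\<And>x. x \<notin> K \<Longrightarrow> \<phi> k x = 0" using test_fun_C1c[OF \<phi>[of k]] by (auto elim: C1c_obtain)
    obtain M where M: "\<And>x. norm (\<phi> k x) \<le> M" using compact_support_bounded'[OF C1_D(3)[OF C] K] by auto
    show ?thesis
    proof (rule ib)
      fix x
      have "norm (\<phi> k x - v' x) \<le> M + 1" using M[of x] v'(3)[of x] by simp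
      then show "\<bar>norm (\<phi> k x - v' x) powr p\<bar> \<le> (M + 1) powr p" using p by (simp add: powr_mono2)
    qed measurable
  qed
  have ig: "integrable lborel (\<lambda>x. w' x * norm (grad (\<phi> k) x - \<xi> x) powr p)" for k
  proof -
    obtain K where K: "compact K" "\<And>x. x \<notin> K \<Longrightarrow> grad (\<phi> k) x = 0" using test_fun_C1c[OF \<phi>[of k]] by (auto elim: C1c_obtain)
    obtain M where M: "\<And>x. norm (grad (\<phi> k) x) \<le> M" using compact_support_bounded'[OF C1_D(2)[OF C] K] by auto
    have i1: "integrable lborel (\<lambda>x. w' x * norm (grad (\<phi> k) x) powr p)"
    proof (rule ib)
      fix x show "\<bar>norm (grad (\<phi> k) x) powr p\<bar> \<le> M powr p" using M[of x] p by (simp add: powr_mono2)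
    qed measurable
    show ?thesis
    proof (rule Bochner_Integration.integrable_bound[where f="\<lambda>x. 2 powr p * (w' x * norm (grad (\<phi> k) x) powr p + w' x * norm (\<xi> x) powr p)"])
      show "AE x in lborel. norm (w' x * norm (grad (\<phi> k) x - \<xi> x) powr p) \<le> norm (2 powr p * (w' x * norm (grad (\<phi> k) x) powr p + w' x * norm (\<xi> x) powr p))"
      proof (rule AE_I2)
        fix x
        have "norm (grad (\<phi> k) x - \<xi> x) powr p \<le> (norm (grad (\<phi> k) x) + norm (\<xi> x)) powr p"
          using p norm_triangle_ineq4 by (intro powr_mono2) auto
        also have "\<dots> \<le> 2 powr p * (norm (grad (\<phi> k) x) powr p + norm (\<xi> x) powr p)" using p by (intro powr_add_le) auto
        finally have "w' x * norm (grad (\<phi> k) x - \<xi> x) powr p \<le> w' x * (2 powr p * (norm (grad (\<phi> k) x) powr p + norm (\<xi> x) powr p))"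
          using w'(3) by (intro mult_left_mono) auto
        also have "\<dots> = 2 powr p * (w' x * norm (grad (\<phi> k) x) powr p + w' x * norm (\<xi> x) powr p)" by (simp add: algebra_simps)
        finally show "norm (w' x * norm (grad (\<phi> k) x - \<xi> x) powr p) \<le> norm (2 powr p * (w' x * norm (grad (\<phi> k) x) powr p + w' x * norm (\<xi> x) powr p))"
          using w'(3)[of x] by simp
      qed
    qed (use i1 int in auto)
  qed
  have "(\<integral>\<^sup>+x. w' x * norm (\<phi> k x - v' x) powr p \<partial>lborel) = ennreal (a k)" for k
    unfolding a_def using w'(3) by (intro nn_integral_eq_integral[OF ia]) auto
  moreover have "(\<integral>\<^sup>+x. w' x * norm (grad (\<phi> k) x - \<xi> x) powr p \<partial>lborel) = ennreal (b k)" for k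
    unfolding b_def using w'(3) by (intro nn_integral_eq_integral[OF ig]) auto
  moreover have "(\<lambda>k. ennreal (a k)) \<longlonglongrightarrow> ennreal 0" "(\<lambda>k. ennreal (b k)) \<longlonglongrightarrow> ennreal 0"
    by (intro tendsto_ennrealI alim blim)+
  ultimately show "\<exists>\<phi>. (\<forall>k. test_fun \<Omega> (\<phi> k)) \<and> (\<lambda>k. \<integral>\<^sup>+x. w' x * norm (\<phi> k x - v' x) powr p \<partial>lborel) \<longlonglongrightarrow> 0
       \<and> (\<lambda>k. \<integral>\<^sup>+x. w' x * norm (grad (\<phi> k) x - \<xi> x) powr p \<partial>lborel) \<longlonglongrightarrow> 0"
    using \<phi> by (intro exI[of _ \<phi>]) simp
qed

text \<open>Integration by parts is exact for the test functions \<phi> k. On the support of \<psi>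
  the weight is bounded below, so \<phi> k and its gradient converge there in L^1, and the identity
  passes to the limit component by component.\<close>

lemma weak_grad_from_approx:
  fixes \<Omega> :: "(real^'n) set"
  assumes \<phi>: "\<And>k. test_fun \<Omega> (\<phi> k)" and p: "p > 1"
    and lim: "(\<lambda>k. \<integral>\<^sup>+x. w x * norm (\<phi> k x - v x) powr p \<partial>lborel) \<longlonglongrightarrow> 0"
      "(\<lambda>k. \<integral>\<^sup>+x. w x * norm (grad (\<phi> k) x - \<xi> x) powr p \<partial>lborel) \<longlonglongrightarrow> 0"
    and [measurable]: "w \<in> borel_measurable borel" "v \<in> borel_measurable borel" "\<xi> \<in> borel_measurable borel"
    and w: "\<And>K. compact K \<Longrightarrow> K \<subseteq> \<Omega> \<Longrightarrow> \<exists>c>0. \<forall>x\<in>K. c \<le> w x"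
    and v: "\<And>x. \<bar>v x\<bar> \<le> 1" and \<xi>: "\<And>K. compact K \<Longrightarrow> K \<subseteq> \<Omega> \<Longrightarrow> integrable lborel (\<lambda>x. indicator K x *\<^sub>R \<xi> x)"
  shows "weak_grad \<Omega> v \<xi>"
  unfolding weak_grad_def
proof (intro allI impI)
  fix \<psi> G assume \<psi>: "C1c \<Omega> \<psi> G"
  obtain K where K: "compact K" "K \<subseteq> \<Omega>" "\<And>x. x \<notin> K \<Longrightarrow> \<psi> x = 0" "\<And>x. x \<notin> K \<Longrightarrow> G x = 0" using \<psi> by (auto elim: C1c_obtain)
  obtain M1 where M1: "\<And>x. norm (\<psi> x) \<le> M1" using compact_support_bounded'[OF C1_D(3)[OF C1c_C1[OF \<psi>]] K(1,3)] by auto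
  obtain M2 where M2: "\<And>x. norm (G x) \<le> M2" using compact_support_bounded'[OF C1_D(2)[OF C1c_C1[OF \<psi>]] K(1,4)] by auto
  obtain c where c: "c > 0" "\<And>x. x \<in> K \<Longrightarrow> c \<le> w x" using w[OF K(1,2)] by auto
  have [measurable]: "\<psi> \<in> borel_measurable borel" "G \<in> borel_measurable borel" using C1_borel[OF C1c_C1[OF \<psi>]] by auto
  note C = test_fun_C1c[OF \<phi>]
  have [measurable]: "\<phi> k \<in> borel_measurable borel" "grad (\<phi> k) \<in> borel_measurable borel" for k
    using C1_borel[OF C1c_C1[OF C[of k]]] by auto
  have iG: "integrable lborel G" "integrable lborel \<psi>" using C1c_integrable[OF \<psi>] by auto
  have i1: "integrable lborel (\<lambda>x. v x *\<^sub>R G x)"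
  proof (rule Bochner_Integration.integrable_bound[OF integrable_norm[OF iG(1)]])
    show "AE x in lborel. norm (v x *\<^sub>R G x) \<le> norm (norm (G x))"
      using v by (intro AE_I2) (simp add: mult_left_le_one_le)
  qed measurable
  have i2: "integrable lborel (\<lambda>x. \<psi> x *\<^sub>R \<xi> x)"
  proof (rule Bochner_Integration.integrable_bound[OF integrable_scaleR_right[OF \<xi>[OF K(1,2)], of M1]])
    show "AE x in lborel. norm (\<psi> x *\<^sub>R \<xi> x) \<le> norm (M1 *\<^sub>R (indicator K x *\<^sub>R \<xi> x))"
    proof (rule AE_I2)
      fix x
      have "\<bar>\<psi> x\<bar> \<le> \<bar>M1\<bar>" using M1[of x] by simp
      then show "norm (\<psi> x *\<^sub>R \<xi> x) \<le> norm (M1 *\<^sub>R (indicator K x *\<^sub>R \<xi> x))"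
        using K(3)[of x] by (cases "x \<in> K") (auto intro: mult_right_mono)
    qed
  qed measurable
  show "(\<integral>x. v x *\<^sub>R G x \<partial>lborel) = - (\<integral>x. \<psi> x *\<^sub>R \<xi> x \<partial>lborel)"
  proof (rule euclidean_eqI)
    fix b :: "real^'n" assume b: "b \<in> Basis"
    have l1: "(\<lambda>k. \<integral>x. (G x \<bullet> b) \<bullet> \<phi> k x \<partial>lborel) \<longlonglongrightarrow> (\<integral>x. (G x \<bullet> b) \<bullet> v x \<partial>lborel)"
    proof (rule wlim_integral)
      show "wlim (\<lambda>x. G x \<bullet> b) \<phi> v"
      proof (rule wlim_weighted[OF lim(1) p _ _ _ K(1) c])
        show "\<bar>G x \<bullet> b\<bar> \<le> M2" for x using Basis_le_norm[OF b, of "G x"] M2[of x] by linarith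
      qed (use K(4) in auto)
      show "integrable lborel (\<lambda>x. (G x \<bullet> b) \<bullet> v x)"
      proof -
        have "integrable lborel (\<lambda>x. (v x *\<^sub>R G x) \<bullet> b)" using i1 by (intro integrable_inner_left)
        then show ?thesis by (simp add: mult.commute)
      qed
    qed auto
    have l2: "(\<lambda>k. \<integral>x. (\<psi> x *\<^sub>R b) \<bullet> grad (\<phi> k) x \<partial>lborel) \<longlonglongrightarrow> (\<integral>x. (\<psi> x *\<^sub>R b) \<bullet> \<xi> x \<partial>lborel)"
    proof (rule wlim_integral)
      show "wlim \<psi> (\<lambda>k. grad (\<phi> k)) \<xi>"
        by (rule wlim_weighted[OF lim(2) p _ _ _ K(1) c]) (use M1 K(3) in auto)
      show "norm (\<psi> x *\<^sub>R b) \<le> \<bar>\<psi> x\<bar>" for x using b by simp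
      show "integrable lborel (\<lambda>x. (\<psi> x *\<^sub>R b) \<bullet> \<xi> x)"
      proof -
        have "integrable lborel (\<lambda>x. (\<psi> x *\<^sub>R \<xi> x) \<bullet> b)" using i2 by (intro integrable_inner_left)
        then show ?thesis by (simp add: inner_commute)
      qed
    qed auto
    have eq: "(\<integral>x. (\<psi> x *\<^sub>R b) \<bullet> grad (\<phi> k) x \<partial>lborel) = - (\<integral>x. (G x \<bullet> b) \<bullet> \<phi> k x \<partial>lborel)" for k
    proof -
      have m: "C1c \<Omega> (\<lambda>x. \<psi> x * \<phi> k x) (\<lambda>x. \<psi> x *\<^sub>R grad (\<phi> k) x + \<phi> k x *\<^sub>R G x)"
        by (rule C1c_mult[OF \<psi> C1c_C1[OF C]])
      obtain Q where Q: "compact Q" "\<And>x. x \<notin> Q \<Longrightarrow> \<phi> k x = 0" "\<And>x. x \<notin> Q \<Longrightarrow> grad (\<phi> k) x = 0" using C[of k] by (auto elim: C1c_obtain)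
      have j1: "integrable lborel (\<lambda>x. (\<psi> x *\<^sub>R b) \<bullet> grad (\<phi> k) x)"
        by (rule compact_support_integrable[OF _ Q(1)])
          (use C1_D[OF C1c_C1[OF C[of k]]] C1_D[OF C1c_C1[OF \<psi>]] Q in \<open>auto intro!: continuous_intros\<close>)
      have j2: "integrable lborel (\<lambda>x. (G x \<bullet> b) \<bullet> \<phi> k x)"
        by (rule compact_support_integrable[OF _ Q(1)])
          (use C1_D[OF C1c_C1[OF C[of k]]] C1_D[OF C1c_C1[OF \<psi>]] Q in \<open>auto intro!: continuous_intros\<close>)
      have "(\<integral>x. (\<psi> x *\<^sub>R grad (\<phi> k) x + \<phi> k x *\<^sub>R G x) \<bullet> b \<partial>lborel) = (\<integral>x. \<psi> x *\<^sub>R grad (\<phi> k) x + \<phi> k x *\<^sub>R G x \<partial>lborel) \<bullet> b"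
        by (rule integral_inner_left) (rule C1c_integrable(2)[OF m])
      also have "\<dots> = 0" by (simp add: C1c_integral_grad[OF m])
      finally have "(\<integral>x. (\<psi> x *\<^sub>R b) \<bullet> grad (\<phi> k) x + (G x \<bullet> b) \<bullet> \<phi> k x \<partial>lborel) = 0"
        by (simp add: inner_add_left inner_commute[of b] mult.commute)
      then show ?thesis using j1 j2 by (simp del: inner_scaleR_left inner_real_def)
    qed
    have "(\<lambda>k. - (\<integral>x. (G x \<bullet> b) \<bullet> \<phi> k x \<partial>lborel)) \<longlonglongrightarrow> (\<integral>x. (\<psi> x *\<^sub>R b) \<bullet> \<xi> x \<partial>lborel)" using l2 unfolding eq .
    from LIMSEQ_unique[OF this tendsto_minus[OF l1]]
    have "(\<integral>x. (G x \<bullet> b) \<bullet> v x \<partial>lborel) = - (\<integral>x. (\<psi> x *\<^sub>R b) \<bullet> \<xi> x \<partial>lborel)" by simp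
    moreover have "(\<integral>x. v x *\<^sub>R G x \<partial>lborel) \<bullet> b = (\<integral>x. (G x \<bullet> b) \<bullet> v x \<partial>lborel)"
    proof -
      have "(\<integral>x. v x *\<^sub>R G x \<partial>lborel) \<bullet> b = (\<integral>x. (v x *\<^sub>R G x) \<bullet> b \<partial>lborel)" by (rule integral_inner_left[symmetric]) (rule i1)
      also have "\<dots> = (\<integral>x. (G x \<bullet> b) \<bullet> v x \<partial>lborel)" by (simp add: mult.commute)
      finally show ?thesis .
    qed
    moreover have "(\<integral>x. \<psi> x *\<^sub>R \<xi> x \<partial>lborel) \<bullet> b = (\<integral>x. (\<psi> x *\<^sub>R b) \<bullet> \<xi> x \<partial>lborel)"
    proof -
      have "(\<integral>x. \<psi> x *\<^sub>R \<xi> x \<partial>lborel) \<bullet> b = (\<integral>x. (\<psi> x *\<^sub>R \<xi> x) \<bullet> b \<partial>lborel)" by (rule integral_inner_left[symmetric]) (rule i2)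
      also have "\<dots> = (\<integral>x. (\<psi> x *\<^sub>R b) \<bullet> \<xi> x \<partial>lborel)" by (simp add: inner_commute)
      finally show ?thesis .
    qed
    ultimately show "(\<integral>x. v x *\<^sub>R G x \<partial>lborel) \<bullet> b = - (\<integral>x. \<psi> x *\<^sub>R \<xi> x \<partial>lborel) \<bullet> b" by simp
  qed
qed

text \<open>Tested with reflected kernels, the two identities make the mollification of \<xi>1 -
  \<xi>2 vanish on each compact part of \<open>S\<close>, while it also converges to \<xi>1 -
  \<xi>2. This identifies the gradients of the two eigenvalue problems, which come from different
  approximating sequences and different norms.\<close>

lemma (in mollifier) weak_grad_unique:
  fixes \<xi>1 \<xi>2 :: "'a \<Rightarrow> 'a"
  assumes w: "weak_grad S u \<xi>1" "weak_grad S u \<xi>2" and S: "open S"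
    and [measurable]: "\<xi>1 \<in> borel_measurable borel" "\<xi>2 \<in> borel_measurable borel"
    and i: "\<And>K. compact K \<Longrightarrow> K \<subseteq> S \<Longrightarrow> integrable lborel (\<lambda>x. indicator K x *\<^sub>R \<xi>1 x)"
      "\<And>K. compact K \<Longrightarrow> K \<subseteq> S \<Longrightarrow> integrable lborel (\<lambda>x. indicator K x *\<^sub>R \<xi>2 x)"
  shows "AE x in lborel. x \<in> S \<longrightarrow> \<xi>1 x = \<xi>2 x"
proof -
  have local: "AE x in lborel. x \<in> K \<longrightarrow> \<xi>1 x = \<xi>2 x" if K: "compact K" "K \<subseteq> S" for K
  proof -
    obtain d where d: "d > 0" "\<And>x. x \<in> K \<Longrightarrow> cball x d \<subseteq> S" using compact_open_margin[OF K(1) S K(2)] by auto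
    define K2 where "K2 = {x + y | x y. x \<in> K \<and> y \<in> cball 0 d}"
    have K2: "compact K2" unfolding K2_def by (rule compact_nbhd[OF K(1)])
    have K2S: "K2 \<subseteq> S"
    proof
      fix z assume "z \<in> K2"
      then obtain a b where "z = a + b" "a \<in> K" "norm b \<le> d" unfolding K2_def by auto
      then show "z \<in> S" using d(2)[of a] by (auto simp: dist_norm)
    qed
    have inK2: "cball x d \<subseteq> K2" if "x \<in> K" for x
    proof
      fix z assume "z \<in> cball x d"
      then show "z \<in> K2" unfolding K2_def using that by (intro CollectI exI[of _ x] exI[of _ "z - x"]) (auto simp: dist_norm norm_minus_commute)
    qed
    have [measurable]: "K \<in> sets borel" "K2 \<in> sets borel" using K K2 by (auto simp: borel_compact)
    define f where "f x = indicator K2 x *\<^sub>R \<xi>1 x - indicator K2 x *\<^sub>R \<xi>2 x" for x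
    have f: "integrable lborel f" unfolding f_def[abs_def] using i[OF K2 K2S] by (rule Bochner_Integration.integrable_diff)
    have [measurable]: "f \<in> borel_measurable borel" using f by auto
    have t: "tcont (indicator K) f"
      unfolding tcont_def
    proof (intro allI impI)
      fix e :: real assume e: "e > 0"
      obtain d where d: "d > 0" "\<And>h. norm h < d \<Longrightarrow> (\<integral>\<^sup>+x. norm (f (x + h) - f x) \<partial>lborel) \<le> ennreal e"
        using L1_translation_continuous[OF f e] by blast
      have "(\<integral>\<^sup>+x. \<bar>indicator K x\<bar> * norm (f (x + h) - f x) \<partial>lborel) \<le> ennreal e" if "norm h \<le> d/2" for h
      proof -
        have "(\<integral>\<^sup>+x. \<bar>indicator K x\<bar> * norm (f (x + h) - f x) \<partial>lborel) \<le> (\<integral>\<^sup>+x. norm (f (x + h) - f x) \<partial>lborel)"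
          by (intro nn_integral_mono ennreal_leI) (auto simp: indicator_def)
        also have "\<dots> \<le> ennreal e" using d that by simp
        finally show ?thesis .
      qed
      then show "\<exists>d>0. \<forall>h. norm h \<le> d \<longrightarrow> (\<integral>\<^sup>+x. \<bar>indicator K x\<bar> * norm (f (x + h) - f x) \<partial>lborel) \<le> ennreal e"
        using d(1) by (intro exI[of _ "d/2"]) auto
    qed
    have "wlim (indicator K) (\<lambda>n. conv (k n) f) f" by (rule wlim_conv[OF t f]) measurable
    moreover have "\<forall>\<^sub>F n in sequentially. (\<integral>\<^sup>+x. \<bar>indicator K x\<bar> * norm (conv (k n) f x - f x) \<partial>lborel) = (\<integral>\<^sup>+x. \<bar>indicator K x\<bar> * norm (f x) \<partial>lborel)"
    proof -
      have "\<forall>\<^sub>F n in sequentially. r n < d" using r_lim d(1) by (intro order_tendstoD) auto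
      then show ?thesis
      proof eventually_elim
        case (elim n)
        have "conv (k n) f x = 0" if x: "x \<in> K" for x
        proof -
          have c: "C1c S (\<lambda>y. k n (x - y)) (\<lambda>y. - k' n (x - y))"
            unfolding C1c_def
          proof (intro conjI exI[of _ "cball x (r n)"] allI impI)
            show "C1 (\<lambda>y. k n (x - y)) (\<lambda>y. - k' n (x - y))" by (rule C1_reflect[OF kC1])
            show "cball x (r n) \<subseteq> S" using d(2)[OF x] elim by (auto simp: subset_iff)
            fix y assume "y \<notin> cball x (r n)"
            then show "k n (x - y) = 0" using k_supp[of n "x - y"] by (simp add: dist_norm)
          qed simp
          have e: "(\<integral>y. k n (x - y) *\<^sub>R \<xi>1 y \<partial>lborel) = (\<integral>y. k n (x - y) *\<^sub>R \<xi>2 y \<partial>lborel)"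
            using w(1)[unfolded weak_grad_def, rule_format, OF c] w(2)[unfolded weak_grad_def, rule_format, OF c]
            by (metis neg_equal_iff_equal)
          have z: "k n (x - y) *\<^sub>R g y = k n (x - y) *\<^sub>R (indicator K2 y *\<^sub>R g y)" for g :: "'a \<Rightarrow> 'a" and y
          proof (cases "y \<in> cball x (r n)")
            case True
            then have "y \<in> K2" using inK2[OF x] elim by auto
            then show ?thesis by simp
          qed (use k_supp[of n "x - y"] in \<open>simp add: dist_norm\<close>)
          have j: "integrable lborel (\<lambda>y. k n (x - y) *\<^sub>R g y)" if "integrable lborel g" for g :: "'a \<Rightarrow> 'a"
            using integrable_lborel_shift(2)[OF conv_ints[OF that, of n x], of x] by simp
          have "conv (k n) f x = (\<integral>y. k n (x - y) *\<^sub>R f y \<partial>lborel)" by (rule conv_commute[OF conv_ints[OF f]])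
          also have "\<dots> = (\<integral>y. k n (x - y) *\<^sub>R (indicator K2 y *\<^sub>R \<xi>1 y) \<partial>lborel) - (\<integral>y. k n (x - y) *\<^sub>R (indicator K2 y *\<^sub>R \<xi>2 y) \<partial>lborel)"
            unfolding f_def scaleR_diff_right by (rule Bochner_Integration.integral_diff[OF j[OF i(1)[OF K2 K2S]] j[OF i(2)[OF K2 K2S]]])
          also have "\<dots> = 0" using e unfolding z[where g=\<xi>1] z[where g=\<xi>2] by simp
          finally show ?thesis .
        qed
        then show ?case by (intro nn_integral_cong) (auto simp: indicator_def)
      qed
    qed
    ultimately have "(\<lambda>n::nat. \<integral>\<^sup>+x. \<bar>indicator K x\<bar> * norm (f x) \<partial>lborel) \<longlonglongrightarrow> 0"
      unfolding wlim_def by (rule Lim_transform_eventually)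
    then have "(\<integral>\<^sup>+x. ennreal (\<bar>indicator K x\<bar> * norm (f x)) \<partial>lborel) = 0"
      by (rule LIMSEQ_unique[OF tendsto_const])
    then have "AE x in lborel. ennreal (\<bar>indicator K x\<bar> * norm (f x)) = 0"
      by (subst (asm) nn_integral_0_iff_AE) auto
    then show ?thesis
    proof eventually_elim
      case (elim x)
      show ?case
      proof
        assume x: "x \<in> K"
        then have "x \<in> K2" using inK2[OF x] d by auto
        then show "\<xi>1 x = \<xi>2 x" using elim x by (simp add: f_def)
      qed
    qed
  qed
  obtain Q where Q: "\<And>n::nat. compact (Q n)" "\<And>n. Q n \<subseteq> S" "\<Union>(range Q) = S"
    by (rule open_Union_compact_subsets[OF S]) (rule that)
  have "AE x in lborel. \<forall>n. x \<in> Q n \<longrightarrow> \<xi>1 x = \<xi>2 x"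
    using local[OF Q(1,2)] by (subst AE_all_countable) auto
  then show ?thesis
  proof eventually_elim
    case (elim x)
    show ?case
    proof
      assume "x \<in> S"
      then obtain n where "x \<in> Q n" unfolding Q(3)[symmetric] by auto
      then show "\<xi>1 x = \<xi>2 x" using elim by blast
    qed
  qed
qed

section \<open>The boundary barrier\<close>

text \<open>Meant for functions that are C^1 in \<open>S\<close> only, such as those containing a
  power of the distance to a point outside \<open>S\<close>; as they vanish off a compact part of
  \<open>S\<close>, they extend by 0.\<close>

lemma C1c_local:
  fixes f :: "'a::euclidean_space \<Rightarrow> real"
  assumes S: "open S" and K: "compact K" "K \<subseteq> S" and z: "\<And>x. x \<notin> K \<Longrightarrow> f x = 0" "\<And>x. x \<notin> K \<Longrightarrow> G x = 0"
    and d: "\<And>x. x \<in> S \<Longrightarrow> GDERIV f x :> G x" and c: "continuous_on S G"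
  shows "C1c S f G"
proof -
  have oK: "open (- K)" using compact_imp_closed[OF K(1)] by auto
  have "GDERIV f x :> G x" for x
  proof (cases "x \<in> S")
    case False
    then have x: "x \<in> - K" using K by auto
    have "(f has_derivative (\<lambda>h. 0)) (at x)"
      by (rule has_derivative_transform_within_open[of "\<lambda>_. 0" _ x UNIV "- K"]) (use x oK z in auto)
    then show ?thesis using x z(2) by (simp add: gderiv_def)
  qed (rule d)
  moreover have "continuous_on UNIV G"
  proof -
    have "continuous_on (- K) G" by (rule continuous_on_eq[OF continuous_on_const[of _ 0]]) (use z(2) in auto)
    then have "continuous_on (S \<union> - K) G" by (rule continuous_on_open_Un[OF S oK c])
    moreover have "S \<union> - K = UNIV" using K by auto
    ultimately show ?thesis by simp
  qed
  ultimately show ?thesis using K z unfolding C1c_def C1_def by blast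
qed

lemma GDERIV_norm_powr:
  fixes x y :: "'a::euclidean_space"
  assumes "x \<noteq> y"
  shows "GDERIV (\<lambda>x. norm (x - y) powr s) x :> (s * norm (x - y) powr (s - 2)) *\<^sub>R (x - y)"
proof -
  have n: "norm (x - y) > 0" using assms by simp
  have 1: "GDERIV (\<lambda>x. norm (x - y)) x :> sgn (x - y)"
  proof -
    have "(norm has_derivative (\<lambda>h. h \<bullet> sgn (x - y))) (at (x - y))"
      using GDERIV_norm[of "x - y"] assms by (simp add: gderiv_def)
    moreover have "((\<lambda>x. x - y) has_derivative (\<lambda>h. h)) (at x)" by (auto intro!: derivative_eq_intros)
    ultimately show ?thesis unfolding gderiv_def
      using diff_chain_at[of "\<lambda>x. x - y" "\<lambda>h. h" x norm "\<lambda>h. h \<bullet> sgn (x - y)"] by (simp add: o_def)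
  qed
  have "GDERIV (\<lambda>x. norm (x - y) powr s) x :> (s * norm (x - y) powr (s - 1)) *\<^sub>R sgn (x - y)"
    by (rule GDERIV_DERIV_compose[OF 1]) (rule has_real_derivative_powr[OF n])
  moreover have "(s * norm (x - y) powr (s - 1)) *\<^sub>R sgn (x - y) = (s * norm (x - y) powr (s - 2)) *\<^sub>R (x - y)"
  proof -
    have "norm (x - y) powr (s - 1) = norm (x - y) powr (s - 2) * norm (x - y)"
      using powr_mult_base[of "norm (x - y)" "s - 2"] n by (simp add: mult.commute)
    then show ?thesis using n by (simp add: sgn_div_norm)
  qed
  ultimately show ?thesis by simp
qed

lemma wlim_dominated:
  fixes h :: "nat \<Rightarrow> 'a::euclidean_space \<Rightarrow> real"
  assumes H: "integrable lborel H" and [measurable]: "\<And>n. h n \<in> borel_measurable borel" "f \<in> borel_measurable borel"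
    and b: "\<And>n x. \<bar>h n x - f x\<bar> \<le> c" and lim: "AE x in lborel. (\<lambda>n. h n x) \<longlonglongrightarrow> f x"
  shows "wlim H h f"
proof -
  have [measurable]: "H \<in> borel_measurable borel" using H by auto
  have i: "integrable lborel (\<lambda>x. \<bar>H x\<bar> * norm (h n x - f x))" for n
    using integrable_inner_bounded[OF integrable_abs[OF H], of "\<lambda>x. norm (h n x - f x)" c] b by simp
  have "(\<lambda>n. \<integral>x. \<bar>H x\<bar> * norm (h n x - f x) \<partial>lborel) \<longlonglongrightarrow> (\<integral>x. 0 \<partial>(lborel :: 'a measure))"
  proof (rule integral_dominated_convergence[where w="\<lambda>x. c * \<bar>H x\<bar>"])
    show "AE x in lborel. (\<lambda>n. \<bar>H x\<bar> * norm (h n x - f x)) \<longlonglongrightarrow> 0"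
      using lim
    proof eventually_elim
      case (elim x)
      have "(\<lambda>n. h n x - f x) \<longlonglongrightarrow> 0" using elim by (simp add: LIM_zero)
      from tendsto_mult_left[OF tendsto_norm_zero[OF this], of "\<bar>H x\<bar>"] show ?case by simp
    qed
    show "AE x in lborel. norm (\<bar>H x\<bar> * norm (h n x - f x)) \<le> c * \<bar>H x\<bar>" for n
      using b by (intro AE_I2) (simp add: abs_mult mult.commute[of c] mult_left_mono)
  qed (use H in auto)
  then have l: "(\<lambda>n. \<integral>x. \<bar>H x\<bar> * norm (h n x - f x) \<partial>lborel) \<longlonglongrightarrow> 0" by simp
  have "(\<integral>\<^sup>+x. \<bar>H x\<bar> * norm (h n x - f x) \<partial>lborel) = ennreal (\<integral>x. \<bar>H x\<bar> * norm (h n x - f x) \<partial>lborel)" for n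
    by (rule nn_integral_eq_integral[OF i]) auto
  then show ?thesis unfolding wlim_def using tendsto_ennrealI[OF l] by simp
qed

lemma Lp_AE_subseq:
  fixes g :: "nat \<Rightarrow> 'a::euclidean_space \<Rightarrow> real"
  assumes lim: "(\<lambda>n. \<integral>\<^sup>+x. norm (g n x - f x) powr p \<partial>lborel) \<longlonglongrightarrow> 0" and p: "p > 0"
    and [measurable]: "\<And>n. g n \<in> borel_measurable borel" "f \<in> borel_measurable borel"
    and i: "\<And>n. integrable lborel (\<lambda>x. norm (g n x - f x) powr p)"
  obtains s :: "nat \<Rightarrow> nat" where "strict_mono s" "AE x in lborel. (\<lambda>n. g (s n) x) \<longlonglongrightarrow> f x"
proof -
  have e: "(\<integral>\<^sup>+x. norm (g n x - f x) powr p \<partial>lborel) = ennreal (\<integral>x. norm (norm (g n x - f x) powr p) \<partial>lborel)" for n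
    using nn_integral_eq_integral[OF i[of n]] by simp
  have "(\<lambda>n. ennreal (\<integral>x. norm (norm (g n x - f x) powr p) \<partial>lborel)) \<longlonglongrightarrow> ennreal 0"
    using lim unfolding e by simp
  then have "(\<lambda>n. \<integral>x. norm (norm (g n x - f x) powr p) \<partial>lborel) \<longlonglongrightarrow> 0"
    by (subst (asm) tendsto_ennreal_iff) auto
  from tendsto_L1_AE_subseq[OF i this] obtain s :: "nat \<Rightarrow> nat"
    where s: "strict_mono s" "AE x in lborel. (\<lambda>n. norm (g (s n) x - f x) powr p) \<longlonglongrightarrow> 0" by blast
  have "AE x in lborel. (\<lambda>n. g (s n) x) \<longlonglongrightarrow> f x"
    using s(2)
  proof eventually_elim
    case (elim x)
    have "(\<lambda>n. (norm (g (s n) x - f x) powr p) powr (1 / p)) \<longlonglongrightarrow> 0"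
      by (rule tendsto_zero_powrI[OF elim tendsto_const]) (use p in auto)
    then have "(\<lambda>n. norm (g (s n) x - f x)) \<longlonglongrightarrow> 0" using p by (simp add: powr_powr)
    then have "(\<lambda>n. g (s n) x - f x) \<longlonglongrightarrow> 0" by (rule tendsto_norm_zero_cancel)
    then show ?case by (simp add: LIM_zero_iff)
  qed
  with s(1) show ?thesis by (rule that)
qed

lemma wlim_subseq: "wlim F g f \<Longrightarrow> strict_mono s \<Longrightarrow> wlim F (\<lambda>n. g (s n)) f"
  unfolding wlim_def using LIMSEQ_subseq_LIMSEQ by (fastforce simp: o_def)

text \<open>Multiples of this field are the fluxes of the radial barriers.\<close>
lemma radial_field_weak_div:
  fixes \<sigma> :: "'a::euclidean_space \<Rightarrow> real"
  assumes S: "open S" and y: "y \<notin> S" and \<sigma>: "C1c S \<sigma> G"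
  defines "s \<equiv> - real DIM('a) - 1"
  shows "(\<integral>x. (norm (x - y) powr s *\<^sub>R (x - y)) \<bullet> G x \<partial>lborel) = (\<integral>x. norm (x - y) powr s * \<sigma> x \<partial>lborel)"
proof -
  obtain K where K: "compact K" "K \<subseteq> S" "\<And>x. x \<notin> K \<Longrightarrow> \<sigma> x = 0" "\<And>x. x \<notin> K \<Longrightarrow> G x = 0" using \<sigma> by (auto elim: C1c_obtain)
  note C = C1c_C1[OF \<sigma>]
  define Z where "Z x = norm (x - y) powr s *\<^sub>R (x - y)" for x
  have cp: "continuous_on S (\<lambda>x. norm (x - y) powr t)" for t
    using y by (intro continuous_intros) auto
  have cZ: "continuous_on S Z" unfolding Z_def[abs_def] by (intro continuous_intros cp)
  define g where "g b x = norm (x - y) powr s *\<^sub>R b + ((x - y) \<bullet> b * (s * norm (x - y) powr (s - 2))) *\<^sub>R (x - y)" for b x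
  have cg: "continuous_on S (g b)" for b unfolding g_def[abs_def] by (intro continuous_intros cp)
  have dZ: "GDERIV (\<lambda>x. Z x \<bullet> b) x :> g b x" if "x \<in> S" for x b
  proof -
    have "GDERIV (\<lambda>x. (x - y) \<bullet> b) x :> b" unfolding gderiv_def by (auto intro!: derivative_eq_intros simp: inner_commute)
    moreover have "x \<noteq> y" using that y by auto
    ultimately have "GDERIV (\<lambda>x. norm (x - y) powr s * ((x - y) \<bullet> b)) x :> norm (x - y) powr s *\<^sub>R b + ((x - y) \<bullet> b) *\<^sub>R ((s * norm (x - y) powr (s - 2)) *\<^sub>R (x - y))"
      by (intro GDERIV_mult GDERIV_norm_powr)
    then show ?thesis by (simp add: Z_def g_def)
  qed
  have C1c: "C1c S (\<lambda>x. \<sigma> x * (Z x \<bullet> b)) (\<lambda>x. \<sigma> x *\<^sub>R g b x + (Z x \<bullet> b) *\<^sub>R G x)" for b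
  proof (rule C1c_local[OF S K(1,2)])
    show "GDERIV (\<lambda>x. \<sigma> x * (Z x \<bullet> b)) x :> \<sigma> x *\<^sub>R g b x + (Z x \<bullet> b) *\<^sub>R G x" if "x \<in> S" for x
      by (rule GDERIV_mult[OF C1_D(1)[OF C] dZ[OF that]])
    show "continuous_on S (\<lambda>x. \<sigma> x *\<^sub>R g b x + (Z x \<bullet> b) *\<^sub>R G x)"
      using C1_D(2,3)[OF C] by (intro continuous_intros cg cZ) (auto intro: continuous_on_subset)
  qed (use K in auto)
  have ic: "integrable lborel h" if "continuous_on S h" "\<And>x. x \<notin> K \<Longrightarrow> h x = 0" for h :: "'a \<Rightarrow> real"
  proof -
    have "integrable lborel (\<lambda>x. indicator K x *\<^sub>R h x)"
      using K that by (intro borel_integrable_compact) (auto intro: continuous_on_subset)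
    moreover have "(\<lambda>x. indicator K x *\<^sub>R h x) = h"
    proof
      fix x show "indicator K x *\<^sub>R h x = h x" using that(2)[of x] by (cases "x \<in> K") auto
    qed
    ultimately show ?thesis by simp
  qed
  have i1: "integrable lborel (\<lambda>x. \<sigma> x * (g b x \<bullet> b))" for b
    by (rule ic) (use C1_D(3)[OF C] K(3) cg[of b] in \<open>auto intro!: continuous_intros intro: continuous_on_subset\<close>)
  have i2: "integrable lborel (\<lambda>x. (Z x \<bullet> b) * (G x \<bullet> b))" for b
    by (rule ic) (use C1_D(2)[OF C] K(4) cZ in \<open>auto intro!: continuous_intros intro: continuous_on_subset\<close>)
  have b: "(\<integral>x. (Z x \<bullet> b) * (G x \<bullet> b) \<partial>lborel) = - (\<integral>x. \<sigma> x * (g b x \<bullet> b) \<partial>lborel)" for b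
  proof -
    have "(\<integral>x. (\<sigma> x *\<^sub>R g b x + (Z x \<bullet> b) *\<^sub>R G x) \<bullet> b \<partial>lborel) = (\<integral>x. \<sigma> x *\<^sub>R g b x + (Z x \<bullet> b) *\<^sub>R G x \<partial>lborel) \<bullet> b"
      by (rule integral_inner_left) (rule C1c_integrable(2)[OF C1c])
    also have "\<dots> = 0" by (simp add: C1c_integral_grad[OF C1c])
    finally have "(\<integral>x. \<sigma> x * (g b x \<bullet> b) + (Z x \<bullet> b) * (G x \<bullet> b) \<partial>lborel) = 0" by (simp add: inner_add_left)
    then show ?thesis using i1[of b] i2[of b] by simp
  qed
  \<comment> \<open>The divergence of the field is N |x - y|^s + s |x - y|^s, with N the dimension,
    and s = - N - 1 makes it - |x - y|^s.\<close>
  have sumg: "(\<Sum>b\<in>Basis. \<sigma> x * (g b x \<bullet> b)) = - (norm (x - y) powr s * \<sigma> x)" for x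
  proof (cases "x \<in> K")
    case True
    then have xy: "norm (x - y) > 0" using K y by auto
    have "(\<Sum>b\<in>Basis. g b x \<bullet> b) = (\<Sum>b\<in>(Basis::'a set). norm (x - y) powr s + (s * norm (x - y) powr (s - 2)) * (((x - y) \<bullet> b) * ((x - y) \<bullet> b)))"
      by (intro sum.cong) (auto simp: g_def inner_add_left)
    also have "\<dots> = real DIM('a) * norm (x - y) powr s + (s * norm (x - y) powr (s - 2)) * ((x - y) \<bullet> (x - y))"
      by (simp add: sum.distrib sum_distrib_left[symmetric] euclidean_inner[of "x - y" "x - y", symmetric])
    also have "(s * norm (x - y) powr (s - 2)) * ((x - y) \<bullet> (x - y)) = s * norm (x - y) powr s"
    proof -
      have "(x - y) \<bullet> (x - y) = norm (x - y) powr 2" using xy by (simp add: power2_norm_eq_inner[symmetric])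
      moreover have "norm (x - y) powr (s - 2) * norm (x - y) powr 2 = norm (x - y) powr s" unfolding powr_add[symmetric] by simp
      ultimately show ?thesis by (simp only: mult.assoc)
    qed
    finally have "(\<Sum>b\<in>Basis. g b x \<bullet> b) = - (norm (x - y) powr s)"
      by (simp add: s_def algebra_simps)
    then show ?thesis by (simp add: sum_distrib_left[symmetric] mult.commute)
  qed (use K(3) in simp)
  have "(\<integral>x. Z x \<bullet> G x \<partial>lborel) = (\<integral>x. (\<Sum>b\<in>Basis. (Z x \<bullet> b) * (G x \<bullet> b)) \<partial>lborel)"
    by (intro Bochner_Integration.integral_cong refl) (rule euclidean_inner)
  also have "\<dots> = (\<Sum>b\<in>Basis. - (\<integral>x. \<sigma> x * (g b x \<bullet> b) \<partial>lborel))"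
    using i2 b by (subst Bochner_Integration.integral_sum) auto
  also have "\<dots> = - (\<integral>x. (\<Sum>b\<in>Basis. \<sigma> x * (g b x \<bullet> b)) \<partial>lborel)"
    using i1 by (subst Bochner_Integration.integral_sum) (auto simp: sum_negf)
  also have "\<dots> = (\<integral>x. norm (x - y) powr s * \<sigma> x \<partial>lborel)" unfolding sumg by simp
  finally show ?thesis unfolding Z_def .
qed

section \<open>Comparison with a radial barrier\<close>

lemma indicator_bounded_integrable:
  "open \<Omega> \<Longrightarrow> bounded \<Omega> \<Longrightarrow> integrable lborel (indicator \<Omega> :: 'a::euclidean_space \<Rightarrow> real)"
  using emeasure_bounded_finite by (intro integrable_real_indicator) auto

lemma bounded_support_integrable:
  fixes f :: "'a::euclidean_space \<Rightarrow> 'b::{banach,second_countable_topology}"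
  assumes \<Omega>: "open \<Omega>" "bounded \<Omega>" and f: "f \<in> borel_measurable borel" "\<And>x. norm (f x) \<le> M" "\<And>x. x \<notin> \<Omega> \<Longrightarrow> f x = 0"
  shows "integrable lborel f"
proof (rule Bochner_Integration.integrable_bound[where f="\<lambda>x. M * indicator \<Omega> x"])
  show "AE x in lborel. norm (f x) \<le> norm (M * indicator \<Omega> x)"
  proof (rule AE_I2)
    fix x show "norm (f x) \<le> norm (M * indicator \<Omega> x)"
      using f(2)[of x] f(3)[of x] by (cases "x \<in> \<Omega>") auto
  qed
qed (use indicator_bounded_integrable[OF \<Omega>] f(1) in auto)

lemma powr_le_add: "0 \<le> a \<Longrightarrow> 0 \<le> r \<Longrightarrow> r \<le> s \<Longrightarrow> a powr r \<le> 1 + a powr s" for a :: real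
proof (cases "a \<le> 1")
  case True
  assume "0 \<le> a" "0 \<le> r"
  then have "a powr r \<le> 1 powr r" using True by (intro powr_mono2) auto
  then show ?thesis by (simp add: add_increasing2)
next
  case False
  assume "r \<le> s"
  then have "a powr r \<le> a powr s" using False by (intro powr_mono) auto
  then show ?thesis by simp
qed

lemma pf_integrable:
  fixes \<xi> :: "'a::euclidean_space \<Rightarrow> 'a"
  assumes \<Omega>: "open \<Omega>" "bounded \<Omega>" and q: "1 < q"
    and \<xi>: "\<xi> \<in> borel_measurable borel" "\<And>x. x \<notin> \<Omega> \<Longrightarrow> \<xi> x = 0" "integrable lborel (\<lambda>x. norm (\<xi> x) powr q)"
  shows "integrable lborel (\<lambda>x. pf q (\<xi> x))"
proof (rule Bochner_Integration.integrable_bound[where f="\<lambda>x. indicator \<Omega> x + norm (\<xi> x) powr q"])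
  note \<xi>(1)[measurable]
  show "(\<lambda>x. pf q (\<xi> x)) \<in> borel_measurable lborel" by measurable
  show "AE x in lborel. norm (pf q (\<xi> x)) \<le> norm (indicator \<Omega> x + norm (\<xi> x) powr q)"
  proof (rule AE_I2)
    fix x
    have "norm (\<xi> x) powr (q - 1) \<le> indicator \<Omega> x + norm (\<xi> x) powr q"
      using powr_le_add[of "norm (\<xi> x)" "q - 1" q] q \<xi>(2)[of x] by (cases "x \<in> \<Omega>") auto
    then show "norm (pf q (\<xi> x)) \<le> norm (indicator \<Omega> x + norm (\<xi> x) powr q)"
      unfolding norm_pf[OF q] by (simp add: add_nonneg_nonneg)
  qed
qed (use indicator_bounded_integrable[OF \<Omega>] \<xi>(3) in auto)

text \<open>The barrier \<psi> = A (R^(-\<alpha>) - |x - y|^(-\<alpha>)) vanishes on the sphere of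
  radius R about y and is nonnegative on \<Omega>. Minus the divergence of its q-flux is \<zeta> =
  \<kappa> |x - y|^(-N-1), which exceeds |mu| and so mu u^(q-1): a strict supersolution. The
  difference of the two equations is tested with bp(u - \<psi>); its left side is nonnegative by
  monotonicity, its right side at most minus the integral of bp(u - \<psi>) over \<Omega>.\<close>

lemma barrier_bound:
  fixes \<Omega> :: "(real^'n) set" and \<xi> :: "real^'n \<Rightarrow> real^'n"
  assumes \<Omega>: "open \<Omega>" "bounded \<Omega>" and R: "R > 0" "\<And>x. x \<in> \<Omega> \<Longrightarrow> R \<le> norm (x - y)"
    and q: "1 < q" "q < real CARD('n)"
    and u: "u \<in> borel_measurable borel" "\<And>x. 0 \<le> u x" "\<And>x. u x \<le> 1" "\<And>x. x \<notin> \<Omega> \<Longrightarrow> u x = 0"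
    and \<xi>: "\<xi> \<in> borel_measurable borel" "\<And>x. x \<notin> \<Omega> \<Longrightarrow> \<xi> x = 0" "integrable lborel (\<lambda>x. norm (\<xi> x) powr q)"
    and \<phi>: "\<And>k. test_fun \<Omega> (\<phi> k)"
    and lim: "(\<lambda>k. \<integral>\<^sup>+x. norm (\<phi> k x - u x) powr q \<partial>lborel) \<longlonglongrightarrow> 0"
      "(\<lambda>k. \<integral>\<^sup>+x. norm (grad (\<phi> k) x - \<xi> x) powr q \<partial>lborel) \<longlonglongrightarrow> 0"
    and wd: "weak_div \<Omega> (\<lambda>x. pf q (\<xi> x)) (\<lambda>x. mu * u x powr (q - 1))"
  obtains A \<alpha> where "A > 0" "\<alpha> > 0"
    "AE x in lborel. x \<in> \<Omega> \<longrightarrow> u x \<le> A * (R powr (- \<alpha>) - norm (x - y) powr (- \<alpha>))"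
proof -
  note u(1)[measurable] \<xi>(1)[measurable]
  define N where "N = real CARD('n)"
  have N: "N > q" using q by (simp add: N_def)
  obtain D0 where D0: "\<And>x. x \<in> \<Omega> \<Longrightarrow> norm x \<le> D0" using \<Omega>(2) unfolding bounded_iff by blast
  define D where "D = \<bar>D0\<bar> + norm y + R"
  have D: "D > 0" "\<And>x. x \<in> \<Omega> \<Longrightarrow> norm (x - y) \<le> D"
  proof -
    show "D > 0" using R by (simp add: D_def add_nonneg_pos)
    show "norm (x - y) \<le> D" if "x \<in> \<Omega>" for x using D0[OF that] norm_triangle_ineq4[of x y] R(1) by (simp add: D_def)
  qed
  have y: "y \<notin> \<Omega>" using R by force
  define s where "s = - N - 1"
  \<comment> \<open>Large enough for \<zeta> \<ge> |mu| + 1 even at the largest distance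
    \<open>D\<close>.\<close>
  define \<kappa> where "\<kappa> = (\<bar>mu\<bar> + 1) * D powr (N + 1)"
  have \<kappa>: "\<kappa> > 0" using D by (simp add: \<kappa>_def add_nonneg_pos)
  \<comment> \<open>The exponent with (\<alpha> + 1) (q - 1) = N, so that the flux of the barrier is
    a multiple of |x - y|^(-N-1) (x - y); it is positive because q - 1 < N.\<close>
  define \<alpha> where "\<alpha> = N / (q - 1) - 1"
  have \<alpha>: "\<alpha> > 0" using N q by (simp add: \<alpha>_def field_simps)
  \<comment> \<open>Makes the coefficient (A \<alpha>)^(q-1) of the flux equal to \<kappa>.\<close>
  define A where "A = \<kappa> powr (1 / (q - 1)) / \<alpha>"
  have A: "A > 0" using \<kappa> \<alpha> by (simp add: A_def)
  have A\<alpha>: "A * \<alpha> = \<kappa> powr (1 / (q - 1))" using \<alpha> by (simp add: A_def)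
  define \<psi> where "\<psi> x = A * (R powr (- \<alpha>) - norm (x - y) powr (- \<alpha>))" for x
  define \<psi>' where "\<psi>' x = (A * \<alpha> * norm (x - y) powr (- \<alpha> - 2)) *\<^sub>R (x - y)" for x
  define Z where "Z x = (\<kappa> * (indicator \<Omega> x * norm (x - y) powr s)) *\<^sub>R (x - y)" for x
  define \<zeta> where "\<zeta> x = \<kappa> * (indicator \<Omega> x * norm (x - y) powr s)" for x
  have [measurable]: "\<Omega> \<in> sets borel" using \<Omega> by simp
  have [measurable]: "\<psi> \<in> borel_measurable borel" "\<psi>' \<in> borel_measurable borel" "Z \<in> borel_measurable borel" "\<zeta> \<in> borel_measurable borel"
    unfolding \<psi>_def[abs_def] \<psi>'_def[abs_def] Z_def[abs_def] \<zeta>_def[abs_def] by measurable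
  have pos: "norm (x - y) > 0" if "x \<in> \<Omega>" for x using R(1) R(2)[OF that] by linarith
  have \<psi>0: "0 \<le> \<psi> x" if "x \<in> \<Omega>" for x
  proof -
    have "norm (x - y) powr (- \<alpha>) \<le> R powr (- \<alpha>)" using R(1) R(2)[OF that] \<alpha> by (intro powr_mono2') auto
    then show ?thesis using A by (simp add: \<psi>_def)
  qed
  have d\<psi>: "GDERIV \<psi> x :> \<psi>' x" if "x \<in> \<Omega>" for x
  proof -
    have xy: "x \<noteq> y" using that y by auto
    have "GDERIV (\<lambda>x. A * (R powr (- \<alpha>) - norm (x - y) powr (- \<alpha>))) x
        :> A *\<^sub>R (0 - (- \<alpha> * norm (x - y) powr (- \<alpha> - 2)) *\<^sub>R (x - y)) + (R powr (- \<alpha>) - norm (x - y) powr (- \<alpha>)) *\<^sub>R 0"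
      by (intro GDERIV_mult GDERIV_const GDERIV_diff GDERIV_norm_powr xy)
    then show ?thesis unfolding \<psi>_def[abs_def] \<psi>'_def by (simp add: mult.assoc)
  qed
  have c\<psi>': "continuous_on \<Omega> \<psi>'" unfolding \<psi>'_def[abs_def] using y by (intro continuous_intros) auto
  have pf\<psi>: "pf q (\<psi>' x) = Z x" if x: "x \<in> \<Omega>" for x
  proof -
    define \<rho> where "\<rho> = norm (x - y)"
    have \<rho>: "\<rho> > 0" using pos[OF x] by (simp add: \<rho>_def)
    have n: "norm (\<psi>' x) = A * \<alpha> * \<rho> powr (- \<alpha> - 1)"
    proof -
      have "norm (\<psi>' x) = A * \<alpha> * (\<rho> powr (- \<alpha> - 2) * \<rho>)" using A \<alpha> by (simp add: \<psi>'_def \<rho>_def)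
      also have "\<rho> powr (- \<alpha> - 2) * \<rho> = \<rho> powr ((- \<alpha> - 2) + 1)" using \<rho> unfolding powr_add by simp
      also have "(- \<alpha> - 2) + 1 = - \<alpha> - 1" by simp
      finally show ?thesis .
    qed
    have "norm (\<psi>' x) powr (q - 2) * (A * \<alpha> * \<rho> powr (- \<alpha> - 2)) = \<kappa> * \<rho> powr s"
    proof -
      have "norm (\<psi>' x) powr (q - 2) = (A * \<alpha>) powr (q - 2) * \<rho> powr ((- \<alpha> - 1) * (q - 2))"
        unfolding n using A \<alpha> \<rho> by (simp add: powr_mult powr_powr)
      then have "norm (\<psi>' x) powr (q - 2) * (A * \<alpha> * \<rho> powr (- \<alpha> - 2))
         = ((A * \<alpha>) powr (q - 2) * (A * \<alpha>)) * (\<rho> powr ((- \<alpha> - 1) * (q - 2)) * \<rho> powr (- \<alpha> - 2))" by simp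
      also have "(A * \<alpha>) powr (q - 2) * (A * \<alpha>) = (A * \<alpha>) powr (q - 1)"
        using powr_mult_base[of "A * \<alpha>" "q - 2"] A \<alpha> by (simp add: mult.commute)
      also have "(A * \<alpha>) powr (q - 1) = \<kappa>" unfolding A\<alpha> using \<kappa> q by (simp add: powr_powr)
      also have "\<rho> powr ((- \<alpha> - 1) * (q - 2)) * \<rho> powr (- \<alpha> - 2) = \<rho> powr ((- \<alpha> - 1) * (q - 2) + (- \<alpha> - 2))"
        by (simp add: powr_add)
      also have "(- \<alpha> - 1) * (q - 2) + (- \<alpha> - 2) = s"
      proof -
        have "(\<alpha> + 1) * (q - 1) = N" using q by (simp add: \<alpha>_def)
        moreover have "(- \<alpha> - 1) * (q - 2) + (- \<alpha> - 2) = - ((\<alpha> + 1) * (q - 1)) - 1" by (simp add: algebra_simps)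
        ultimately show ?thesis by (simp add: s_def)
      qed
      finally show ?thesis .
    qed
    then show ?thesis using x unfolding pf_def Z_def \<rho>_def
      by (simp add: \<psi>'_def[of x])
  qed
  have \<zeta>1: "\<bar>mu\<bar> + 1 \<le> \<zeta> x" if x: "x \<in> \<Omega>" for x
  proof -
    have "D powr s \<le> norm (x - y) powr s" using D(2)[OF x] pos[OF x] N q by (intro powr_mono2') (auto simp: s_def)
    then have "\<kappa> * D powr s \<le> \<kappa> * norm (x - y) powr s" using \<kappa> by (intro mult_left_mono) auto
    moreover have "\<kappa> * D powr s = \<bar>mu\<bar> + 1" using D by (simp add: \<kappa>_def s_def powr_add[symmetric])
    ultimately show ?thesis using x by (simp add: \<zeta>_def)
  qed
  define ZM where "ZM = \<kappa> * R powr s * D"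
  have rs: "norm (x - y) powr s \<le> R powr s" if "x \<in> \<Omega>" for x
    using R(1) R(2)[OF that] N q by (intro powr_mono2') (auto simp: s_def)
  have Zb: "norm (Z x) \<le> ZM" for x
  proof (cases "x \<in> \<Omega>")
    case True
    have "norm (Z x) = (\<kappa> * norm (x - y) powr s) * norm (x - y)" using True \<kappa> by (simp add: Z_def)
    also have "\<dots> \<le> (\<kappa> * R powr s) * D" using rs[OF True] D(2)[OF True] \<kappa> by (intro mult_mono) auto
    finally show ?thesis by (simp add: ZM_def)
  qed (use \<kappa> D in \<open>simp add: Z_def ZM_def\<close>)
  have Z0: "Z x = 0" if "x \<notin> \<Omega>" for x using that by (simp add: Z_def)
  have \<zeta>b: "\<bar>\<zeta> x\<bar> \<le> \<kappa> * R powr s" for x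
    using rs[of x] \<kappa> by (cases "x \<in> \<Omega>") (auto simp: \<zeta>_def abs_mult)
  define X where "X x = pf q (\<xi> x)" for x
  have [measurable]: "X \<in> borel_measurable borel" unfolding X_def[abs_def] by measurable
  have nX: "norm (X x) = norm (\<xi> x) powr (q - 1)" for x unfolding X_def by (rule norm_pf[OF q(1)])
  have Xq: "integrable lborel (\<lambda>x. norm (X x) powr (q / (q - 1)))"
    unfolding nX powr_powr using \<xi>(3) q by simp
  define F where "F x = X x - Z x" for x
  have [measurable]: "F \<in> borel_measurable borel" unfolding F_def[abs_def] by measurable
  have q': "q / (q - 1) > 0" using q by simp
  have Fq: "integrable lborel (\<lambda>x. norm (F x) powr (q / (q - 1)))"
    unfolding F_def
  proof (rule Lp_diff_integrable[OF Xq _ q'])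
    show "integrable lborel (\<lambda>x. norm (Z x) powr (q / (q - 1)))"
      by (rule bounded_support_integrable[OF \<Omega>, where M="ZM powr (q / (q - 1))"]) (use Zb Z0 q' in \<open>auto intro!: powr_mono2\<close>)
  qed auto
  have F0: "F x = 0" if "x \<notin> \<Omega>" for x using Z0[OF that] \<xi>(2)[OF that] by (simp add: F_def X_def pf_def)
  have Xi: "integrable lborel X" unfolding X_def[abs_def] by (rule pf_integrable[OF \<Omega> q(1) \<xi>])
  have Zi: "integrable lborel Z" by (rule bounded_support_integrable[OF \<Omega>, where M=ZM]) (use Zb Z0 in auto)
  define Q where "Q x = mu * u x powr (q - 1) - \<zeta> x" for x
  have [measurable]: "Q \<in> borel_measurable borel" unfolding Q_def[abs_def] by measurable
  have up: "\<bar>mu * u x powr (q - 1)\<bar> \<le> \<bar>mu\<bar>" for x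
  proof -
    have "u x powr (q - 1) \<le> 1 powr (q - 1)" using u(2,3)[of x] q by (intro powr_mono2) auto
    then have "\<bar>mu\<bar> * u x powr (q - 1) \<le> \<bar>mu\<bar> * 1" by (intro mult_left_mono) auto
    then show ?thesis by (simp add: abs_mult)
  qed
  have Qb: "\<bar>Q x\<bar> \<le> \<bar>mu\<bar> + \<kappa> * R powr s" for x using up[of x] \<zeta>b[of x] by (simp add: Q_def)
  have Q0: "Q x = 0" if "x \<notin> \<Omega>" for x using that u(4) by (simp add: Q_def \<zeta>_def)
  have Q1: "Q x \<le> -1" if "x \<in> \<Omega>" for x using up[of x] \<zeta>1[OF that] by (simp add: Q_def)
  note C = test_fun_C1c[OF \<phi>]
  have [measurable]: "\<phi> k \<in> borel_measurable borel" "grad (\<phi> k) \<in> borel_measurable borel" for k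
    using C1_borel[OF C1c_C1[OF C[of k]]] by auto
  \<comment> \<open>The zero boundary values of \<open>u\<close> enter through its approximation by
    test functions: since \<psi> \<ge> 0 on \<Omega>, bp(\<phi> k - \<psi>) vanishes wherever \<phi>
    k does, hence has compact support in \<Omega>.\<close>
  define ch where "ch k x = indicator \<Omega> x * bp (\<phi> k x - \<psi> x)" for k x
  define Gk where "Gk k x = (indicator \<Omega> x * bp' (\<phi> k x - \<psi> x)) *\<^sub>R (grad (\<phi> k) x - \<psi>' x)" for k x
  define chi where "chi x = indicator \<Omega> x * bp (u x - \<psi> x)" for x
  define G where "G x = (indicator \<Omega> x * bp' (u x - \<psi> x)) *\<^sub>R (\<xi> x - \<psi>' x)" for x
  have [measurable]: "ch k \<in> borel_measurable borel" "Gk k \<in> borel_measurable borel" "chi \<in> borel_measurable borel" "G \<in> borel_measurable borel" for k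
    unfolding ch_def[abs_def] Gk_def[abs_def] chi_def[abs_def] G_def[abs_def] by measurable
  have C1c: "C1c \<Omega> (ch k) (Gk k)" for k
  proof -
    obtain K where K: "compact K" "K \<subseteq> \<Omega>" "\<And>x. x \<notin> K \<Longrightarrow> \<phi> k x = 0" "\<And>x. x \<notin> K \<Longrightarrow> grad (\<phi> k) x = 0"
      using C[of k] by (auto elim: C1c_obtain)
    show ?thesis
    proof (rule C1c_local[OF \<Omega>(1) K(1,2)])
      show "ch k x = 0" "Gk k x = 0" if "x \<notin> K" for x
        using \<psi>0[of x] K(3)[OF that] by (auto simp: ch_def Gk_def indicator_def bp_zero)
      show "GDERIV (ch k) x :> Gk k x" if x: "x \<in> \<Omega>" for x
      proof -
        have "GDERIV (\<lambda>x. \<phi> k x - \<psi> x) x :> grad (\<phi> k) x - \<psi>' x"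
          by (rule GDERIV_diff[OF C1_D(1)[OF C1c_C1[OF C]] d\<psi>[OF x]])
        from GDERIV_DERIV_compose[OF this bp_DERIV]
        have "GDERIV (\<lambda>x. bp (\<phi> k x - \<psi> x)) x :> bp' (\<phi> k x - \<psi> x) *\<^sub>R (grad (\<phi> k) x - \<psi>' x)" .
        then have "((\<lambda>x. bp (\<phi> k x - \<psi> x)) has_derivative (\<lambda>h. h \<bullet> Gk k x)) (at x)"
          using x by (simp add: gderiv_def Gk_def)
        then have "(ch k has_derivative (\<lambda>h. h \<bullet> Gk k x)) (at x)"
          by (rule has_derivative_transform_within_open[OF _ \<Omega>(1) x]) (simp add: ch_def)
        then show ?thesis by (simp add: gderiv_def)
      qed
      have cd: "continuous_on \<Omega> \<psi>"
        unfolding \<psi>_def[abs_def] using y by (intro continuous_intros) auto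
      have "continuous_on \<Omega> (\<lambda>x. bp' (\<phi> k x - \<psi> x))"
        by (rule continuous_on_compose2[OF bp_continuous(2)[of UNIV]])
          (use C1_D(3)[OF C1c_C1[OF C[of k]]] cd in \<open>auto intro!: continuous_intros intro: continuous_on_subset\<close>)
      then have "continuous_on \<Omega> (\<lambda>x. bp' (\<phi> k x - \<psi> x) *\<^sub>R (grad (\<phi> k) x - \<psi>' x))"
        using C1_D(2)[OF C1c_C1[OF C[of k]]] c\<psi>' by (intro continuous_intros) (auto intro: continuous_on_subset)
      then show "continuous_on \<Omega> (Gk k)"
        by (rule continuous_on_eq) (simp add: Gk_def)
    qed
  qed
  have eqk: "(\<integral>x. F x \<bullet> Gk k x \<partial>lborel) = (\<integral>x. Q x \<bullet> ch k x \<partial>lborel)" for k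
  proof -
    note c = C1c[of k]
    obtain K where K: "compact K" "K \<subseteq> \<Omega>" "\<And>x. x \<notin> K \<Longrightarrow> ch k x = 0" "\<And>x. x \<notin> K \<Longrightarrow> Gk k x = 0" using c by (auto elim: C1c_obtain)
    obtain M1 where M1: "\<And>x. norm (ch k x) \<le> M1" using compact_support_bounded'[OF C1_D(3)[OF C1c_C1[OF c]] K(1,3)] by auto
    obtain M2 where M2: "\<And>x. norm (Gk k x) \<le> M2" using compact_support_bounded'[OF C1_D(2)[OF C1c_C1[OF c]] K(1,4)] by auto
    have 1: "(\<integral>x. X x \<bullet> Gk k x \<partial>lborel) = (\<integral>x. (mu * u x powr (q - 1)) * ch k x \<partial>lborel)"
      using wd c unfolding weak_div_def X_def by blast
    have 2: "(\<integral>x. Z x \<bullet> Gk k x \<partial>lborel) = (\<integral>x. \<zeta> x * ch k x \<partial>lborel)"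
    proof -
      have "(\<integral>x. Z x \<bullet> Gk k x \<partial>lborel) = (\<integral>x. \<kappa> * ((norm (x - y) powr s *\<^sub>R (x - y)) \<bullet> Gk k x) \<partial>lborel)"
      proof (intro Bochner_Integration.integral_cong refl)
        fix x show "Z x \<bullet> Gk k x = \<kappa> * ((norm (x - y) powr s *\<^sub>R (x - y)) \<bullet> Gk k x)"
          by (cases "x \<in> \<Omega>") (simp_all add: Z_def Gk_def)
      qed
      also have "\<dots> = \<kappa> * (\<integral>x. norm (x - y) powr s * ch k x \<partial>lborel)"
        using radial_field_weak_div[OF \<Omega>(1) y c] by (simp add: s_def N_def)
      also have "\<dots> = (\<integral>x. \<kappa> * (norm (x - y) powr s * ch k x) \<partial>lborel)" by simp
      also have "\<dots> = (\<integral>x. \<zeta> x * ch k x \<partial>lborel)"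
      proof (intro Bochner_Integration.integral_cong refl)
        fix x show "\<kappa> * (norm (x - y) powr s * ch k x) = \<zeta> x * ch k x"
          by (cases "x \<in> \<Omega>") (simp_all add: \<zeta>_def ch_def)
      qed
      finally show ?thesis .
    qed
    have i: "integrable lborel (\<lambda>x. X x \<bullet> Gk k x)" "integrable lborel (\<lambda>x. Z x \<bullet> Gk k x)"
      by (rule integrable_inner_bounded[OF _ _ M2]; use Xi Zi in measurable)+
    have j1: "integrable lborel (\<lambda>x. mu * u x powr (q - 1))" by (rule bounded_support_integrable[OF \<Omega>, where M="\<bar>mu\<bar>"]) (use up u(4) in auto)
    have j2: "integrable lborel \<zeta>" by (rule bounded_support_integrable[OF \<Omega>, where M="\<kappa> * R powr s"]) (use \<zeta>b in \<open>auto simp: \<zeta>_def\<close>)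
    have j: "integrable lborel (\<lambda>x. (mu * u x powr (q - 1)) \<bullet> ch k x)" "integrable lborel (\<lambda>x. \<zeta> x \<bullet> ch k x)"
      by (rule integrable_inner_bounded[OF _ _ M1]; use j1 j2 in measurable)+
    have "(\<integral>x. F x \<bullet> Gk k x \<partial>lborel) = (\<integral>x. X x \<bullet> Gk k x \<partial>lborel) - (\<integral>x. Z x \<bullet> Gk k x \<partial>lborel)"
      unfolding F_def inner_diff_left using i by (rule Bochner_Integration.integral_diff)
    also have "\<dots> = (\<integral>x. (mu * u x powr (q - 1)) \<bullet> ch k x \<partial>lborel) - (\<integral>x. \<zeta> x \<bullet> ch k x \<partial>lborel)"
      unfolding 1 2 by simp
    also have "\<dots> = (\<integral>x. Q x \<bullet> ch k x \<partial>lborel)"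
      unfolding Q_def inner_diff_left using j by (rule Bochner_Integration.integral_diff[symmetric])
    finally show ?thesis .
  qed
  have \<phi>i: "integrable lborel (\<lambda>x. norm (\<phi> k x - u x) powr q)" for k
  proof -
    obtain K where K: "compact K" "K \<subseteq> \<Omega>" "\<And>x. x \<notin> K \<Longrightarrow> \<phi> k x = 0" using C[of k] by (auto elim: C1c_obtain)
    obtain M where M: "\<And>x. norm (\<phi> k x) \<le> M" using compact_support_bounded'[OF C1_D(3)[OF C1c_C1[OF C]] K(1,3)] by auto
    show ?thesis
    proof (rule bounded_support_integrable[OF \<Omega>, where M="(M + 1) powr q"])
      show "norm (norm (\<phi> k x - u x) powr q) \<le> (M + 1) powr q" for x
      proof -
        have "norm (\<phi> k x - u x) \<le> M + 1" using M[of x] u(2,3)[of x] by simp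
        then show ?thesis using q by (simp add: powr_mono2)
      qed
      show "norm (\<phi> k x - u x) powr q = 0" if "x \<notin> \<Omega>" for x using that K u(4) by (metis diff_zero norm_zero powr_zero_eq_one powr_0 subsetD)
    qed measurable
  qed
  \<comment> \<open>The weight \<open>H\<close> below is merely integrable, so the factors
    bp'(\<phi> k - \<psi>) are treated by dominated convergence, which asks for convergence almost
    everywhere along a subsequence.\<close>
  obtain t :: "nat \<Rightarrow> nat" where t: "strict_mono t" "AE x in lborel. (\<lambda>n. \<phi> (t n) x) \<longlonglongrightarrow> u x"
    by (rule Lp_AE_subseq[OF lim(1) _ _ _ \<phi>i]) (use q in auto)
  define \<psi>d where "\<psi>d x = indicator \<Omega> x *\<^sub>R \<psi>' x" for x
  have [measurable]: "\<psi>d \<in> borel_measurable borel" unfolding \<psi>d_def[abs_def] by measurable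
  have \<psi>db: "norm (\<psi>d x) \<le> A * \<alpha> * R powr (- \<alpha> - 2) * D" for x
  proof (cases "x \<in> \<Omega>")
    case True
    have "norm (x - y) powr (- \<alpha> - 2) \<le> R powr (- \<alpha> - 2)" using R(1) R(2)[OF True] \<alpha> by (intro powr_mono2') auto
    then have "(A * \<alpha> * norm (x - y) powr (- \<alpha> - 2)) * norm (x - y) \<le> (A * \<alpha> * R powr (- \<alpha> - 2)) * D"
      using D(2)[OF True] A \<alpha> by (intro mult_mono mult_left_mono) auto
    then show ?thesis using True A \<alpha> by (simp add: \<psi>d_def \<psi>'_def)
  qed (use A \<alpha> D in \<open>simp add: \<psi>d_def\<close>)
  have \<psi>dq: "integrable lborel (\<lambda>x. norm (\<psi>d x) powr q)"
    by (rule bounded_support_integrable[OF \<Omega>, where M="(A * \<alpha> * R powr (- \<alpha> - 2) * D) powr q"]) (use \<psi>db q in \<open>auto intro!: powr_mono2 simp: \<psi>d_def\<close>)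
  have xd: "integrable lborel (\<lambda>x. norm (\<xi> x - \<psi>d x) powr q)"
    by (rule Lp_diff_integrable[OF \<xi>(3) \<psi>dq]) (use q in auto)
  define H where "H x = norm (F x) * norm (\<xi> x - \<psi>d x)" for x
  have iH: "integrable lborel H" unfolding H_def[abs_def]
    by (rule Lp_pair_integrable[OF xd Fq q(1)]) auto
  have [measurable]: "H \<in> borel_measurable borel" using iH by auto
  have w1: "wlim (\<lambda>x. norm (F x)) (\<lambda>n. grad (\<phi> (t n))) \<xi>"
    by (rule wlim_subseq[OF wlim_Lp[OF lim(2) q(1)] t(1)]) (use Fq in auto)
  have w2: "wlim H (\<lambda>n x. bp' (\<phi> (t n) x - \<psi> x)) (\<lambda>x. bp' (u x - \<psi> x))"
  proof (rule wlim_dominated[OF iH, where c=1])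
    show "\<bar>bp' (\<phi> (t n) x - \<psi> x) - bp' (u x - \<psi> x)\<bar> \<le> 1" for n x
      using bp'_bounds[of "\<phi> (t n) x - \<psi> x"] bp'_bounds[of "u x - \<psi> x"] by linarith
    show "AE x in lborel. (\<lambda>n. bp' (\<phi> (t n) x - \<psi> x)) \<longlonglongrightarrow> bp' (u x - \<psi> x)"
      using t(2)
    proof eventually_elim
      case (elim x)
      have "isCont bp' (u x - \<psi> x)" using bp_continuous(2)[of UNIV] by (simp add: continuous_on_eq_continuous_at)
      then show ?case by (rule isCont_tendsto_compose) (intro tendsto_intros elim)
    qed
  qed auto
  \<comment> \<open>The gradient moves with weight |F|, the factor bp' with the weight H = |F|
    |\<xi> - \<psi>d|.\<close>
  have w3: "wlim (\<lambda>x. norm (F x)) (\<lambda>n. Gk (t n)) G"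
  proof (rule wlim_add_mono[OF w1 w2, where c=1])
    fix n x
    show "\<bar>norm (F x)\<bar> * norm (Gk (t n) x - G x) \<le> 1 * (\<bar>norm (F x)\<bar> * norm (grad (\<phi> (t n)) x - \<xi> x))
      + \<bar>H x\<bar> * norm (bp' (\<phi> (t n) x - \<psi> x) - bp' (u x - \<psi> x))"
    proof (cases "x \<in> \<Omega>")
      case True
      define a where "a = bp' (\<phi> (t n) x - \<psi> x)"
      define b where "b = bp' (u x - \<psi> x)"
      have a: "0 \<le> a" "a \<le> 1" using bp'_bounds by (auto simp: a_def)
      have "Gk (t n) x - G x = a *\<^sub>R (grad (\<phi> (t n)) x - \<xi> x) + (a - b) *\<^sub>R (\<xi> x - \<psi>d x)"
        using True by (simp add: Gk_def G_def \<psi>d_def a_def b_def algebra_simps)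
      then have "norm (Gk (t n) x - G x) \<le> a * norm (grad (\<phi> (t n)) x - \<xi> x) + \<bar>a - b\<bar> * norm (\<xi> x - \<psi>d x)"
        using norm_triangle_ineq[of "a *\<^sub>R (grad (\<phi> (t n)) x - \<xi> x)" "(a - b) *\<^sub>R (\<xi> x - \<psi>d x)"] a by simp
      also have "\<dots> \<le> 1 * norm (grad (\<phi> (t n)) x - \<xi> x) + \<bar>a - b\<bar> * norm (\<xi> x - \<psi>d x)"
        using a by (intro add_right_mono mult_right_mono) auto
      finally have "norm (F x) * norm (Gk (t n) x - G x) \<le> norm (F x) * (norm (grad (\<phi> (t n)) x - \<xi> x) + \<bar>a - b\<bar> * norm (\<xi> x - \<psi>d x))"
        by (intro mult_left_mono) auto
      also have "\<dots> = norm (F x) * norm (grad (\<phi> (t n)) x - \<xi> x) + H x * \<bar>a - b\<bar>" by (simp add: H_def algebra_simps)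
      finally show ?thesis by (simp add: a_def b_def H_def)
    qed (use F0 in simp)
  qed auto
  have Gle: "norm (G x) \<le> norm (\<xi> x - \<psi>d x)" for x
    using bp'_bounds[of "u x - \<psi> x"] by (cases "x \<in> \<Omega>") (auto simp: G_def \<psi>d_def mult_left_le_one_le)
  have iFG: "integrable lborel (\<lambda>x. F x \<bullet> G x)"
  proof (rule Bochner_Integration.integrable_bound[OF iH])
    show "AE x in lborel. norm (F x \<bullet> G x) \<le> norm (H x)"
    proof (rule AE_I2)
      fix x
      have "norm (F x \<bullet> G x) \<le> norm (F x) * norm (G x)" using Cauchy_Schwarz_ineq2[of "F x" "G x"] by simp
      also have "\<dots> \<le> H x" unfolding H_def using Gle by (intro mult_left_mono) auto
      finally show "norm (F x \<bullet> G x) \<le> norm (H x)" by (simp add: H_def)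
    qed
  qed measurable
  have l1: "(\<lambda>n. \<integral>x. F x \<bullet> Gk (t n) x \<partial>lborel) \<longlonglongrightarrow> (\<integral>x. F x \<bullet> G x \<partial>lborel)"
    by (rule wlim_integral[OF w3 _ _ _ _ iFG]) auto
  have Qq: "integrable lborel (\<lambda>x. \<bar>Q x\<bar> powr (q / (q - 1)))"
    by (rule bounded_support_integrable[OF \<Omega>, where M="(\<bar>mu\<bar> + \<kappa> * R powr s) powr (q / (q - 1))"]) (use Qb Q0 q' in \<open>auto intro!: powr_mono2\<close>)
  have w4: "wlim Q (\<lambda>n. \<phi> (t n)) u"
    by (rule wlim_subseq[OF wlim_Lp[OF lim(1) q(1)] t(1)]) (use Qq in auto)
  have w5: "wlim Q (\<lambda>n. ch (t n)) chi"
  proof (rule wlim_mono[OF w4, where c=1])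
    fix n x
    have "\<bar>ch (t n) x - chi x\<bar> \<le> \<bar>\<phi> (t n) x - u x\<bar>"
      using bp_Lipschitz[of "\<phi> (t n) x - \<psi> x" "u x - \<psi> x"] by (cases "x \<in> \<Omega>") (auto simp: ch_def chi_def)
    then show "\<bar>Q x\<bar> * norm (ch (t n) x - chi x) \<le> 1 * (\<bar>Q x\<bar> * norm (\<phi> (t n) x - u x))"
      by (simp add: mult_left_mono)
  qed auto
  have chib: "0 \<le> chi x" "chi x \<le> 1" "x \<notin> \<Omega> \<Longrightarrow> chi x = 0" for x
  proof -
    show "0 \<le> chi x" using bp_ge0 by (simp add: chi_def indicator_def)
    show "chi x \<le> 1"
    proof (cases "x \<in> \<Omega> \<and> \<psi> x < u x")
      case True
      then show ?thesis using bp_abs_le[of "u x - \<psi> x"] bp_ge0[of "u x - \<psi> x"] \<psi>0[of x] u(3)[of x] by (simp add: chi_def)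
    next
      case False
      then show ?thesis by (auto simp: chi_def bp_zero indicator_def)
    qed
  qed (simp add: chi_def)
  have chii: "integrable lborel chi" by (rule bounded_support_integrable[OF \<Omega>, where M=1]) (use chib in auto)
  have iQ: "integrable lborel (\<lambda>x. Q x \<bullet> chi x)"
  proof -
    have "integrable lborel Q" by (rule bounded_support_integrable[OF \<Omega>, where M="\<bar>mu\<bar> + \<kappa> * R powr s"]) (use Qb Q0 in auto)
    then show ?thesis by (rule integrable_inner_bounded[where M=1]) (use chib in auto)
  qed
  have l2: "(\<lambda>n. \<integral>x. Q x \<bullet> ch (t n) x \<partial>lborel) \<longlonglongrightarrow> (\<integral>x. Q x \<bullet> chi x \<partial>lborel)"
    by (rule wlim_integral[OF w5 _ _ _ _ iQ]) auto
  have eq: "(\<integral>x. F x \<bullet> G x \<partial>lborel) = (\<integral>x. Q x \<bullet> chi x \<partial>lborel)"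
    using LIMSEQ_unique[OF l1[unfolded eqk] l2] .
  \<comment> \<open>Monotonicity of the q-flux gives the sign on the left; on the right Q \<le> -1
    on \<Omega>, so the integral of \<open>chi\<close> is at most 0.\<close>
  have "0 \<le> (\<integral>x. F x \<bullet> G x \<partial>lborel)"
  proof (rule Bochner_Integration.integral_nonneg)
    fix x
    show "0 \<le> F x \<bullet> G x"
    proof (cases "x \<in> \<Omega>")
      case True
      have "F x \<bullet> G x = bp' (u x - \<psi> x) * ((pf q (\<xi> x) - pf q (\<psi>' x)) \<bullet> (\<xi> x - \<psi>' x))"
        using True by (simp add: F_def G_def X_def pf\<psi>)
      then show ?thesis using mult_nonneg_nonneg[OF bp'_bounds(1)[of "u x - \<psi> x"] pf_monotone0[OF q(1), of "\<xi> x" "\<psi>' x"]] by simp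
    qed (use F0 in simp)
  qed
  also note eq
  also have "(\<integral>x. Q x \<bullet> chi x \<partial>lborel) \<le> (\<integral>x. - chi x \<partial>lborel)"
  proof (rule integral_mono[OF iQ])
    show "integrable lborel (\<lambda>x. - chi x)" using chii by simp
    fix x
    show "Q x \<bullet> chi x \<le> - chi x"
    proof (cases "x \<in> \<Omega>")
      case True
      then show ?thesis using mult_right_mono[OF Q1[OF True] chib(1)[of x]] by simp
    qed (use chib in simp)
  qed
  finally have "(\<integral>x. chi x \<partial>lborel) \<le> 0" by simp
  moreover have "0 \<le> (\<integral>x. chi x \<partial>lborel)" using chib by (intro Bochner_Integration.integral_nonneg) auto
  ultimately have "(\<integral>x. chi x \<partial>lborel) = 0" by simp
  then have "AE x in lborel. chi x = 0" using integral_nonneg_eq_0_iff_AE[OF chii] chib by simp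
  then have "AE x in lborel. x \<in> \<Omega> \<longrightarrow> u x \<le> A * (R powr (- \<alpha>) - norm (x - y) powr (- \<alpha>))"
  proof eventually_elim
    case (elim x)
    show ?case
    proof
      assume "x \<in> \<Omega>"
      then have "bp (u x - \<psi> x) = 0" using elim by (simp add: chi_def)
      then have "u x \<le> \<psi> x" using bp_pos_iff[of "u x - \<psi> x"] by auto
      then show "u x \<le> A * (R powr (- \<alpha>) - norm (x - y) powr (- \<alpha>))" by (simp add: \<psi>_def)
    qed
  qed
  with A \<alpha> show ?thesis by (rule that)
qed

section \<open>Exterior balls at a C^2 boundary and smallness near it\<close>

lemma C2_fun_second_order:
  fixes \<gamma> :: "real^'n \<Rightarrow> real"
  assumes "C2_fun \<gamma>"
  obtains g M \<delta> where "(\<gamma> has_derivative (\<lambda>h. h \<bullet> g)) (at a)" "M \<ge> 0" "\<delta> > 0"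
    "\<And>b. norm (b - a) < \<delta> \<Longrightarrow> \<bar>\<gamma> b - \<gamma> a - (b - a) \<bullet> g\<bar> \<le> M * norm (b - a) ^ 2"
proof -
  obtain Df :: "real^'n \<Rightarrow> ((real^'n) \<Rightarrow>\<^sub>L real)" and D2f where
    d: "\<And>x. (\<gamma> has_derivative blinfun_apply (Df x)) (at x)" "\<And>x. (Df has_derivative blinfun_apply (D2f x)) (at x)"
    and c: "continuous_on UNIV D2f"
    using assms unfolding C2_fun_def by blast
  \<comment> \<open>On a small ball the second derivative differs by less than 1 from its value at
    \<open>a\<close>, so \<open>M\<close> bounds it there. The mean value inequality, applied to the
    derivative and then to the function minus its linear part, gives the quadratic
    remainder.\<close>
  define M where "M = norm (D2f a) + 1"
  have "isCont D2f a" using c by (simp add: continuous_on_eq_continuous_at)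
  then obtain \<delta> where \<delta>: "\<delta> > 0" "\<And>b. dist b a < \<delta> \<Longrightarrow> dist (D2f b) (D2f a) < 1"
    unfolding continuous_at_eps_delta by (metis zero_less_one)
  have D2: "norm (D2f b) \<le> M" if "b \<in> ball a \<delta>" for b
    using \<delta>(2)[of b] that norm_triangle_sub[of "D2f b" "D2f a"] by (simp add: M_def dist_norm norm_minus_commute)
  have D1: "norm (Df b - Df a) \<le> M * norm (b - a)" if "b \<in> ball a \<delta>" for b
    by (rule differentiable_bound[where S="ball a \<delta>" and f'="\<lambda>x. blinfun_apply (D2f x)"])
      (use that \<delta>(1) d(2) D2 in \<open>auto intro: has_derivative_at_withinI simp: norm_blinfun.rep_eq[symmetric]\<close>)
  define g where "g = adjoint (blinfun_apply (Df a)) 1"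
  have g: "blinfun_apply (Df a) h = h \<bullet> g" for h
    using adjoint_works[of "blinfun_apply (Df a)" h 1] blinfun.bounded_linear_right[of "Df a"]
    by (simp add: g_def linear_linear)
  have gf: "blinfun_apply (Df a) = (\<lambda>h. h \<bullet> g)" by (rule ext) (rule g)
  have "\<bar>\<gamma> b - \<gamma> a - (b - a) \<bullet> g\<bar> \<le> M * norm (b - a) ^ 2" if b: "norm (b - a) < \<delta>" for b
  proof -
    define h where "h x = \<gamma> x - blinfun_apply (Df a) x" for x
    have dh: "(h has_derivative blinfun_apply (Df x - Df a)) (at x)" for x
    proof -
      have "(h has_derivative (\<lambda>y. blinfun_apply (Df x) y - blinfun_apply (Df a) y)) (at x)"
        unfolding h_def[abs_def] by (intro has_derivative_diff d(1) bounded_linear_imp_has_derivative blinfun.bounded_linear_right)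
      moreover have "blinfun_apply (Df x - Df a) = (\<lambda>y. blinfun_apply (Df x) y - blinfun_apply (Df a) y)" by (simp add: fun_eq_iff blinfun.diff_left)
      ultimately show ?thesis by simp
    qed
    have "norm (h b - h a) \<le> (M * norm (b - a)) * norm (b - a)"
    proof (rule differentiable_bound[where S="cball a (norm (b - a))" and f'="\<lambda>x. blinfun_apply (Df x - Df a)"])
      fix x assume x: "x \<in> cball a (norm (b - a))"
      show "(h has_derivative blinfun_apply (Df x - Df a)) (at x within cball a (norm (b - a)))"
        by (rule has_derivative_at_withinI[OF dh])
      have "norm (Df x - Df a) \<le> M * norm (x - a)" using x b by (intro D1) simp
      also have "\<dots> \<le> M * norm (b - a)" using x by (intro mult_left_mono) (auto simp: M_def dist_norm norm_minus_commute)
      finally show "onorm (blinfun_apply (Df x - Df a)) \<le> M * norm (b - a)" by (simp add: norm_blinfun.rep_eq)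
    qed (auto simp: dist_norm norm_minus_commute)
    moreover have "h b - h a = \<gamma> b - \<gamma> a - (b - a) \<bullet> g" by (simp add: h_def g inner_diff_left)
    ultimately show ?thesis by (simp add: power2_eq_square mult.assoc)
  qed
  moreover have "(\<gamma> has_derivative (\<lambda>h. h \<bullet> g)) (at a)" using d(1)[of a] by (simp only: gf)
  moreover have "M \<ge> 0" by (simp add: M_def)
  ultimately show ?thesis using \<delta>(1) by (intro that)
qed

text \<open>Near x0, in rotated coordinates, \<Omega> is the supergraph of \<gamma>, and \<gamma>
  lies above a paraboloid with slope \<open>g\<close> and opening \<open>M\<close>. A ball under the
  graph, tangent at x0 and of radius small compared with 1/M, stays below that paraboloid.\<close>

lemma exterior_ball:
  fixes \<Omega> :: "(real^'n) set"
  assumes \<Omega>: "open \<Omega>" "C2_boundary \<Omega>" and x0: "x0 \<in> frontier \<Omega>"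
  obtains y R where "R > 0" "norm (x0 - y) = R" "\<And>x. x \<in> \<Omega> \<Longrightarrow> R \<le> norm (x - y)"
proof -
  obtain r T k and \<gamma> :: "real^'n \<Rightarrow> real" where r: "r > 0" and T: "orthogonal_transformation T" and \<gamma>: "C2_fun \<gamma>"
    and k: "\<And>y t. \<gamma> (y + t *\<^sub>R axis k 1) = \<gamma> y" and loc: "\<And>x. x \<in> ball x0 r \<Longrightarrow> x \<in> \<Omega> \<longleftrightarrow> (T x) $ k > \<gamma> (T x)"
    using \<Omega>(2) x0 unfolding C2_boundary_def by blast
  have lin: "linear T" and nT: "norm (T x) = norm x" for x using T orthogonal_transformation by blast+
  have cT: "isCont T x" for x using lin by (simp add: linear_continuous_at linear_linear)
  have c\<gamma>: "isCont \<gamma> x" for x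
  proof -
    obtain g where "(\<gamma> has_derivative (\<lambda>h. h \<bullet> g)) (at x)" by (rule C2_fun_second_order[OF \<gamma>, of x]) (rule that)
    then show ?thesis by (rule has_derivative_continuous)
  qed
  have cm: "isCont (\<lambda>x. \<gamma> (T x)) x" for x using isCont_o2[OF cT c\<gamma>] .
  \<comment> \<open>A frontier point of an open set is not in the set but is in its closure, so it
    lies neither above nor below the graph.\<close>
  have G: "(T x0) $ k = \<gamma> (T x0)"
  proof (rule antisym)
    show "(T x0) $ k \<le> \<gamma> (T x0)"
      using loc[of x0] x0 \<Omega>(1) r by (auto simp: frontier_def interior_open not_less)
    show "\<gamma> (T x0) \<le> (T x0) $ k"
    proof (rule ccontr)
      assume "\<not> ?thesis"
      then have "(T x0) $ k < \<gamma> (T x0)" by simp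
      have "open {x. (T x) $ k < \<gamma> (T x)}"
        by (rule open_Collect_less) (use cT cm in \<open>auto intro!: continuous_intros simp: continuous_on_eq_continuous_at\<close>)
      then have "open ({x. (T x) $ k < \<gamma> (T x)} \<inter> ball x0 r)" by blast
      moreover have "x0 \<in> {x. (T x) $ k < \<gamma> (T x)} \<inter> ball x0 r" using \<open>(T x0) $ k < \<gamma> (T x0)\<close> r by simp
      moreover have "x0 \<in> closure \<Omega>" using x0 by (simp add: frontier_def)
      ultimately have "\<Omega> \<inter> ({x. (T x) $ k < \<gamma> (T x)} \<inter> ball x0 r) \<noteq> {}"
        unfolding closure_iff_nhds_not_empty by blast
      then show False using loc by force
    qed
  qed
  obtain g M \<delta> where g: "(\<gamma> has_derivative (\<lambda>h. h \<bullet> g)) (at (T x0))" "M \<ge> 0" "\<delta> > 0"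
    "\<And>b. norm (b - T x0) < \<delta> \<Longrightarrow> \<bar>\<gamma> b - \<gamma> (T x0) - (b - T x0) \<bullet> g\<bar> \<le> M * norm (b - T x0) ^ 2"
    by (rule C2_fun_second_order[OF \<gamma>, of "T x0"]) (rule that)
  have gk: "g $ k = 0"
  proof -
    have "((\<lambda>t::real. T x0 + t *\<^sub>R axis k 1) has_derivative (\<lambda>t. t *\<^sub>R axis k 1)) (at 0)"
      by (auto intro!: derivative_eq_intros)
    from diff_chain_at[OF this, of \<gamma> "\<lambda>h. h \<bullet> g"] g(1)
    have "((\<lambda>t::real. \<gamma> (T x0)) has_derivative (\<lambda>t. (t *\<^sub>R axis k 1) \<bullet> g)) (at 0)"
      by (simp add: o_def k)
    then have "(\<lambda>t::real. (t *\<^sub>R axis k 1) \<bullet> g) = (\<lambda>t. 0)"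
      using has_derivative_const has_derivative_unique by blast
    from fun_cong[OF this, of 1] show ?thesis by (simp add: inner_axis')
  qed
  \<comment> \<open>Normal to the graph, pointing into \<Omega>. The component \<open>k\<close> of
    \<open>g\<close> is 0 because \<gamma> is constant in that direction; hence |n| \<ge> 1.\<close>
  define n where "n = axis k 1 - g"
  have nn: "norm n \<ge> 1" using component_le_norm_cart[of n k] gk by (simp add: n_def)
  then have n0: "norm n > 0" "n \<noteq> 0" by auto
  obtain m where m: "T m = n /\<^sub>R norm n" using orthogonal_transformation_surj[OF T] by (metis surjD)
  have nm: "norm m = 1" using nT[of m, symmetric] n0 unfolding m by simp
  \<comment> \<open>The ball lies within 2 R of x0, so the first two bounds keep it where the graph
    description and the Taylor estimate hold; the third gives the curvature condition 2 R M \<le>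
    1.\<close>
  define R where "R = min (r / 3) (min (\<delta> / 3) (1 / (2 * (M + 1))))"
  have R: "R > 0" "2 * R < r" "2 * R < \<delta>" "R \<le> 1 / (2 * (M + 1))" using r g(2,3) by (auto simp: R_def)
  define y where "y = x0 - R *\<^sub>R m"
  have "R \<le> norm (x - y)" if x: "x \<in> \<Omega>" for x
  proof (rule ccontr)
    assume "\<not> ?thesis"
    then have l: "norm (x - y) < R" by simp
    define d where "d = T x - T x0"
    have Txy: "T (x - y) = d + (R / norm n) *\<^sub>R n"
      using lin m by (simp add: y_def d_def linear_diff linear_add linear_scale divide_inverse)
    have xx0: "norm (x - x0) < 2 * R"
      using norm_triangle_ineq4[of "x - y" "R *\<^sub>R m"] l nm R(1) by (simp add: y_def)
    have nd: "norm d < \<delta>" using xx0 R(3) nT[of "x - x0"] lin by (simp add: d_def linear_diff)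
    have pos: "(T x) $ k > \<gamma> (T x)" using loc[of x] x xx0 R(2) by (simp add: dist_norm norm_minus_commute)
    \<comment> \<open>Expanding the square cancels R^2 and, with |n| \<ge> 1, leaves 2 R (d
      \<bullet> n) < - |d|^2, whereas lying above the graph gives d \<bullet> n > - M |d|^2. With 2
      R M \<le> 1 the two exclude each other.\<close>
    have "(d + (R / norm n) *\<^sub>R n) \<bullet> (d + (R / norm n) *\<^sub>R n) < R ^ 2"
      using l nT[of "x - y"] power_strict_mono[OF l, of 2] unfolding Txy by (simp add: power2_norm_eq_inner[symmetric])
    moreover have "(d + (R / norm n) *\<^sub>R n) \<bullet> (d + (R / norm n) *\<^sub>R n)
        = d \<bullet> d + 2 * (R / norm n) * (d \<bullet> n) + (R / norm n) ^ 2 * (n \<bullet> n)"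
      by (simp add: inner_add_left inner_add_right inner_commute power2_eq_square algebra_simps)
    moreover have "(R / norm n) ^ 2 * (n \<bullet> n) = R ^ 2"
      using n0 by (simp add: power_divide power2_norm_eq_inner)
    ultimately have "d \<bullet> d + 2 * (R / norm n) * (d \<bullet> n) < 0" by linarith
    then have "norm n * (d \<bullet> d) + 2 * R * (d \<bullet> n) < 0" using n0(1)
      by (simp add: field_simps split: if_splits)
    moreover have "1 * (d \<bullet> d) \<le> norm n * (d \<bullet> d)" using nn by (intro mult_right_mono) auto
    ultimately have 1: "2 * R * (d \<bullet> n) < - (d \<bullet> d)" by linarith
    have "\<gamma> (T x) \<ge> \<gamma> (T x0) + d \<bullet> g - M * (d \<bullet> d)"
      using g(4)[of "T x"] nd by (simp add: d_def power2_norm_eq_inner abs_le_iff)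
    then have 2: "d \<bullet> n + M * (d \<bullet> d) > 0"
      using pos G by (simp add: n_def inner_diff_right inner_axis d_def)
    have "0 < 2 * R * (d \<bullet> n + M * (d \<bullet> d))" using 2 R(1) by simp
    then have "0 < (2 * R * M - 1) * (d \<bullet> d)" using 1 by (simp add: algebra_simps)
    moreover have "2 * R * M \<le> 1"
    proof -
      have "R * (2 * (M + 1)) \<le> 1" using R(4) g(2) by (simp add: field_simps)
      then show ?thesis using R(1) by (simp add: algebra_simps)
    qed
    ultimately show False using mult_nonpos_nonneg[of "2 * R * M - 1" "d \<bullet> d"] by simp
  qed
  moreover have "norm (x0 - y) = R" using nm R(1) by (simp add: y_def)
  ultimately show ?thesis using R(1) that by blast
qed

text \<open>The barrier attached to a frontier point is continuous and 0 there, so u \<le> t0 almost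
  everywhere on a ball about that point. Finitely many such balls cover the compact frontier, and
  what they leave of \<Omega> is compact.\<close>

lemma boundary_small:
  fixes \<Omega> :: "(real^'n) set" and \<xi> :: "real^'n \<Rightarrow> real^'n"
  assumes \<Omega>: "open \<Omega>" "bounded \<Omega>" "C2_boundary \<Omega>"
    and q: "1 < q" "q < real CARD('n)"
    and u: "u \<in> borel_measurable borel" "\<And>x. 0 \<le> u x" "\<And>x. u x \<le> 1" "\<And>x. x \<notin> \<Omega> \<Longrightarrow> u x = 0"
    and \<xi>: "\<xi> \<in> borel_measurable borel" "\<And>x. x \<notin> \<Omega> \<Longrightarrow> \<xi> x = 0" "integrable lborel (\<lambda>x. norm (\<xi> x) powr q)"
    and \<phi>: "\<And>k. test_fun \<Omega> (\<phi> k)"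
    and lim: "(\<lambda>k. \<integral>\<^sup>+x. norm (\<phi> k x - u x) powr q \<partial>lborel) \<longlonglongrightarrow> 0"
      "(\<lambda>k. \<integral>\<^sup>+x. norm (grad (\<phi> k) x - \<xi> x) powr q \<partial>lborel) \<longlonglongrightarrow> 0"
    and wd: "weak_div \<Omega> (\<lambda>x. pf q (\<xi> x)) (\<lambda>x. mu * u x powr (q - 1))"
    and t0: "0 < t0"
  obtains K where "compact K" "K \<subseteq> \<Omega>" "AE x in lborel. x \<in> \<Omega> - K \<longrightarrow> u x \<le> t0"
proof -
  have "\<exists>\<rho>>0. AE x in lborel. x \<in> \<Omega> \<inter> ball a \<rho> \<longrightarrow> u x \<le> t0" if a: "a \<in> frontier \<Omega>" for a
  proof -
    obtain y R where R: "R > 0" "norm (a - y) = R" "\<And>x. x \<in> \<Omega> \<Longrightarrow> R \<le> norm (x - y)"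
      by (rule exterior_ball[OF \<Omega>(1,3) a]) (rule that)
    obtain A \<alpha> where b: "A > 0" "\<alpha> > 0" "AE x in lborel. x \<in> \<Omega> \<longrightarrow> u x \<le> A * (R powr (- \<alpha>) - norm (x - y) powr (- \<alpha>))"
      by (rule barrier_bound[OF \<Omega>(1,2) R(1,3) q u \<xi> \<phi> lim wd]) (assumption | rule that)+
    define f where "f x = A * (R powr (- \<alpha>) - norm (x - y) powr (- \<alpha>))" for x
    have "isCont f a" unfolding f_def[abs_def] using R by (intro continuous_intros) auto
    then have "(f \<longlongrightarrow> f a) (nhds a)" by (simp only: isCont_def tendsto_at_iff_tendsto_nhds)
    then have "\<forall>\<^sub>F x in nhds a. f x < t0" by (rule order_tendstoD(2)) (use R t0 in \<open>simp add: f_def\<close>)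
    then obtain \<rho> where \<rho>: "\<rho> > 0" "\<And>x. dist x a < \<rho> \<Longrightarrow> f x < t0"
      unfolding eventually_nhds_metric by blast
    have "AE x in lborel. x \<in> \<Omega> \<inter> ball a \<rho> \<longrightarrow> u x \<le> t0"
      using b(3) by eventually_elim (use \<rho>(2) in \<open>force simp: dist_commute f_def\<close>)
    with \<rho>(1) show ?thesis by blast
  qed
  then obtain \<rho> where \<rho>: "\<And>a. a \<in> frontier \<Omega> \<Longrightarrow> \<rho> a > 0" "\<And>a. a \<in> frontier \<Omega> \<Longrightarrow> AE x in lborel. x \<in> \<Omega> \<inter> ball a (\<rho> a) \<longrightarrow> u x \<le> t0"
    by metis
  have "compact (frontier \<Omega>)" using \<Omega>(2) by (rule compact_frontier_bounded)
  moreover have "\<And>a. a \<in> frontier \<Omega> \<Longrightarrow> open (ball a (\<rho> a))" by simp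
  moreover have "frontier \<Omega> \<subseteq> (\<Union>a\<in>frontier \<Omega>. ball a (\<rho> a))" using \<rho>(1) by auto
  ultimately obtain F where F: "F \<subseteq> frontier \<Omega>" "finite F" "frontier \<Omega> \<subseteq> (\<Union>a\<in>F. ball a (\<rho> a))"
    by (rule compactE_image)
  define U where "U = (\<Union>a\<in>F. ball a (\<rho> a))"
  have "AE x in lborel. \<forall>a\<in>F. x \<in> \<Omega> \<inter> ball a (\<rho> a) \<longrightarrow> u x \<le> t0"
    using F(1,2) \<rho>(2) by (intro AE_finite_allI) auto
  then have ae: "AE x in lborel. x \<in> \<Omega> - (\<Omega> - U) \<longrightarrow> u x \<le> t0"
    by eventually_elim (auto simp: U_def)
  have "\<Omega> - U = closure \<Omega> - U" using F(3) \<Omega>(1) by (auto simp: U_def frontier_def interior_open closure_def)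
  moreover have "compact (closure \<Omega> - U)" using \<Omega>(2) by (intro compact_diff) (auto simp: U_def compact_closure)
  ultimately have "compact (\<Omega> - U)" by simp
  then show ?thesis using ae by (intro that) auto
qed

section \<open>Reduction to the local statement\<close>

lemma weak_div_cong_AE:
  assumes "weak_div \<Omega> F R" and S: "S \<subseteq> \<Omega>"
    and [measurable]: "F \<in> borel_measurable borel" "F' \<in> borel_measurable borel" "R \<in> borel_measurable borel" "R' \<in> borel_measurable borel"
    and ae: "AE x in lborel. x \<in> S \<longrightarrow> F x = F' x" "AE x in lborel. x \<in> S \<longrightarrow> R x = R' x"
  shows "weak_div S F' R'"
  unfolding weak_div_def
proof (intro allI impI)
  fix \<phi> G assume c: "C1c S \<phi> G"
  have [measurable]: "\<phi> \<in> borel_measurable borel" "G \<in> borel_measurable borel" using C1_borel[OF C1c_C1[OF c]] by auto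
  obtain K where K: "K \<subseteq> S" "\<And>x. x \<notin> K \<Longrightarrow> \<phi> x = 0" "\<And>x. x \<notin> K \<Longrightarrow> G x = 0"
    using c by (rule C1c_obtain) (rule that)
  then have z: "\<phi> x = 0" "G x = 0" if "x \<notin> S" for x using that by blast+
  have "(\<integral>x. F' x \<bullet> G x \<partial>lborel) = (\<integral>x. F x \<bullet> G x \<partial>lborel)"
    by (rule integral_cong_AE) (use ae(1) z in \<open>auto elim!: eventually_mono\<close>)
  also have "\<dots> = (\<integral>x. R x * \<phi> x \<partial>lborel)"
    using assms(1) C1c_subset[OF c S] unfolding weak_div_def by blast
  also have "\<dots> = (\<integral>x. R' x * \<phi> x \<partial>lborel)"
    by (rule integral_cong_AE) (use ae(2) z in \<open>auto elim!: eventually_mono\<close>)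
  finally show "(\<integral>x. F' x \<bullet> G x \<partial>lborel) = (\<integral>x. R' x * \<phi> x \<partial>lborel)" .
qed

lemma weak_grad_cong_AE:
  assumes "weak_grad \<Omega> u g" and S: "S \<subseteq> \<Omega>"
    and [measurable]: "u \<in> borel_measurable borel" "u' \<in> borel_measurable borel" "g \<in> borel_measurable borel" "g' \<in> borel_measurable borel"
    and ae: "AE x in lborel. x \<in> S \<longrightarrow> u x = u' x" "AE x in lborel. x \<in> S \<longrightarrow> g x = g' x"
  shows "weak_grad S u' g'"
  unfolding weak_grad_def
proof (intro allI impI)
  fix \<phi> G assume c: "C1c S \<phi> G"
  have [measurable]: "\<phi> \<in> borel_measurable borel" "G \<in> borel_measurable borel" using C1_borel[OF C1c_C1[OF c]] by auto
  obtain K where K: "K \<subseteq> S" "\<And>x. x \<notin> K \<Longrightarrow> \<phi> x = 0" "\<And>x. x \<notin> K \<Longrightarrow> G x = 0"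
    using c by (rule C1c_obtain) (rule that)
  then have z: "\<phi> x = 0" "G x = 0" if "x \<notin> S" for x using that by blast+
  have "(\<integral>x. u' x *\<^sub>R G x \<partial>lborel) = (\<integral>x. u x *\<^sub>R G x \<partial>lborel)"
    by (rule integral_cong_AE) (use ae(1) z in \<open>auto elim!: eventually_mono\<close>)
  also have "\<dots> = - (\<integral>x. \<phi> x *\<^sub>R g x \<partial>lborel)"
    using assms(1) C1c_subset[OF c S] unfolding weak_grad_def by blast
  also have "(\<integral>x. \<phi> x *\<^sub>R g x \<partial>lborel) = (\<integral>x. \<phi> x *\<^sub>R g' x \<partial>lborel)"
    by (rule integral_cong_AE) (use ae(2) z in \<open>auto elim!: eventually_mono\<close>)
  finally show "(\<integral>x. u' x *\<^sub>R G x \<partial>lborel) = - (\<integral>x. \<phi> x *\<^sub>R g' x \<partial>lborel)" .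
qed

lemma weighted_local_integrable:
  fixes \<xi> :: "'a::euclidean_space \<Rightarrow> 'b::euclidean_space"
  assumes i: "integrable lborel (\<lambda>x. w x * norm (\<xi> x) powr p)" and p: "1 \<le> p"
    and [measurable]: "\<xi> \<in> borel_measurable borel" and K: "compact K" and c: "c > 0" "\<And>x. x \<in> K \<Longrightarrow> c \<le> w x"
  shows "integrable lborel (\<lambda>x. norm (indicator K x *\<^sub>R \<xi> x) powr p)"
    and "integrable lborel (\<lambda>x. indicator K x *\<^sub>R \<xi> x)"
proof -
  have [measurable]: "K \<in> sets borel" using K by (simp add: borel_compact)
  show 1: "integrable lborel (\<lambda>x. norm (indicator K x *\<^sub>R \<xi> x) powr p)"
  proof (rule Bochner_Integration.integrable_bound[OF integrable_mult_right[OF i, of "1 / c"]])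
    show "AE x in lborel. norm (norm (indicator K x *\<^sub>R \<xi> x) powr p) \<le> norm (1 / c * (w x * norm (\<xi> x) powr p))"
    proof (rule AE_I2)
      fix x show "norm (norm (indicator K x *\<^sub>R \<xi> x) powr p) \<le> norm (1 / c * (w x * norm (\<xi> x) powr p))"
      proof (cases "x \<in> K")
        case True
        have "c * norm (\<xi> x) powr p \<le> w x * norm (\<xi> x) powr p" using c(2)[OF True] by (intro mult_right_mono) auto
        then show ?thesis using True c(1) c(2)[OF True] by (simp add: abs_mult field_simps)
      qed (use p in simp)
    qed
  qed measurable
  have "integrable lborel (indicator K :: 'a \<Rightarrow> real)"
    using emeasure_bounded_finite[OF compact_imp_bounded[OF K]] by (intro integrable_real_indicator) auto
  then have 2: "integrable lborel (\<lambda>x. indicator K x + norm (indicator K x *\<^sub>R \<xi> x) powr p)" using 1 by simp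
  show "integrable lborel (\<lambda>x. indicator K x *\<^sub>R \<xi> x)"
  proof (rule Bochner_Integration.integrable_bound[OF 2])
    show "AE x in lborel. norm (indicator K x *\<^sub>R \<xi> x) \<le> norm (indicator K x + norm (indicator K x *\<^sub>R \<xi> x) powr p)"
    proof (rule AE_I2)
      fix x show "norm (indicator K x *\<^sub>R \<xi> x) \<le> norm (indicator K x + norm (indicator K x *\<^sub>R \<xi> x) powr p)"
        using powr_le_add[of "norm (\<xi> x)" 1 p] p by (cases "x \<in> K") auto
    qed
  qed measurable
qed

text \<open>Translates an eigenpair into Borel data on the whole space: \<open>w'\<close> is the
  weight extended by 0, \<open>u\<close> a Borel version of the eigenfunction with values in [0, 1].
  It is stated for a general weight so that it also covers the unweighted problem, with the
  indicator of \<Omega> as \<open>w'\<close>.\<close>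

lemma eigenpair_borel:
  fixes \<Omega> :: "(real^'n) set"
  assumes W: "W0 p w \<Omega> v g" and E: "weak_eig p w \<Omega> lam v g" and p: "p > 1" and \<Omega>: "open \<Omega>" "bounded \<Omega>"
    and w': "w' \<in> borel_measurable borel" "\<And>x. x \<in> \<Omega> \<Longrightarrow> w' x = w x" "\<And>x. 0 \<le> w' x" "\<And>x. w' x \<le> Wb" "\<And>x. x \<notin> \<Omega> \<Longrightarrow> w' x = 0"
    and u: "u \<in> borel_measurable borel" "AE x in lborel. x \<in> \<Omega> \<longrightarrow> v x = u x" "\<And>x. 0 \<le> u x" "\<And>x. u x \<le> 1"
  obtains \<xi> \<phi> where "\<xi> \<in> borel_measurable borel" "\<And>x. x \<notin> \<Omega> \<Longrightarrow> \<xi> x = 0" "integrable lborel (\<lambda>x. w' x * norm (\<xi> x) powr p)"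
    "\<And>k. test_fun \<Omega> (\<phi> k)" "(\<lambda>k. \<integral>\<^sup>+x. w' x * norm (\<phi> k x - u x) powr p \<partial>lborel) \<longlonglongrightarrow> 0"
    "(\<lambda>k. \<integral>\<^sup>+x. w' x * norm (grad (\<phi> k) x - \<xi> x) powr p \<partial>lborel) \<longlonglongrightarrow> 0"
    "integrable lborel (\<lambda>x. w' x *\<^sub>R pf p (\<xi> x))" "integrable lborel (\<lambda>x. lam * (w' x * u x powr (p - 1)))"
    "\<And>\<rho>. test_fun \<Omega> \<rho> \<Longrightarrow> (\<integral>x. (w' x *\<^sub>R pf p (\<xi> x)) \<bullet> grad \<rho> x \<partial>lborel) = (\<integral>x. lam * (w' x * u x powr (p - 1)) * \<rho> x \<partial>lborel)"
proof -
  note w'(1)[measurable] u(1)[measurable]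
  have [measurable]: "\<Omega> \<in> sets borel" using \<Omega> by simp
  have "g \<in> borel_measurable lebesgue" using W by (simp add: W0_def)
  then obtain g' where g'[measurable]: "g' \<in> borel_measurable borel" and gg': "AE x in lborel. g x = g' x"
    by (rule lebesgue_borel_rep) (rule that)
  define \<xi> where "\<xi> x = indicator \<Omega> x *\<^sub>R g' x" for x
  have \<xi>[measurable]: "\<xi> \<in> borel_measurable borel" unfolding \<xi>_def[abs_def] by measurable
  have \<xi>0: "\<xi> x = 0" if "x \<notin> \<Omega>" for x using that by (simp add: \<xi>_def)
  have g: "AE x in lborel. x \<in> \<Omega> \<longrightarrow> g x = \<xi> x" using gg' by eventually_elim (simp add: \<xi>_def)
  have u1: "\<bar>u x\<bar> \<le> 1" for x using u(3,4)[of x] by simp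
  note X = W0_extract[OF W p \<Omega> w' u(1,2) u1 \<xi> g]
  obtain \<phi> where \<phi>: "\<And>k. test_fun \<Omega> (\<phi> k)" "(\<lambda>k. \<integral>\<^sup>+x. w' x * norm (\<phi> k x - u x) powr p \<partial>lborel) \<longlonglongrightarrow> 0"
    "(\<lambda>k. \<integral>\<^sup>+x. w' x * norm (grad (\<phi> k) x - \<xi> x) powr p \<partial>lborel) \<longlonglongrightarrow> 0" using X(2) by auto
  have Wb: "Wb \<ge> 0" using w'(3)[of undefined] w'(4)[of undefined] by linarith
  have "integrable lborel (\<lambda>x. Wb * indicator \<Omega> x + w' x * norm (\<xi> x) powr p)"
    using indicator_bounded_integrable[OF \<Omega>] X(1) by simp
  then have F: "integrable lborel (\<lambda>x. w' x *\<^sub>R pf p (\<xi> x))"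
  proof (rule Bochner_Integration.integrable_bound)
    show "AE x in lborel. norm (w' x *\<^sub>R pf p (\<xi> x)) \<le> norm (Wb * indicator \<Omega> x + w' x * norm (\<xi> x) powr p)"
    proof (rule AE_I2)
      fix x
      show "norm (w' x *\<^sub>R pf p (\<xi> x)) \<le> norm (Wb * indicator \<Omega> x + w' x * norm (\<xi> x) powr p)"
      proof (cases "x \<in> \<Omega>")
        case True
        have "w' x * norm (\<xi> x) powr (p - 1) \<le> w' x * (1 + norm (\<xi> x) powr p)"
          using powr_le_add[of "norm (\<xi> x)" "p - 1" p] p w'(3)[of x] by (intro mult_left_mono) auto
        also have "\<dots> \<le> Wb + w' x * norm (\<xi> x) powr p" using w'(4)[of x] by (simp add: algebra_simps)
        finally show ?thesis using True w'(3)[of x] norm_pf[OF p, of "\<xi> x"] Wb by simp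
      qed (use w'(5) in simp)
    qed
  qed measurable
  have R: "integrable lborel (\<lambda>x. lam * (w' x * u x powr (p - 1)))"
  proof (rule bounded_support_integrable[OF \<Omega>, where M="\<bar>lam\<bar> * Wb"])
    fix x
    have "u x powr (p - 1) \<le> 1 powr (p - 1)" using u(3,4)[of x] p by (intro powr_mono2) auto
    then have "w' x * u x powr (p - 1) \<le> Wb * 1" using w'(3,4)[of x] Wb by (intro mult_mono) auto
    then show "norm (lam * (w' x * u x powr (p - 1))) \<le> \<bar>lam\<bar> * Wb" using w'(3)[of x] by (simp add: abs_mult mult_left_mono)
    show "lam * (w' x * u x powr (p - 1)) = 0" if "x \<notin> \<Omega>" using w'(5)[OF that] by simp
  qed measurable
  have eq: "(\<integral>x. (w' x *\<^sub>R pf p (\<xi> x)) \<bullet> grad \<rho> x \<partial>lborel) = (\<integral>x. lam * (w' x * u x powr (p - 1)) * \<rho> x \<partial>lborel)"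
    if \<rho>: "test_fun \<Omega> \<rho>" for \<rho>
  proof -
    have [measurable]: "\<rho> \<in> borel_measurable borel" "grad \<rho> \<in> borel_measurable borel"
      using C1_borel[OF C1c_C1[OF test_fun_C1c[OF \<rho>]]] by auto
    have 1: "(LINT x:\<Omega>|lebesgue. w x * norm (g x) powr (p - 2) * (g x \<bullet> grad \<rho> x)) = (\<integral>x. (w' x *\<^sub>R pf p (\<xi> x)) \<bullet> grad \<rho> x \<partial>lborel)"
      unfolding set_lebesgue_integral_def
    proof (rule lebesgue_transfer(1))
      show "AE x in lborel. indicator \<Omega> x *\<^sub>R (w x * norm (g x) powr (p - 2) * (g x \<bullet> grad \<rho> x)) = (w' x *\<^sub>R pf p (\<xi> x)) \<bullet> grad \<rho> x"
        using g
      proof eventually_elim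
        case (elim x)
        then show ?case using w'(2)[of x] w'(5)[of x] by (cases "x \<in> \<Omega>") (auto simp: pf_def)
      qed
    qed measurable
    have 2: "(LINT x:\<Omega>|lebesgue. w x * \<bar>v x\<bar> powr (p - 2) * v x * \<rho> x) = (\<integral>x. w' x * u x powr (p - 1) * \<rho> x \<partial>lborel)"
      unfolding set_lebesgue_integral_def
    proof (rule lebesgue_transfer(1))
      show "AE x in lborel. indicator \<Omega> x *\<^sub>R (w x * \<bar>v x\<bar> powr (p - 2) * v x * \<rho> x) = w' x * u x powr (p - 1) * \<rho> x"
        using u(2)
      proof eventually_elim
        case (elim x)
        have "\<bar>u x\<bar> powr (p - 2) * u x = u x powr (p - 1)"
          using u(3)[of x] powr_mult_base[of "u x" "p - 2"] by (simp add: mult.commute)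
        then show ?case using w'(2)[of x] w'(5)[of x] elim by (cases "x \<in> \<Omega>") (auto simp: mult.assoc)
      qed
    qed measurable
    have "(\<integral>x. (w' x *\<^sub>R pf p (\<xi> x)) \<bullet> grad \<rho> x \<partial>lborel) = lam * (\<integral>x. w' x * u x powr (p - 1) * \<rho> x \<partial>lborel)"
      using E \<rho> unfolding weak_eig_def 1[symmetric] 2[symmetric] by blast
    also have "\<dots> = (\<integral>x. lam * (w' x * u x powr (p - 1) * \<rho> x) \<partial>lborel)" by simp
    finally show ?thesis by (simp only: mult.assoc)
  qed
  show ?thesis by (rule that[OF \<xi> \<xi>0 X(1) \<phi> F R eq])
qed

text \<open>Both eigenfunctions are represented by one Borel function \<open>u\<close>. What has to
  be arranged is the situation of \<open>two_equations\<close>: a kernel, a single gradient for both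
  problems, and a compact set off which u \<le> 1/2.\<close>

lemma first_eigenfunctions_differ:
  fixes \<Omega> :: "(real^'n) set" and p q :: real and w w' u :: "real^'n \<Rightarrow> real"
  assumes \<Omega>: "open \<Omega>" "bounded \<Omega>" "C2_boundary \<Omega>"
    and q: "1 < q" "q < p" "q < real CARD('n)"
    and w': "w' \<in> borel_measurable borel" "\<And>x. x \<in> \<Omega> \<Longrightarrow> w' x = w x" "\<And>x. 0 \<le> w' x" "\<And>x. w' x \<le> Wb" "\<And>x. x \<notin> \<Omega> \<Longrightarrow> w' x = 0"
    and wL: "\<And>x y. x \<in> \<Omega> \<Longrightarrow> y \<in> \<Omega> \<Longrightarrow> \<bar>w' x - w' y\<bar> \<le> L * dist x y" "0 \<le> L"
    and w'0: "\<And>K. compact K \<Longrightarrow> K \<subseteq> \<Omega> \<Longrightarrow> \<exists>c>0. \<forall>x\<in>K. c \<le> w' x"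
    and u: "u \<in> borel_measurable borel" "\<And>x. 0 \<le> u x" "\<And>x. u x \<le> 1" "\<And>x. x \<notin> \<Omega> \<Longrightarrow> u x = 0"
    and top: "\<And>c. c < 1 \<Longrightarrow> \<not> (AE x in lborel. u x \<le> c)"
    and Wp: "W0 p w \<Omega> v g" "weak_eig p w \<Omega> lam v g" and v: "AE x in lborel. x \<in> \<Omega> \<longrightarrow> v x = u x"
    and Wq: "W0 q (\<lambda>_. 1) \<Omega> z h" "weak_eig q (\<lambda>_. 1) \<Omega> mu z h" and z: "AE x in lborel. x \<in> \<Omega> \<longrightarrow> z x = u x"
  shows False
proof -
  have p: "p > 1" using q by simp
  note u(1)[measurable] w'(1)[measurable]
  have [measurable]: "\<Omega> \<in> sets borel" using \<Omega> by simp
  obtain \<xi>p \<phi>p where P: "\<xi>p \<in> borel_measurable borel" "\<And>x. x \<notin> \<Omega> \<Longrightarrow> \<xi>p x = 0" "integrable lborel (\<lambda>x. w' x * norm (\<xi>p x) powr p)"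
    "\<And>k. test_fun \<Omega> (\<phi>p k)" "(\<lambda>k. \<integral>\<^sup>+x. w' x * norm (\<phi>p k x - u x) powr p \<partial>lborel) \<longlonglongrightarrow> 0"
    "(\<lambda>k. \<integral>\<^sup>+x. w' x * norm (grad (\<phi>p k) x - \<xi>p x) powr p \<partial>lborel) \<longlonglongrightarrow> 0"
    "integrable lborel (\<lambda>x. w' x *\<^sub>R pf p (\<xi>p x))" "integrable lborel (\<lambda>x. lam * (w' x * u x powr (p - 1)))"
    "\<And>\<rho>. test_fun \<Omega> \<rho> \<Longrightarrow> (\<integral>x. (w' x *\<^sub>R pf p (\<xi>p x)) \<bullet> grad \<rho> x \<partial>lborel) = (\<integral>x. lam * (w' x * u x powr (p - 1)) * \<rho> x \<partial>lborel)"
    by (rule eigenpair_borel[OF Wp p \<Omega>(1,2) w' u(1) v u(2,3)]) (assumption | rule that)+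
  have ind: "(indicator \<Omega> :: real^'n \<Rightarrow> real) \<in> borel_measurable borel" "\<And>x. x \<in> \<Omega> \<Longrightarrow> indicator \<Omega> x = (1::real)"
    "\<And>x. 0 \<le> (indicator \<Omega> x :: real)" "\<And>x. indicator \<Omega> x \<le> (1::real)" "\<And>x. x \<notin> \<Omega> \<Longrightarrow> indicator \<Omega> x = (0::real)"
    by auto
  obtain \<xi> \<phi> where Q: "\<xi> \<in> borel_measurable borel" "\<And>x. x \<notin> \<Omega> \<Longrightarrow> \<xi> x = 0" "integrable lborel (\<lambda>x. indicator \<Omega> x * norm (\<xi> x) powr q)"
    "\<And>k. test_fun \<Omega> (\<phi> k)" "(\<lambda>k. \<integral>\<^sup>+x. indicator \<Omega> x * norm (\<phi> k x - u x) powr q \<partial>lborel) \<longlonglongrightarrow> 0"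
    "(\<lambda>k. \<integral>\<^sup>+x. indicator \<Omega> x * norm (grad (\<phi> k) x - \<xi> x) powr q \<partial>lborel) \<longlonglongrightarrow> 0"
    "integrable lborel (\<lambda>x. indicator \<Omega> x *\<^sub>R pf q (\<xi> x))" "integrable lborel (\<lambda>x. mu * (indicator \<Omega> x * u x powr (q - 1)))"
    "\<And>\<rho>. test_fun \<Omega> \<rho> \<Longrightarrow> (\<integral>x. (indicator \<Omega> x *\<^sub>R pf q (\<xi> x)) \<bullet> grad \<rho> x \<partial>lborel) = (\<integral>x. mu * (indicator \<Omega> x * u x powr (q - 1)) * \<rho> x \<partial>lborel)"
    by (rule eigenpair_borel[OF Wq q(1) \<Omega>(1,2) ind u(1) z u(2,3)]) (assumption | rule that)+
  note [measurable] = P(1) Q(1)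
  have \<phi>c: "C1c \<Omega> (\<phi> k) (grad (\<phi> k))" for k by (rule test_fun_C1c[OF Q(4)])
  have [measurable]: "\<phi> k \<in> borel_measurable borel" for k by (rule C1_borel[OF C1c_C1[OF \<phi>c]])
  have z\<phi>: "\<phi> k x = 0" "grad (\<phi> k) x = 0" if "x \<notin> \<Omega>" for k x
  proof -
    obtain K where "K \<subseteq> \<Omega>" "\<And>x. x \<notin> K \<Longrightarrow> \<phi> k x = 0" "\<And>x. x \<notin> K \<Longrightarrow> grad (\<phi> k) x = 0"
      using \<phi>c[of k] by (rule C1c_obtain) (rule that)
    then show "\<phi> k x = 0" "grad (\<phi> k) x = 0" using that by blast+
  qed
  have i1: "indicator \<Omega> x * norm (\<phi> k x - u x) powr q = norm (\<phi> k x - u x) powr q" for k x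
    using z\<phi>[of x k] u(4)[of x] by (cases "x \<in> \<Omega>") auto
  have i2: "indicator \<Omega> x * norm (grad (\<phi> k) x - \<xi> x) powr q = norm (grad (\<phi> k) x - \<xi> x) powr q" for k x
    using z\<phi>[of x k] Q(2)[of x] by (cases "x \<in> \<Omega>") auto
  have i3: "indicator \<Omega> x * norm (\<xi> x) powr q = norm (\<xi> x) powr q" for x
    using Q(2)[of x] by (cases "x \<in> \<Omega>") auto
  have i4: "indicator \<Omega> x *\<^sub>R pf q (\<xi> x) = pf q (\<xi> x)" for x
    using Q(2)[of x] by (cases "x \<in> \<Omega>") (auto simp: pf_def)
  have i5: "indicator \<Omega> x * u x powr (q - 1) = u x powr (q - 1)" for x
    using u(4)[of x] by (cases "x \<in> \<Omega>") auto
  note lim = Q(5,6)[unfolded i1 i2]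
  have ui: "integrable lborel u" by (rule bounded_support_integrable[OF \<Omega>(1,2), where M=1]) (use u in auto)
  \<comment> \<open>Some approximating test function has nonzero integral: otherwise
    \<open>u\<close> would have integral 0 and vanish almost everywhere, against \<open>top\<close>.
    The mollifying kernels are its rescalings.\<close>
  obtain j where j: "(\<integral>x. \<phi> j x \<partial>lborel) \<noteq> 0"
  proof (rule ccontr)
    assume "\<not> thesis"
    then have zero: "(\<integral>x. \<phi> k x \<partial>lborel) = 0" for k using that by blast
    have ip: "\<bar>indicator \<Omega> x\<bar> powr t = (indicator \<Omega> x :: real)" for x t
      by (cases "x \<in> \<Omega>") auto
    have wl: "wlim (indicator \<Omega>) \<phi> u"
      by (rule wlim_Lp[OF lim(1) q(1)]) (use indicator_bounded_integrable[OF \<Omega>(1,2)] ip in auto)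
    have i\<Omega>: "indicator \<Omega> x \<bullet> u x = u x" "indicator \<Omega> x \<bullet> \<phi> n x = \<phi> n x" for x n
      using u(4)[of x] z\<phi>(1)[of x n] by (cases "x \<in> \<Omega>"; simp)+
    have iu: "integrable lborel (\<lambda>x. indicator \<Omega> x \<bullet> u x)" using ui by (simp only: i\<Omega>)
    have "(\<lambda>n. \<integral>x. indicator \<Omega> x \<bullet> \<phi> n x \<partial>lborel) \<longlonglongrightarrow> (\<integral>x. indicator \<Omega> x \<bullet> u x \<partial>lborel)"
      by (rule wlim_integral[OF wl _ _ _ _ iu]) auto
    then have "(\<lambda>n::nat. 0) \<longlonglongrightarrow> (\<integral>x. u x \<partial>lborel)"
      by (simp only: i\<Omega> zero)
    then have "(\<integral>x. u x \<partial>lborel) = 0" by (simp add: LIMSEQ_const_iff)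
    then have "AE x in lborel. u x = 0" using integral_nonneg_eq_0_iff_AE[OF ui] u(2) by simp
    then have "AE x in lborel. u x \<le> 0" by eventually_elim simp
    then show False using top[of 0] by simp
  qed
  obtain k k' C r where "smooth_mollifier (k :: nat \<Rightarrow> real^'n \<Rightarrow> real) k' C r"
    by (rule smooth_mollifier_exists[OF Q(4) j]) (rule that)
  then interpret smooth_mollifier k k' C r .
  have wdp: "weak_div \<Omega> (\<lambda>x. w' x *\<^sub>R pf p (\<xi>p x)) (\<lambda>x. lam * (w' x * u x powr (p - 1)))"
    by (rule weak_div_extend[OF \<Omega>(1) P(7,8,9)])
  have wdq: "weak_div \<Omega> (\<lambda>x. pf q (\<xi> x)) (\<lambda>x. mu * u x powr (q - 1))"
    by (rule weak_div_extend[OF \<Omega>(1) Q(7,8,9)[unfolded i4 i5]])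
  have u1: "\<bar>u x\<bar> \<le> 1" for x using u(2,3)[of x] by simp
  have lp: "integrable lborel (\<lambda>x. indicator K x *\<^sub>R \<xi>p x)" if K: "compact K" "K \<subseteq> \<Omega>" for K
  proof -
    obtain c where "c > 0" "\<And>x. x \<in> K \<Longrightarrow> c \<le> w' x" using w'0[OF K] by blast
    then show ?thesis using p by (intro weighted_local_integrable(2)[OF P(3) _ _ K(1)]) auto
  qed
  have lq: "integrable lborel (\<lambda>x. indicator K x *\<^sub>R \<xi> x)" if K: "compact K" "K \<subseteq> \<Omega>" for K
    by (rule weighted_local_integrable(2)[OF Q(3) _ _ K(1), where c=1]) (use q K in auto)
  have wgp: "weak_grad \<Omega> u \<xi>p"
    by (rule weak_grad_from_approx[OF P(4) p P(5,6)]) (use w'0 u1 lp in auto)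
  have wgq: "weak_grad \<Omega> u \<xi>"
    by (rule weak_grad_from_approx[OF Q(4) q(1) Q(5,6)]) (use u1 lq in \<open>auto intro!: exI[of _ 1]\<close>)
  \<comment> \<open>\<open>\<xi>p\<close> comes from the weighted L^p problem and
    \<open>\<xi>\<close> from the L^q problem, but both are weak gradients of \<open>u\<close> in
    \<Omega>.\<close>
  have \<xi>\<xi>: "AE x in lborel. x \<in> \<Omega> \<longrightarrow> \<xi>p x = \<xi> x"
    by (rule weak_grad_unique[OF wgp wgq \<Omega>(1)]) (use lp lq in auto)
  obtain K0 where K0: "compact K0" "K0 \<subseteq> \<Omega>" and K0ae: "AE x in lborel. x \<in> \<Omega> - K0 \<longrightarrow> u x \<le> 1 / 2"
    by (rule boundary_small[OF \<Omega> q(1,3) u Q(1,2) Q(3)[unfolded i3] Q(4) lim wdq, of "1/2"]) (simp | assumption | rule that)+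
  obtain d where d: "d > 0" "\<And>x. x \<in> K0 \<Longrightarrow> cball x d \<subseteq> \<Omega>"
    by (rule compact_open_margin[OF K0(1) \<Omega>(1) K0(2)]) (rule that)
  \<comment> \<open>Closed and open d-neighbourhoods of \<open>K0\<close>; on the compact
    \<open>B\<close> the weight has a positive lower bound, although it may degenerate at the
    boundary of \<Omega>.\<close>
  define B where "B = {x + y | x y. x \<in> K0 \<and> y \<in> cball 0 d}"
  define S where "S = (\<Union>x\<in>K0. ball x d)"
  have B: "compact B" unfolding B_def by (rule compact_nbhd[OF K0(1)])
  have B\<Omega>: "B \<subseteq> \<Omega>"
  proof
    fix b assume "b \<in> B"
    then obtain x y where "b = x + y" "x \<in> K0" "norm y \<le> d" by (auto simp: B_def)
    then show "b \<in> \<Omega>" using d(2)[of x] by (auto simp: dist_norm subset_iff)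
  qed
  have S: "open S" and K0S: "K0 \<subseteq> S" using d(1) by (auto simp: S_def)
  have SB: "S \<subseteq> B"
  proof
    fix b assume "b \<in> S"
    then obtain x where "x \<in> K0" "b \<in> ball x d" by (auto simp: S_def)
    then have "b = x + (b - x) \<and> x \<in> K0 \<and> b - x \<in> cball 0 d" by (simp add: dist_norm norm_minus_commute)
    then show "b \<in> B" unfolding B_def by blast
  qed
  have S\<Omega>: "S \<subseteq> \<Omega>" using SB B\<Omega> by blast
  have [measurable]: "B \<in> sets borel" "K0 \<in> sets borel" using B K0 by (auto simp: borel_compact)
  obtain c where c: "c > 0" "\<And>x. x \<in> B \<Longrightarrow> c \<le> w' x" using w'0[OF B B\<Omega>] by blast
  \<comment> \<open>The bound near the boundary holds almost everywhere, while the locale asks for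
    it at every point; hence the minimum with 1/2 off \<open>K0\<close>, which changes
    \<open>u\<close> only on a null subset of \<open>B\<close>.\<close>
  define u1 where "u1 x = indicator B x * (if x \<in> K0 then u x else min (u x) (1 / 2))" for x
  define \<xi>1 where "\<xi>1 x = indicator B x *\<^sub>R \<xi>p x" for x
  have u1m[measurable]: "u1 \<in> borel_measurable borel" unfolding u1_def[abs_def] by measurable
  have \<xi>1m[measurable]: "\<xi>1 \<in> borel_measurable borel" unfolding \<xi>1_def[abs_def] by measurable
  have ae: "AE x in lborel. x \<in> B \<longrightarrow> u1 x = u x"
    using K0ae by eventually_elim (use B\<Omega> in \<open>auto simp: u1_def\<close>)
  have ae1: "AE x in lborel. x \<in> S \<longrightarrow> u x = u1 x" using ae by eventually_elim (use SB in auto)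
  have ae2: "AE x in lborel. x \<in> S \<longrightarrow> \<xi>p x = \<xi>1 x" by (rule AE_I2) (use SB in \<open>auto simp: \<xi>1_def\<close>)
  have ae3: "AE x in lborel. x \<in> S \<longrightarrow> \<xi> x = \<xi>1 x" using \<xi>\<xi> ae2 by eventually_elim (use S\<Omega> in auto)
  have "two_equations k k' C r S K0 B p q u1 w' \<xi>1 c Wb L lam mu (1 / 2)"
  proof
    show u1i: "0 \<le> u1 x" "u1 x \<le> 1" for x using u(2,3)[of x] by (auto simp: u1_def indicator_def)
    show "u1 x = 0" "\<xi>1 x = 0" if "x \<notin> B" for x using that by (auto simp: u1_def \<xi>1_def)
    have u1\<Omega>: "u1 x = 0" if "x \<notin> \<Omega>" for x using that B\<Omega> by (auto simp: u1_def indicator_def)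
    show "integrable lborel u1"
      using u1i u1\<Omega> by (intro bounded_support_integrable[OF \<Omega>(1,2), where M=1]) auto
    show "integrable lborel (\<lambda>x. norm (\<xi>1 x) powr p)"
      unfolding \<xi>1_def by (rule weighted_local_integrable(1)[OF P(3) _ _ B c]) (use p in auto)
    show "u1 x \<le> 1 / 2" if "x \<notin> K0" for x using that by (auto simp: u1_def indicator_def)
    show "weak_grad S u1 \<xi>1" by (rule weak_grad_cong_AE[OF wgp S\<Omega> _ _ _ _ ae1 ae2]) auto
    show "weak_div S (\<lambda>x. w' x *\<^sub>R pf p (\<xi>1 x)) (\<lambda>x. lam * (w' x * u1 x powr (p - 1)))"
    proof (rule weak_div_cong_AE[OF wdp S\<Omega>])
      show "AE x in lborel. x \<in> S \<longrightarrow> w' x *\<^sub>R pf p (\<xi>p x) = w' x *\<^sub>R pf p (\<xi>1 x)" using ae2 by eventually_elim simp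
      show "AE x in lborel. x \<in> S \<longrightarrow> lam * (w' x * u x powr (p - 1)) = lam * (w' x * u1 x powr (p - 1))" using ae1 by eventually_elim simp
    qed auto
    show "weak_div S (\<lambda>x. pf q (\<xi>1 x)) (\<lambda>x. mu * u1 x powr (q - 1))"
    proof (rule weak_div_cong_AE[OF wdq S\<Omega>])
      show "AE x in lborel. x \<in> S \<longrightarrow> pf q (\<xi> x) = pf q (\<xi>1 x)" using ae3 by eventually_elim simp
      show "AE x in lborel. x \<in> S \<longrightarrow> mu * u x powr (q - 1) = mu * u1 x powr (q - 1)" using ae1 by eventually_elim simp
    qed auto
    show "\<bar>w' x - w' y\<bar> \<le> L * dist x y" if "x \<in> S" "y \<in> S" for x y using wL(1) that S\<Omega> by blast
    show "c \<le> w' x" if "x \<in> S" for x using c(2) that SB by blast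
    show "\<bar>w' x\<bar> \<le> Wb" for x using w'(3,4)[of x] by simp
  qed (use S K0S SB B K0 q c(1) wL(2) w'(1) \<xi>1m in auto)
  then interpret two_equations k k' C r S K0 B p q u1 w' \<xi>1 c Wb L lam mu "1 / 2" .
  show False
  proof (rule contradiction)
    fix t :: real assume t: "t < 1"
    show "\<not> (AE x in lborel. u1 x \<le> t)"
    proof
      assume "AE x in lborel. u1 x \<le> t"
      \<comment> \<open>Outside \<open>B\<close> the function \<open>u1\<close> is 0 and says
        nothing about \<open>u\<close>; there u \<le> 1/2 holds almost everywhere, which explains
        the maximum.\<close>
      with ae K0ae have "AE x in lborel. u x \<le> max t (1 / 2)"
      proof eventually_elim
        case (elim x)
        then show ?case using u(4)[of x] K0S SB by (cases "x \<in> \<Omega>"; cases "x \<in> B") auto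
      qed
      then show False using top[of "max t (1 / 2)"] t by simp
    qed
  qed
qed

theorem theorem2p1:
  fixes \<Omega> :: "(real^'n) set" and p q :: real and w v z :: "real^'n \<Rightarrow> real"
  assumes "CARD('n) \<ge> 2"
    and "open \<Omega>" and "connected \<Omega>" and "\<Omega> \<noteq> {}" and "bounded \<Omega>" and "C2_boundary \<Omega>"
    and "1 < q" and "q < p" and "p < real CARD('n)"
    and "p < real CARD('n) * q / (real CARD('n) - q)"
    and "\<exists>C. lipschitz_on C (closure \<Omega>) w"
    and "\<forall>x\<in>closure \<Omega>. w x \<ge> 0"
    and "Muckenhoupt p \<Omega> w"
    and "\<forall>x\<in>\<Omega>. w x > 0"
    and "first_eigenfunction p w \<Omega> v"
    and "first_eigenfunction q (\<lambda>_. 1) \<Omega> z"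
  shows "\<not> (AE x in lebesgue. x \<in> \<Omega> \<longrightarrow> v x = z x)"
proof
  assume "AE x in lebesgue. x \<in> \<Omega> \<longrightarrow> v x = z x"
  then have vz: "AE x in lborel. x \<in> \<Omega> \<longrightarrow> v x = z x" by (simp add: AE_completion_iff)
  note \<Omega> = \<open>open \<Omega>\<close> \<open>bounded \<Omega>\<close>
  obtain lam g where P: "W0 p w \<Omega> v g" "weak_eig p w \<Omega> lam v g"
    and pos: "AE x in lebesgue. x \<in> \<Omega> \<longrightarrow> v x > 0" and nv: "Linf_norm_one \<Omega> v"
    using \<open>first_eigenfunction p w \<Omega> v\<close> unfolding first_eigenfunction_def by blast
  obtain mu h where Q: "W0 q (\<lambda>_. 1) \<Omega> z h" "weak_eig q (\<lambda>_. 1) \<Omega> mu z h"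
    using \<open>first_eigenfunction q (\<lambda>_. 1) \<Omega> z\<close> unfolding first_eigenfunction_def by blast
  have [measurable]: "\<Omega> \<in> sets borel" using \<Omega> by simp
  have "v \<in> borel_measurable lebesgue" using P by (simp add: W0_def)
  then obtain v' where [measurable]: "v' \<in> borel_measurable borel" and v': "AE x in lborel. v x = v' x"
    using completion_ex_borel_measurable_real[of v lborel] by auto
  \<comment> \<open>A Borel representative, truncated to [0, 1] and put to 0 off \<Omega>, so that
    the bounds hold at every point.\<close>
  define u where "u x = indicator \<Omega> x * max 0 (min 1 (v' x))" for x
  have u: "u \<in> borel_measurable borel" unfolding u_def[abs_def] by measurable
  have "AE x in lborel. x \<in> \<Omega> \<longrightarrow> v x > 0" using pos by (simp add: AE_completion_iff)
  moreover have "AE x in lborel. x \<in> \<Omega> \<longrightarrow> \<bar>v x\<bar> \<le> 1" using nv by (simp add: Linf_norm_one_def AE_completion_iff)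
  ultimately have vu: "AE x in lborel. x \<in> \<Omega> \<longrightarrow> v x = u x" using v' by eventually_elim (auto simp: u_def)
  then have zu: "AE x in lborel. x \<in> \<Omega> \<longrightarrow> z x = u x" using vz by eventually_elim auto
  have top: "\<not> (AE x in lborel. u x \<le> t)" if "t < 1" for t
  proof
    assume "AE x in lborel. u x \<le> t"
    then have "AE x in lborel. x \<in> \<Omega> \<longrightarrow> \<bar>v x\<bar> \<le> t" using vu by eventually_elim (auto simp: u_def)
    then show False using nv that by (auto simp: Linf_norm_one_def AE_completion_iff)
  qed
  obtain L where L: "L-lipschitz_on (closure \<Omega>) w" using \<open>\<exists>C. lipschitz_on C (closure \<Omega>) w\<close> by blast
  have cw: "continuous_on (closure \<Omega>) w" using L by (rule lipschitz_on_continuous_on)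
  have "compact (w ` closure \<Omega>)" using cw \<Omega>(2) by (intro compact_continuous_image) (auto simp: compact_closure)
  then have "bounded (w ` closure \<Omega>)" by (rule compact_imp_bounded)
  then obtain W where W: "\<forall>y\<in>w ` closure \<Omega>. norm y \<le> W" unfolding bounded_iff by blast
  have c\<Omega>: "continuous_on \<Omega> w" using cw closure_subset by (rule continuous_on_subset)
  \<comment> \<open>The assumptions govern the weight on the closure of \<Omega>; extension by 0
    makes it Borel and bounded on the whole space, while the Lipschitz bound is kept for pairs of
    points of \<Omega>.\<close>
  define w' where "w' x = indicator \<Omega> x *\<^sub>R w x" for x
  have w': "w' \<in> borel_measurable borel"
    unfolding w'_def[abs_def] using c\<Omega> by (intro borel_measurable_continuous_on_indicator) auto
  have w\<Omega>: "w' x = w x" if "x \<in> \<Omega>" for x using that by (simp add: w'_def)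
  show False
  proof (rule first_eigenfunctions_differ[OF \<Omega> \<open>C2_boundary \<Omega>\<close> \<open>1 < q\<close> \<open>q < p\<close> _ w' w\<Omega> _ _ _ _ _ _ u _ _ _ top P vu Q zu])
    show "q < real CARD('n)" using \<open>q < p\<close> \<open>p < real CARD('n)\<close> by simp
    show "0 \<le> w' x" for x using \<open>\<forall>x\<in>\<Omega>. w x > 0\<close> by (auto simp: w'_def indicator_def intro: less_imp_le)
    show "w' x \<le> \<bar>W\<bar>" for x using bspec[OF W, of "w x"] closure_subset[of \<Omega>] by (auto simp: w'_def indicator_def)
    show "w' x = 0" "u x = 0" if "x \<notin> \<Omega>" for x using that by (simp_all add: w'_def u_def)
    show "\<bar>w' x - w' y\<bar> \<le> L * dist x y" if "x \<in> \<Omega>" "y \<in> \<Omega>" for x y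
      using lipschitz_onD[OF L, of x y] closure_subset[of \<Omega>] that by (auto simp: w\<Omega> dist_real_def)
    show "0 \<le> L" using L by (rule lipschitz_on_nonneg)
    show "0 \<le> u x" "u x \<le> 1" for x by (auto simp: u_def indicator_def)
    \<comment> \<open>The weight may vanish on the boundary, so a positive lower bound is available
      on compact subsets, where the minimum is attained.\<close>
    show "\<exists>c>0. \<forall>x\<in>K. c \<le> w' x" if K: "compact K" "K \<subseteq> \<Omega>" for K
    proof (cases "K = {}")
      case False
      obtain a where "a \<in> K" "\<And>x. x \<in> K \<Longrightarrow> w a \<le> w x"
        using continuous_attains_inf[OF K(1) False continuous_on_subset[OF c\<Omega> K(2)]] by blast
      then show ?thesis using K(2) \<open>\<forall>x\<in>\<Omega>. w x > 0\<close> by (intro exI[of _ "w a"]) (auto simp: w\<Omega> subset_iff)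
    qed (auto intro: exI[of _ 1])
  qed
qed

end
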